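(* The tied--boxed Hecke algebra $bH_n(q)$ is cellular (in the sense of Graham--Lehrer), with cellular basis \[B=\{\mathbf{m}^{\boldsymbol\lambda}_{\mathfrak{s}\mathfrak{t}}\mid \boldsymbol\lambda \text{ a multipartition of } n,\ \mathfrak{s},\mathfrak{t}\in T(\boldsymbol\lambda)\},\] where $\mathbf{m}^{\boldsymbol\lambda}_{\mathfrak{s}\mathfrak{t}}=z_{d(\mathfrak{s})}^{*}\,\mathbf{m}_{\boldsymbol\lambda}\,z_{d(\mathfrak{t})}$ and $\mathbf{m}_{\boldsymbol\lambda}=\mathbb{E}_{\mathbf{I}_{\boldsymbol\lambda}}\sum_{w\in\mathfrak{S}_{\boldsymbol\lambda}}q^{\ell(w)}z_w$, the poset being the multipartitions of $n$ under the dominance order and $*$ being the anti-automorphism.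
   Context: $\mathbb{S}=\mathbb{C}[q,q^{-1}]$. $bH_n(q)$ is the $\mathbb{S}$--algebra presented by generators $e_1,\dots,e_{n-1}$, $z_1,\dots,z_{n-1}$ and relations: $e_i^2=e_i$, $e_ie_j=e_je_i$; $z_iz_jz_i=z_jz_iz_j$ if $|i-j|=1$, $z_iz_j=z_jz_i$ if $|i-j|>1$; $e_iz_i=z_i$; $e_iz_j=z_je_i$; $z_i^2=e_i+(q-q^{-1})z_i$. $*$ is the $\mathbb{S}$--linear anti-automorphism of $bH_n(q)$ fixing every $e_i$ and $z_i$. For $w\in\mathfrak{S}_n$ with reduced expression $s_{i_1}\cdots s_{i_r}$, $z_w=z_{i_1}\cdots z_{i_r}$ and $\ell(w)=r$. A multipartition of $n$ is a tuple $\boldsymbol\lambda=(\lambda^{(1)},\dots,\lambda^{(k)})$ of nonempty partitions with total size $n$; $\operatorname{comp}(\boldsymbol\lambda)=(|\lambda^{(1)}|,\dots,|\lambda^{(k)}|)$. $\mathbf{I}_{\boldsymbol\lambda}$ is the linear set partition of $[n]$ whose blocks are the consecutive intervals of lengths $|\lambda^{(1)}|,\dots,|\lambda^{(k)}|$. Linear set partitions are ordered by $\mathbf{I}\preceq\mathbf{J}$ iff each block of $\mathbf{J}$ is a union of blocks of $\mathbf{I}$; $\operatorname{E}_\mathbf{J}=\prod e_i$ over $i$ with $i,i+1$ in the same block of $\mathbf{J}$; $\mathbb{E}_\mathbf{I}=\sum_{\mathbf{J}\succeq\mathbf{I}}(-1)^{|\mathbf{I}|-|\mathbf{J}|}\operatorname{E}_\mathbf{J}$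 ($|\cdot|$ = number of blocks). A $\boldsymbol\lambda$-multitableau is a filling of the Young diagrams of the components by $1,\dots,n$ bijectively; $\mathfrak{S}_n$ acts on the right by permuting entries. $\mathfrak{t}^{\boldsymbol\lambda}$ is the multitableau with $1,\dots,n$ entered in order along rows of the first component, then the second, etc.; $\mathfrak{S}_{\boldsymbol\lambda}$ is its row stabilizer; for a row-standard $\mathfrak{s}$, $d(\mathfrak{s})$ is the unique permutation with $\mathfrak{t}^{\boldsymbol\lambda}d(\mathfrak{s})=\mathfrak{s}$. A multitableau is standard if in each component entries increase along rows and down columns; it is of the initial kind if its $i$th component contains exactly the entries of the $i$th component of $\mathfrak{t}^{\boldsymbol\lambda}$. $T(\boldsymbol\lambda)$ is the set of standard $\boldsymbol\lambda$-multitableaux of the initial kind. *)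

theory Defs
  imports Complex_Main "HOL-Library.Poly_Mapping" "HOL-Library.Disjoint_Sets"
    "HOL-Combinatorics.Permutations" "HOL-Combinatorics.Transposition"
begin

text \<open>Laurent polynomials over C, realised as the group algebra of (int,+):
  finitely supported functions int => complex with convolution product.\<close>
type_synonym laurent = "int \<Rightarrow>\<^sub>0 complex"

definition qq :: laurent where "qq = Poly_Mapping.single 1 1"
definition qinv :: laurent where "qinv = Poly_Mapping.single (-1) 1"

datatype gen = GE nat | GZ nat

datatype wrd = Wrd "gen list"

fun wrd_list :: "wrd \<Rightarrow> gen list" where "wrd_list (Wrd xs) = xs"

instantiation wrd :: monoid_add
begin
definition zero_wrd_def: "0 = Wrd []"
definition plus_wrd_def: "a + b = Wrd (wrd_list a @ wrd_list b)"
instance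
proof
  fix a b c :: wrd
  show "a + b + c = a + (b + c)" by (cases a; cases b; cases c) (simp add: plus_wrd_def)
  show "0 + a = a" by (cases a) (simp add: plus_wrd_def zero_wrd_def)
  show "a + 0 = a" by (cases a) (simp add: plus_wrd_def zero_wrd_def)
qed
end

text \<open>The free (noncommutative, unital) S-algebra on words: S-linear combinations of
  words, multiplication = concatenation of words.\<close>
type_synonym fa = "wrd \<Rightarrow>\<^sub>0 laurent"

definition sc :: "laurent \<Rightarrow> fa" where "sc c = Poly_Mapping.single 0 c"

definition gE :: "nat \<Rightarrow> fa" where "gE i = Poly_Mapping.single (Wrd [GE i]) 1"
definition gZ :: "nat \<Rightarrow> fa" where "gZ i = Poly_Mapping.single (Wrd [GZ i]) 1"

definition gens :: "nat \<Rightarrow> gen set" where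
  "gens n = GE ` {1..<n} \<union> GZ ` {1..<n}"

definition fa_carrier :: "nat \<Rightarrow> fa set" where
  "fa_carrier n = {p. \<forall>u \<in> Poly_Mapping.keys p. set (wrd_list u) \<subseteq> gens n}"

text \<open>The S-linear anti-automorphism fixing every generator: reversal of words.\<close>
definition fstar :: "fa \<Rightarrow> fa" where
  "fstar p = (\<Sum>u\<in>Poly_Mapping.keys p. Poly_Mapping.single (Wrd (rev (wrd_list u))) (Poly_Mapping.lookup p u))"

text \<open>Defining relations of bH_n(q), written as elements r (meaning r = 0).\<close>
definition bH_rels :: "nat \<Rightarrow> fa set" where
  "bH_rels n =
     (\<Union>i\<in>{1..<n}. {gE i * gE i - gE i,
                      gE i * gZ i - gZ i,
                      gZ i * gZ i - (gE i + sc (qq - qinv) * gZ i)})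
   \<union> (\<Union>i\<in>{1..<n}. \<Union>j\<in>{1..<n}.
        {gE i * gE j - gE j * gE i, gE i * gZ j - gZ j * gE i}
      \<union> (if i = j + 1 \<or> j = i + 1 then {gZ i * gZ j * gZ i - gZ j * gZ i * gZ j} else {})
      \<union> (if i > j + 1 \<or> j > i + 1 then {gZ i * gZ j - gZ j * gZ i} else {}))"

inductive_set two_sided_ideal :: "fa set \<Rightarrow> fa set \<Rightarrow> fa set" for A R where
  zero: "0 \<in> two_sided_ideal A R"
| gen: "r \<in> R \<Longrightarrow> a \<in> A \<Longrightarrow> b \<in> A \<Longrightarrow> a * r * b \<in> two_sided_ideal A R"
| add: "x \<in> two_sided_ideal A R \<Longrightarrow> y \<in> two_sided_ideal A R \<Longrightarrow> x + y \<in> two_sided_ideal A R"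

text \<open>bH_n(q) = fa_carrier n / bH_ideal n.\<close>
definition bH_ideal :: "nat \<Rightarrow> fa set" where
  "bH_ideal n = two_sided_ideal (fa_carrier n) (bH_rels n)"

definition cidx :: "'l set \<Rightarrow> ('l \<Rightarrow> 'm set) \<Rightarrow> ('l \<times> 'm \<times> 'm) set" where
  "cidx L M = Sigma L (\<lambda>l. M l \<times> M l)"

text \<open>Cell datum (L, M, C, star) for the S-algebra A/I: L a finite poset (strict order lt),
  M l finite sets, {C l s t} an S-basis of A/I, star an S-linear anti-involution of A/I with
  star (C l s t) = C l t s, and the multiplication rule (C3) modulo A(<l).\<close>
definition cellular_datum ::
  "fa set \<Rightarrow> fa set \<Rightarrow> (fa \<Rightarrow> fa) \<Rightarrow> 'l set \<Rightarrow> ('l \<Rightarrow> 'l \<Rightarrow> bool)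
     \<Rightarrow> ('l \<Rightarrow> 'm set) \<Rightarrow> ('l \<Rightarrow> 'm \<Rightarrow> 'm \<Rightarrow> fa) \<Rightarrow> bool" where
  "cellular_datum A I star L lt M C \<longleftrightarrow>
     finite L \<and>
     (\<forall>x\<in>L. \<not> lt x x) \<and> (\<forall>x\<in>L. \<forall>y\<in>L. \<forall>z\<in>L. lt x y \<longrightarrow> lt y z \<longrightarrow> lt x z) \<and>
     (\<forall>l\<in>L. finite (M l)) \<and>
     (\<forall>(l, s, t)\<in>cidx L M. C l s t \<in> A) \<and>
     \<comment> \<open>(C1) the C l s t form an S-basis of A/I (injectively indexed)\<close>
     (\<forall>c. (\<Sum>(l, s, t)\<in>cidx L M. sc (c (l, s, t)) * C l s t) \<in> I
            \<longrightarrow> (\<forall>i\<in>cidx L M. c i = 0)) \<and>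
     (\<forall>a\<in>A. \<exists>c. a - (\<Sum>(l, s, t)\<in>cidx L M. sc (c (l, s, t)) * C l s t) \<in> I) \<and>
     \<comment> \<open>(C2) star is a well-defined S-linear anti-involution of A/I\<close>
     (\<forall>x\<in>A. star x \<in> A) \<and>
     (\<forall>x\<in>I. star x \<in> I) \<and>
     (\<forall>x\<in>A. \<forall>y\<in>A. star (x + y) - (star x + star y) \<in> I) \<and>
     (\<forall>c. \<forall>x\<in>A. star (sc c * x) - sc c * star x \<in> I) \<and>
     (\<forall>x\<in>A. \<forall>y\<in>A. star (x * y) - star y * star x \<in> I) \<and>
     (\<forall>x\<in>A. star (star x) - x \<in> I) \<and>
     (\<forall>(l, s, t)\<in>cidx L M. star (C l s t) - C l t s \<in> I) \<and>
     \<comment> \<open>(C3)\<close>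
     (\<forall>l\<in>L. \<forall>s\<in>M l. \<forall>a\<in>A. \<exists>r. \<forall>t\<in>M l. \<exists>c.
        a * C l s t - (\<Sum>s'\<in>M l. sc (r s') * C l s' t)
          - (\<Sum>(m, u, v)\<in>cidx L M. if lt m l then sc (c (m, u, v)) * C m u v else 0) \<in> I)"

definition is_partition :: "nat list \<Rightarrow> bool" where
  "is_partition p \<longleftrightarrow> sorted_wrt (\<ge>) p \<and> 0 \<notin> set p"

definition msize :: "nat list list \<Rightarrow> nat" where
  "msize lam = sum_list (map sum_list lam)"

definition multipartitions :: "nat \<Rightarrow> nat list list set" where
  "multipartitions n = {lam. (\<forall>p\<in>set lam. is_partition p \<and> p \<noteq> []) \<and> msize lam = n}"

definition comp_of :: "nat list list \<Rightarrow> nat \<Rightarrow> nat list" where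
  "comp_of lam k = (if k < length lam then lam ! k else [])"

definition part_of :: "nat list \<Rightarrow> nat \<Rightarrow> nat" where
  "part_of p j = (if j < length p then p ! j else 0)"

definition dom_sum :: "nat list list \<Rightarrow> nat \<Rightarrow> nat \<Rightarrow> nat" where
  "dom_sum lam k j = (\<Sum>a<k. sum_list (comp_of lam a)) + (\<Sum>b<j. part_of (comp_of lam k) b)"

definition dominates :: "nat list list \<Rightarrow> nat list list \<Rightarrow> bool" where
  "dominates lam mu \<longleftrightarrow> (\<forall>k j. dom_sum mu k j \<le> dom_sum lam k j)"

definition cells :: "nat list list \<Rightarrow> (nat \<times> nat \<times> nat) set" where
  "cells lam = {(k, r, c). k < length lam \<and> r < length (lam ! k) \<and> c < lam ! k ! r}"

definition multitableaux :: "nat list list \<Rightarrow> (nat \<times> nat \<times> nat \<Rightarrow> nat) set" where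
  "multitableaux lam = {t. bij_betw t (cells lam) {1..msize lam} \<and> (\<forall>x. x \<notin> cells lam \<longrightarrow> t x = 0)}"

definition tlam :: "nat list list \<Rightarrow> nat \<times> nat \<times> nat \<Rightarrow> nat" where
  "tlam lam = (\<lambda>(k, r, c). if (k, r, c) \<in> cells lam
      then (\<Sum>a<k. sum_list (lam ! a)) + (\<Sum>b<r. lam ! k ! b) + c + 1 else 0)"

definition standard :: "nat list list \<Rightarrow> (nat \<times> nat \<times> nat \<Rightarrow> nat) \<Rightarrow> bool" where
  "standard lam t \<longleftrightarrow>
     (\<forall>k r c. (k, r, Suc c) \<in> cells lam \<longrightarrow> t (k, r, c) < t (k, r, Suc c)) \<and>
     (\<forall>k r c. (k, Suc r, c) \<in> cells lam \<longrightarrow> t (k, r, c) < t (k, Suc r, c))"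

definition initial_kind :: "nat list list \<Rightarrow> (nat \<times> nat \<times> nat \<Rightarrow> nat) \<Rightarrow> bool" where
  "initial_kind lam t \<longleftrightarrow>
     (\<forall>k. t ` {x \<in> cells lam. fst x = k} = tlam lam ` {x \<in> cells lam. fst x = k})"

definition Tset :: "nat list list \<Rightarrow> (nat \<times> nat \<times> nat \<Rightarrow> nat) set" where
  "Tset lam = {t \<in> multitableaux lam. standard lam t \<and> initial_kind lam t}"

text \<open>Right action of S_n on tableaux: t.w = w o t; hence the product in S_n is
  (x y)(i) = y (x i), and s_{i1} ... s_{ir} = s_{ir} o ... o s_{i1}.\<close>
definition sadj :: "nat \<Rightarrow> nat \<Rightarrow> nat" where "sadj i = transpose i (Suc i)"

fun perm_of_word :: "nat list \<Rightarrow> nat \<Rightarrow> nat" where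
  "perm_of_word [] = id"
| "perm_of_word (i # ws) = perm_of_word ws \<circ> sadj i"

definition reduced_words :: "nat \<Rightarrow> (nat \<Rightarrow> nat) \<Rightarrow> nat list set" where
  "reduced_words n w = {ws. set ws \<subseteq> {1..<n} \<and> perm_of_word ws = w \<and>
      (\<forall>vs. set vs \<subseteq> {1..<n} \<and> perm_of_word vs = w \<longrightarrow> length ws \<le> length vs)}"

definition perm_len :: "nat \<Rightarrow> (nat \<Rightarrow> nat) \<Rightarrow> nat" where
  "perm_len n w = length (SOME ws. ws \<in> reduced_words n w)"

definition zw :: "nat \<Rightarrow> (nat \<Rightarrow> nat) \<Rightarrow> fa" where
  "zw n w = foldr (\<lambda>i acc. gZ i * acc) (SOME ws. ws \<in> reduced_words n w) 1"

definition row_stab :: "nat list list \<Rightarrow> (nat \<Rightarrow> nat) set" where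
  "row_stab lam = {w. w permutes {1..msize lam} \<and>
     (\<forall>k r c. (k, r, c) \<in> cells lam \<longrightarrow>
        (\<exists>c'. (k, r, c') \<in> cells lam \<and> w (tlam lam (k, r, c)) = tlam lam (k, r, c')))}"

definition dperm :: "nat list list \<Rightarrow> (nat \<times> nat \<times> nat \<Rightarrow> nat) \<Rightarrow> nat \<Rightarrow> nat" where
  "dperm lam s = (THE w. w permutes {1..msize lam} \<and> (\<forall>x\<in>cells lam. s x = w (tlam lam x)))"

definition linear_set_partitions :: "nat \<Rightarrow> nat set set set" where
  "linear_set_partitions n = {P. partition_on {1..n} P \<and> (\<forall>B\<in>P. \<exists>a b. B = {a..b})}"

definition lsp_le :: "nat set set \<Rightarrow> nat set set \<Rightarrow> bool" where
  "lsp_le I J \<longleftrightarrow> (\<forall>B\<in>J. \<exists>C\<subseteq>I. B = \<Union>C)"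

definition EJ :: "nat \<Rightarrow> nat set set \<Rightarrow> fa" where
  "EJ n J = foldr (\<lambda>i acc. gE i * acc)
     (sorted_list_of_set {i\<in>{1..<n}. \<exists>B\<in>J. i \<in> B \<and> Suc i \<in> B}) 1"

definition EE :: "nat \<Rightarrow> nat set set \<Rightarrow> fa" where
  "EE n I = (\<Sum>J\<in>{J \<in> linear_set_partitions n. lsp_le I J}.
              sc ((-1) ^ (card I - card J)) * EJ n J)"

definition Ilam :: "nat list list \<Rightarrow> nat set set" where
  "Ilam lam = (\<lambda>k. {(\<Sum>a<k. sum_list (lam ! a)) + 1 .. (\<Sum>a<Suc k. sum_list (lam ! a))})
                ` {..<length lam}"

definition m_lam :: "nat \<Rightarrow> nat list list \<Rightarrow> fa" where
  "m_lam n lam = EE n (Ilam lam) * (\<Sum>w\<in>row_stab lam. sc (qq ^ perm_len n w) * zw n w)"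

definition m_basis :: "nat \<Rightarrow> nat list list \<Rightarrow> (nat \<times> nat \<times> nat \<Rightarrow> nat)
     \<Rightarrow> (nat \<times> nat \<times> nat \<Rightarrow> nat) \<Rightarrow> fa" where
  "m_basis n lam s t = fstar (zw n (dperm lam s)) * m_lam n lam * zw n (dperm lam t)"

end

theory Submission
  imports Defs
begin

text \<open>The elements \<open>\<bbbE>\<^sub>I\<close> are orthogonal central idempotents with sum 1, one for each set \<open>C\<close> of cut points of
  \<open>[n]\<close>. In the corner of \<open>C\<close> the generator \<open>z\<^sub>i\<close> vanishes for \<open>i \<in> C\<close> and satisfies the quadratic relation of
  the Hecke algebra otherwise, so \<open>\<bbbm>\<^sub>\<lambda>\<close> generates a permutation module with a basis labelled by words (the word
  of a tableau sends an entry to its row). Garnir relations straighten every word into lattice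
  words, that is, standard tableaux of the initial kind, modulo the ideal of the more dominant
  multipartitions; this gives the spanning property and the multiplication rule.

  For independence, \<open>\<Sum> (f\<^sup>\<lambda>)\<^sup>2 = m!\<close> shows that there are at most as many \<open>\<bbbm>\<^sub>\<ss>\<^sub>\<tt>\<close> as pairs of a set \<open>C\<close> and a
  permutation that preserves the blocks of \<open>C\<close>, while the regular representations of the corners
  separate as many elements of the algebra as there are such pairs.\<close>

section \<open>Inversions and reduced words\<close>

text \<open>Straightening leaves the class of partitions: a Garnir relation moves boxes up one row
  of \<open>f0\<close>, and the new row lengths need not decrease. The permutation modules are
  therefore indexed by sorted words of arbitrary compositions in each block. Nothing has to be
  corrected later, because a composition whose rows do not decrease has no lattice rearrangement and
  so contributes no spanning element. A Garnir element is the image of one basis word under two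
  homomorphisms of permutation modules, one splitting letters and one merging them. The first is an
  expansion of sums, the second is left multiplication by an element of the algebra. Hence every
  relation found in a module is a statement about two-sided ideals. The algebra is known only by its
  presentation, so the spanning argument says nothing about independence. The scalars form a domain
  and not a field; this is why the final comparison of cardinalities uses a system of linear
  equations solved without division, instead of dimensions. The tableaux of the initial kind are
  singled out by the cuts: a word that has a letter of a foreign component at some position labels
  the zero element.\<close>

definition pos_pairs :: "nat \<Rightarrow> (nat \<times> nat) set" where
  "pos_pairs n = {(a, b). 1 \<le> a \<and> a < b \<and> b \<le> n}"

text \<open>Only strict descents count and \<open>f\<close> is an arbitrary function, so that one
  statistic serves both permutations, where it is the Coxeter length, and words with repeated
  letters.\<close>

definition ninv :: "nat \<Rightarrow> (nat \<Rightarrow> nat) \<Rightarrow> nat" where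
  "ninv n f = (\<Sum>(a, b)\<in>pos_pairs n. of_bool (f b < f a))"

lemma finite_pos_pairs [simp]: "finite (pos_pairs n)"
proof -
  have "pos_pairs n \<subseteq> {1..n} \<times> {1..n}" by (auto simp: pos_pairs_def)
  then show ?thesis by (rule finite_subset) auto
qed

lemma sadj_simps [simp]: "sadj i i = Suc i" "sadj i (Suc i) = i"
  by (simp_all add: sadj_def)

lemma sadj_other: "j \<noteq> i \<Longrightarrow> j \<noteq> Suc i \<Longrightarrow> sadj i j = j"
  by (simp add: sadj_def)

lemma sadj_sadj [simp]: "sadj i (sadj i x) = x"
  by (simp add: sadj_def)

lemma sadj_o [simp]: "sadj i \<circ> sadj i = id"
  by (auto simp: fun_eq_iff)

lemma o_sadj_o [simp]: "f \<circ> sadj i \<circ> sadj i = f"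
  by (auto simp: fun_eq_iff)

lemma inj_sadj: "inj (sadj i)"
  by (simp add: sadj_def)

lemma bij_sadj: "bij (sadj i)"
  by (simp add: sadj_def)

lemma inv_sadj [simp]: "inv (sadj i) = sadj i"
  by (simp add: sadj_def)

lemma sadj_permutes: "1 \<le> i \<Longrightarrow> i < n \<Longrightarrow> sadj i permutes {1..n}"
  unfolding sadj_def by (rule permutes_swap_id) auto

lemma o_sadj_permutes: "g permutes {1..n} \<Longrightarrow> 1 \<le> i \<Longrightarrow> i < n \<Longrightarrow> g \<circ> sadj i permutes {1..n}"
  by (intro permutes_compose sadj_permutes)

lemma sadj_far_commute: "Suc i < j \<Longrightarrow> sadj i \<circ> sadj j = sadj j \<circ> sadj i"
  by (auto simp: fun_eq_iff sadj_def transpose_def)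

lemma sadj_braid: "sadj i \<circ> sadj (Suc i) \<circ> sadj i = sadj (Suc i) \<circ> sadj i \<circ> sadj (Suc i)"
  by (auto simp: fun_eq_iff sadj_def transpose_def)

lemma sadj_less: "a < b \<Longrightarrow> (a, b) \<noteq> (i, Suc i) \<Longrightarrow> sadj i a < sadj i b"
  by (auto simp: sadj_def transpose_def)

text \<open>The transposition permutes the pairs of positions other than \<open>(i, Suc i)\<close>
  and keeps each of them in increasing order. Only the exceptional pair can change its
  contribution.\<close>

lemma ninv_swap:
  assumes "1 \<le> i" "i < n"
  shows "int (ninv n (f \<circ> sadj i)) = int (ninv n f) + of_bool (f i < f (Suc i)) - of_bool (f (Suc i) < f i)"
proof -
  let ?P = "pos_pairs n - {(i, Suc i)}"
  have ins: "pos_pairs n = insert (i, Suc i) ?P" using assms by (auto simp: pos_pairs_def)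
  have split: "ninv n h = of_bool (h (Suc i) < h i) + (\<Sum>(a, b)\<in>?P. of_bool (h b < h a))" for h
    unfolding ninv_def by (subst ins, subst sum.insert) auto
  have inj: "inj_on (\<lambda>(a, b). (sadj i a, sadj i b)) A" for A
    using inj_sadj by (auto simp: inj_on_def)
  have rng: "sadj i a \<in> {1..n} \<longleftrightarrow> a \<in> {1..n}" for a
    using permutes_in_image[OF sadj_permutes[OF assms]] .
  have into: "(\<lambda>(a, b). (sadj i a, sadj i b)) ` ?P \<subseteq> ?P"
  proof
    fix x assume "x \<in> (\<lambda>(a, b). (sadj i a, sadj i b)) ` ?P"
    then obtain a b where x: "x = (sadj i a, sadj i b)" and ab: "(a, b) \<in> pos_pairs n" "(a, b) \<notin> {(i, Suc i)}"
      by auto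
    then have r: "1 \<le> sadj i a" "sadj i b \<le> n" using rng[of a] rng[of b] by (auto simp: pos_pairs_def)
    have l: "sadj i a < sadj i b" using ab sadj_less[of a b i] by (auto simp: pos_pairs_def)
    have "(sadj i a, sadj i b) \<noteq> (i, Suc i)"
    proof
      assume "(sadj i a, sadj i b) = (i, Suc i)"
      then have "a = Suc i" "b = i" by (metis prod.inject sadj_sadj sadj_simps)+
      then show False using ab by (auto simp: pos_pairs_def)
    qed
    with r l show "x \<in> ?P" by (auto simp: pos_pairs_def x)
  qed
  have bij: "bij_betw (\<lambda>(a, b). (sadj i a, sadj i b)) ?P ?P"
    unfolding bij_betw_def using inj endo_inj_surj[OF _ into inj] finite_pos_pairs by blast
  have "(\<Sum>(a, b)\<in>?P. of_bool ((f \<circ> sadj i) b < (f \<circ> sadj i) a)) = (\<Sum>(a, b)\<in>?P. of_bool (f b < f a) :: nat)"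
    using sum.reindex_bij_betw[OF bij, of "\<lambda>(a, b). of_bool (f b < f a) :: nat"]
    unfolding case_prod_unfold comp_apply fst_conv snd_conv .
  then show ?thesis
    using split[of f] split[of "f \<circ> sadj i"] by auto
qed

lemma ninv_asc: "1 \<le> i \<Longrightarrow> i < n \<Longrightarrow> f i < f (Suc i) \<Longrightarrow> ninv n (f \<circ> sadj i) = Suc (ninv n f)"
  using ninv_swap[of i n f] by auto

lemma ninv_desc: "1 \<le> i \<Longrightarrow> i < n \<Longrightarrow> f (Suc i) < f i \<Longrightarrow> Suc (ninv n (f \<circ> sadj i)) = ninv n f"
  using ninv_swap[of i n f] by auto

definition srt :: "nat \<Rightarrow> (nat \<Rightarrow> nat) \<Rightarrow> bool" where
  "srt n f \<longleftrightarrow> (\<forall>i. 1 \<le> i \<longrightarrow> i < n \<longrightarrow> f i \<le> f (Suc i))"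

lemma srt_le: assumes "srt n f" "1 \<le> a" "a \<le> b" "b \<le> n" shows "f a \<le> f b"
  using assms(3,4)
proof (induction b rule: dec_induct)
  case (step m)
  then have "f m \<le> f (Suc m)" using assms(1,2) by (auto simp: srt_def)
  with step show ?case by simp
qed simp

lemma srt_ninv: "srt n f \<longleftrightarrow> ninv n f = 0"
proof
  assume "srt n f"
  then have "\<not> f b < f a" if "(a, b) \<in> pos_pairs n" for a b
    using that srt_le[of n f a b] by (auto simp: pos_pairs_def)
  then show "ninv n f = 0" unfolding ninv_def by (intro sum.neutral) auto
next
  assume 0: "ninv n f = 0"
  show "srt n f" unfolding srt_def
  proof (intro allI impI)
    fix i assume "1 \<le> i" "i < n"
    with 0 show "f i \<le> f (Suc i)" using ninv_desc[of i n f] by (cases "f (Suc i) < f i") auto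
  qed
qed

lemma not_srt_desc: "\<not> srt n f \<Longrightarrow> \<exists>i. 1 \<le> i \<and> i < n \<and> f (Suc i) < f i"
  by (auto simp: srt_def not_le)

text \<open>Weakly increasing and injective means strictly increasing on positions, hence
  \<open>i \<le> g i\<close> throughout, which only the identity satisfies.\<close>

lemma permutes_srt_id:
  assumes "g permutes {1..n}" "srt n g" shows "g = id"
proof (rule ext)
  fix x
  have inj: "inj g" using permutes_inj[OF assms(1)] .
  have ge: "g i \<ge> i" if "i \<le> n" for i using that
  proof (induction i)
    case (Suc i)
    show ?case
    proof (cases "i = 0")
      case True
      then show ?thesis using permutes_in_seg[OF assms(1), of "Suc i"] Suc by auto
    next
      case False
      then have "g i \<le> g (Suc i)" using assms(2) Suc by (auto simp: srt_def)
      moreover have "g i \<noteq> g (Suc i)" using injD[OF inj, of i "Suc i"] by auto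
      moreover have "i \<le> g i" using Suc by simp
      ultimately show ?thesis by simp
    qed
  qed simp
  have "\<forall>x\<in>{1..n}. g x \<ge> x"
  proof
    fix x assume "x \<in> {1..n}"
    then have "x \<le> n" by simp
    then show "x \<le> g x" by (rule ge)
  qed
  from permutes_natset_ge[OF assms(1) this] have "g = id" .
  then show "g x = id x" by simp
qed

text \<open>\<open>gw [i\<^sub>1, \<dots>, i\<^sub>r] = s\<^sub>i\<^sub>1 \<circ> \<dots> \<circ> s\<^sub>i\<^sub>r\<close> is the inverse of \<open>perm_of_word [i\<^sub>1, \<dots>, i\<^sub>r]\<close>; with it,
  right multiplication by a generator permutes positions of words.\<close>
definition gw :: "nat list \<Rightarrow> nat \<Rightarrow> nat" where
  "gw ws = foldr (\<lambda>i g. sadj i \<circ> g) ws id"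

lemma gw_Nil [simp]: "gw [] = id"
  by (simp add: gw_def)

lemma gw_Cons [simp]: "gw (i # ws) = sadj i \<circ> gw ws"
  by (simp add: gw_def)

lemma gw_append: "gw (us @ vs) = gw us \<circ> gw vs"
  by (induction us) (simp_all add: comp_assoc)

lemma gw_permutes: "set ws \<subseteq> {1..<n} \<Longrightarrow> gw ws permutes {1..n}"
proof (induction ws)
  case (Cons i ws)
  then have "sadj i permutes {1..n}" "gw ws permutes {1..n}" using sadj_permutes[of i n] by auto
  then show ?case using permutes_compose[of "gw ws" "{1..n}" "sadj i"] by (simp add: comp_def)
qed (simp add: permutes_id)

lemma gw_rev_apply: "gw (rev ws) (gw ws x) = x"
  by (induction ws) (simp_all add: gw_append)

lemma gw_rev: "gw (rev ws) \<circ> gw ws = id"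
  by (rule ext) (simp add: gw_rev_apply)

lemma inv_gw: "inv (gw ws) = gw (rev ws)"
  using gw_rev[of ws] gw_rev[of "rev ws"] by (intro inv_unique_comp) auto

lemma perm_of_word_gw: "perm_of_word ws = gw (rev ws)"
  by (induction ws) (simp_all add: gw_append)

text \<open>Each letter changes the inversion number by at most one.\<close>

lemma ninv_gw_le: "set ws \<subseteq> {1..<n} \<Longrightarrow> ninv n (gw ws) \<le> length ws"
proof (induction ws rule: rev_induct)
  case (snoc i ws)
  then have "1 \<le> i" "i < n" by auto
  from ninv_swap[OF this, of "gw ws"] have "ninv n (gw ws \<circ> sadj i) \<le> Suc (ninv n (gw ws))"
    by (auto simp: of_bool_def split: if_splits)
  then show ?case using snoc by (simp add: gw_append comp_def)
qed (simp add: srt_ninv[symmetric] srt_def)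

text \<open>Reducedness is measured by inversions, which can be computed letter by letter;
  \<open>reduced_words_redw\<close> identifies it with minimality of the length.\<close>

definition redw :: "nat \<Rightarrow> (nat \<Rightarrow> nat) \<Rightarrow> nat list \<Rightarrow> bool" where
  "redw n g ws \<longleftrightarrow> set ws \<subseteq> {1..<n} \<and> gw ws = g \<and> length ws = ninv n g"

lemma redw_snoc_asc:
  assumes "redw n g ws" "1 \<le> i" "i < n" "g i < g (Suc i)"
  shows "redw n (g \<circ> sadj i) (ws @ [i])"
  using assms ninv_asc[of i n g] by (auto simp: redw_def gw_append)

lemma redw_exists: "g permutes {1..n} \<Longrightarrow> \<exists>ws. redw n g ws"
proof (induction "ninv n g" arbitrary: g)
  case 0
  then have "g = id" using permutes_srt_id srt_ninv by metis
  then show ?case using 0 by (intro exI[of _ "[]"]) (auto simp: redw_def)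
next
  case (Suc k)
  then have "\<not> srt n g" by (simp add: srt_ninv)
  then obtain i where i: "1 \<le> i" "i < n" "g (Suc i) < g i" using not_srt_desc by blast
  have "k = ninv n (g \<circ> sadj i)" using ninv_desc[OF i] Suc by simp
  from Suc.hyps(1)[OF this] obtain ws where "redw n (g \<circ> sadj i) ws"
    using o_sadj_permutes Suc i by blast
  from redw_snoc_asc[OF this i(1,2)] i(3) show ?case by auto
qed

text \<open>The word without its last letter has at most \<open>length ws\<close> inversions to
  offer, so the last letter must create one. In particular a reduced word ends in a descent.\<close>

lemma redw_snocD:
  assumes "redw n g (ws @ [i])"
  shows "redw n (g \<circ> sadj i) ws" "1 \<le> i" "i < n" "g (Suc i) < g i"
proof -
  let ?h = "gw ws"
  have s: "set ws \<subseteq> {1..<n}" and i: "1 \<le> i" "i < n" and g: "g = ?h \<circ> sadj i"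
    and l: "Suc (length ws) = ninv n g" using assms by (auto simp: redw_def gw_append)
  have "ninv n ?h \<le> length ws" using ninv_gw_le[OF s] .
  moreover have "int (ninv n g) = int (ninv n ?h) + of_bool (?h i < ?h (Suc i)) - of_bool (?h (Suc i) < ?h i)"
    unfolding g by (rule ninv_swap[OF i])
  ultimately have a: "?h i < ?h (Suc i)" and eq: "length ws = ninv n ?h"
    using l unfolding of_bool_def by (simp_all split: if_splits)
  show "redw n (g \<circ> sadj i) ws" using s eq g by (simp add: redw_def)
  show "1 \<le> i" "i < n" by fact+
  show "g (Suc i) < g i" using a g by simp
qed

text \<open>The reversed word bounds the inversions of \<open>inv g\<close> by those of
  \<open>g\<close>; a reduced word of \<open>inv g\<close>, reversed in turn, gives the opposite
  bound.\<close>

lemma redw_rev: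
  assumes "redw n g ws" shows "redw n (inv g) (rev ws)"
proof -
  have s: "set ws \<subseteq> {1..<n}" and g: "gw ws = g" and l: "length ws = ninv n g"
    using assms by (auto simp: redw_def)
  have gp: "g permutes {1..n}" using gw_permutes[OF s] g by simp
  have ig: "gw (rev ws) = inv g" using g inv_gw by metis
  have 1: "ninv n (inv g) \<le> ninv n g" using ninv_gw_le[of "rev ws" n] s ig l by simp
  obtain vs where vs: "redw n (inv g) vs" using redw_exists[OF permutes_inv[OF gp]] by blast
  then have "gw (rev vs) = g" using inv_gw[of vs] permutes_inv_inv[OF gp] by (simp add: redw_def)
  then have "ninv n g \<le> ninv n (inv g)" using ninv_gw_le[of "rev vs" n] vs by (auto simp: redw_def)
  then show ?thesis using 1 s ig l by (simp add: redw_def)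
qed

lemma ninv_inv: "g permutes {1..n} \<Longrightarrow> ninv n (inv g) = ninv n g"
  using redw_exists[of g n] redw_rev[of n g] by (auto simp: redw_def)

text \<open>\<open>perm_of_word\<close> composes in the order opposite to \<open>gw\<close>, which
  is why \<open>inv w\<close> appears on the right.\<close>

lemma reduced_words_redw:
  assumes "w permutes {1..n}"
  shows "reduced_words n w = {ws. redw n (inv w) ws}"
proof -
  have pw: "perm_of_word ws = w \<longleftrightarrow> gw ws = inv w" for ws
    using inv_gw[of ws] inv_gw[of "rev ws"] permutes_inv_inv[OF assms]
    by (auto simp: perm_of_word_gw)
  obtain us where us: "redw n (inv w) us" using redw_exists[OF permutes_inv[OF assms]] by blast
  show ?thesis
  proof (intro equalityI subsetI)
    fix ws assume "ws \<in> reduced_words n w"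
    then have ws: "set ws \<subseteq> {1..<n}" "gw ws = inv w"
      and m: "\<And>vs. set vs \<subseteq> {1..<n} \<Longrightarrow> gw vs = inv w \<Longrightarrow> length ws \<le> length vs"
      by (auto simp: reduced_words_def pw)
    have "length ws \<le> ninv n (inv w)" using m[of us] us by (auto simp: redw_def)
    moreover have "ninv n (inv w) \<le> length ws" using ninv_gw_le[OF ws(1)] ws(2) by simp
    ultimately show "ws \<in> {ws. redw n (inv w) ws}" using ws by (simp add: redw_def)
  next
    fix ws assume "ws \<in> {ws. redw n (inv w) ws}"
    then show "ws \<in> reduced_words n w"
      using ninv_gw_le by (fastforce simp: reduced_words_def pw redw_def)
  qed
qed

lemma some_reduced_word:
  assumes "w permutes {1..n}"
  shows "redw n (inv w) (SOME ws. ws \<in> reduced_words n w)"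
  unfolding reduced_words_redw[OF assms]
  using someI_ex[OF redw_exists[OF permutes_inv[OF assms]]] by simp

lemma perm_len_ninv: "w permutes {1..n} \<Longrightarrow> perm_len n w = ninv n w"
  using some_reduced_word[of w n] ninv_inv[of w n] by (simp add: perm_len_def redw_def)

section \<open>Permutation modules in a corner of the algebra\<close>

text \<open>\<open>qp k\<close> stands for the power \<open>k\<close> of \<open>q\<close>, and
  \<open>u\<close> for the central idempotent of one cut set. The braid relations hold in the whole
  ring, whereas the quadratic relation is available only after multiplication by \<open>u\<close>;
  straightening uses nothing else about the algebra.\<close>

locale hecke_corner =
  fixes n :: nat and cut :: "nat set"
    and z :: "nat \<Rightarrow> 'a::ring_1" and u :: 'a and qp :: "int \<Rightarrow> 'a" and star :: "'a \<Rightarrow> 'a"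
  assumes qp_comm: "x * qp k = qp k * x" and qp_add: "qp (k + l) = qp k * qp l" and qp_0: "qp 0 = 1"
    and braid: "1 \<le> i \<Longrightarrow> Suc i < n \<Longrightarrow> z i * z (Suc i) * z i = z (Suc i) * z i * z (Suc i)"
    and far: "1 \<le> i \<Longrightarrow> Suc i < j \<Longrightarrow> j < n \<Longrightarrow> z i * z j = z j * z i"
    and u_idem: "u * u = u" and u_comm: "x * u = u * x"
    and quad: "1 \<le> i \<Longrightarrow> i < n \<Longrightarrow> i \<notin> cut \<Longrightarrow> u * (z i * z i) = u + (qp 1 - qp (-1)) * (u * z i)"
    and cut_z: "1 \<le> i \<Longrightarrow> i < n \<Longrightarrow> i \<in> cut \<Longrightarrow> u * z i = 0"
    and star_add: "star (x + y) = star x + star y" and star_mult: "star (x * y) = star y * star x"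
    and star_star: "star (star x) = x"
    and star_z: "star (z i) = z i" and star_u: "star u = u" and star_qp: "star (qp k) = qp k"
begin

definition tw :: "nat list \<Rightarrow> 'a" where "tw ws = prod_list (map z ws)"

lemma tw_Nil [simp]: "tw [] = 1" and tw_append: "tw (us @ vs) = tw us * tw vs"
  and tw_single [simp]: "tw [i] = z i"
  by (simp_all add: tw_def)

text \<open>The inductive step of Matsumoto's theorem. Both \<open>i\<close> and \<open>j\<close>
  are descents of \<open>g\<close>, so \<open>g\<close> also has reduced words that end in a longest
  word in these two letters. Each given word is compared with one of them by the induction
  hypothesis, and a single far or braid relation connects the two.\<close>

lemma redw_tw_step:
  assumes IH: "\<And>h a b. redw n h a \<Longrightarrow> redw n h b \<Longrightarrow> length a = k \<Longrightarrow> tw a = tw b"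
    and ws: "redw n g (ws @ [i])" and vs: "redw n g (vs @ [j])" and l: "length ws = k" and ij: "i < j"
  shows "tw (ws @ [i]) = tw (vs @ [j])"
proof -
  note w = redw_snocD[OF ws] and v = redw_snocD[OF vs]
  have g: "g permutes {1..n}" using ws gw_permutes by (auto simp: redw_def)
  have lv: "length vs = k" using ws vs l by (simp add: redw_def)
  show ?thesis
  proof (cases "Suc i < j")
    case True
    \<comment> \<open>With both descents undone, a reduced word \<open>r\<close> of
      \<open>g2\<close> extends by \<open>j\<close> or by \<open>i\<close> to reduced words of the
      two predecessors of \<open>g\<close>.\<close>
    define g2 where "g2 = g \<circ> sadj i \<circ> sadj j"
    have g2': "g2 = g \<circ> sadj j \<circ> sadj i" unfolding g2_def comp_assoc sadj_far_commute[OF True] ..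
    have "g2 permutes {1..n}" unfolding g2_def by (intro o_sadj_permutes g w v)
    then obtain r where r: "redw n g2 r" using redw_exists by blast
    have "g2 j < g2 (Suc j)" using v(4) True by (simp add: g2_def sadj_other)
    from redw_snoc_asc[OF r v(2,3) this] have 1: "redw n (g \<circ> sadj i) (r @ [j])" by (simp only: g2_def o_sadj_o)
    have "g2 i < g2 (Suc i)" using w(4) True by (simp add: g2' sadj_other)
    from redw_snoc_asc[OF r w(2,3) this] have 2: "redw n (g \<circ> sadj j) (r @ [i])" by (simp only: g2' o_sadj_o)
    have "tw ws = tw (r @ [j])" "tw vs = tw (r @ [i])"
      using IH[OF w(1) 1 l] IH[OF v(1) 2 lv] by auto
    then show ?thesis using far[OF w(2) True v(3)] by (simp add: tw_append mult.assoc)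
  next
    case False
    then have j: "j = Suc i" using ij by simp
    \<comment> \<open>All three inversions among the positions \<open>i\<close>,
      \<open>Suc i\<close>, \<open>Suc (Suc i)\<close> are undone; climbing back from
      \<open>g3\<close> along the two sides of the braid relation reaches both predecessors of
      \<open>g\<close>.\<close>
    define g3 where "g3 = g \<circ> sadj i \<circ> sadj j \<circ> sadj i"
    have g3': "g3 = g \<circ> sadj j \<circ> sadj i \<circ> sadj j"
      unfolding g3_def j using arg_cong[OF sadj_braid[of i], of "\<lambda>h. g \<circ> h"] by (simp add: comp_assoc)
    have gs: "g (Suc i) < g i" "g (Suc (Suc i)) < g (Suc i)" using w(4) v(4) j by auto
    have o: "sadj i (Suc (Suc i)) = Suc (Suc i)" "sadj (Suc i) i = i" by (simp_all add: sadj_other)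
    have "g3 permutes {1..n}" unfolding g3_def by (intro o_sadj_permutes g w v)
    then obtain r where r: "redw n g3 r" using redw_exists by blast
    have "g3 i < g3 (Suc i)" using gs by (simp add: g3_def j o)
    from redw_snoc_asc[OF r w(2,3) this] have 1: "redw n (g \<circ> sadj i \<circ> sadj j) (r @ [i])" by (simp only: g3_def o_sadj_o)
    have "(g \<circ> sadj i \<circ> sadj j) j < (g \<circ> sadj i \<circ> sadj j) (Suc j)" using gs by (simp add: j o)
    from redw_snoc_asc[OF 1 v(2,3) this] have 2: "redw n (g \<circ> sadj i) (r @ [i] @ [j])" by (simp only: o_sadj_o append_assoc)
    have "g3 j < g3 (Suc j)" using gs by (simp add: g3' j o)
    from redw_snoc_asc[OF r v(2,3) this] have 3: "redw n (g \<circ> sadj j \<circ> sadj i) (r @ [j])" by (simp only: g3' o_sadj_o)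
    have "(g \<circ> sadj j \<circ> sadj i) i < (g \<circ> sadj j \<circ> sadj i) (Suc i)" using gs by (simp add: j o)
    from redw_snoc_asc[OF 3 w(2,3) this] have 4: "redw n (g \<circ> sadj j) (r @ [j] @ [i])" by (simp only: o_sadj_o append_assoc)
    have "tw ws = tw (r @ [i] @ [j])" "tw vs = tw (r @ [j] @ [i])"
      using IH[OF w(1) 2 l] IH[OF v(1) 4 lv] by auto
    moreover have "z i * z j * z i = z j * z i * z j" using braid[of i] w(2) v(3) j by simp
    ultimately show ?thesis by (simp add: tw_append mult.assoc del: append_Cons append.simps)
  qed
qed

lemma redw_tw: "redw n g ws \<Longrightarrow> redw n g vs \<Longrightarrow> tw ws = tw vs"
proof (induction "length ws" arbitrary: g ws vs)
  case 0
  have "length vs = length ws" using 0(2,3) unfolding redw_def by metis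
  then have "ws = []" "vs = []" using 0(1) by auto
  then show ?case by simp
next
  case (Suc k)
  have IH: "\<And>h a b. redw n h a \<Longrightarrow> redw n h b \<Longrightarrow> length a = k \<Longrightarrow> tw a = tw b"
    using Suc.hyps(1) by blast
  obtain ws' i where w: "ws = ws' @ [i]" using Suc(2) by (cases ws rule: rev_cases) auto
  have "length vs = length ws" using Suc.prems by (simp add: redw_def)
  then obtain vs' j where v: "vs = vs' @ [j]" using Suc(2) by (cases vs rule: rev_cases) auto
  have l: "length ws' = k" "length vs' = k" using Suc(2) w v \<open>length vs = length ws\<close> by auto
  have p: "redw n g (ws' @ [i])" "redw n g (vs' @ [j])" using Suc.prems w v by auto
  consider "i < j" | "j < i" | "i = j" by linarith
  then show ?case
  proof cases
    case 1
    show ?thesis unfolding w v by (rule redw_tw_step[where k = k, OF _ p l(1) 1]) (fact IH)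
  next
    case 2
    show ?thesis unfolding w v by (rule redw_tw_step[where k = k, OF _ p(2,1) l(2) 2, symmetric]) (fact IH)
  next
    case 3
    have "tw ws' = tw vs'" using IH[of _ ws' vs'] redw_snocD(1) Suc.prems l unfolding w v 3 by blast
    then show ?thesis unfolding w v 3 by (simp add: tw_append)
  qed
qed

definition T :: "(nat \<Rightarrow> nat) \<Rightarrow> 'a" where "T g = tw (SOME ws. redw n g ws)"

lemma T_redw: "redw n g ws \<Longrightarrow> T g = tw ws"
  unfolding T_def by (rule redw_tw) (rule someI)

lemma T_id [simp]: "T id = 1"
proof -
  have "redw n id []" by (simp add: redw_def srt_ninv[symmetric] srt_def)
  then show ?thesis using T_redw[of id "[]"] by simp
qed

lemma T_asc:
  assumes "g permutes {1..n}" "1 \<le> i" "i < n" "g i < g (Suc i)"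
  shows "T (g \<circ> sadj i) = T g * z i"
proof -
  obtain r where r: "redw n g r" using redw_exists assms(1) by blast
  show ?thesis using T_redw[OF redw_snoc_asc[OF r assms(2-4)]] T_redw[OF r] by (simp add: tw_append)
qed

lemma T_desc:
  assumes "g permutes {1..n}" "1 \<le> i" "i < n" "g (Suc i) < g i"
  shows "T g = T (g \<circ> sadj i) * z i"
  using T_asc[OF o_sadj_permutes[OF assms(1-3)] assms(2,3)] assms(4) by simp

lemma permutes_ninv_induct [consumes 1, case_names id desc]:
  assumes "g permutes {1..n}" and "P id"
    and "\<And>g i. g permutes {1..n} \<Longrightarrow> 1 \<le> i \<Longrightarrow> i < n \<Longrightarrow> g (Suc i) < g i \<Longrightarrow> P (g \<circ> sadj i) \<Longrightarrow> P g"
  shows "P g"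
  using assms(1)
proof (induction "ninv n g" arbitrary: g)
  case 0
  then have "g = id" using permutes_srt_id srt_ninv by metis
  show ?case unfolding \<open>g = id\<close> by (rule assms(2))
next
  case (Suc k)
  then have "\<not> srt n g" by (simp add: srt_ninv)
  then obtain i where i: "1 \<le> i" "i < n" "g (Suc i) < g i" using not_srt_desc by blast
  have "k = ninv n (g \<circ> sadj i)" using ninv_desc[OF i] Suc(2) by simp
  from Suc(1)[OF this o_sadj_permutes[OF Suc.prems i(1,2)]] show ?case by (rule assms(3)[OF Suc.prems i])
qed

lemma star_1: "star 1 = 1"
  using star_qp[of 0] by (simp add: qp_0)

lemma star_0: "star 0 = 0"
  using star_add[of 0 0] by simp

lemma star_sum: "star (sum f A) = (\<Sum>x\<in>A. star (f x))"
  by (induction A rule: infinite_finite_induct) (simp_all add: star_0 star_add)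

lemma star_tw: "star (tw ws) = tw (rev ws)"
  by (induction ws) (simp_all add: tw_def star_mult star_z star_1)

lemma star_T:
  assumes "g permutes {1..n}" shows "star (T g) = T (inv g)"
proof -
  obtain r where r: "redw n g r" using redw_exists assms by blast
  show ?thesis using T_redw[OF r] T_redw[OF redw_rev[OF r]] star_tw by simp
qed

lemma uz_z: "1 \<le> i \<Longrightarrow> i < n \<Longrightarrow> i \<notin> cut \<Longrightarrow> u * x * z i * z i = u * x + (qp 1 - qp (-1)) * (u * x * z i)"
proof -
  assume a: "1 \<le> i" "i < n" "i \<notin> cut"
  have c: "x * (qp 1 - qp (-1)) = (qp 1 - qp (-1)) * x"
    by (simp add: right_diff_distrib left_diff_distrib qp_comm)
  have "u * x * z i * z i = x * (u * (z i * z i))" by (metis mult.assoc u_comm)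
  also have "\<dots> = x * u + x * (qp 1 - qp (-1)) * (u * z i)"
    unfolding quad[OF a] by (simp only: distrib_left mult.assoc)
  also have "\<dots> = u * x + (qp 1 - qp (-1)) * (x * (u * z i))"
    unfolding c u_comm[of x] mult.assoc ..
  also have "\<dots> = u * x + (qp 1 - qp (-1)) * (u * x * z i)"
    unfolding u_comm[of x, symmetric] mult.assoc ..
  finally show ?thesis .
qed

definition X :: "(nat \<Rightarrow> nat) \<Rightarrow> 'a" where "X g = u * T g"

lemma X_asc:
  "g permutes {1..n} \<Longrightarrow> 1 \<le> i \<Longrightarrow> i < n \<Longrightarrow> g i < g (Suc i) \<Longrightarrow> X g * z i = X (g \<circ> sadj i)"
  using T_asc[of g i] by (simp add: X_def mult.assoc)

lemma X_desc:
  assumes "g permutes {1..n}" "1 \<le> i" "i < n" "i \<notin> cut" "g (Suc i) < g i"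
  shows "X g * z i = X (g \<circ> sadj i) + (qp 1 - qp (-1)) * X g"
  using T_desc[OF assms(1-3,5)] uz_z[OF assms(2-4), of "T (g \<circ> sadj i)"] by (simp add: X_def mult.assoc)

lemma X_cut: "1 \<le> i \<Longrightarrow> i < n \<Longrightarrow> i \<in> cut \<Longrightarrow> X g * z i = 0"
  unfolding X_def by (metis cut_z mult.assoc mult_zero_right u_comm)

lemma u_X [simp]: "u * X g = X g"
  by (simp add: X_def u_idem mult.assoc[symmetric])

text \<open>Transpositions other than the one at \<open>j\<close> preserve \<open>{1..j}\<close>, so
  a reduced word of \<open>g\<close> has to contain the letter \<open>j\<close>, and
  \<open>z j\<close> vanishes in the corner.\<close>

lemma X_block:
  assumes "g permutes {1..n}" "1 \<le> j" "j < n" "j \<in> cut" "g ` {1..j} \<noteq> {1..j}"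
  shows "X g = 0"
  using assms(1,5)
proof (induction rule: permutes_ninv_induct)
  case (desc g i)
  have Xg: "X g = X (g \<circ> sadj i) * z i" using T_desc[OF desc(1-4)] by (simp add: X_def mult.assoc)
  show ?case
  proof (cases "i = j")
    case True
    then show ?thesis using Xg X_cut assms by simp
  next
    case False
    have "sadj i permutes {1..j}" if "i < j" using sadj_permutes[OF desc(2) that] .
    moreover have "sadj i ` {1..j} = id ` {1..j}" if "j < i" using that
      by (intro image_cong) (auto simp: sadj_other)
    ultimately have "sadj i ` {1..j} = {1..j}" using False permutes_image[of "sadj i" "{1..j}"]
      by (cases "i < j") auto
    then have "(g \<circ> sadj i) ` {1..j} = g ` {1..j}" by (metis image_comp)
    then have "X (g \<circ> sadj i) = 0" using desc(5,6) by metis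
    then show ?thesis using Xg by simp
  qed
qed simp

text \<open>The element of the permutation module with sorted word \<open>f0\<close> that is labelled by the word \<open>f\<close>;
  it is zero unless \<open>f\<close> is a rearrangement of \<open>f0\<close>.\<close>
definition e :: "(nat \<Rightarrow> nat) \<Rightarrow> (nat \<Rightarrow> nat) \<Rightarrow> 'a" where
  "e f0 f = (\<Sum>g | g permutes {1..n} \<and> f0 \<circ> g = f. qp (int (ninv n g) - int (ninv n f)) * X g)"

text \<open>The strict increase at cuts says that no letter of the sorted word \<open>f0\<close>
  occurs in two different blocks.\<close>

definition good :: "(nat \<Rightarrow> nat) \<Rightarrow> bool" where
  "good f0 \<longleftrightarrow> srt n f0 \<and> (\<forall>i\<in>cut. 1 \<le> i \<longrightarrow> i < n \<longrightarrow> f0 i < f0 (Suc i))"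

lemma finite_fib [simp]: "finite A \<Longrightarrow> finite {g. g permutes A \<and> P g}"
  by (rule finite_subset[OF _ finite_permutations[of A]]) auto

lemma u_e [simp]: "u * e f0 f = e f0 f"
  unfolding e_def sum_distrib_left
  by (rule sum.cong) (simp_all add: mult.assoc[symmetric] qp_comm, simp add: mult.assoc)

text \<open>Since \<open>f0\<close> is sorted, a strict ascent of the word \<open>f\<close> is an
  ascent of every \<open>g\<close> in the sum. The exponent counts the inversions of
  \<open>g\<close> between equal letters of \<open>f\<close>, and swapping two unequal letters does
  not change that number.\<close>

lemma e_asc:
  assumes "good f0" "1 \<le> i" "i < n" "f i < f (Suc i)"
  shows "e f0 f * z i = e f0 (f \<circ> sadj i)"
proof -
  have s: "srt n f0" using assms(1) by (simp add: good_def)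
  have asc: "g i < g (Suc i)" if g: "g permutes {1..n}" "f0 \<circ> g = f" for g
  proof (rule ccontr)
    assume "\<not> g i < g (Suc i)"
    moreover have "1 \<le> g (Suc i)" "g i \<le> n" using permutes_in_seg[OF g(1)] assms(2,3) by auto
    ultimately have "f0 (g (Suc i)) \<le> f0 (g i)" by (intro srt_le[OF s]) auto
    then show False using g(2) assms(4) by auto
  qed
  have "e f0 f * z i = (\<Sum>g | g permutes {1..n} \<and> f0 \<circ> g = f.
      qp (int (ninv n (g \<circ> sadj i)) - int (ninv n (f \<circ> sadj i))) * X (g \<circ> sadj i))"
    unfolding e_def sum_distrib_right
  proof (rule sum.cong[OF refl])
    fix g assume "g \<in> {g. g permutes {1..n} \<and> f0 \<circ> g = f}"
    then have g: "g permutes {1..n}" "f0 \<circ> g = f" by auto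
    note a = asc[OF g]
    have "int (ninv n (g \<circ> sadj i)) - int (ninv n (f \<circ> sadj i)) = int (ninv n g) - int (ninv n f)"
      using ninv_asc[OF assms(2,3) a] ninv_asc[OF assms(2-4)] by simp
    then show "qp (int (ninv n g) - int (ninv n f)) * X g * z i =
      qp (int (ninv n (g \<circ> sadj i)) - int (ninv n (f \<circ> sadj i))) * X (g \<circ> sadj i)"
      using X_asc[OF g(1) assms(2,3) a] by (simp add: mult.assoc)
  qed
  also have "\<dots> = e f0 (f \<circ> sadj i)"
    unfolding e_def
    by (rule sum.reindex_bij_witness[where i = "\<lambda>g. g \<circ> sadj i" and j = "\<lambda>g. g \<circ> sadj i"])
      (use o_sadj_permutes assms(2,3) in \<open>auto simp: comp_assoc[symmetric]\<close>)
  finally show ?thesis .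
qed

text \<open>A permutation \<open>g\<close> in the sum that preserved \<open>{1..i}\<close> would
  force \<open>f i < f (Suc i)\<close>, because \<open>f0\<close> is sorted and jumps at the cut. So
  each term dies by \<open>X_block\<close>.\<close>

lemma e_block:
  assumes "good f0" "1 \<le> i" "i < n" "i \<in> cut" "f (Suc i) \<le> f i"
  shows "e f0 f = 0"
  unfolding e_def
proof (rule sum.neutral, clarify)
  fix g assume g: "g permutes {1..n}" and f: "f = f0 \<circ> g"
  have s: "srt n f0" using assms(1) by (simp add: good_def)
  have "g ` {1..i} \<noteq> {1..i}"
  proof
    assume im: "g ` {1..i} = {1..i}"
    have "g i \<in> g ` {1..i}" using assms by auto
    then have 1: "1 \<le> g i" "g i \<le> i" using im by auto
    have "g (Suc i) \<notin> g ` {1..i}"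
    proof
      assume "g (Suc i) \<in> g ` {1..i}"
      then obtain x where "x \<in> {1..i}" "g (Suc i) = g x" by blast
      with injD[OF permutes_inj[OF g]] show False by fastforce
    qed
    then have 2: "Suc i \<le> g (Suc i)" "g (Suc i) \<le> n" using im permutes_in_seg[OF g, of "Suc i"] assms by auto
    have "f0 (g i) \<le> f0 i" using 1 assms by (intro srt_le[OF s]) auto
    also have "\<dots> < f0 (Suc i)" using assms by (auto simp: good_def)
    also have "\<dots> \<le> f0 (g (Suc i))" using 2 assms by (intro srt_le[OF s]) auto
    finally show False using assms(5) f by simp
  qed
  then have "X g = 0" using X_block g assms by blast
  then show "qp (int (ninv n g) - int (ninv n (f0 \<circ> g))) * X g = 0" by simp
qed

text \<open>The fibre over \<open>f\<close> is stable under the swap. On each pair formed by an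
  ascending \<open>g\<close> and its swap, whose weights differ by one factor \<open>q\<close>, the
  quadratic relation shows that \<open>z i\<close> acts with eigenvalue \<open>q\<close>.\<close>

lemma e_eq:
  assumes "good f0" "1 \<le> i" "i < n" "f i = f (Suc i)"
  shows "e f0 f * z i = qp 1 * e f0 f"
proof (cases "i \<in> cut")
  case True
  then show ?thesis using e_block[of f0 i f] assms by simp
next
  case False
  let ?S = "{g. g permutes {1..n} \<and> f0 \<circ> g = f}"
  let ?A = "{g \<in> ?S. g i < g (Suc i)}" and ?D = "{g \<in> ?S. g (Suc i) < g i}"
  let ?F = "\<lambda>g. qp (int (ninv n g) - int (ninv n f)) * X g"
  have fs: "f \<circ> sadj i = f"
  proof
    fix x show "(f \<circ> sadj i) x = f x"
      using assms(4) by (cases "x = i"; cases "x = Suc i") (auto simp: sadj_other)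
  qed
  have clos: "g \<circ> sadj i \<in> ?S" if "g \<in> ?S" for g
    using that o_sadj_permutes assms(2,3) fs by (auto simp: comp_assoc[symmetric])
  have S: "?S = ?A \<union> ?D"
  proof -
    have "g i \<noteq> g (Suc i)" if "g permutes {1..n}" for g using injD[OF permutes_inj[OF that], of i "Suc i"] by auto
    then show ?thesis by (auto simp: neq_iff)
  qed
  \<comment> \<open>Any sum over the fibre is a sum over its ascending half, each term joined by its
    swapped partner.\<close>
  have sumS: "(\<Sum>g\<in>?S. G g) = (\<Sum>g\<in>?A. G g + G (g \<circ> sadj i))" for G :: "_ \<Rightarrow> 'a"
  proof -
    have "(\<Sum>g\<in>?S. G g) = (\<Sum>g\<in>?A. G g) + (\<Sum>g\<in>?D. G g)"
      by (subst S, subst sum.union_disjoint) auto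
    also have "(\<Sum>g\<in>?D. G g) = (\<Sum>g\<in>?A. G (g \<circ> sadj i))"
      by (rule sum.reindex_bij_witness[where i = "\<lambda>g. g \<circ> sadj i" and j = "\<lambda>g. g \<circ> sadj i"])
        (use clos in auto)
    finally show ?thesis unfolding sum.distrib .
  qed
  have "e f0 f * z i = (\<Sum>g\<in>?A. ?F g * z i + ?F (g \<circ> sadj i) * z i)"
    unfolding e_def sum_distrib_right by (rule sumS)
  also have "\<dots> = (\<Sum>g\<in>?A. qp 1 * ?F g + qp 1 * ?F (g \<circ> sadj i))"
  proof (rule sum.cong[OF refl])
    fix g assume "g \<in> ?A"
    then have g: "g permutes {1..n}" "f0 \<circ> g = f" "g i < g (Suc i)" by auto
    let ?a = "int (ninv n g) - int (ninv n f)"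
    have l: "int (ninv n (g \<circ> sadj i)) - int (ninv n f) = ?a + 1" using ninv_asc[OF assms(2,3) g(3)] by simp
    have x: "X (g \<circ> sadj i) * z i = X g + (qp 1 - qp (-1)) * X (g \<circ> sadj i)"
      using X_desc[OF o_sadj_permutes[OF g(1) assms(2,3)] assms(2,3) False] g(3) by simp
    have q: "qp (?a + 1) * qp (-1) = qp ?a" using qp_add[of "?a + 1" "-1"] by simp
    have q2: "qp (?a + 1) * qp 1 = qp 1 * qp (?a + 1)" by (rule qp_comm)
    have q1: "qp 1 * qp ?a = qp (?a + 1)" using qp_add[of 1 ?a] by (simp add: add.commute)
    have "?F g * z i + ?F (g \<circ> sadj i) * z i
       = qp ?a * X (g \<circ> sadj i) + qp (?a + 1) * (X g + (qp 1 - qp (-1)) * X (g \<circ> sadj i))"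
      unfolding l using X_asc[OF g(1) assms(2,3) g(3)] x by (simp add: mult.assoc)
    also have "\<dots> = qp (?a + 1) * X g + qp (?a + 1) * qp 1 * X (g \<circ> sadj i)"
      by (simp add: distrib_left left_diff_distrib right_diff_distrib q mult.assoc[symmetric])
    also have "\<dots> = qp 1 * ?F g + qp 1 * ?F (g \<circ> sadj i)"
      unfolding l mult.assoc[symmetric] q1 q2 ..
    finally show "?F g * z i + ?F (g \<circ> sadj i) * z i = qp 1 * ?F g + qp 1 * ?F (g \<circ> sadj i)" .
  qed
  also have "\<dots> = qp 1 * e f0 f"
    unfolding e_def sum_distrib_left by (rule sumS[symmetric])
  finally show ?thesis .
qed

text \<open>The second alternative covers \<open>i\<close> in the cut set, where
  \<open>e_block\<close> already kills \<open>e f0 f\<close>.\<close>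

lemma e_desc:
  assumes "good f0" "1 \<le> i" "i < n" "f (Suc i) < f i"
  shows "e f0 f * z i = e f0 (f \<circ> sadj i) + (qp 1 - qp (-1)) * e f0 f \<or> e f0 f * z i = 0"
proof (cases "i \<in> cut")
  case True
  then show ?thesis using e_block[of f0 i f] assms by simp
next
  case False
  let ?h = "f \<circ> sadj i"
  have 1: "e f0 ?h * z i = e f0 f" using e_asc[of f0 i ?h] assms by simp
  have "e f0 f * z i = u * e f0 ?h * z i * z i" using 1 by simp
  also have "\<dots> = e f0 ?h + (qp 1 - qp (-1)) * e f0 f"
    using uz_z[OF assms(2,3) False, of "e f0 ?h"] 1 by simp
  finally show ?thesis by simp
qed

end

section \<open>Rearrangements of a sorted word and their row-increasing permutations\<close>

definition orb :: "nat \<Rightarrow> (nat \<Rightarrow> nat) \<Rightarrow> (nat \<Rightarrow> nat) set" where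
  "orb n f0 = (\<lambda>g. f0 \<circ> g) ` {g. g permutes {1..n}}"

lemma finite_orb [simp]: "finite (orb n f0)"
  unfolding orb_def by (intro finite_imageI finite_permutations) simp

lemma orb_refl [simp]: "f0 \<in> orb n f0"
  unfolding orb_def using permutes_id[of "{1..n}"] by (metis comp_id imageI mem_Collect_eq)

lemma orb_compI: "g permutes {1..n} \<Longrightarrow> f0 \<circ> g \<in> orb n f0"
  by (simp add: orb_def)

lemma orb_swap: "f \<in> orb n f0 \<Longrightarrow> 1 \<le> i \<Longrightarrow> i < n \<Longrightarrow> f \<circ> sadj i \<in> orb n f0"
  unfolding orb_def using o_sadj_permutes by (auto simp only: comp_assoc image_iff mem_Collect_eq)

lemma orb_comp: "h \<in> orb n h0 \<Longrightarrow> c \<circ> h \<in> orb n (c \<circ> h0)"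
  unfolding orb_def by (auto simp only: comp_assoc image_iff mem_Collect_eq)

lemma orb_sym: "f \<in> orb n f0 \<Longrightarrow> f0 \<in> orb n f"
proof -
  assume "f \<in> orb n f0"
  then obtain g where g: "g permutes {1..n}" "f = f0 \<circ> g" by (auto simp: orb_def)
  have "f \<circ> inv g = f0" unfolding g(2) comp_assoc permutes_inv_o(1)[OF g(1)] by simp
  then show "f0 \<in> orb n f" using orb_compI[OF permutes_inv[OF g(1)], of f] by simp
qed

lemma orb_trans: "f \<in> orb n h \<Longrightarrow> h \<in> orb n f0 \<Longrightarrow> f \<in> orb n f0"
proof -
  assume "f \<in> orb n h" "h \<in> orb n f0"
  then obtain g g' where g: "g permutes {1..n}" "f = h \<circ> g" "g' permutes {1..n}" "h = f0 \<circ> g'"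
    by (auto simp: orb_def)
  then have "f = f0 \<circ> (g' \<circ> g)" by (simp add: comp_assoc)
  then show ?thesis using orb_compI[OF permutes_compose[OF g(1,3)]] by metis
qed

lemma sorted_words_eq:
  assumes "mset (map f [1..<Suc n]) = mset (map h [1..<Suc n])" "srt n f" "srt n h" "x \<in> {1..n}"
  shows "f x = h x"
proof -
  have s: "sorted (map k [1..<Suc n])" if "srt n k" for k
    using srt_le[OF that] by (auto simp: sorted_iff_nth_mono nth_append simp del: upt_Suc)
  have "map f [1..<Suc n] = map h [1..<Suc n]"
    using assms(1) s[OF assms(2)] s[OF assms(3)] by (metis properties_for_sort)
  then have "map f [1..<Suc n] ! (x - 1) = map h [1..<Suc n] ! (x - 1)" by (rule arg_cong)
  moreover have "map k [1..<Suc n] ! (x - 1) = k x" for k :: "nat \<Rightarrow> nat"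
    using assms(4) by (subst nth_map) (auto simp del: upt_Suc)
  ultimately show ?thesis by metis
qed

lemma orb_mset:
  assumes "f \<in> orb n f0" shows "mset (map f [1..<Suc n]) = mset (map f0 [1..<Suc n])"
proof -
  obtain g where g: "g permutes {1..n}" "f = f0 \<circ> g" using assms by (auto simp: orb_def)
  have "mset (map k [1..<Suc n]) = image_mset k (mset_set {1..n})" for k
    by (metis atLeastLessThanSuc_atLeastAtMost mset_map mset_upt)
  then show ?thesis using permutes_image_mset[OF g(1)] g(2) by (metis multiset.map_comp)
qed

lemma orb_srt_unique:
  assumes "f \<in> orb n f0" "srt n f" "srt n f0" shows "f = f0"
proof
  fix x
  obtain g where g: "g permutes {1..n}" "f = f0 \<circ> g" using assms by (auto simp: orb_def)
  show "f x = f0 x"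
  proof (cases "x \<in> {1..n}")
    case True
    then show ?thesis using sorted_words_eq[OF orb_mset[OF assms(1)] assms(2,3)] by blast
  next
    case False
    then show ?thesis using permutes_not_in[OF g(1), of x] g(2) by simp
  qed
qed

lemma orb_induct [consumes 2, case_names base desc]:
  assumes "f \<in> orb n f0" "srt n f0" and "P f0"
    and "\<And>f i. f \<in> orb n f0 \<Longrightarrow> 1 \<le> i \<Longrightarrow> i < n \<Longrightarrow> f (Suc i) < f i \<Longrightarrow> P (f \<circ> sadj i) \<Longrightarrow> P f"
  shows "P f"
  using assms(1)
proof (induction "ninv n f" arbitrary: f)
  case 0
  then have "f = f0" using orb_srt_unique assms(2) srt_ninv by metis
  show ?case unfolding \<open>f = f0\<close> by (rule assms(3))
next
  case (Suc k)
  then have "\<not> srt n f" by (simp add: srt_ninv)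
  then obtain i where i: "1 \<le> i" "i < n" "f (Suc i) < f i" using not_srt_desc by blast
  have "k = ninv n (f \<circ> sadj i)" using ninv_desc[OF i] Suc(2) by simp
  from Suc(1)[OF this orb_swap[OF Suc.prems i(1,2)]] show ?case by (rule assms(4)[OF Suc.prems i])
qed

text \<open>For \<open>g = w\<inverse>\<close> this says that \<open>w\<close> is the permutation \<open>d(\<ss>)\<close> of a row-standard tableau.\<close>
definition rowinc :: "nat \<Rightarrow> (nat \<Rightarrow> nat) \<Rightarrow> (nat \<Rightarrow> nat) \<Rightarrow> bool" where
  "rowinc n f0 g \<longleftrightarrow> (\<forall>x y. 1 \<le> x \<and> x < y \<and> y \<le> n \<and> f0 x = f0 y \<longrightarrow> inv g x < inv g y)"

lemma inv_o_sadj: "g permutes {1..n} \<Longrightarrow> inv (g \<circ> sadj i) = sadj i \<circ> inv g"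
  using o_inv_distrib[OF permutes_bij bij_sadj] by simp

text \<open>The word is sorted by swapping strict descents only. Equal letters are never exchanged
  on the way, so the accumulated permutation keeps them in order.\<close>

lemma rowinc_exists:
  assumes "srt n f0" "f \<in> orb n f0"
  shows "\<exists>g. g permutes {1..n} \<and> rowinc n f0 g \<and> f0 \<circ> g = f"
  using assms(2,1)
proof (induction rule: orb_induct)
  case base
  have "rowinc n f0 id" unfolding rowinc_def inv_id by simp
  then show ?case using permutes_id[of "{1..n}"] comp_id by metis
next
  case (desc f i)
  then obtain g where g: "g permutes {1..n}" "rowinc n f0 g" "f0 \<circ> g = f \<circ> sadj i" by blast
  have "f0 (g i) = f (Suc i)" "f0 (g (Suc i)) = f i"
    using fun_cong[OF g(3), of i] fun_cong[OF g(3), of "Suc i"] by simp_all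
  then have ne: "f0 (g i) \<noteq> f0 (g (Suc i))" using desc by simp
  have "rowinc n f0 (g \<circ> sadj i)" unfolding rowinc_def
  proof (intro allI impI)
    fix x y assume xy: "1 \<le> x \<and> x < y \<and> y \<le> n \<and> f0 x = f0 y"
    then have l: "inv g x < inv g y" using g(2) by (auto simp: rowinc_def)
    have "(inv g x, inv g y) \<noteq> (i, Suc i)"
    proof
      assume "(inv g x, inv g y) = (i, Suc i)"
      then have "x = g i" "y = g (Suc i)" using permutes_inverses(1)[OF g(1)] by (metis prod.inject)+
      then show False using ne xy by simp
    qed
    then show "inv (g \<circ> sadj i) x < inv (g \<circ> sadj i) y"
      unfolding inv_o_sadj[OF g(1)] comp_apply using l by (intro sadj_less) auto
  qed
  moreover have "f0 \<circ> (g \<circ> sadj i) = f" using g(3) by (metis comp_assoc o_sadj_o)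
  ultimately show ?case using o_sadj_permutes[OF g(1) desc(2,3)] by blast
qed

text \<open>\<open>A\<close> is the algebra under study inside a possibly larger ring
  \<open>'a\<close>. Multipliers produced by the argument must be shown to lie in \<open>A\<close>,
  because the ideals formed later admit only such factors.\<close>

locale hecke_alg = hecke_corner +
  fixes A :: "'a set" and sc :: "laurent \<Rightarrow> 'a"
  assumes sc_add: "sc (c + d) = sc c + sc d" and sc_mult: "sc (c * d) = sc c * sc d" and sc_1: "sc 1 = 1"
    and sc_comm: "x * sc c = sc c * x" and star_sc: "star (sc c) = sc c" and A_sc: "sc c \<in> A"
    and qp_sc: "\<exists>c. qp k = sc c"
    and A_z: "1 \<le> i \<Longrightarrow> i < n \<Longrightarrow> z i \<in> A" and A_u: "u \<in> A"
    and A_add: "x \<in> A \<Longrightarrow> y \<in> A \<Longrightarrow> x + y \<in> A" and A_mult: "x \<in> A \<Longrightarrow> y \<in> A \<Longrightarrow> x * y \<in> A"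
    and A_star: "x \<in> A \<Longrightarrow> star x \<in> A"
begin

lemma sc_0: "sc 0 = 0"
  using sc_add[of 0 0] by simp

lemma sc_uminus: "sc (- c) = - sc c"
  using sc_add[of c "- c"] by (simp add: sc_0 eq_neg_iff_add_eq_0 add.commute)

lemma A_qp: "qp k \<in> A"
  using qp_sc[of k] A_sc by auto

lemma A_0: "0 \<in> A"
  using A_sc[of 0] by (simp add: sc_0)

lemma A_1: "1 \<in> A" using A_qp[of 0] by (simp add: qp_0)

lemma A_sum: "(\<And>x. x \<in> I \<Longrightarrow> f x \<in> A) \<Longrightarrow> sum f I \<in> A"
  by (induction I rule: infinite_finite_induct) (auto simp: A_0 A_add)

lemma A_T: assumes "g permutes {1..n}" shows "T g \<in> A"
proof -
  obtain r where r: "redw n g r" using redw_exists assms by blast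
  have "set r \<subseteq> {1..<n}" using r by (simp add: redw_def)
  then have "tw r \<in> A" by (induction r) (auto simp: tw_def A_1 intro!: A_mult A_z)
  then show ?thesis using T_redw[OF r] by simp
qed

lemma A_e: "e f0 f \<in> A"
  unfolding e_def X_def by (intro A_sum) (auto intro!: A_mult A_qp A_u A_T)

text \<open>Row-increase excludes a descent of \<open>g\<close> between equal letters of
  \<open>f0\<close>. Hence every step of a reduced word is a strict ascent of the word, and
  \<open>e_asc\<close> applies each time.\<close>

lemma e_T:
  assumes "g permutes {1..n}" "good f0" "rowinc n f0 g"
  shows "e f0 (f0 \<circ> g) = e f0 f0 * T g"
  using assms(1,3)
proof (induction rule: permutes_ninv_induct)
  case id
  show ?case unfolding comp_id T_id by simp
next
  case (desc g i)
  have s: "srt n f0" using assms(2) by (simp add: good_def)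
  let ?h = "g \<circ> sadj i"
  have gg: "inv g (g x) = x" for x using permutes_inverses(2)[OF desc(1)] by simp
  have "rowinc n f0 ?h" unfolding rowinc_def
  proof (intro allI impI)
    fix x y assume xy: "1 \<le> x \<and> x < y \<and> y \<le> n \<and> f0 x = f0 y"
    then have l: "inv g x < inv g y" using desc.prems by (auto simp: rowinc_def)
    have "(inv g x, inv g y) \<noteq> (i, Suc i)"
    proof
      assume "(inv g x, inv g y) = (i, Suc i)"
      then have "x = g i" "y = g (Suc i)" using permutes_inverses(1)[OF desc(1)] by (metis prod.inject)+
      then show False using desc(4) xy by simp
    qed
    then show "inv ?h x < inv ?h y"
      unfolding inv_o_sadj[OF desc(1)] comp_apply using l by (intro sadj_less) auto
  qed
  from desc.IH[OF this] have IH: "e f0 (f0 \<circ> ?h) = e f0 f0 * T ?h" .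
  have b: "1 \<le> g (Suc i)" "g i \<le> n" using permutes_in_seg[OF desc(1)] desc(2,3) by auto
  have "f0 (g (Suc i)) \<le> f0 (g i)" using desc(4) b by (intro srt_le[OF s]) auto
  moreover have "f0 (g (Suc i)) \<noteq> f0 (g i)"
  proof
    assume "f0 (g (Suc i)) = f0 (g i)"
    then have "inv g (g (Suc i)) < inv g (g i)" using desc.prems desc(4) b by (auto simp: rowinc_def)
    then show False by (simp add: gg)
  qed
  ultimately have a: "(f0 \<circ> ?h) i < (f0 \<circ> ?h) (Suc i)" by simp
  have "e f0 (f0 \<circ> g) = e f0 (f0 \<circ> ?h \<circ> sadj i)" by (metis comp_assoc o_sadj_o)
  also have "\<dots> = e f0 (f0 \<circ> ?h) * z i" by (rule e_asc[OF assms(2) desc(2,3) a, symmetric])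
  also have "\<dots> = e f0 f0 * T g" unfolding IH T_desc[OF desc(1-4)] by (simp add: mult.assoc)
  finally show ?case .
qed

lemma e_right:
  assumes "good f0" "f \<in> orb n f0"
  shows "\<exists>t\<in>A. e f0 f = e f0 f0 * t"
proof -
  have "srt n f0" using assms by (simp add: good_def)
  from rowinc_exists[OF this assms(2)] obtain g where
    g: "g permutes {1..n}" "rowinc n f0 g" "f0 \<circ> g = f" by blast
  show ?thesis using e_T[OF g(1) assms(1) g(2)] g A_T by auto
qed

text \<open>The fibre over \<open>f0\<close> is a stabiliser subgroup, so it is closed under
  inversion; the anti-automorphism inverts permutations and inversion keeps the length.\<close>

lemma star_e: "star (e f0 f0) = e f0 f0"
proof -
  have "star (e f0 f0) = (\<Sum>g | g permutes {1..n} \<and> f0 \<circ> g = f0. qp (int (ninv n g) - int (ninv n f0)) * X (inv g))"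
    unfolding e_def star_sum
  proof (rule sum.cong[OF refl], clarify)
    fix g assume g: "g permutes {1..n}" "f0 \<circ> g = f0"
    have "star (qp k * X g) = qp k * X (inv g)" for k
      unfolding X_def star_mult star_u star_qp star_T[OF g(1)] by (metis mult.assoc qp_comm u_comm)
    then show "star (qp (int (ninv n g) - int (ninv n f0)) * X g) = qp (int (ninv n g) - int (ninv n f0)) * X (inv g)" .
  qed
  also have "\<dots> = e f0 f0"
    unfolding e_def
  proof (rule sum.reindex_bij_witness[where i = inv and j = inv], goal_cases)
    case (3 g)
    then show ?case using permutes_inv_inv[of g "{1..n}"] by auto
  next
    case (1 g)
    then show ?case using permutes_inv_inv[of g "{1..n}"] by auto
  next
    case (2 g)
    then have g: "g permutes {1..n}" "f0 \<circ> g = f0" by auto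
    have "f0 \<circ> inv g = f0 \<circ> g \<circ> inv g" using g(2) by simp
    also have "\<dots> = f0" unfolding comp_assoc permutes_inv_o(1)[OF g(1)] by simp
    finally show ?case using permutes_inv[OF g(1)] by simp
  next
    case (4 g)
    then have g: "g permutes {1..n}" "f0 \<circ> g = f0" by auto
    have "f0 \<circ> inv g = f0 \<circ> g \<circ> inv g" using g(2) by simp
    also have "\<dots> = f0" unfolding comp_assoc permutes_inv_o(1)[OF g(1)] by simp
    finally show ?case using permutes_inv[OF g(1)] by simp
  next
    case (5 g)
    then show ?case using ninv_inv[of g n] by simp
  qed
  finally show ?thesis .
qed

text \<open>Permutations are grouped by the finer word \<open>h0 \<circ> g\<close>. This embeds the
  permutation module of the coarser content into that of the finer one.\<close>

lemma e_coarsen: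
  "e (c \<circ> h0) F = (\<Sum>h | h \<in> orb n h0 \<and> c \<circ> h = F. qp (int (ninv n h) - int (ninv n F)) * e h0 h)"
proof -
  let ?S = "{g. g permutes {1..n} \<and> (c \<circ> h0) \<circ> g = F}" and ?T = "{h. h \<in> orb n h0 \<and> c \<circ> h = F}"
  let ?G = "\<lambda>g. qp (int (ninv n g) - int (ninv n F)) * X g"
  have "e (c \<circ> h0) F = (\<Sum>h\<in>?T. \<Sum>g\<in>{g \<in> ?S. h0 \<circ> g = h}. ?G g)"
    unfolding e_def
    by (rule sum.group[symmetric]) (auto simp only: finite_fib finite_Collect_conjI finite_orb orb_compI comp_assoc
        finite_atLeastAtMost Collect_mem_eq simp_thms)
  also have "\<dots> = (\<Sum>h\<in>?T. qp (int (ninv n h) - int (ninv n F)) * e h0 h)"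
  proof (rule sum.cong[OF refl], clarify)
    fix h assume h: "h \<in> orb n h0" "F = c \<circ> h"
    have set_eq: "{g \<in> {g. g permutes {1..n} \<and> (c \<circ> h0) \<circ> g = c \<circ> h}. h0 \<circ> g = h} = {g. g permutes {1..n} \<and> h0 \<circ> g = h}"
      by (auto simp only: comp_assoc)
    have "qp (int (ninv n g) - int (ninv n (c \<circ> h))) * x
      = qp (int (ninv n h) - int (ninv n (c \<circ> h))) * (qp (int (ninv n g) - int (ninv n h)) * x)" for g x
      using qp_add[of "int (ninv n h) - int (ninv n (c \<circ> h))" "int (ninv n g) - int (ninv n h)"]
      by (simp add: mult.assoc)
    then show "(\<Sum>g\<in>{g \<in> {g. g permutes {1..n} \<and> (c \<circ> h0) \<circ> g = c \<circ> h}. h0 \<circ> g = h}.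
        qp (int (ninv n g) - int (ninv n (c \<circ> h))) * X g) = qp (int (ninv n h) - int (ninv n (c \<circ> h))) * e h0 h"
      unfolding set_eq unfolding e_def sum_distrib_left by simp
  qed
  finally show ?thesis .
qed

text \<open>The projection opposite to the embedding \<open>e_coarsen\<close>. Expanding the coarse
  generator gives \<open>e h0 h0 * y'\<close>; applying \<open>star\<close> turns \<open>y'\<close>
  into a left multiplier that is right on the sorted word, and right multiplication by the
  \<open>z i\<close> carries the identity along the whole orbit.\<close>

lemma e_left_map:
  assumes h0: "good h0" and ch0: "good (c \<circ> h0)" and c: "mono c"
  shows "\<exists>y\<in>A. \<forall>h\<in>orb n h0. y * e h0 h = qp (int (ninv n h) - int (ninv n (c \<circ> h))) * e (c \<circ> h0) (c \<circ> h)"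
proof -
  have s: "srt n h0" "srt n (c \<circ> h0)" using h0 ch0 by (simp_all add: good_def)
  have "\<forall>h\<in>orb n h0. \<exists>t. t \<in> A \<and> e h0 h = e h0 h0 * t" using e_right[OF h0] by blast
  then obtain t where t: "\<And>h. h \<in> orb n h0 \<Longrightarrow> t h \<in> A \<and> e h0 h = e h0 h0 * t h" by metis
  let ?I = "{h. h \<in> orb n h0 \<and> c \<circ> h = c \<circ> h0}"
  define y' where "y' = (\<Sum>h\<in>?I. qp (int (ninv n h) - int (ninv n (c \<circ> h0))) * t h)"
  have "e (c \<circ> h0) (c \<circ> h0) = (\<Sum>h\<in>?I. qp (int (ninv n h) - int (ninv n (c \<circ> h0))) * e h0 h)"
    by (rule e_coarsen)
  also have "\<dots> = e h0 h0 * y'" unfolding y'_def sum_distrib_left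
  proof (rule sum.cong[OF refl])
    fix h assume "h \<in> ?I"
    then have "e h0 h = e h0 h0 * t h" using t by blast
    then show "qp (int (ninv n h) - int (ninv n (c \<circ> h0))) * e h0 h = e h0 h0 * (qp (int (ninv n h) - int (ninv n (c \<circ> h0))) * t h)"
      by (metis mult.assoc qp_comm)
  qed
  finally have "star (e (c \<circ> h0) (c \<circ> h0)) = star (e h0 h0 * y')" by simp
  then have base: "star y' * e h0 h0 = e (c \<circ> h0) (c \<circ> h0)" by (simp add: star_mult star_e)
  have "y' \<in> A" unfolding y'_def by (intro A_sum A_mult A_qp) (use t in blast)
  have "star y' * e h0 h = qp (int (ninv n h) - int (ninv n (c \<circ> h))) * e (c \<circ> h0) (c \<circ> h)" if "h \<in> orb n h0" for h
    using that s(1)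
  proof (induction rule: orb_induct)
    case base
    have "ninv n h0 = 0" "ninv n (c \<circ> h0) = 0" using s by (simp_all only: srt_ninv)
    then show ?case unfolding \<open>star y' * e h0 h0 = e (c \<circ> h0) (c \<circ> h0)\<close>
      by (simp only: qp_0 of_nat_0 diff_self mult_1_left)
  next
    case (desc h i)
    let ?h = "h \<circ> sadj i"
    have a: "?h i < ?h (Suc i)" using desc(4) by simp
    have hh: "h = ?h \<circ> sadj i" by simp
    have n1: "ninv n h = Suc (ninv n ?h)" using ninv_desc[OF desc(2-4)] by simp
    have "e h0 h = e h0 ?h * z i" using e_asc[OF h0 desc(2,3) a] unfolding o_sadj_o ..
    then have "star y' * e h0 h = star y' * e h0 ?h * z i" by (simp only: mult.assoc)
    then have key: "star y' * e h0 h = qp (int (ninv n ?h) - int (ninv n (c \<circ> ?h))) * (e (c \<circ> h0) (c \<circ> ?h) * z i)"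
      unfolding desc(5) by (simp only: mult.assoc)
    have "(c \<circ> ?h) i \<le> (c \<circ> ?h) (Suc i)" using a c by (simp add: monoD)
    then consider "(c \<circ> ?h) i < (c \<circ> ?h) (Suc i)" | "(c \<circ> ?h) i = (c \<circ> ?h) (Suc i)" by linarith
    then show ?case
    proof cases
      case 1
      have "c \<circ> ?h \<circ> sadj i = c \<circ> h" by (simp only: comp_assoc sadj_o comp_id)
      then have eqs: "e (c \<circ> h0) (c \<circ> ?h) * z i = e (c \<circ> h0) (c \<circ> h)" "ninv n (c \<circ> h) = Suc (ninv n (c \<circ> ?h))"
        using e_asc[where f = "c \<circ> ?h", OF ch0 desc(2,3) 1] ninv_asc[where f = "c \<circ> ?h", OF desc(2,3) 1]
        by (simp_all only:)
      have "int (ninv n h) - int (ninv n (c \<circ> h)) = int (ninv n ?h) - int (ninv n (c \<circ> ?h))"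
        using n1 eqs(2) by linarith
      then show ?thesis unfolding key eqs(1) by (simp only:)
    next
      \<comment> \<open>The two letters become equal under \<open>c\<close>. The inversion that
        \<open>c\<close> forgets is paid for by the eigenvalue \<open>q\<close> of
        \<open>e_eq\<close>.\<close>
      case 2
      have "c \<circ> h = c \<circ> ?h"
      proof
        fix x show "(c \<circ> h) x = (c \<circ> ?h) x"
          using 2 by (cases "x = i"; cases "x = Suc i") (auto simp: sadj_other)
      qed
      then have ch: "c \<circ> h = c \<circ> ?h" .
      have "int (ninv n h) - int (ninv n (c \<circ> h)) = (int (ninv n ?h) - int (ninv n (c \<circ> ?h))) + 1"
        unfolding ch n1 by linarith
      then show ?thesis
        unfolding key e_eq[where f = "c \<circ> ?h", OF ch0 desc(2,3) 2] ch by (simp only: qp_add mult.assoc)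
    qed
  qed
  then show ?thesis using A_star[OF \<open>y' \<in> A\<close>] by blast
qed

end

section \<open>Garnir relations\<close>

definition cnt :: "nat \<Rightarrow> (nat \<Rightarrow> nat) \<Rightarrow> nat \<Rightarrow> nat" where
  "cnt n f v = card {p \<in> {1..n}. f p = v}"

lemma orb_cnt:
  assumes "f \<in> orb n f0" shows "cnt n f v = cnt n f0 v"
proof -
  obtain g where g: "g permutes {1..n}" "f = f0 \<circ> g" using assms by (auto simp: orb_def)
  have "bij_betw g {p \<in> {1..n}. f p = v} {p \<in> {1..n}. f0 p = v}"
    unfolding bij_betw_def
  proof (intro conjI)
    show "inj_on g {p \<in> {1..n}. f p = v}" using permutes_inj[OF g(1)] by (rule inj_on_subset) simp
    show "g ` {p \<in> {1..n}. f p = v} = {p \<in> {1..n}. f0 p = v}"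
    proof (intro equalityI subsetI)
      fix y assume "y \<in> {p \<in> {1..n}. f0 p = v}"
      then have "inv g y \<in> {1..n}" "g (inv g y) = y" "f (inv g y) = v"
        using permutes_in_image[OF permutes_inv[OF g(1)], of y] permutes_inverses(1)[OF g(1), of y] g(2) by auto
      then show "y \<in> g ` {p \<in> {1..n}. f p = v}" by force
    next
      fix y assume "y \<in> g ` {p \<in> {1..n}. f p = v}"
      then show "y \<in> {p \<in> {1..n}. f0 p = v}" using permutes_in_image[OF g(1)] g(2) by force
    qed
  qed
  then show ?thesis unfolding cnt_def by (rule bij_betw_same_card)
qed

lemma orbI_cnt:
  assumes "\<And>v. cnt n f v = cnt n f0 v" "\<And>p. p \<notin> {1..n} \<Longrightarrow> f p = f0 p"
  shows "f \<in> orb n f0"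
proof -
  have "image_mset f (mset_set {1..n}) = image_mset f0 (mset_set {1..n})"
  proof (rule multiset_eqI)
    fix v
    have "count (image_mset k (mset_set {1..n})) v = cnt n k v" for k :: "nat \<Rightarrow> nat"
      unfolding cnt_def by (subst count_image_mset_eq_card_vimage) (auto intro: arg_cong[where f = card])
    then show "count (image_mset f (mset_set {1..n})) v = count (image_mset f0 (mset_set {1..n})) v"
      using assms(1) by metis
  qed
  then obtain g where g: "g permutes {1..n}" "\<forall>x\<in>{1..n}. f x = f0 (g x)"
    using image_mset_eq_implies_permutes[of "{1..n}" f f0] by blast
  have "f = f0 \<circ> g"
  proof
    fix x show "f x = (f0 \<circ> g) x"
      using g assms(2)[of x] permutes_not_in[OF g(1), of x] by (cases "x \<in> {1..n}") auto
  qed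
  then show ?thesis using orb_compI[OF g(1)] by simp
qed

lemma orb_outside: "f \<in> orb n f0 \<Longrightarrow> p \<notin> {1..n} \<Longrightarrow> f p = f0 p"
  using permutes_not_in by (fastforce simp: orb_def)

lemma sorted_exists: "\<exists>f0\<in>orb n f. srt n f0"
proof (induction "ninv n f" arbitrary: f)
  case 0
  then show ?case using srt_ninv orb_refl by metis
next
  case (Suc k)
  then have "\<not> srt n f" by (simp add: srt_ninv)
  then obtain i where i: "1 \<le> i" "i < n" "f (Suc i) < f i" using not_srt_desc by blast
  have "k = ninv n (f \<circ> sadj i)" using ninv_desc[OF i] Suc(2) by simp
  from Suc(1)[OF this] obtain f0 where f0: "f0 \<in> orb n (f \<circ> sadj i)" "srt n f0" by blast
  show ?case using orb_trans[OF f0(1) orb_swap[OF orb_refl i(1,2)]] f0(2) by blast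
qed

lemma cnt_upd:
  assumes "p \<in> {1..n}" "H p = x" "v \<noteq> x"
  shows "cnt n (H(p := v)) w = (if w = x then cnt n H w - 1 else if w = v then Suc (cnt n H w) else cnt n H w)"
proof -
  have "{q \<in> {1..n}. (H(p := v)) q = w} =
    (if w = x then {q \<in> {1..n}. H q = w} - {p} else if w = v then insert p {q \<in> {1..n}. H q = w} else {q \<in> {1..n}. H q = w})"
    using assms by auto
  then show ?thesis using assms unfolding cnt_def by (auto simp: card_Diff_singleton)
qed

text \<open>Raising the letter at \<open>p\<close> can only lose inversions with earlier positions
  whose letters lie above \<open>v\<close> and not above \<open>w\<close>. These are excluded by
  \<open>before\<close>, so only later positions contribute.\<close>

lemma ninv_upd:
  assumes p: "p \<in> {1..n}" and vw: "v \<le> w" and before: "\<And>a. 1 \<le> a \<Longrightarrow> a < p \<Longrightarrow> \<not> (v < f a \<and> f a \<le> w)"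
  shows "ninv n (f(p := w)) = ninv n (f(p := v)) + card {b. p < b \<and> b \<le> n \<and> v \<le> f b \<and> f b < w}"
proof -
  have "ninv n (f(p := w)) = (\<Sum>(a, b)\<in>pos_pairs n.
     of_bool ((f(p := v)) b < (f(p := v)) a) + of_bool (a = p \<and> v \<le> f b \<and> f b < w))"
    unfolding ninv_def
  proof (rule sum.cong[OF refl], clarify)
    fix a b assume ab: "(a, b) \<in> pos_pairs n"
    show "of_bool ((f(p := w)) b < (f(p := w)) a) =
      (of_bool ((f(p := v)) b < (f(p := v)) a) + of_bool (a = p \<and> v \<le> f b \<and> f b < w) :: nat)"
      using ab before[of a] vw by (auto simp: pos_pairs_def not_less)
  qed
  also have "\<dots> = ninv n (f(p := v)) + (\<Sum>(a, b)\<in>pos_pairs n. of_bool (a = p \<and> v \<le> f b \<and> f b < w))"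
    unfolding ninv_def by (simp add: sum.distrib case_prod_unfold)
  also have "(\<Sum>(a, b)\<in>pos_pairs n. of_bool (a = p \<and> v \<le> f b \<and> f b < w) :: nat)
    = card {x \<in> pos_pairs n. fst x = p \<and> v \<le> f (snd x) \<and> f (snd x) < w}"
    by (simp add: case_prod_unfold Int_def)
  also have "\<dots> = card {b. p < b \<and> b \<le> n \<and> v \<le> f b \<and> f b < w}"
    by (rule bij_betw_same_card[of snd], rule bij_betwI[where g = "\<lambda>b. (p, b)"])
      (use p in \<open>auto simp: pos_pairs_def\<close>)
  finally show ?thesis .
qed

text \<open>An exchange argument: the two set differences have equal positive size, the elements
  gained are at most \<open>p\<close> and the elements given up exceed \<open>p\<close>.\<close>

lemma sum_less_of_initial:
  fixes C Fr :: "nat set"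
  assumes "finite Fr" "C \<subseteq> Fr" "card C = card {x \<in> Fr. x \<le> p}" "C \<noteq> {x \<in> Fr. x \<le> p}"
  shows "\<Sum>{x \<in> Fr. x \<le> p} < \<Sum>C"
proof -
  let ?D = "{x \<in> Fr. x \<le> p}"
  have fin: "finite C" "finite ?D" using assms finite_subset by auto
  have c: "card (C - ?D) = card (?D - C)"
    using card_Diff_subset_Int[of C ?D] card_Diff_subset_Int[of ?D C] fin assms(3) by (simp add: Int_commute)
  have "C - ?D \<noteq> {}"
  proof
    assume "C - ?D = {}"
    then have "C \<subseteq> ?D" by blast
    then show False using card_subset_eq[OF fin(2)] assms(3,4) by blast
  qed
  then have pos: "card (C - ?D) > 0" using fin by (simp add: card_gt_0_iff)
  have "\<Sum>(?D - C) \<le> of_nat (card (?D - C)) * p" by (rule sum_bounded_above) auto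
  also have "\<dots> < card (C - ?D) * Suc p" using pos c by simp
  also have "\<dots> \<le> \<Sum>(C - ?D)"
  proof -
    have "Suc p \<le> x" if "x \<in> C - ?D" for x using that assms(2) by auto
    then show ?thesis using sum_bounded_below[of "C - ?D" "Suc p" "\<lambda>x. x"] by simp
  qed
  finally have "\<Sum>(?D - C) < \<Sum>(C - ?D)" .
  moreover have "\<Sum>C = \<Sum>(C - ?D) + \<Sum>(C \<inter> ?D)" "\<Sum>?D = \<Sum>(?D - C) + \<Sum>(C \<inter> ?D)"
    using sum.Int_Diff[OF fin(1), of "\<lambda>x. x" ?D] sum.Int_Diff[OF fin(2), of "\<lambda>x. x" C]
    by (simp_all add: Int_commute add.commute)
  ultimately show ?thesis by linarith
qed

text \<open>Words carry letters divisible by 3, the letter of row \<open>r\<close> in component \<open>k\<close> being \<open>3 * (k * n + r)\<close>.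
  The spare letters \<open>\<rho> + 1\<close>, \<open>\<rho> + 2\<close> split the boxes that a Garnir relation moves between the
  neighbouring rows \<open>\<rho>\<close> and \<open>\<rho> + 3\<close> of one component.\<close>

definition col :: "nat \<Rightarrow> nat \<Rightarrow> nat" where
  "col \<rho> x = (if x = \<rho> + 1 then \<rho> else if x = \<rho> + 2 then \<rho> + 3 else x)"

text \<open>Forgets which free boxes have been assigned to the lower row, leaving a single free
  letter.\<close>

definition mrg :: "nat \<Rightarrow> nat \<Rightarrow> nat" where
  "mrg \<rho> x = (if x = \<rho> + 2 then \<rho> + 1 else x)"

text \<open>Meant for words without the letter \<open>\<rho>\<close>. There it preserves the order
  of the letters and lets all free boxes count as boxes of the upper row.\<close>

definition ren :: "nat \<Rightarrow> nat \<Rightarrow> nat" where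
  "ren \<rho> x = (if x = \<rho> + 1 then \<rho> else x)"

lemma mono_col: "mono (col \<rho>)" and mono_mrg: "mono (mrg \<rho>)" and mono_ren: "mono (ren \<rho>)"
  by (auto simp: mono_def col_def mrg_def ren_def)

definition free_pos :: "nat \<Rightarrow> nat \<Rightarrow> (nat \<Rightarrow> nat) \<Rightarrow> nat set" where
  "free_pos n \<rho> H = {p \<in> {1..n}. H p = \<rho> + 1}"

definition fill :: "nat \<Rightarrow> (nat \<Rightarrow> nat) \<Rightarrow> nat set \<Rightarrow> nat \<Rightarrow> nat" where
  "fill \<rho> H C p = (if p \<in> C then \<rho> + 2 else H p)"

lemma finite_free_pos [simp]: "finite (free_pos n \<rho> H)"
  by (simp add: free_pos_def)

lemma srt_mono: "srt n h \<Longrightarrow> mono c \<Longrightarrow> srt n (c \<circ> h)"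
  by (auto simp: srt_def mono_def)

text \<open>The index, counted from 0, of the block that contains position \<open>p\<close>; an
  element \<open>i\<close> of \<open>C\<close> cuts between \<open>i\<close> and
  \<open>Suc i\<close>.\<close>

definition blk_of :: "nat set \<Rightarrow> nat \<Rightarrow> nat" where "blk_of C p = card {i \<in> C. 1 \<le> i \<and> i < p}"

lemma blk_Suc_cut: "i \<in> C \<Longrightarrow> 1 \<le> i \<Longrightarrow> blk_of C (Suc i) = Suc (blk_of C i)"
proof -
  assume i: "i \<in> C" "1 \<le> i"
  have "{j \<in> C. 1 \<le> j \<and> j < Suc i} = insert i {j \<in> C. 1 \<le> j \<and> j < i}" using i by auto
  moreover have "finite {j \<in> C. 1 \<le> j \<and> j < i}" by (rule finite_subset[of _ "{..<i}"]) auto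
  ultimately show ?thesis unfolding blk_of_def by simp
qed

lemma block_letter_eq:
  fixes n :: nat assumes "r < n" "s < n" "k * n + r = l * n + s" shows "k = l \<and> r = s"
proof -
  have k: "(k * n + r) div n = k" and l: "(l * n + s) div n = l" using assms(1,2) by simp_all
  have "k = l" using k l unfolding assms(3) by simp
  then show ?thesis using assms(3) by simp
qed

text \<open>Sorted words of multicompositions: block \<open>k\<close> carries letters of component
  \<open>k\<close> only, but row lengths may be zero or increase.\<close>

definition valid_word :: "nat \<Rightarrow> nat set \<Rightarrow> (nat \<Rightarrow> nat) \<Rightarrow> bool" where
  "valid_word n C f0 \<longleftrightarrow> srt n f0 \<and> (\<forall>p. p \<notin> {1..n} \<longrightarrow> f0 p = 0) \<and>
     (\<forall>p\<in>{1..n}. \<exists>r<n. f0 p = 3 * (blk_of C p * n + r))"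

text \<open>The bound keeps \<open>\<rho> + 3\<close> in the component of \<open>\<rho>\<close>;
  without it the next letter could be the first row of the following component.\<close>

definition adj_letter :: "nat \<Rightarrow> nat \<Rightarrow> bool" where
  "adj_letter n \<rho> \<longleftrightarrow> (\<exists>k r. \<rho> = 3 * (k * n + r) \<and> Suc r < n)"

text \<open>The ballot condition inside each component. For the word of a tableau with increasing
  rows it expresses that the columns increase.\<close>

definition lattice_word :: "nat \<Rightarrow> (nat \<Rightarrow> nat) \<Rightarrow> bool" where
  "lattice_word n f \<longleftrightarrow> (\<forall>\<rho>. adj_letter n \<rho> \<longrightarrow>
     (\<forall>p\<le>n. card {q \<in> {1..p}. f q = \<rho> + 3} \<le> card {q \<in> {1..p}. f q = \<rho>}))"

context hecke_alg
begin

abbreviation blk :: "nat \<Rightarrow> nat" where "blk \<equiv> blk_of cut"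

abbreviation valid :: "(nat \<Rightarrow> nat) \<Rightarrow> bool" where "valid \<equiv> valid_word n cut"

abbreviation adj :: "nat \<Rightarrow> bool" where "adj \<equiv> adj_letter n"

lemma valid_good: assumes "valid f0" shows "good f0"
  unfolding good_def
proof (intro conjI ballI impI)
  fix i assume i: "i \<in> cut" "1 \<le> i" "i < n"
  then obtain r s where rs: "r < n" "f0 i = 3 * (blk i * n + r)" "f0 (Suc i) = 3 * (blk (Suc i) * n + s)"
    using assms unfolding valid_word_def by (meson Suc_leI atLeastAtMost_iff le_SucI less_imp_le_nat)
  then show "f0 i < f0 (Suc i)" using blk_Suc_cut[OF i(1,2)] by simp
qed (use assms in \<open>simp add: valid_word_def\<close>)

text \<open>Neighbouring rows belong to one component, whereas a valid word passes to the next
  component at a cut.\<close>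

lemma valid_adj_cut:
  assumes "valid f0" "adj \<rho>" "i \<in> cut" "1 \<le> i" "i < n"
  shows "\<not> (f0 i = \<rho> \<and> f0 (Suc i) = \<rho> + 3)"
proof
  assume a: "f0 i = \<rho> \<and> f0 (Suc i) = \<rho> + 3"
  obtain k t where kt: "\<rho> = 3 * (k * n + t)" "Suc t < n" using assms(2) by (auto simp: adj_letter_def)
  obtain r s where rs: "r < n" "f0 i = 3 * (blk i * n + r)" "s < n" "f0 (Suc i) = 3 * (blk (Suc i) * n + s)"
    using assms unfolding valid_word_def by (meson Suc_leI atLeastAtMost_iff le_SucI less_imp_le_nat)
  have "blk i * n + r = k * n + t" "blk (Suc i) * n + s = k * n + Suc t" using a kt rs by auto
  then have "blk i = k" "blk (Suc i) = k" using block_letter_eq rs kt by (metis Suc_lessD)+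
  then show False using blk_Suc_cut assms by simp
qed

text \<open>A pointwise smaller sorted word has more boxes in earlier rows, so these are contents
  strictly above \<open>f0\<close> in the dominance order.\<close>

definition low :: "(nat \<Rightarrow> nat) \<Rightarrow> (nat \<Rightarrow> nat) set" where
  "low f0 = {f1. valid f1 \<and> (\<forall>p. f1 p \<le> f0 p) \<and> f1 \<noteq> f0}"

inductive_set K :: "(nat \<Rightarrow> nat) \<Rightarrow> 'a set" for f0 where
  zero: "0 \<in> K f0"
| gen: "f1 \<in> low f0 \<Longrightarrow> a \<in> A \<Longrightarrow> b \<in> A \<Longrightarrow> a * e f1 f1 * b \<in> K f0"
| add: "x \<in> K f0 \<Longrightarrow> y \<in> K f0 \<Longrightarrow> x + y \<in> K f0"

lemma K_left: "x \<in> K f0 \<Longrightarrow> a \<in> A \<Longrightarrow> a * x \<in> K f0"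
proof (induction rule: K.induct)
  case (gen f1 c b)
  have "(a * c) * e f1 f1 * b \<in> K f0" by (intro K.gen A_mult gen)
  then show ?case by (simp add: mult.assoc)
qed (auto simp: distrib_left intro: K.zero K.add)

lemma K_right: "x \<in> K f0 \<Longrightarrow> a \<in> A \<Longrightarrow> x * a \<in> K f0"
proof (induction rule: K.induct)
  case (gen f1 c b)
  have "c * e f1 f1 * (b * a) \<in> K f0" by (intro K.gen A_mult gen)
  then show ?case by (simp add: mult.assoc)
qed (auto simp: distrib_right intro: K.zero K.add)

lemma K_star: "x \<in> K f0 \<Longrightarrow> star x \<in> K f0"
proof (induction rule: K.induct)
  case (gen f1 a b)
  have "star b * e f1 f1 * star a \<in> K f0" by (intro K.gen A_star gen)
  then show ?case by (simp add: star_mult star_e mult.assoc)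
qed (auto simp: star_add star_0 intro: K.zero K.add)

text \<open>The sum over all ways to put \<open>j\<close> of the free boxes of \<open>H\<close> into row \<open>\<rho> + 3\<close> and the others into row \<open>\<rho>\<close>.\<close>
definition garnir :: "nat \<Rightarrow> (nat \<Rightarrow> nat) \<Rightarrow> (nat \<Rightarrow> nat) \<Rightarrow> nat \<Rightarrow> 'a" where
  "garnir \<rho> f0 H j = (\<Sum>C | C \<subseteq> free_pos n \<rho> H \<and> card C = j.
     qp (2 * int (ninv n (fill \<rho> H C)) - int (ninv n H) - int (ninv n (col \<rho> \<circ> fill \<rho> H C)))
       * e f0 (col \<rho> \<circ> fill \<rho> H C))"

text \<open>Fibres and inversion numbers depend only on comparisons between letters, so a
  relabelling that preserves the order on the letters in use changes nothing.\<close>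

lemma e_rename:
  assumes "\<And>p q. p \<in> {1..n} \<Longrightarrow> q \<in> {1..n} \<Longrightarrow> c (w p) < c (w q) \<longleftrightarrow> w p < w q" and "f \<in> orb n w"
  shows "e (c \<circ> w) (c \<circ> f) = e w f"
proof -
  obtain g where g: "g permutes {1..n}" "f = w \<circ> g" using assms(2) by (auto simp: orb_def)
  have im: "k x \<in> {1..n} \<longleftrightarrow> x \<in> {1..n}" if "k permutes {1..n}" for k x using permutes_in_image[OF that] .
  have inj: "w p = w q" if "p \<in> {1..n}" "q \<in> {1..n}" "c (w p) = c (w q)" for p q
    using assms(1)[OF that(1,2)] assms(1)[OF that(2,1)] that(3) by (metis linorder_neq_iff)
  have "(c \<circ> w) \<circ> k = c \<circ> f \<longleftrightarrow> w \<circ> k = f" if k: "k permutes {1..n}" for k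
  proof
    assume eq: "(c \<circ> w) \<circ> k = c \<circ> f"
    show "w \<circ> k = f"
    proof
      fix x show "(w \<circ> k) x = f x"
      proof (cases "x \<in> {1..n}")
        case True
        then show ?thesis using fun_cong[OF eq, of x] inj[of "k x" "g x"] im[OF k] im[OF g(1)] g(2) by simp
      next
        case False
        then show ?thesis using permutes_not_in[OF k] permutes_not_in[OF g(1)] g(2) by simp
      qed
    qed
  qed (simp only: comp_assoc)
  then have "{k. k permutes {1..n} \<and> (c \<circ> w) \<circ> k = c \<circ> f} = {k. k permutes {1..n} \<and> w \<circ> k = f}" by blast
  moreover have "ninv n (c \<circ> f) = ninv n f"
    unfolding ninv_def
  proof (rule sum.cong[OF refl], clarify)
    fix a b assume "(a, b) \<in> pos_pairs n"
    then have "g a \<in> {1..n}" "g b \<in> {1..n}" using im[OF g(1)] by (auto simp: pos_pairs_def)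
    then show "of_bool ((c \<circ> f) b < (c \<circ> f) a) = (of_bool (f b < f a) :: nat)"
      using assms(1)[of "g b" "g a"] g(2) by simp
  qed
  ultimately show ?thesis unfolding e_def by simp
qed

end

lemma cnt_col:
  "cnt n (col \<rho> \<circ> h) v = (if v = \<rho> then cnt n h \<rho> + cnt n h (\<rho> + 1)
     else if v = \<rho> + 3 then cnt n h (\<rho> + 3) + cnt n h (\<rho> + 2)
     else if v = \<rho> + 1 \<or> v = \<rho> + 2 then 0 else cnt n h v)"
proof -
  have "{p \<in> {1..n}. (col \<rho> \<circ> h) p = v} =
    (if v = \<rho> then {p \<in> {1..n}. h p = \<rho>} \<union> {p \<in> {1..n}. h p = \<rho> + 1}
     else if v = \<rho> + 3 then {p \<in> {1..n}. h p = \<rho> + 3} \<union> {p \<in> {1..n}. h p = \<rho> + 2}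
     else if v = \<rho> + 1 \<or> v = \<rho> + 2 then {} else {p \<in> {1..n}. h p = v})"
    by (auto simp: col_def)
  moreover have "card ({p \<in> {1..n}. h p = a} \<union> {p \<in> {1..n}. h p = b})
    = card {p \<in> {1..n}. h p = a} + card {p \<in> {1..n}. h p = b}" if "a \<noteq> b" for a b
    using that by (intro card_Un_disjoint) auto
  ultimately show ?thesis unfolding cnt_def by (auto simp del: One_nat_def)
qed

lemma cnt_mrg:
  "cnt n (mrg \<rho> \<circ> h) v = (if v = \<rho> + 1 then cnt n h (\<rho> + 1) + cnt n h (\<rho> + 2)
     else if v = \<rho> + 2 then 0 else cnt n h v)"
proof -
  have "{p \<in> {1..n}. (mrg \<rho> \<circ> h) p = v} =
    (if v = \<rho> + 1 then {p \<in> {1..n}. h p = \<rho> + 1} \<union> {p \<in> {1..n}. h p = \<rho> + 2}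
     else if v = \<rho> + 2 then {} else {p \<in> {1..n}. h p = v})"
    by (auto simp: mrg_def)
  moreover have "card ({p \<in> {1..n}. h p = a} \<union> {p \<in> {1..n}. h p = b})
    = card {p \<in> {1..n}. h p = a} + card {p \<in> {1..n}. h p = b}" if "a \<noteq> b" for a b
    using that by (intro card_Un_disjoint) auto
  ultimately show ?thesis unfolding cnt_def by (auto simp del: One_nat_def)
qed

lemma cnt_fill:
  assumes "C \<subseteq> free_pos n \<rho> H" and "\<And>p. p \<in> {1..n} \<Longrightarrow> H p \<noteq> \<rho> + 2"
  shows "cnt n (fill \<rho> H C) v = (if v = \<rho> + 2 then card C
     else if v = \<rho> + 1 then cnt n H v - card C else cnt n H v)"
proof -
  have fin: "finite C" using assms(1) finite_free_pos finite_subset by blast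
  have "{p \<in> {1..n}. fill \<rho> H C p = v} = (if v = \<rho> + 2 then C
     else if v = \<rho> + 1 then {p \<in> {1..n}. H p = v} - C else {p \<in> {1..n}. H p = v})"
    using assms by (auto simp: fill_def free_pos_def)
  moreover have "C \<subseteq> {p \<in> {1..n}. H p = \<rho> + 1}" using assms(1) by (auto simp: free_pos_def)
  ultimately show ?thesis using fin unfolding cnt_def by (auto simp: card_Diff_subset)
qed

lemma cnt_0: "cnt n f v = 0 \<longleftrightarrow> (\<forall>p\<in>{1..n}. f p \<noteq> v)"
  by (auto simp: cnt_def)

lemma card_free_pos: "card (free_pos n \<rho> H) = cnt n H (\<rho> + 1)"
  by (simp add: free_pos_def cnt_def)

text \<open>The equations say that \<open>j\<close> free boxes placed in row
  \<open>\<rho> + 3\<close>, and the others in row \<open>\<rho>\<close>, complete \<open>H\<close>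
  to the content of \<open>f0\<close>.\<close>

definition garnir_cond :: "nat \<Rightarrow> nat \<Rightarrow> (nat \<Rightarrow> nat) \<Rightarrow> (nat \<Rightarrow> nat) \<Rightarrow> nat \<Rightarrow> bool" where
  "garnir_cond n \<rho> f0 H j \<longleftrightarrow> (\<forall>p. p \<notin> {1..n} \<longrightarrow> H p = 0) \<and> (\<forall>p\<in>{1..n}. H p \<noteq> \<rho> + 2) \<and> j \<le> cnt n H (\<rho> + 1) \<and>
    cnt n f0 \<rho> = cnt n H \<rho> + (cnt n H (\<rho> + 1) - j) \<and> cnt n f0 (\<rho> + 3) = cnt n H (\<rho> + 3) + j \<and>
    cnt n f0 (\<rho> + 1) = 0 \<and> cnt n f0 (\<rho> + 2) = 0 \<and>
    (\<forall>v. v \<notin> {\<rho>, \<rho> + 1, \<rho> + 2, \<rho> + 3} \<longrightarrow> cnt n f0 v = cnt n H v)"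

context hecke_alg
begin

text \<open>The fillings of the word with \<open>p0\<close> freed split according to whether
  \<open>p0\<close> stays in row \<open>\<rho>\<close> or goes to row \<open>\<rho> + 3\<close>. The
  hypotheses place \<open>p0\<close> after the other letters \<open>\<rho>\<close> and before the
  free and the lower ones, so that each change of the letter at \<open>p0\<close> alters the
  inversion numbers in a computable way.\<close>

lemma garnir_rec:
  assumes p0: "p0 \<in> {1..n}" "H p0 = \<rho>" and no2: "\<And>p. p \<in> {1..n} \<Longrightarrow> H p \<noteq> \<rho> + 2"
    and after: "\<And>b. b \<in> {1..n} \<Longrightarrow> H b \<in> {\<rho> + 1, \<rho> + 3} \<Longrightarrow> p0 < b"
    and last: "\<And>a. a \<in> {1..n} \<Longrightarrow> H a = \<rho> \<Longrightarrow> a \<le> p0" and j: "1 \<le> j"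
  shows "garnir \<rho> f0 (H(p0 := \<rho> + 1)) j = garnir \<rho> f0 H j
    + qp (int (cnt n H (\<rho> + 1)) - 2 * (int j - 1)) * garnir \<rho> f0 (H(p0 := \<rho> + 3)) (j - 1)"
proof -
  let ?s = "H(p0 := \<rho> + 1)" and ?t = "H(p0 := \<rho> + 3)" and ?Fr = "free_pos n \<rho> H"
  let ?q = "int (cnt n H (\<rho> + 1)) - 2 * (int j - 1)"
  let ?w = "\<lambda>H C. 2 * int (ninv n (fill \<rho> H C)) - int (ninv n H) - int (ninv n (col \<rho> \<circ> fill \<rho> H C))"
  let ?F = "\<lambda>H C. qp (?w H C) * e f0 (col \<rho> \<circ> fill \<rho> H C)"
  have fs: "free_pos n \<rho> ?s = insert p0 ?Fr" and ft: "free_pos n \<rho> ?t = ?Fr" and p0n: "p0 \<notin> ?Fr"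
    using p0 by (auto simp: free_pos_def)
  have Hn: "H(p0 := \<rho>) = H" using p0(2) by auto
  have bet: "x = \<rho> + 1 \<or> x = \<rho> + 2 \<or> x = \<rho> + 3" if "\<rho> < x" "x \<le> \<rho> + 3" for x using that by linarith
  have N1: "ninv n ?s = ninv n H"
  proof -
    have "False" if "p0 < b" "b \<le> n" "\<rho> \<le> H b" "H b < \<rho> + 1" for b
      using last[of b] that by simp
    then have "{b. p0 < b \<and> b \<le> n \<and> \<rho> \<le> H b \<and> H b < \<rho> + 1} = {}" by blast
    moreover have "\<not> (\<rho> < H a \<and> H a \<le> \<rho> + 1)" if "1 \<le> a" "a < p0" for a
      using after[of a] that p0 by fastforce
    ultimately show ?thesis using ninv_upd[OF p0(1), of \<rho> "\<rho> + 1" H] Hn by simp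
  qed
  have N3: "ninv n ?t = ninv n H + cnt n H (\<rho> + 1)"
  proof -
    have "{b. p0 < b \<and> b \<le> n \<and> \<rho> \<le> H b \<and> H b < \<rho> + 3} = ?Fr"
    proof (intro equalityI subsetI)
      fix b assume b: "b \<in> {b. p0 < b \<and> b \<le> n \<and> \<rho> \<le> H b \<and> H b < \<rho> + 3}"
      then have "b \<in> {1..n}" "H b \<noteq> \<rho>" using last[of b] by auto
      then show "b \<in> ?Fr" using b no2[of b] bet[of "H b"] by (auto simp: free_pos_def)
    qed (use after in \<open>auto simp: free_pos_def\<close>)
    moreover have "\<not> (\<rho> < H a \<and> H a \<le> \<rho> + 3)" if "1 \<le> a" "a < p0" for a
      using after[of a] that p0 no2[of a] bet[of "H a"] by fastforce
    ultimately show ?thesis using ninv_upd[OF p0(1), of \<rho> "\<rho> + 3" H] Hn card_free_pos[of n \<rho> H] by simp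
  qed
  have t1: "?F ?s C = ?F H C" if C: "C \<subseteq> ?Fr" for C
  proof -
    have p0C: "p0 \<notin> C" using C p0n by auto
    have f: "fill \<rho> ?s C = (fill \<rho> H C)(p0 := \<rho> + 1)" "(fill \<rho> H C)(p0 := \<rho>) = fill \<rho> H C"
      using p0C p0 by (auto simp: fill_def)
    have "False" if "p0 < b" "b \<le> n" "\<rho> \<le> fill \<rho> H C b" "fill \<rho> H C b < \<rho> + 1" for b
      using last[of b] that by (simp add: fill_def split: if_splits)
    then have "{b. p0 < b \<and> b \<le> n \<and> \<rho> \<le> fill \<rho> H C b \<and> fill \<rho> H C b < \<rho> + 1} = {}" by blast
    moreover have "\<not> (\<rho> < fill \<rho> H C a \<and> fill \<rho> H C a \<le> \<rho> + 1)" if "1 \<le> a" "a < p0" for a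
    proof
      assume "\<rho> < fill \<rho> H C a \<and> fill \<rho> H C a \<le> \<rho> + 1"
      then have "fill \<rho> H C a = \<rho> + 1" by linarith
      then have "H a = \<rho> + 1" by (auto simp: fill_def split: if_splits)
      then show False using after[of a] that p0 by simp
    qed
    ultimately have "ninv n (fill \<rho> ?s C) = ninv n (fill \<rho> H C)"
      using ninv_upd[OF p0(1), of \<rho> "\<rho> + 1" "fill \<rho> H C"] f by simp
    moreover have "col \<rho> \<circ> fill \<rho> ?s C = col \<rho> \<circ> fill \<rho> H C"
      using p0 by (auto simp: fun_eq_iff col_def fill_def)
    ultimately show ?thesis using N1 by simp
  qed
  \<comment> \<open>The exponent gains the number of free boxes of \<open>H\<close>, from the change
    of \<open>ninv n H\<close>, and loses twice the \<open>j - 1\<close> boxes of \<open>C\<close>,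
    from the change in the filled word.\<close>
  have t2: "?F ?s (insert p0 C) = qp ?q * ?F ?t C" if C: "C \<subseteq> ?Fr" "card C = j - 1" for C
  proof -
    have p0C: "p0 \<notin> C" using C p0n by auto
    have f: "fill \<rho> ?s (insert p0 C) = (fill \<rho> H C)(p0 := \<rho> + 2)" "fill \<rho> ?t C = (fill \<rho> H C)(p0 := \<rho> + 3)"
      using p0C p0 by (auto simp: fill_def)
    have "{b. p0 < b \<and> b \<le> n \<and> \<rho> + 2 \<le> fill \<rho> H C b \<and> fill \<rho> H C b < \<rho> + 3} = C"
    proof (intro equalityI subsetI)
      fix b assume b: "b \<in> {b. p0 < b \<and> b \<le> n \<and> \<rho> + 2 \<le> fill \<rho> H C b \<and> fill \<rho> H C b < \<rho> + 3}"
      then have "b \<in> {1..n}" "fill \<rho> H C b = \<rho> + 2" by auto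
      then show "b \<in> C" using no2[of b] by (auto simp: fill_def split: if_splits)
    next
      fix b assume b: "b \<in> C"
      then have "b \<in> {1..n}" "H b = \<rho> + 1" using C(1) by (auto simp: free_pos_def)
      then show "b \<in> {b. p0 < b \<and> b \<le> n \<and> \<rho> + 2 \<le> fill \<rho> H C b \<and> fill \<rho> H C b < \<rho> + 3}"
        using after[of b] b by (auto simp: fill_def)
    qed
    moreover have "\<not> (\<rho> + 2 < fill \<rho> H C a \<and> fill \<rho> H C a \<le> \<rho> + 3)" if "1 \<le> a" "a < p0" for a
    proof
      assume "\<rho> + 2 < fill \<rho> H C a \<and> fill \<rho> H C a \<le> \<rho> + 3"
      then have "fill \<rho> H C a = \<rho> + 3" by linarith
      then have "H a = \<rho> + 3" by (auto simp: fill_def split: if_splits)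
      then show False using after[of a] that p0 by simp
    qed
    ultimately have "ninv n (fill \<rho> ?t C) = ninv n (fill \<rho> ?s (insert p0 C)) + (j - 1)"
      using ninv_upd[OF p0(1), of "\<rho> + 2" "\<rho> + 3" "fill \<rho> H C"] f C(2) by simp
    moreover have cf: "col \<rho> \<circ> fill \<rho> ?s (insert p0 C) = col \<rho> \<circ> fill \<rho> ?t C"
      using p0C by (auto simp: fun_eq_iff col_def fill_def)
    ultimately have "?w ?s (insert p0 C) = ?q + ?w ?t C" using N1 N3 j by simp
    then show ?thesis unfolding cf by (simp only: qp_add mult.assoc)
  qed
  let ?I = "{C. C \<subseteq> ?Fr \<and> card C = j}" and ?J = "{C. C \<subseteq> ?Fr \<and> card C = j - 1}"
  have fin: "finite C" if "C \<subseteq> ?Fr" for C using that finite_free_pos finite_subset by blast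
  have finIJ: "finite ?I" "finite ?J" using finite_Pow_iff[of ?Fr] by (auto intro: finite_subset[of _ "Pow ?Fr"])
  have idx: "{C. C \<subseteq> insert p0 ?Fr \<and> card C = j} = ?I \<union> insert p0 ` ?J"
  proof (intro equalityI subsetI)
    fix C assume C: "C \<in> {C. C \<subseteq> insert p0 ?Fr \<and> card C = j}"
    show "C \<in> ?I \<union> insert p0 ` ?J"
    proof (cases "p0 \<in> C")
      case True
      have "finite C" using C fin finite_subset[of C "insert p0 ?Fr"] by auto
      then have "C = insert p0 (C - {p0})" "C - {p0} \<in> ?J" using True C by auto
      then show ?thesis by blast
    qed (use C in auto)
  next
    fix C assume "C \<in> ?I \<union> insert p0 ` ?J"
    then show "C \<in> {C. C \<subseteq> insert p0 ?Fr \<and> card C = j}"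
    proof
      assume "C \<in> insert p0 ` ?J"
      then obtain D where D: "C = insert p0 D" "D \<subseteq> ?Fr" "card D = j - 1" by auto
      then have "card C = j" using fin[OF D(2)] p0n j by (subst D(1), subst card_insert_disjoint) auto
      then show ?thesis using D by auto
    qed auto
  qed
  have "garnir \<rho> f0 ?s j = (\<Sum>C\<in>?I \<union> insert p0 ` ?J. ?F ?s C)"
    unfolding garnir_def fs idx ..
  also have "\<dots> = (\<Sum>C\<in>?I. ?F ?s C) + (\<Sum>C\<in>insert p0 ` ?J. ?F ?s C)"
    using p0n finIJ by (intro sum.union_disjoint) auto
  also have "(\<Sum>C\<in>insert p0 ` ?J. ?F ?s C) = (\<Sum>C\<in>?J. ?F ?s (insert p0 C))"
  proof (rule sum.reindex[unfolded comp_def])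
    show "inj_on (insert p0) ?J"
    proof (rule inj_onI)
      fix C D assume "C \<in> ?J" "D \<in> ?J" "insert p0 C = insert p0 D"
      then show "C = D" using p0n insert_ident[of p0 C D] by blast
    qed
  qed
  also have "\<dots> = qp ?q * garnir \<rho> f0 ?t (j - 1)"
    unfolding garnir_def ft sum_distrib_left by (intro sum.cong[OF refl] t2) auto
  also have "(\<Sum>C\<in>?I. ?F ?s C) = garnir \<rho> f0 H j"
    unfolding garnir_def by (intro sum.cong[OF refl] t1) auto
  finally show ?thesis .
qed

lemma garnir_orb:
  assumes v: "valid f0" and c: "garnir_cond n \<rho> f0 H j" and C: "C \<subseteq> free_pos n \<rho> H" "card C = j"
  shows "col \<rho> \<circ> fill \<rho> H C \<in> orb n f0"
proof (rule orbI_cnt)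
  have no2: "\<And>p. p \<in> {1..n} \<Longrightarrow> H p \<noteq> \<rho> + 2" using c by (auto simp: garnir_cond_def)
  fix w
  have cf: "cnt n (fill \<rho> H C) v = (if v = \<rho> + 2 then card C else if v = \<rho> + 1 then cnt n H v - card C else cnt n H v)" for v
    using cnt_fill[OF C(1)] no2 by blast
  consider "w \<notin> {\<rho>, \<rho> + 1, \<rho> + 2, \<rho> + 3}" | "w = \<rho>" | "w = \<rho> + 3" | "w \<in> {\<rho> + 1, \<rho> + 2}" by blast
  then show "cnt n (col \<rho> \<circ> fill \<rho> H C) w = cnt n f0 w"
    using c C(2) unfolding cnt_col cf garnir_cond_def by cases auto
next
  fix p assume p: "p \<notin> {1..n}"
  then have "p \<notin> C" using C(1) by (auto simp: free_pos_def)
  then show "(col \<rho> \<circ> fill \<rho> H C) p = f0 p"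
    using p c v by (auto simp: fill_def col_def garnir_cond_def valid_word_def)
qed

text \<open>\<open>h0\<close> is the sorted word in which the free boxes are already divided:
  \<open>col\<close> turns it into \<open>f0\<close>, and \<open>mrg\<close> into the sorted form of
  \<open>H\<close>. The merge stays strict at cuts because by \<open>valid_adj_cut\<close> the two
  spare letters never meet there.\<close>

lemma garnir_setup:
  assumes v: "valid f0" and a: "adj \<rho>" and c: "garnir_cond n \<rho> f0 H j"
  obtains h0 where "good h0" "good (mrg \<rho> \<circ> h0)" "col \<rho> \<circ> h0 = f0" "H \<in> orb n (mrg \<rho> \<circ> h0)"
    "cnt n h0 (\<rho> + 2) = j" "\<And>p. p \<notin> {1..n} \<Longrightarrow> h0 p = 0"
proof -
  have no2: "\<And>p. p \<in> {1..n} \<Longrightarrow> H p \<noteq> \<rho> + 2" and out: "\<And>p. p \<notin> {1..n} \<Longrightarrow> H p = 0"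
    using c by (auto simp: garnir_cond_def)
  have vout: "\<And>p. p \<notin> {1..n} \<Longrightarrow> f0 p = 0" and vs: "srt n f0" using v by (auto simp: valid_word_def)
  have "j \<le> card (free_pos n \<rho> H)" using c by (simp add: garnir_cond_def card_free_pos)
  then obtain C where C: "C \<subseteq> free_pos n \<rho> H" "card C = j" using obtain_subset_with_card_n by metis
  let ?h = "fill \<rho> H C"
  have cf: "cnt n ?h v = (if v = \<rho> + 2 then card C else if v = \<rho> + 1 then cnt n H v - card C else cnt n H v)" for v
    using cnt_fill[OF C(1)] no2 by blast
  obtain h0 where h0: "h0 \<in> orb n ?h" "srt n h0" using sorted_exists by blast
  have Cout: "p \<notin> C" if "p \<notin> {1..n}" for p using C(1) that by (auto simp: free_pos_def)
  have hout: "h0 p = 0" if "p \<notin> {1..n}" for p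
    using orb_outside[OF h0(1) that] out[OF that] Cout[OF that] by (simp add: fill_def)
  have ch: "col \<rho> \<circ> ?h \<in> orb n f0" by (rule garnir_orb[OF v c C])
  have "col \<rho> \<circ> h0 \<in> orb n f0" using orb_trans[OF orb_comp[OF h0(1)] ch] .
  then have ceq: "col \<rho> \<circ> h0 = f0" by (rule orb_srt_unique[OF _ srt_mono[OF h0(2) mono_col] vs])
  then have colh: "col \<rho> (h0 p) = f0 p" for p by (auto simp: fun_eq_iff)
  have g: "good h0" unfolding good_def
  proof (intro conjI ballI impI)
    fix i assume i: "i \<in> cut" "1 \<le> i" "i < n"
    then have "col \<rho> (h0 i) < col \<rho> (h0 (Suc i))" using valid_good[OF v] colh by (auto simp: good_def)
    then show "h0 i < h0 (Suc i)" using mono_col[of \<rho>] by (meson leD leI monoD)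
  qed (rule h0(2))
  have gm: "good (mrg \<rho> \<circ> h0)" unfolding good_def
  proof (intro conjI ballI impI)
    fix i assume i: "i \<in> cut" "1 \<le> i" "i < n"
    have "h0 i < h0 (Suc i)" using g i by (auto simp: good_def)
    moreover have "\<not> (h0 i = \<rho> + 1 \<and> h0 (Suc i) = \<rho> + 2)"
      using valid_adj_cut[OF v a i] colh[of i] colh[of "Suc i"] by (auto simp: col_def)
    ultimately show "(mrg \<rho> \<circ> h0) i < (mrg \<rho> \<circ> h0) (Suc i)" by (auto simp: mrg_def)
  qed (rule srt_mono[OF h0(2) mono_mrg])
  have "mrg \<rho> \<circ> ?h = H"
  proof
    fix p show "(mrg \<rho> \<circ> ?h) p = H p"
      using C(1) no2[of p] out[of p] by (cases "p \<in> {1..n}") (auto simp: mrg_def fill_def free_pos_def)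
  qed
  then have "H \<in> orb n (mrg \<rho> \<circ> h0)" using orb_comp[OF orb_sym[OF h0(1)], of "mrg \<rho>"] by simp
  moreover have "cnt n h0 (\<rho> + 2) = j" using orb_cnt[OF h0(1)] cf C(2) by simp
  ultimately show ?thesis using that g gm ceq hout by blast
qed

text \<open>The basis element of \<open>H\<close> is embedded into the module of \<open>h0\<close>
  by \<open>e_coarsen\<close> and then projected along \<open>col\<close> by
  \<open>e_left_map\<close>. The two exponents add up to the one in \<open>garnir\<close>, and the
  multiplier \<open>y\<close> does not depend on \<open>H\<close>.\<close>

lemma garnir_left:
  assumes h0: "good h0" "good (mrg \<rho> \<circ> h0)" and c: "col \<rho> \<circ> h0 = f0" "good f0"
    and j: "cnt n h0 (\<rho> + 2) = j" and out: "\<And>p. p \<notin> {1..n} \<Longrightarrow> h0 p = 0"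
  shows "\<exists>y\<in>A. \<forall>H\<in>orb n (mrg \<rho> \<circ> h0). garnir \<rho> f0 H j = y * e (mrg \<rho> \<circ> h0) H"
proof -
  have "good (col \<rho> \<circ> h0)" using c by simp
  from e_left_map[OF h0(1) this mono_col] obtain y where y: "y \<in> A"
    "\<And>h. h \<in> orb n h0 \<Longrightarrow> y * e h0 h = qp (int (ninv n h) - int (ninv n (col \<rho> \<circ> h))) * e f0 (col \<rho> \<circ> h)"
    unfolding c(1) by blast
  have "garnir \<rho> f0 H j = y * e (mrg \<rho> \<circ> h0) H" if H: "H \<in> orb n (mrg \<rho> \<circ> h0)" for H
  proof -
    have Hout: "H p = 0" if "p \<notin> {1..n}" for p
      using orb_outside[OF H that] out[OF that] by (simp add: mrg_def)
    have no2: "H p \<noteq> \<rho> + 2" for p using H by (auto simp: orb_def mrg_def split: if_splits)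
    have cH: "cnt n H v = cnt n (mrg \<rho> \<circ> h0) v" for v by (rule orb_cnt[OF H])
    have Cout: "p \<notin> C" if "p \<notin> {1..n}" "C \<subseteq> free_pos n \<rho> H" for p C using that by (auto simp: free_pos_def)
    have "y * e (mrg \<rho> \<circ> h0) H = (\<Sum>h | h \<in> orb n h0 \<and> mrg \<rho> \<circ> h = H.
        y * (qp (int (ninv n h) - int (ninv n H)) * e h0 h))"
      unfolding e_coarsen sum_distrib_left ..
    also have "\<dots> = (\<Sum>h | h \<in> orb n h0 \<and> mrg \<rho> \<circ> h = H.
        qp (2 * int (ninv n h) - int (ninv n H) - int (ninv n (col \<rho> \<circ> h))) * e f0 (col \<rho> \<circ> h))"
    proof (rule sum.cong[OF refl])
      fix h assume "h \<in> {h. h \<in> orb n h0 \<and> mrg \<rho> \<circ> h = H}"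
      then have h: "h \<in> orb n h0" by simp
      have "2 * int (ninv n h) - int (ninv n H) - int (ninv n (col \<rho> \<circ> h))
        = (int (ninv n h) - int (ninv n H)) + (int (ninv n h) - int (ninv n (col \<rho> \<circ> h)))" by linarith
      then have "qp (2 * int (ninv n h) - int (ninv n H) - int (ninv n (col \<rho> \<circ> h)))
        = qp (int (ninv n h) - int (ninv n H)) * qp (int (ninv n h) - int (ninv n (col \<rho> \<circ> h)))"
        by (simp only: qp_add)
      moreover have "y * (qp (int (ninv n h) - int (ninv n H)) * e h0 h) = qp (int (ninv n h) - int (ninv n H)) * (y * e h0 h)"
        by (metis mult.assoc qp_comm)
      ultimately show "y * (qp (int (ninv n h) - int (ninv n H)) * e h0 h) =
        qp (2 * int (ninv n h) - int (ninv n H) - int (ninv n (col \<rho> \<circ> h))) * e f0 (col \<rho> \<circ> h)"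
        using y(2)[OF h] by (simp only: mult.assoc)
    qed
    finally have yH: "y * e (mrg \<rho> \<circ> h0) H = (\<Sum>h | h \<in> orb n h0 \<and> mrg \<rho> \<circ> h = H.
        qp (2 * int (ninv n h) - int (ninv n H) - int (ninv n (col \<rho> \<circ> h))) * e f0 (col \<rho> \<circ> h))" .
    \<comment> \<open>A word that \<open>mrg\<close> sends to \<open>H\<close> is determined by the
      positions of \<open>\<rho> + 2\<close>; this matches the sum over words with the sum over
      subsets \<open>C\<close>.\<close>
    have fl: "fill \<rho> H {p \<in> {1..n}. h p = \<rho> + 2} = h" if h: "h \<in> orb n h0" "mrg \<rho> \<circ> h = H" for h
    proof
      fix p
      have "H p = mrg \<rho> (h p)" using h(2) by auto
      moreover have "h p = 0" if "p \<notin> {1..n}" using orb_outside[OF h(1) that] out[OF that] by simp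
      ultimately show "fill \<rho> H {p \<in> {1..n}. h p = \<rho> + 2} p = h p"
        by (cases "p \<in> {1..n}") (auto simp: fill_def mrg_def)
    qed
    have "(\<Sum>h | h \<in> orb n h0 \<and> mrg \<rho> \<circ> h = H.
        qp (2 * int (ninv n h) - int (ninv n H) - int (ninv n (col \<rho> \<circ> h))) * e f0 (col \<rho> \<circ> h)) = garnir \<rho> f0 H j"
      unfolding garnir_def
    proof (rule sum.reindex_bij_witness[where i = "fill \<rho> H" and j = "\<lambda>h. {p \<in> {1..n}. h p = \<rho> + 2}"], goal_cases)
      case (1 h)
      then show ?case using fl by blast
    next
      case (2 h)
      then have h: "h \<in> orb n h0" "mrg \<rho> \<circ> h = H" by auto
      have "{p \<in> {1..n}. h p = \<rho> + 2} \<subseteq> free_pos n \<rho> H" using h(2) by (auto simp: free_pos_def mrg_def)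
      moreover have "card {p \<in> {1..n}. h p = \<rho> + 2} = j" using orb_cnt[OF h(1), of "\<rho> + 2"] j by (simp add: cnt_def)
      ultimately show ?case by simp
    next
      case (3 C)
      then show ?case using no2 by (auto simp: fill_def free_pos_def)
    next
      case (4 C)
      then have C: "C \<subseteq> free_pos n \<rho> H" "card C = j" by auto
      have "mrg \<rho> \<circ> fill \<rho> H C = H"
        using C(1) no2 by (auto simp: fun_eq_iff mrg_def fill_def free_pos_def)
      moreover have "fill \<rho> H C \<in> orb n h0"
      proof (rule orbI_cnt)
        fix v show "cnt n (fill \<rho> H C) v = cnt n h0 v"
          using C(2) j unfolding cnt_fill[OF C(1) no2] cH cnt_mrg by auto
      qed (use Cout[OF _ C(1)] Hout out in \<open>auto simp: fill_def\<close>)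
      ultimately show ?case by simp
    next
      case (5 h)
      then have "fill \<rho> H {p \<in> {1..n}. h p = \<rho> + 2} = h" using fl by blast
      then show ?case by (simp only:)
    qed
    then show ?thesis using yH by simp
  qed
  then show ?thesis using y(1) by blast
qed

end

section \<open>Straightening and the spanning set\<close>

context hecke_alg
begin

text \<open>The recursion of \<open>garnir_rec\<close> turns letters \<open>\<rho>\<close> of \<open>H\<close> into free boxes. Once none is left, \<open>garnir_left\<close> makes
  the Garnir element a left multiple of an element \<open>e f1 f\<close> with \<open>f1\<close> below \<open>f0\<close>.\<close>
lemma garnir_ord_K:
  assumes v: "valid f0" and a: "adj \<rho>" and "garnir_cond n \<rho> f0 H j" and "cnt n H \<rho> < j"
    and "\<And>a b. a \<in> {1..n} \<Longrightarrow> b \<in> {1..n} \<Longrightarrow> H a = \<rho> \<Longrightarrow> H b \<in> {\<rho> + 1, \<rho> + 3} \<Longrightarrow> a < b"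
  shows "garnir \<rho> f0 H j \<in> K f0"
  using assms(3-5)
proof (induction "cnt n H \<rho>" arbitrary: H j)
  case (0 H j)
  obtain h0 where h0: "good h0" "good (mrg \<rho> \<circ> h0)" "col \<rho> \<circ> h0 = f0" "H \<in> orb n (mrg \<rho> \<circ> h0)"
    "cnt n h0 (\<rho> + 2) = j" "\<And>p. p \<notin> {1..n} \<Longrightarrow> h0 p = 0"
    using garnir_setup[OF v a "0.prems"(1)] by blast
  have colh: "f0 p = col \<rho> (h0 p)" for p using h0(3) by auto
  obtain y where y: "y \<in> A" "garnir \<rho> f0 H j = y * e (mrg \<rho> \<circ> h0) H"
    using garnir_left[OF h0(1-3) valid_good[OF v] h0(5,6)] h0(4) by blast
  define w where "w = mrg \<rho> \<circ> h0"
  define f1 where "f1 = ren \<rho> \<circ> w"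
  have wH: "H \<in> orb n w" using h0(4) by (simp add: w_def)
  have "cnt n w \<rho> = 0" using orb_cnt[OF wH, of \<rho>] 0 by simp
  then have nw: "w p \<noteq> \<rho>" if "p \<in> {1..n}" for p using that by (simp add: cnt_0)
  have nh: "h0 p \<noteq> \<rho>" if "p \<in> {1..n}" for p using nw[OF that] by (auto simp: w_def mrg_def)
  \<comment> \<open>Since \<open>\<rho>\<close> no longer occurs in \<open>w\<close>, the free
    letter can take its place without changing the order of the letters.\<close>
  have "ren \<rho> (w p) < ren \<rho> (w q) \<longleftrightarrow> w p < w q" if "p \<in> {1..n}" "q \<in> {1..n}" for p q
    using nw[OF that(1)] nw[OF that(2)] by (auto simp: ren_def)
  from e_rename[of "ren \<rho>" w, OF this wH] have er: "e w H = e f1 (ren \<rho> \<circ> H)"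
    unfolding f1_def by simp
  \<comment> \<open>\<open>f1\<close> arises from \<open>f0\<close> by moving up the boxes that
    carry \<open>\<rho> + 2\<close> in \<open>h0\<close>.\<close>
  have f1p: "f1 p = f0 p \<and> h0 p \<noteq> \<rho> + 2 \<or> f1 p = \<rho> \<and> f0 p = \<rho> + 3" for p
    unfolding colh by (auto simp: f1_def w_def ren_def mrg_def col_def)
  have vf1: "valid f1" unfolding valid_word_def
  proof (intro conjI allI ballI impI)
    show "srt n f1" unfolding f1_def w_def
      using h0(2) by (intro srt_mono[OF _ mono_ren]) (simp add: good_def)
    show "f1 p = 0" if "p \<notin> {1..n}" for p
      using h0(6)[OF that] by (simp add: f1_def w_def mrg_def ren_def)
    fix p assume p: "p \<in> {1..n}"
    then obtain r where r: "r < n" "f0 p = 3 * (blk p * n + r)" using v unfolding valid_word_def by blast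
    show "\<exists>r<n. f1 p = 3 * (blk p * n + r)"
    proof (cases "f1 p = f0 p")
      case False
      then have "f1 p = \<rho>" "f0 p = \<rho> + 3" using f1p[of p] by auto
      moreover obtain k t where kt: "\<rho> = 3 * (k * n + t)" "Suc t < n" using a by (auto simp: adj_letter_def)
      ultimately have "blk p * n + r = k * n + Suc t" using r by simp
      then have "blk p = k" using block_letter_eq[OF r(1) kt(2)] by simp
      then show ?thesis using \<open>f1 p = \<rho>\<close> kt by (intro exI[of _ t]) auto
    qed (use r in auto)
  qed
  \<comment> \<open>The count of \<open>\<rho>\<close> is 0 and below \<open>j\<close>, so
    \<open>j\<close> is positive and at least one box moves; this makes \<open>f1\<close> strictly
    smaller.\<close>
  have "\<exists>p\<in>{1..n}. h0 p = \<rho> + 2" using h0(5) 0 cnt_0[of n h0 "\<rho> + 2"] by auto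
  then have "f1 \<noteq> f0" using f1p by (metis add_eq_self_zero zero_neq_numeral)
  moreover have "f1 p \<le> f0 p" for p using f1p[of p] by auto
  ultimately have lf1: "f1 \<in> low f0" using vf1 by (simp add: low_def)
  have "ren \<rho> \<circ> H \<in> orb n f1" unfolding f1_def by (rule orb_comp[OF wH])
  from e_right[OF valid_good[OF vf1] this] obtain t where t: "t \<in> A" "e f1 (ren \<rho> \<circ> H) = e f1 f1 * t" by blast
  show ?case using K.gen[OF lf1 y(1) t(1)] y(2) er t(2) by (simp add: w_def mult.assoc)
next
  case (Suc i H j)
  let ?P = "{a \<in> {1..n}. H a = \<rho>}"
  have "?P \<noteq> {}" using Suc(2) cnt_0[of n H \<rho>] by auto
  then have "Max ?P \<in> ?P" by (intro Max_in) auto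
  define p0 where "p0 = Max ?P"
  have p0: "p0 \<in> {1..n}" "H p0 = \<rho>" using \<open>Max ?P \<in> ?P\<close> by (auto simp: p0_def)
  have last: "a \<le> p0" if "a \<in> {1..n}" "H a = \<rho>" for a using that by (auto simp: p0_def)
  have after: "p0 < b" if "b \<in> {1..n}" "H b \<in> {\<rho> + 1, \<rho> + 3}" for b using Suc.prems(3)[OF p0(1) that(1) p0(2) that(2)] .
  have c: "garnir_cond n \<rho> f0 H j" by fact
  then have no2: "\<And>p. p \<in> {1..n} \<Longrightarrow> H p \<noteq> \<rho> + 2" by (auto simp: garnir_cond_def)
  have j: "1 < j" using Suc by simp
  let ?s = "H(p0 := \<rho> + 1)" and ?t = "H(p0 := \<rho> + 3)"
  have cs: "cnt n ?s v = (if v = \<rho> then cnt n H v - 1 else if v = \<rho> + 1 then Suc (cnt n H v) else cnt n H v)" for v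
    by (rule cnt_upd[where H = H, OF p0]) simp
  have ct: "cnt n ?t v = (if v = \<rho> then cnt n H v - 1 else if v = \<rho> + 3 then Suc (cnt n H v) else cnt n H v)" for v
    by (rule cnt_upd[where H = H, OF p0]) simp
  \<comment> \<open>In both new words the number of letters \<open>\<rho>\<close> drops by one while
    \<open>j\<close> drops by at most one, so the inequality \<open>cnt n H \<rho> < j\<close>
    survives.\<close>
  have "garnir \<rho> f0 ?s j \<in> K f0"
  proof (rule Suc.hyps(1))
    show "i = cnt n ?s \<rho>" "cnt n ?s \<rho> < j" using cs Suc by auto
    show "garnir_cond n \<rho> f0 ?s j"
      using c p0 Suc(2) unfolding garnir_cond_def cs by auto
    fix a b assume ab: "a \<in> {1..n}" "b \<in> {1..n}" "?s a = \<rho>" "?s b \<in> {\<rho> + 1, \<rho> + 3}"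
    then have "a \<noteq> p0" "H a = \<rho>" by (auto split: if_splits)
    then show "a < b" using ab last[of a] Suc.prems(3)[of a b] by (cases "b = p0") auto
  qed
  moreover have "garnir \<rho> f0 ?t (j - 1) \<in> K f0"
  proof (rule Suc.hyps(1))
    show "i = cnt n ?t \<rho>" "cnt n ?t \<rho> < j - 1" using ct Suc by auto
    show "garnir_cond n \<rho> f0 ?t (j - 1)"
      using c p0 Suc(2) j unfolding garnir_cond_def ct by auto
    fix a b assume ab: "a \<in> {1..n}" "b \<in> {1..n}" "?t a = \<rho>" "?t b \<in> {\<rho> + 1, \<rho> + 3}"
    then have "a \<noteq> p0" "H a = \<rho>" by (auto split: if_splits)
    then show "a < b" using ab last[of a] Suc.prems(3)[of a b] by (cases "b = p0") auto
  qed
  moreover have rec: "garnir \<rho> f0 ?s j = garnir \<rho> f0 H j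
    + qp (int (cnt n H (\<rho> + 1)) - 2 * (int j - 1)) * garnir \<rho> f0 ?t (j - 1)"
    by (rule garnir_rec) (use p0 no2 after last j in auto)
  have "garnir \<rho> f0 H j = garnir \<rho> f0 ?s j
    + (- qp (int (cnt n H (\<rho> + 1)) - 2 * (int j - 1))) * garnir \<rho> f0 ?t (j - 1)" unfolding rec by simp
  moreover have "- qp k \<in> A" for k using qp_sc[of k] sc_uminus A_sc by metis
  ultimately show ?case using K.add K_left by metis
qed

text \<open>One multiplier \<open>y\<close> serves all rearrangements of the sorted merged word. On
  the sorted word the letters are in the order required by \<open>garnir_ord_K\<close>, and right
  multiplication reaches \<open>H\<close> from there.\<close>

lemma garnir_K:
  assumes v: "valid f0" and a: "adj \<rho>" and c: "garnir_cond n \<rho> f0 H j" and l: "cnt n H \<rho> < j"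
  shows "garnir \<rho> f0 H j \<in> K f0"
proof -
  obtain h0 where h0: "good h0" "good (mrg \<rho> \<circ> h0)" "col \<rho> \<circ> h0 = f0" "H \<in> orb n (mrg \<rho> \<circ> h0)"
    "cnt n h0 (\<rho> + 2) = j" "\<And>p. p \<notin> {1..n} \<Longrightarrow> h0 p = 0"
    using garnir_setup[OF v a c] by blast
  let ?w = "mrg \<rho> \<circ> h0"
  obtain y where y: "y \<in> A" "\<And>H'. H' \<in> orb n ?w \<Longrightarrow> garnir \<rho> f0 H' j = y * e ?w H'"
    using garnir_left[OF h0(1-3) valid_good[OF v] h0(5,6)] by blast
  have cn: "cnt n ?w x = cnt n H x" for x using orb_cnt[OF h0(4), of x] by simp
  have sw: "srt n ?w" using h0(2) by (simp add: good_def)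
  have "garnir \<rho> f0 ?w j \<in> K f0"
  proof (rule garnir_ord_K[OF v a])
    show "garnir_cond n \<rho> f0 ?w j"
      using c h0(6) unfolding garnir_cond_def cn by (auto simp: mrg_def)
    show "cnt n ?w \<rho> < j" using l by (simp only: cn)
    fix a b assume ab: "a \<in> {1..n}" "b \<in> {1..n}" "?w a = \<rho>" "?w b \<in> {\<rho> + 1, \<rho> + 3}"
    show "a < b"
    proof (rule ccontr)
      assume "\<not> a < b"
      then have "?w b \<le> ?w a" using ab(1,2) by (intro srt_le[OF sw]) auto
      then show False using ab(3,4) by auto
    qed
  qed
  then have "y * e ?w ?w \<in> K f0" using y(2)[OF orb_refl] by simp
  moreover obtain t where "t \<in> A" "e ?w H = e ?w ?w * t" using e_right[OF h0(2,4)] by blast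
  ultimately show ?thesis using y(2)[OF h0(4)] K_right[of "y * e ?w ?w" f0 t] by (simp add: mult.assoc)
qed

abbreviation lattice :: "(nat \<Rightarrow> nat) \<Rightarrow> bool" where "lattice \<equiv> lattice_word n"

section \<open>Spans over the Laurent polynomials\<close>

inductive_set spn :: "'a set \<Rightarrow> 'a set" for S where
  zero: "0 \<in> spn S"
| base: "x \<in> S \<Longrightarrow> y \<in> spn S \<Longrightarrow> sc c * x + y \<in> spn S"

lemma spn_add: "x \<in> spn S \<Longrightarrow> y \<in> spn S \<Longrightarrow> x + y \<in> spn S"
  by (induction rule: spn.induct) (auto simp: add.assoc intro: spn.base)

lemma spn_in: "x \<in> S \<Longrightarrow> x \<in> spn S"
  using spn.base[OF _ spn.zero, of x S 1] by (simp add: sc_1)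

lemma spn_map:
  assumes "x \<in> spn S" and add: "\<And>x y. \<phi> (x + y) = \<phi> x + \<phi> y" and scm: "\<And>c x. \<phi> (sc c * x) = sc c * \<phi> x"
    and S: "\<And>x. x \<in> S \<Longrightarrow> \<phi> x \<in> spn S'" and scale: "\<And>c x. x \<in> spn S' \<Longrightarrow> sc c * x \<in> spn S'"
  shows "\<phi> x \<in> spn S'"
  using assms(1)
proof (induction rule: spn.induct)
  case zero
  have "\<phi> 0 = 0" using add[of 0 0] by simp
  then show ?case by (simp add: spn.zero)
qed (auto simp: add scm intro!: spn_add scale S)

lemma spn_sc: "x \<in> spn S \<Longrightarrow> sc c * x \<in> spn S"
proof (induction rule: spn.induct)
  case (base x y d)
  then show ?case using spn.base[of x S "sc c * y" "c * d"] by (simp add: distrib_left sc_mult mult.assoc)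
qed (auto intro: spn.zero)

lemma spn_trans: "x \<in> spn S \<Longrightarrow> S \<subseteq> spn S' \<Longrightarrow> x \<in> spn S'"
  using spn_map[of x S "\<lambda>x. x" S'] spn_sc by blast

lemma spn_left: "x \<in> spn S \<Longrightarrow> (\<And>x. x \<in> S \<Longrightarrow> a * x \<in> spn S') \<Longrightarrow> a * x \<in> spn S'"
  by (rule spn_map[of x S "\<lambda>x. a * x"]) (auto simp: distrib_left spn_sc, metis mult.assoc sc_comm)

lemma spn_right: "x \<in> spn S \<Longrightarrow> (\<And>x. x \<in> S \<Longrightarrow> x * a \<in> spn S') \<Longrightarrow> x * a \<in> spn S'"
  by (rule spn_map[of x S "\<lambda>x. x * a"]) (auto simp: distrib_right spn_sc mult.assoc)

lemma spn_uminus: "x \<in> spn S \<Longrightarrow> - x \<in> spn S"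
  using spn_sc[of x S "- 1"] by (simp add: sc_uminus sc_1)

lemma spn_sum: "(\<And>i. i \<in> I \<Longrightarrow> f i \<in> spn S) \<Longrightarrow> sum f I \<in> spn S"
  by (induction I rule: infinite_finite_induct) (auto intro: spn.zero spn_add)

lemma spn_qp: "x \<in> spn S \<Longrightarrow> qp k * x \<in> spn S"
  using qp_sc[of k] spn_sc by metis

text \<open>If the lattice condition fails at \<open>p\<close>, free the letters \<open>\<rho> + 3\<close> up to \<open>p\<close> and the letters \<open>\<rho>\<close> after \<open>p\<close>. In the
  Garnir relation all words other than \<open>f\<close> have a larger moment \<open>\<Sum>q. q * f q\<close>.\<close>
lemma straighten:
  assumes v: "valid f0" and "f \<in> orb n f0"
  shows "e f0 f \<in> spn (e f0 ` {f' \<in> orb n f0. lattice f'} \<union> K f0)"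
  using assms(2)
proof (induction "Max ((\<lambda>f. \<Sum>q\<in>{1..n}. q * f q) ` orb n f0) - (\<Sum>q\<in>{1..n}. q * f q)" arbitrary: f rule: less_induct)
  case less
  let ?S = "e f0 ` {f' \<in> orb n f0. lattice f'} \<union> K f0" and ?M = "\<lambda>f. \<Sum>q\<in>{1..n}. q * f q"
  show ?case
  proof (cases "lattice f")
    case True
    then show ?thesis using less.prems by (intro spn_in) auto
  next
    case False
    then obtain \<rho> p where a: "adj \<rho>" and p: "p \<le> n" and
      vio: "card {q \<in> {1..p}. f q = \<rho>} < card {q \<in> {1..p}. f q = \<rho> + 3}"
      by (auto simp: lattice_word_def not_le)
    let ?C = "{q \<in> {1..p}. f q = \<rho> + 3}" and ?D = "{q \<in> {p<..n}. f q = \<rho>}"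
    define H where "H = (\<lambda>q. if q \<in> ?C \<union> ?D then \<rho> + 1 else f q)"
    let ?j = "card ?C"
    have fout: "f q = 0" if "q \<notin> {1..n}" for q
      using orb_outside[OF less.prems that] v that by (simp add: valid_word_def)
    obtain k t where kt: "\<rho> = 3 * (k * n + t)" using a by (auto simp: adj_letter_def)
    have f3: "\<exists>m. f q = 3 * m" for q
    proof -
      obtain g where g: "g permutes {1..n}" "f = f0 \<circ> g" using less.prems by (auto simp: orb_def)
      have "\<exists>m. f0 x = 3 * m" for x using v unfolding valid_word_def by (cases "x \<in> {1..n}") fastforce+
      then show ?thesis using g by simp
    qed
    have fne: "f q \<noteq> \<rho> + 1" "f q \<noteq> \<rho> + 2" for q using f3[of q] kt by presburger+
    have Fr: "free_pos n \<rho> H = ?C \<union> ?D" using p fne by (auto simp: free_pos_def H_def)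
    \<comment> \<open>The filling that gives back \<open>f\<close> uses an initial segment of the
      free positions, hence has the smallest sum of positions among subsets of its size.\<close>
    have CFr: "?C = {x \<in> free_pos n \<rho> H. x \<le> p}" unfolding Fr by auto
    have "cnt n H (\<rho> + 1) = card (?C \<union> ?D)" using Fr card_free_pos[of n \<rho> H] by simp
    also have "\<dots> = card ?C + card ?D" by (intro card_Un_disjoint) auto
    finally have c1: "cnt n H (\<rho> + 1) = card ?C + card ?D" .
    have "{q \<in> {1..n}. H q = \<rho>} = {q \<in> {1..p}. f q = \<rho>}" using p fne by (auto simp: H_def)
    then have c0: "cnt n H \<rho> = card {q \<in> {1..p}. f q = \<rho>}" by (simp add: cnt_def)
    have "{q \<in> {1..n}. f q = \<rho>} = {q \<in> {1..p}. f q = \<rho>} \<union> ?D" using p by auto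
    then have "cnt n f \<rho> = card ({q \<in> {1..p}. f q = \<rho>} \<union> ?D)" by (simp only: cnt_def)
    also have "\<dots> = card {q \<in> {1..p}. f q = \<rho>} + card ?D" by (intro card_Un_disjoint) auto
    finally have f0c: "cnt n f \<rho> = cnt n H \<rho> + card ?D" unfolding c0 .
    have "{q \<in> {1..n}. f q = \<rho> + 3} = {q \<in> {1..n}. H q = \<rho> + 3} \<union> ?C" using p by (auto simp: H_def)
    then have "cnt n f (\<rho> + 3) = card ({q \<in> {1..n}. H q = \<rho> + 3} \<union> ?C)" by (simp only: cnt_def)
    also have "\<dots> = cnt n H (\<rho> + 3) + card ?C"
      unfolding cnt_def by (intro card_Un_disjoint) (auto simp: H_def)
    finally have f3c: "cnt n f (\<rho> + 3) = cnt n H (\<rho> + 3) + card ?C" .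
    have oth: "cnt n f w = cnt n H w" if "w \<notin> {\<rho>, \<rho> + 1, \<rho> + 2, \<rho> + 3}" for w
      unfolding cnt_def using that by (intro arg_cong[where f = card]) (auto simp: H_def)
    have c: "garnir_cond n \<rho> f0 H ?j"
      unfolding garnir_cond_def
    proof (intro conjI allI ballI impI)
      show "H q = 0" if "q \<notin> {1..n}" for q using fout[OF that] that p by (auto simp: H_def)
      show "H q \<noteq> \<rho> + 2" for q using fne by (auto simp: H_def)
      show "cnt n f0 (\<rho> + 1) = 0" "cnt n f0 (\<rho> + 2) = 0"
        using orb_cnt[OF less.prems] fne by (metis cnt_0)+
    qed (use orb_cnt[OF less.prems] c1 f0c f3c oth in auto)
    \<comment> \<open>The inequality required by \<open>garnir_K\<close> is exactly the violated
      lattice condition: fewer letters \<open>\<rho>\<close> than letters \<open>\<rho> + 3\<close>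
      up to \<open>p\<close>.\<close>
    have gK: "garnir \<rho> f0 H ?j \<in> K f0" by (rule garnir_K[OF v a c]) (use vio c0 in simp)
    let ?I = "{C. C \<subseteq> free_pos n \<rho> H \<and> card C = ?j}"
    let ?w = "\<lambda>C. 2 * int (ninv n (fill \<rho> H C)) - int (ninv n H) - int (ninv n (col \<rho> \<circ> fill \<rho> H C))"
    let ?F = "\<lambda>C. qp (?w C) * e f0 (col \<rho> \<circ> fill \<rho> H C)"
    have finI: "finite ?I" by (rule finite_subset[of _ "Pow (free_pos n \<rho> H)"]) auto
    have CI: "?C \<in> ?I" using Fr by auto
    have colC: "col \<rho> \<circ> fill \<rho> H ?C = f"
      using fne by (auto simp: fun_eq_iff col_def fill_def H_def)
    \<comment> \<open>Choosing a free position \<open>q\<close> for the lower row raises its letter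
      by 3, which adds \<open>3 * q\<close> to the moment.\<close>
    have M: "?M (col \<rho> \<circ> fill \<rho> H C) = (\<Sum>q\<in>{1..n}. q * col \<rho> (H q)) + 3 * \<Sum>C" if "C \<in> ?I" for C
    proof -
      have C: "C \<subseteq> {1..n}" "\<And>q. q \<in> C \<Longrightarrow> H q = \<rho> + 1" using that by (auto simp: free_pos_def)
      have "?M (col \<rho> \<circ> fill \<rho> H C) = (\<Sum>q\<in>{1..n}. q * col \<rho> (H q) + 3 * (if q \<in> C then q else 0))"
        using C(2) by (intro sum.cong[OF refl]) (auto simp: col_def fill_def algebra_simps)
      also have "\<dots> = (\<Sum>q\<in>{1..n}. q * col \<rho> (H q)) + 3 * (\<Sum>q\<in>{1..n}. if q \<in> C then q else 0)"
        by (simp add: sum.distrib sum_distrib_left)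
      also have "(\<Sum>q\<in>{1..n}. if q \<in> C then q else 0) = \<Sum>C"
        using C(1) by (simp add: sum.inter_restrict[symmetric] Int_absorb1)
      finally show ?thesis .
    qed
    have rest: "e f0 (col \<rho> \<circ> fill \<rho> H C) \<in> spn ?S" if "C \<in> ?I - {?C}" for C
    proof (rule less.hyps)
      show o: "col \<rho> \<circ> fill \<rho> H C \<in> orb n f0" using that by (intro garnir_orb[OF v c]) auto
      have "\<Sum>{x \<in> free_pos n \<rho> H. x \<le> p} < \<Sum>C"
        using that CFr by (intro sum_less_of_initial) auto
      then have "?M f < ?M (col \<rho> \<circ> fill \<rho> H C)"
        using M[OF CI] M[of C] that unfolding CFr[symmetric] colC by simp
      moreover have "?M (col \<rho> \<circ> fill \<rho> H C) \<le> Max (?M ` orb n f0)" by (intro Max_ge finite_imageI finite_orb imageI[where f = ?M] o)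
      ultimately show "Max (?M ` orb n f0) - ?M (col \<rho> \<circ> fill \<rho> H C) < Max (?M ` orb n f0) - ?M f" by linarith
    qed
    have "garnir \<rho> f0 H ?j = ?F ?C + (\<Sum>C\<in>?I - {?C}. ?F C)"
      unfolding garnir_def by (rule sum.remove[OF finI CI])
    then have "qp (?w ?C) * e f0 f = garnir \<rho> f0 H ?j + - (\<Sum>C\<in>?I - {?C}. ?F C)"
      unfolding colC by simp
    also have "\<dots> \<in> spn ?S"
    proof (rule spn_add)
      show "garnir \<rho> f0 H ?j \<in> spn ?S" by (rule spn_in) (use gK in blast)
      have "(\<Sum>C\<in>?I - {?C}. ?F C) \<in> spn ?S" by (rule spn_sum, rule spn_qp, rule rest)
      then show "- (\<Sum>C\<in>?I - {?C}. ?F C) \<in> spn ?S" by (rule spn_uminus)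
    qed
    finally have "qp (- ?w ?C) * (qp (?w ?C) * e f0 f) \<in> spn ?S" by (rule spn_qp)
    moreover have "qp (- ?w ?C) * (qp (?w ?C) * e f0 f) = e f0 f"
      using qp_add[of "- ?w ?C" "?w ?C"] by (simp add: mult.assoc[symmetric] qp_0)
    ultimately show ?thesis by simp
  qed
qed

end

text \<open>The new assumption says that in the corner the algebra acts from the right through
  scalars and the \<open>z i\<close> alone. It is phrased as closure of submodules, so that elements
  of \<open>A\<close> never have to be expanded here.\<close>

locale hecke_gen = hecke_alg +
  assumes A_right: "\<And>V x b. (\<And>x. x \<in> V \<Longrightarrow> u * x = x) \<Longrightarrow> (\<And>x y. x \<in> V \<Longrightarrow> y \<in> V \<Longrightarrow> x + y \<in> V) \<Longrightarrow>
     (\<And>c x. x \<in> V \<Longrightarrow> sc c * x \<in> V) \<Longrightarrow> (\<And>x i. x \<in> V \<Longrightarrow> 1 \<le> i \<Longrightarrow> i < n \<Longrightarrow> x * z i \<in> V) \<Longrightarrow>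
     x \<in> V \<Longrightarrow> b \<in> A \<Longrightarrow> x * b \<in> V"
begin

lemma spn_u: "x \<in> spn S \<Longrightarrow> (\<And>x. x \<in> S \<Longrightarrow> u * x = x) \<Longrightarrow> u * x = x"
proof (induction rule: spn.induct)
  case (base x y c)
  have "u * (sc c * x) = sc c * (u * x)" by (metis mult.assoc sc_comm)
  then show ?case using base by (simp add: distrib_left)
qed simp

lemma e_z_spn:
  assumes "good f0" "f \<in> orb n f0" "1 \<le> i" "i < n"
  shows "e f0 f * z i \<in> spn (e f0 ` orb n f0)"
proof -
  have o: "f \<circ> sadj i \<in> orb n f0" using orb_swap[OF assms(2-4)] .
  have S: "e f0 h \<in> spn (e f0 ` orb n f0)" if "h \<in> orb n f0" for h using that by (intro spn_in) auto
  consider "f i < f (Suc i)" | "f i = f (Suc i)" | "f (Suc i) < f i" by linarith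
  then show ?thesis
  proof cases
    case 1
    then show ?thesis using e_asc[where f = f, OF assms(1,3,4)] S[OF o] by simp
  next
    case 2
    then show ?thesis using e_eq[where f = f, OF assms(1,3,4)] S[OF assms(2)] spn_qp by simp
  next
    case 3
    have "(qp 1 - qp (-1)) * e f0 f = qp 1 * e f0 f + - (qp (-1) * e f0 f)" by (simp add: left_diff_distrib)
    moreover have "e f0 (f \<circ> sadj i) + (qp 1 * e f0 f + - (qp (-1) * e f0 f)) \<in> spn (e f0 ` orb n f0)"
      by (intro spn_add spn_qp spn_uminus S o assms(2))
    ultimately have "e f0 (f \<circ> sadj i) + (qp 1 - qp (-1)) * e f0 f \<in> spn (e f0 ` orb n f0)" by (simp only:)
    then show ?thesis using e_desc[where f = f, OF assms(1,3,4) 3] spn.zero by auto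
  qed
qed

lemma x_right:
  assumes "valid f0" "b \<in> A"
  shows "e f0 f0 * b \<in> spn (e f0 ` {f \<in> orb n f0. lattice f} \<union> K f0)"
proof -
  have "e f0 f0 * b \<in> spn (e f0 ` orb n f0)"
  proof (rule A_right)
    show "u * x = x" if "x \<in> spn (e f0 ` orb n f0)" for x
      by (rule spn_u[OF that]) auto
    show "x * z i \<in> spn (e f0 ` orb n f0)" if "x \<in> spn (e f0 ` orb n f0)" "1 \<le> i" "i < n" for x i
      using that(1) by (rule spn_right) (use e_z_spn[OF valid_good[OF assms(1)] _ that(2,3)] in auto)
  qed (use assms in \<open>auto intro: spn_add spn_sc spn_in\<close>)
  then show ?thesis by (rule spn_trans) (use straighten[OF assms(1)] in auto)
qed

lemma spn_split:
  assumes "x \<in> spn (S \<union> K f0)" shows "\<exists>s\<in>spn S. \<exists>k\<in>K f0. x = s + k"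
  using assms
proof (induction rule: spn.induct)
  case zero
  then show ?case using spn.zero K.zero by force
next
  case (base x y c)
  then obtain s k where sk: "s \<in> spn S" "k \<in> K f0" "y = s + k" by blast
  from base(1) show ?case
  proof
    assume "x \<in> S"
    then show ?case using spn.base[OF _ sk(1), of x c] sk by (metis add.assoc)
  next
    assume "x \<in> K f0"
    then have "sc c * x + k \<in> K f0" using sk(2) K_left A_sc by (intro K.add) auto
    moreover have "sc c * x + y = s + (sc c * x + k)" using sk(3) by (simp add: algebra_simps)
    ultimately show ?case using sk(1) by blast
  qed
qed

lemma spn_finite:
  assumes "x \<in> spn (h ` I)" "finite I" shows "\<exists>c. x = (\<Sum>i\<in>I. sc (c i) * h i)"
  using assms(1)
proof (induction rule: spn.induct)
  case zero
  then show ?case by (intro exI[of _ "\<lambda>_. 0"]) (simp add: sc_0)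
next
  case (base x y d)
  then obtain i c where i: "i \<in> I" "x = h i" and c: "y = (\<Sum>i\<in>I. sc (c i) * h i)" by auto
  have "(\<Sum>j\<in>I. sc ((c(i := d + c i)) j) * h j) = (\<Sum>j\<in>I. (if j = i then sc d * h i else 0) + sc (c j) * h j)"
    by (rule sum.cong) (auto simp: sc_add distrib_right)
  also have "\<dots> = sc d * x + y" using i assms(2) by (simp add: sum.distrib c)
  finally show ?case by metis
qed

text \<open>The anti-automorphism fixes \<open>e f0 f0\<close> and the ideal \<open>K f0\<close>, so
  this is \<open>x_right\<close> applied to \<open>star a\<close> and read backwards.\<close>

lemma x_left:
  assumes "valid f0" "a \<in> A"
  shows "\<exists>r. \<exists>k\<in>K f0. a * e f0 f0 = (\<Sum>f | f \<in> orb n f0 \<and> lattice f. sc (r f) * star (e f0 f)) + k"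
proof -
  obtain s k where sk: "s \<in> spn (e f0 ` {f \<in> orb n f0. lattice f})" "k \<in> K f0" "e f0 f0 * star a = s + k"
    using spn_split[OF x_right[OF assms(1) A_star[OF assms(2)]]] by blast
  obtain r where r: "s = (\<Sum>f | f \<in> orb n f0 \<and> lattice f. sc (r f) * e f0 f)"
    using spn_finite[OF sk(1)] by auto
  have "a * e f0 f0 = star (e f0 f0 * star a)" by (simp add: star_mult star_star star_e)
  also have "\<dots> = (\<Sum>f | f \<in> orb n f0 \<and> lattice f. sc (r f) * star (e f0 f)) + star k"
    unfolding sk(3) r by (simp add: star_add star_sum star_mult star_sc sc_comm)
  finally show ?thesis using K_star[OF sk(2)] by blast
qed

text \<open>A chosen representative; by \<open>mb_eq\<close> the elements \<open>mb\<close> depend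
  only on the words and not on the choice.\<close>

definition dl :: "(nat \<Rightarrow> nat) \<Rightarrow> (nat \<Rightarrow> nat) \<Rightarrow> nat \<Rightarrow> nat" where
  "dl f0 f = (SOME g. g permutes {1..n} \<and> rowinc n f0 g \<and> f0 \<circ> g = f)"

definition mb :: "(nat \<Rightarrow> nat) \<Rightarrow> (nat \<Rightarrow> nat) \<Rightarrow> (nat \<Rightarrow> nat) \<Rightarrow> 'a" where
  "mb f0 f f' = star (T (dl f0 f)) * e f0 f0 * T (dl f0 f')"

lemma dl:
  assumes "valid f0" "f \<in> orb n f0"
  shows "dl f0 f permutes {1..n}" "rowinc n f0 (dl f0 f)" "f0 \<circ> dl f0 f = f"
proof -
  have "srt n f0" using assms(1) by (simp add: valid_word_def)
  from someI_ex[OF rowinc_exists[OF this assms(2)]]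
  show "dl f0 f permutes {1..n}" "rowinc n f0 (dl f0 f)" "f0 \<circ> dl f0 f = f" unfolding dl_def by auto
qed

lemma e_T_valid:
  "valid f0 \<Longrightarrow> g permutes {1..n} \<Longrightarrow> rowinc n f0 g \<Longrightarrow> e f0 (f0 \<circ> g) = e f0 f0 * T g"
  using e_T valid_good by blast

lemma mb_star_e:
  assumes "valid f0" "f \<in> orb n f0"
  shows "mb f0 f f' = star (e f0 f) * T (dl f0 f')"
proof -
  have "e f0 f = e f0 f0 * T (dl f0 f)" using e_T_valid[OF assms(1) dl(1,2)[OF assms]] dl(3)[OF assms] by simp
  then show ?thesis by (simp add: mb_def star_mult star_e)
qed

lemma mb_eq:
  assumes v: "valid f0" and g: "g permutes {1..n}" "rowinc n f0 g" and h: "h permutes {1..n}" "rowinc n f0 h"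
  shows "star (T g) * e f0 f0 * T h = mb f0 (f0 \<circ> g) (f0 \<circ> h)"
proof -
  have o: "f0 \<circ> g \<in> orb n f0" "f0 \<circ> h \<in> orb n f0" using g h by (auto intro: orb_compI)
  have eq: "e f0 f0 * T g = e f0 f0 * T (dl f0 (f0 \<circ> g))" "e f0 f0 * T h = e f0 f0 * T (dl f0 (f0 \<circ> h))"
    using e_T_valid[OF v g] e_T_valid[OF v h] e_T_valid[OF v dl(1,2)[OF v o(1)]] e_T_valid[OF v dl(1,2)[OF v o(2)]]
      dl(3)[OF v o(1)] dl(3)[OF v o(2)] by simp_all
  have "star (T g) * e f0 f0 = star (T (dl f0 (f0 \<circ> g))) * e f0 f0"
    using arg_cong[OF eq(1), of star] by (simp add: star_mult star_e)
  then show ?thesis unfolding mb_def using eq(2) by (metis mult.assoc)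
qed

definition Bs :: "(nat \<Rightarrow> nat) set \<Rightarrow> 'a set" where
  "Bs L = {mb f1 f f' | f1 f f'. f1 \<in> L \<and> f \<in> orb n f1 \<and> lattice f \<and> f' \<in> orb n f1 \<and> lattice f'}"

definition below :: "(nat \<Rightarrow> nat) \<Rightarrow> (nat \<Rightarrow> nat) set" where
  "below f0 = {f1. valid f1 \<and> (\<forall>p. f1 p \<le> f0 p)}"

lemma below_low: "f1 \<in> low f0 \<Longrightarrow> below f1 \<subseteq> low f0"
proof
  fix f2 assume f: "f1 \<in> low f0" "f2 \<in> below f1"
  have "f2 \<noteq> f0"
  proof
    assume "f2 = f0"
    then have "f1 = f0" using f by (auto simp: low_def below_def fun_eq_iff intro: antisym)
    then show False using f by (simp add: low_def)
  qed
  then show "f2 \<in> low f0" using f by (auto simp: low_def below_def intro: le_trans)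
qed

lemma K_span_aux:
  assumes "k \<in> K f0"
    and "\<And>f1 a b. f1 \<in> low f0 \<Longrightarrow> a \<in> A \<Longrightarrow> b \<in> A \<Longrightarrow> a * e f1 f1 * b \<in> spn (Bs (below f1))"
  shows "k \<in> spn (Bs (low f0))"
  using assms(1)
proof (induction rule: K.induct)
  case (gen f1 a b)
  have "Bs (below f1) \<subseteq> Bs (low f0)" using below_low[OF gen(1)] unfolding Bs_def by blast
  then show ?case using assms(2)[OF gen] by (meson spn_in spn_trans subset_iff)
qed (auto intro: spn.zero spn_add)

text \<open>Induction on the sum of the letters, which drops strictly on \<open>low f0\<close>. The
  right factor is straightened first, then the left one against the same \<open>e f0 f0\<close>;
  both errors fall into \<open>K f0\<close> and are covered by the induction hypothesis.\<close>

lemma two_sided_span: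
  "valid f0 \<Longrightarrow> a \<in> A \<Longrightarrow> b \<in> A \<Longrightarrow> a * e f0 f0 * b \<in> spn (Bs (below f0))"
proof (induction "\<Sum>p\<in>{1..n}. f0 p" arbitrary: f0 a b rule: less_induct)
  case (less f0 a b)
  note 1 = less.prems
  have K: "k \<in> spn (Bs (low f0))" if "k \<in> K f0" for k
    using that
  proof (rule K_span_aux)
    fix f1 a b assume gen: "f1 \<in> low f0" "a \<in> A" "b \<in> A"
    have f1: "valid f1" "\<And>p. f1 p \<le> f0 p" "f1 \<noteq> f0" using gen(1) by (auto simp: low_def)
    then obtain p where "f1 p \<noteq> f0 p" by auto
    then have "p \<in> {1..n}" "f1 p < f0 p" using f1 1(1) by (auto simp: valid_word_def order_less_le)
    then have "(\<Sum>p\<in>{1..n}. f1 p) < (\<Sum>p\<in>{1..n}. f0 p)" using f1(2) by (intro sum_strict_mono_ex1) auto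
    from less.hyps[OF this f1(1) gen(2,3)] show "a * e f1 f1 * b \<in> spn (Bs (below f1))" .
  qed
  have "low f0 \<subseteq> below f0" by (auto simp: low_def below_def)
  then have "Bs (low f0) \<subseteq> Bs (below f0)" unfolding Bs_def by blast
  then have KB: "k \<in> spn (Bs (below f0))" if "k \<in> K f0" for k
    using K[OF that] by (meson spn_in spn_trans subset_iff)
  have "a * (e f0 f0 * b) \<in> spn (Bs (below f0))"
    using x_right[OF 1(1,3)]
  proof (rule spn_left)
    fix x assume "x \<in> e f0 ` {f \<in> orb n f0. lattice f} \<union> K f0"
    then show "a * x \<in> spn (Bs (below f0))"
    proof
      assume "x \<in> K f0"
      then show ?thesis using K_left[OF _ 1(2)] KB by blast
    next
      assume "x \<in> e f0 ` {f \<in> orb n f0. lattice f}"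
      then obtain f' where f': "f' \<in> orb n f0" "lattice f'" "x = e f0 f'" by blast
      have x: "x = e f0 f0 * T (dl f0 f')"
        using e_T_valid[OF 1(1) dl(1,2)[OF 1(1) f'(1)]] dl(3)[OF 1(1) f'(1)] f'(3) by simp
      obtain r k where rk: "k \<in> K f0"
        "a * e f0 f0 = (\<Sum>f | f \<in> orb n f0 \<and> lattice f. sc (r f) * star (e f0 f)) + k"
        using x_left[OF 1(1,2)] by blast
      have "a * x = (a * e f0 f0) * T (dl f0 f')" by (simp add: x mult.assoc)
      also have "\<dots> = (\<Sum>f | f \<in> orb n f0 \<and> lattice f. sc (r f) * mb f0 f f') + k * T (dl f0 f')"
        unfolding rk(2) distrib_right sum_distrib_right
        by (intro arg_cong2[where f = "(+)"] sum.cong) (auto simp: mb_star_e[OF 1(1)] mult.assoc)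
      also have "\<dots> \<in> spn (Bs (below f0))"
      proof (intro spn_add spn_sum spn_sc)
        show "k * T (dl f0 f') \<in> spn (Bs (below f0))"
          by (rule KB) (intro K_right[OF rk(1)] A_T dl(1)[OF 1(1) f'(1)])
        fix f assume "f \<in> {f. f \<in> orb n f0 \<and> lattice f}"
        then have "mb f0 f f' \<in> Bs (below f0)" using 1(1) f' unfolding Bs_def below_def by blast
        then show "mb f0 f f' \<in> spn (Bs (below f0))" by (rule spn_in)
      qed
      finally show ?thesis .
    qed
  qed
  then show ?case by (simp add: mult.assoc)
qed

lemma K_span: "valid f0 \<Longrightarrow> k \<in> K f0 \<Longrightarrow> k \<in> spn (Bs (low f0))"
  by (erule K_span_aux, rule two_sided_span) (auto simp: low_def)

text \<open>The coefficients come from straightening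
  \<open>a * star (T (dl f0 f)) * e f0 f0\<close>, before the right factor is attached. Hence they
  do not depend on \<open>f'\<close>, as the cellular multiplication rule demands.\<close>

lemma mb_left:
  assumes v: "valid f0" and a: "a \<in> A" and f: "f \<in> orb n f0"
  shows "\<exists>r. \<forall>f'. f' \<in> orb n f0 \<longrightarrow>
    a * mb f0 f f' - (\<Sum>h | h \<in> orb n f0 \<and> lattice h. sc (r h) * mb f0 h f') \<in> spn (Bs (low f0))"
proof -
  let ?g = "dl f0 f"
  have "a * star (T ?g) \<in> A" by (intro A_mult a A_star A_T dl(1)[OF v f])
  from x_left[OF v this] obtain r k where rk: "k \<in> K f0"
    "a * star (T ?g) * e f0 f0 = (\<Sum>f | f \<in> orb n f0 \<and> lattice f. sc (r f) * star (e f0 f)) + k" by blast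
  have "a * mb f0 f f' - (\<Sum>h | h \<in> orb n f0 \<and> lattice h. sc (r h) * mb f0 h f') \<in> spn (Bs (low f0))"
    if f': "f' \<in> orb n f0" for f'
  proof -
    have "a * mb f0 f f' = (a * star (T ?g) * e f0 f0) * T (dl f0 f')" by (simp add: mb_def mult.assoc)
    also have "\<dots> = (\<Sum>f | f \<in> orb n f0 \<and> lattice f. sc (r f) * mb f0 f f') + k * T (dl f0 f')"
      unfolding rk(2) distrib_right sum_distrib_right
      by (intro arg_cong2[where f = "(+)"] sum.cong) (auto simp: mb_star_e[OF v] mult.assoc)
    finally show ?thesis using K_span[OF v K_right[OF rk(1) A_T[OF dl(1)[OF v f']]]] by simp
  qed
  then show ?thesis by blast
qed

text \<open>For a word with strictly increasing letters the stabiliser is trivial and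
  \<open>e f0 f0\<close> is \<open>u\<close> itself, so spanning its two-sided ideal means spanning
  the corner.\<close>

lemma corner_span:
  assumes "b \<in> A" shows "u * b \<in> spn (Bs {f0. valid f0})"
proof -
  \<comment> \<open>Position \<open>p\<close> gets a row of its own, numbered \<open>p - 1\<close>,
    in its component; row numbers below \<open>n\<close> always suffice for this.\<close>
  define f0 where "f0 p = (if p \<in> {1..n} then 3 * (blk p * n + (p - 1)) else 0)" for p
  have bm: "blk p \<le> blk (Suc p)" for p
    unfolding blk_of_def by (intro card_mono) (auto intro: finite_subset[of _ "{..p}"])
  have st: "f0 i < f0 (Suc i)" if "1 \<le> i" "i < n" for i
  proof -
    have "f0 i = 3 * (blk i * n + (i - 1))" "f0 (Suc i) = 3 * (blk (Suc i) * n + i)"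
      using that by (auto simp: f0_def)
    moreover have "blk i * n + (i - 1) < blk (Suc i) * n + i"
      using bm that(1) by (intro add_le_less_mono mult_le_mono1) auto
    ultimately show ?thesis by (simp only: mult_less_mono2 zero_less_numeral)
  qed
  then have s: "srt n f0" by (auto simp: srt_def intro: less_imp_le)
  have v: "valid f0" unfolding valid_word_def
  proof (intro conjI allI impI ballI s)
    fix p assume "p \<in> {1..n}"
    then show "\<exists>r<n. f0 p = 3 * (blk p * n + r)" by (intro exI[of _ "p - 1"]) (auto simp: f0_def)
  qed (auto simp: f0_def)
  have "g = id" if g: "g permutes {1..n}" "f0 \<circ> g = f0" for g
  proof -
    have "srt n g" unfolding srt_def
    proof (intro allI impI, rule ccontr)
      fix i assume i: "1 \<le> i" "i < n" "\<not> g i \<le> g (Suc i)"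
      then have "f0 (g (Suc i)) \<le> f0 (g i)"
        using permutes_in_seg[OF g(1)] by (intro srt_le[OF s]) auto
      then have "f0 (Suc i) \<le> f0 i" using fun_cong[OF g(2), of i] fun_cong[OF g(2), of "Suc i"] by simp
      then show False using st[OF i(1,2)] by simp
    qed
    then show ?thesis using permutes_srt_id[OF g(1)] by simp
  qed
  then have fib: "{g. g permutes {1..n} \<and> f0 \<circ> g = f0} = {id}"
    using permutes_id[of "{1..n}"] by (intro equalityI subsetI) (blast, metis (mono_tags) comp_id mem_Collect_eq singletonD)
  have "ninv n f0 = 0" "ninv n id = 0" using s by (simp_all add: srt_ninv[symmetric], simp add: srt_def)
  then have "e f0 f0 = u" unfolding e_def fib by (simp only: X_def T_id, simp add: qp_0)
  then have "u * b \<in> spn (Bs (below f0))" using two_sided_span[OF v A_1 assms] by simp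
  moreover have "Bs (below f0) \<subseteq> Bs {f0. valid f0}" unfolding Bs_def below_def by blast
  ultimately show ?thesis by (meson spn_in spn_trans subset_iff)
qed

end

section \<open>The algebra as a quotient type\<close>

lemma fa_sum_single: "(p :: 'a \<Rightarrow>\<^sub>0 'b::comm_monoid_add) = (\<Sum>w\<in>Poly_Mapping.keys p. Poly_Mapping.single w (Poly_Mapping.lookup p w))"
proof (rule poly_mapping_eqI)
  fix k
  have "Poly_Mapping.lookup (\<Sum>w\<in>Poly_Mapping.keys p. Poly_Mapping.single w (Poly_Mapping.lookup p w)) k
    = (\<Sum>w\<in>Poly_Mapping.keys p. if w = k then Poly_Mapping.lookup p w else 0)"
    by (simp add: lookup_sum lookup_single when_def)
  also have "\<dots> = Poly_Mapping.lookup p k" by (simp add: in_keys_iff)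
  finally show "Poly_Mapping.lookup p k = Poly_Mapping.lookup
    (\<Sum>w\<in>Poly_Mapping.keys p. Poly_Mapping.single w (Poly_Mapping.lookup p w)) k" by simp
qed

lemma fa_induct [case_names zero single add]:
  fixes p :: "'a \<Rightarrow>\<^sub>0 'b::comm_monoid_add"
  assumes "P 0" "\<And>w c. P (Poly_Mapping.single w c)" "\<And>x y. P x \<Longrightarrow> P y \<Longrightarrow> P (x + y)"
  shows "P p"
proof -
  have "P (\<Sum>w\<in>F. Poly_Mapping.single w (f w))" if "finite F" for F and f :: "'a \<Rightarrow> 'b"
    using that by (induction rule: finite_induct) (auto intro: assms)
  then show ?thesis using fa_sum_single[of p] by (metis finite_keys)
qed

text \<open>Keys may cancel in \<open>p + r\<close>. As \<open>h w 0 = 0\<close>, all three sums can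
  be extended to the union of the supports of \<open>p\<close> and \<open>r\<close>.\<close>

lemma sum_keys_add:
  fixes h :: "'a \<Rightarrow> 'b::monoid_add \<Rightarrow> 'c::comm_monoid_add"
  assumes "\<And>w. h w 0 = 0" "\<And>w c d. h w (c + d) = h w c + h w d"
  shows "(\<Sum>w\<in>Poly_Mapping.keys (p + r). h w (Poly_Mapping.lookup (p + r) w))
    = (\<Sum>w\<in>Poly_Mapping.keys p. h w (Poly_Mapping.lookup p w)) + (\<Sum>w\<in>Poly_Mapping.keys r. h w (Poly_Mapping.lookup r w))"
proof -
  let ?U = "Poly_Mapping.keys p \<union> Poly_Mapping.keys r"
  have *: "(\<Sum>w\<in>Poly_Mapping.keys s. h w (Poly_Mapping.lookup s w)) = (\<Sum>w\<in>?U. h w (Poly_Mapping.lookup s w))"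
    if "Poly_Mapping.keys s \<subseteq> ?U" for s
    using that by (intro sum.mono_neutral_left) (auto simp: in_keys_iff assms)
  show ?thesis
    using *[of "p + r"] *[of p] *[of r] Poly_Mapping.keys_add[of p r]
    by (simp add: lookup_add assms sum.distrib)
qed

section \<open>Linear extension of maps on words, and the anti-automorphism\<close>

definition lin :: "(wrd \<Rightarrow> fa) \<Rightarrow> fa \<Rightarrow> fa" where
  "lin F p = (\<Sum>w\<in>Poly_Mapping.keys p. sc (Poly_Mapping.lookup p w) * F w)"

lemma sc_add_fa: "sc (c + d) = sc c + sc d" and sc_mult_fa: "sc (c * d) = sc c * sc d"
  and sc_0_fa [simp]: "sc 0 = 0" and sc_1_fa [simp]: "sc 1 = 1"
  by (simp_all add: sc_def single_add mult_single)

lemma sc_single: "sc c * Poly_Mapping.single w d = Poly_Mapping.single w (c * d)"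
  and single_sc: "Poly_Mapping.single w d * sc c = Poly_Mapping.single w (d * c)"
  by (simp_all add: sc_def mult_single)

lemma sc_central: "sc c * x = x * sc c"
  by (induction x rule: fa_induct) (simp_all add: sc_single single_sc distrib_left distrib_right mult.commute)

lemma lin_0 [simp]: "lin F 0 = 0"
  by (simp add: lin_def)

lemma lin_add: "lin F (p + r) = lin F p + lin F r"
  unfolding lin_def by (rule sum_keys_add) (simp_all add: sc_add_fa distrib_right)

lemma lin_single: "lin F (Poly_Mapping.single w c) = sc c * F w"
  by (cases "c = 0") (simp_all add: lin_def)

lemma lin_hom:
  assumes "\<And>v w. F (v + w) = F v * F w" shows "lin F (p * r) = lin F p * lin F r"
proof (induction p rule: fa_induct)
  case (single v c)
  show ?case
  proof (induction r rule: fa_induct)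
    case (single w d)
    have "sc c * sc d * (F v * F w) = sc c * F v * (sc d * F w)" by (metis sc_central mult.assoc)
    then show ?case by (simp add: mult_single lin_single assms sc_mult_fa)
  qed (simp_all add: distrib_left lin_add)
qed (simp_all add: distrib_right lin_add)

lemma lin_antihom:
  assumes "\<And>v w. F (v + w) = F w * F v" shows "lin F (p * r) = lin F r * lin F p"
proof (induction p rule: fa_induct)
  case (single v c)
  show ?case
  proof (induction r rule: fa_induct)
    case (single w d)
    have "sc c * sc d * (F w * F v) = sc d * F w * (sc c * F v)" by (metis sc_central mult.assoc)
    then show ?case by (simp add: mult_single lin_single assms sc_mult_fa)
  qed (simp_all add: distrib_left distrib_right lin_add)
qed (simp_all add: distrib_left distrib_right lin_add)

lemma fstar_lin: "fstar = lin (\<lambda>w. Poly_Mapping.single (Wrd (rev (wrd_list w))) 1)"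
  by (simp add: fun_eq_iff fstar_def lin_def sc_single)

lemma wrd_list_add [simp]: "wrd_list (v + w) = wrd_list v @ wrd_list w" and wrd_list_0 [simp]: "wrd_list 0 = []"
  by (simp_all add: plus_wrd_def zero_wrd_def)

lemma fstar_add: "fstar (x + y) = fstar x + fstar y" and fstar_0 [simp]: "fstar 0 = 0"
  and fstar_single: "fstar (Poly_Mapping.single w c) = Poly_Mapping.single (Wrd (rev (wrd_list w))) c"
  by (simp_all add: fstar_lin lin_add lin_single sc_single)

lemma fstar_mult: "fstar (x * y) = fstar y * fstar x"
  unfolding fstar_lin by (rule lin_antihom) (simp add: mult_single plus_wrd_def)

lemma fstar_uminus: "fstar (- x) = - fstar x"
  using fstar_add[of x "- x"] by (simp add: eq_neg_iff_add_eq_0 add.commute)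

lemma fstar_diff: "fstar (x - y) = fstar x - fstar y"
  using fstar_add[of x "- y"] by (simp add: fstar_uminus)

lemma fstar_fstar: "fstar (fstar x) = x"
proof (induction x rule: fa_induct)
  case (single w c)
  then show ?case by (cases w) (simp add: fstar_single)
qed (simp_all add: fstar_add)

lemma fstar_sc [simp]: "fstar (sc c) = sc c" and fstar_gE [simp]: "fstar (gE i) = gE i" and fstar_gZ [simp]: "fstar (gZ i) = gZ i"
  by (simp_all add: sc_def gE_def gZ_def fstar_single) (simp add: zero_wrd_def)

text \<open>Kills every word that contains a generator foreign to \<open>gens n\<close>. It is a
  multiplicative retraction onto the subalgebra \<open>fa_carrier n\<close>.\<close>

definition ret :: "nat \<Rightarrow> fa \<Rightarrow> fa" where
  "ret n = lin (\<lambda>w. if set (wrd_list w) \<subseteq> gens n then Poly_Mapping.single w 1 else 0)"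

lemma ret_add: "ret n (x + y) = ret n x + ret n y" and ret_0 [simp]: "ret n 0 = 0"
  by (simp_all add: ret_def lin_add)

lemma ret_mult: "ret n (x * y) = ret n x * ret n y"
  unfolding ret_def by (rule lin_hom) (auto simp: mult_single)

lemma ret_single: "ret n (Poly_Mapping.single w c) = (if set (wrd_list w) \<subseteq> gens n then Poly_Mapping.single w c else 0)"
  by (simp add: ret_def lin_single sc_single)

lemma ret_diff: "ret n (x - y) = ret n x - ret n y"
  by (metis add_diff_cancel diff_add_cancel ret_add)

lemma ret_sc [simp]: "ret n (sc c) = sc c"
  and ret_gE: "ret n (gE i) = (if i \<in> {1..<n} then gE i else 0)"
  and ret_gZ: "ret n (gZ i) = (if i \<in> {1..<n} then gZ i else 0)"
  by (auto simp: sc_def gE_def gZ_def ret_single gens_def)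

lemma carrier_add: "x \<in> fa_carrier n \<Longrightarrow> y \<in> fa_carrier n \<Longrightarrow> x + y \<in> fa_carrier n"
  unfolding fa_carrier_def using Poly_Mapping.keys_add by fast

lemma carrier_single: "set (wrd_list w) \<subseteq> gens n \<Longrightarrow> Poly_Mapping.single w c \<in> fa_carrier n"
  by (auto simp: fa_carrier_def)

lemma carrier_0 [simp]: "0 \<in> fa_carrier n" and carrier_sc [simp]: "sc c \<in> fa_carrier n" and carrier_1 [simp]: "1 \<in> fa_carrier n"
  and carrier_gE: "1 \<le> i \<Longrightarrow> i < n \<Longrightarrow> gE i \<in> fa_carrier n" and carrier_gZ: "1 \<le> i \<Longrightarrow> i < n \<Longrightarrow> gZ i \<in> fa_carrier n"
  by (auto simp: fa_carrier_def sc_def gE_def gZ_def gens_def)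

lemma carrier_sum: "(\<And>i. i \<in> I \<Longrightarrow> f i \<in> fa_carrier n) \<Longrightarrow> sum f I \<in> fa_carrier n"
  by (induction I rule: infinite_finite_induct) (auto intro: carrier_add)

lemma ret_carrier: "ret n x \<in> fa_carrier n"
  by (induction x rule: fa_induct) (auto simp: ret_add ret_single intro: carrier_add carrier_single)

lemma ret_id: "x \<in> fa_carrier n \<Longrightarrow> ret n x = x"
proof -
  assume "x \<in> fa_carrier n"
  then have "ret n x = (\<Sum>w\<in>Poly_Mapping.keys x. Poly_Mapping.single w (Poly_Mapping.lookup x w))"
    unfolding ret_def lin_def by (intro sum.cong) (auto simp: fa_carrier_def sc_single)
  then show ?thesis using fa_sum_single[of x] by simp
qed

lemma carrier_mult: "x \<in> fa_carrier n \<Longrightarrow> y \<in> fa_carrier n \<Longrightarrow> x * y \<in> fa_carrier n"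
  using ret_mult[of n x y] ret_carrier[of n "x * y"] by (simp add: ret_id)

lemma carrier_fstar: "x \<in> fa_carrier n \<Longrightarrow> fstar x \<in> fa_carrier n"
  unfolding fstar_def by (intro carrier_sum carrier_single) (auto simp: fa_carrier_def)

text \<open>All the algebras \<open>bH\<^sub>n(q)\<close> sit inside one algebra \<open>bH\<^sub>\<infinity>(q)\<close>, which makes the quotient a single type.\<close>

definition ideal_inf :: "fa set" where
  "ideal_inf = two_sided_ideal UNIV ((\<Union>n. bH_rels n) \<union> {gE 0, gZ 0})"

lemma ideal_add: "x \<in> two_sided_ideal A R \<Longrightarrow> y \<in> two_sided_ideal A R \<Longrightarrow> x + y \<in> two_sided_ideal A R"
  by (rule two_sided_ideal.add)

lemma ideal_left:
  "x \<in> two_sided_ideal A R \<Longrightarrow> a \<in> A \<Longrightarrow> (\<And>b. b \<in> A \<Longrightarrow> a * b \<in> A) \<Longrightarrow> a * x \<in> two_sided_ideal A R"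
proof (induction rule: two_sided_ideal.induct)
  case (gen r b c)
  then have "(a * b) * r * c \<in> two_sided_ideal A R" by (intro two_sided_ideal.gen) auto
  then show ?case by (simp add: mult.assoc)
qed (auto simp: distrib_left intro: two_sided_ideal.zero two_sided_ideal.add)

lemma ideal_right:
  "x \<in> two_sided_ideal A R \<Longrightarrow> a \<in> A \<Longrightarrow> (\<And>b. b \<in> A \<Longrightarrow> b * a \<in> A) \<Longrightarrow> x * a \<in> two_sided_ideal A R"
proof (induction rule: two_sided_ideal.induct)
  case (gen r b c)
  then have "b * r * (c * a) \<in> two_sided_ideal A R" by (intro two_sided_ideal.gen) auto
  then show ?case by (simp add: mult.assoc)
qed (auto simp: distrib_right intro: two_sided_ideal.zero two_sided_ideal.add)

lemma inf_add: "x \<in> ideal_inf \<Longrightarrow> y \<in> ideal_inf \<Longrightarrow> x + y \<in> ideal_inf"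
  and inf_left: "x \<in> ideal_inf \<Longrightarrow> a * x \<in> ideal_inf" and inf_right: "x \<in> ideal_inf \<Longrightarrow> x * a \<in> ideal_inf"
  and inf_0: "0 \<in> ideal_inf"
  unfolding ideal_inf_def by (auto intro: ideal_add ideal_left ideal_right two_sided_ideal.zero)

lemma inf_uminus: "x \<in> ideal_inf \<Longrightarrow> - x \<in> ideal_inf"
  using inf_left[of x "- 1"] by simp

lemma inf_rel: "r \<in> bH_rels n \<Longrightarrow> r \<in> ideal_inf"
proof -
  assume "r \<in> bH_rels n"
  then have "r \<in> (\<Union>n. bH_rels n) \<union> {gE 0, gZ 0}" by blast
  then have "1 * r * 1 \<in> ideal_inf" unfolding ideal_inf_def by (rule two_sided_ideal.gen) auto
  then show ?thesis by simp
qed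

lemma bH_relsI:
  "1 \<le> i \<Longrightarrow> i < n \<Longrightarrow> gE i * gE i - gE i \<in> bH_rels n"
  "1 \<le> i \<Longrightarrow> i < n \<Longrightarrow> gE i * gZ i - gZ i \<in> bH_rels n"
  "1 \<le> i \<Longrightarrow> i < n \<Longrightarrow> gZ i * gZ i - (gE i + sc (qq - qinv) * gZ i) \<in> bH_rels n"
  "1 \<le> i \<Longrightarrow> i < n \<Longrightarrow> 1 \<le> j \<Longrightarrow> j < n \<Longrightarrow> gE i * gE j - gE j * gE i \<in> bH_rels n"
  "1 \<le> i \<Longrightarrow> i < n \<Longrightarrow> 1 \<le> j \<Longrightarrow> j < n \<Longrightarrow> gE i * gZ j - gZ j * gE i \<in> bH_rels n"
  "1 \<le> i \<Longrightarrow> i < n \<Longrightarrow> 1 \<le> j \<Longrightarrow> j < n \<Longrightarrow> i = j + 1 \<or> j = i + 1 \<Longrightarrow>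
     gZ i * gZ j * gZ i - gZ j * gZ i * gZ j \<in> bH_rels n"
  "1 \<le> i \<Longrightarrow> i < n \<Longrightarrow> 1 \<le> j \<Longrightarrow> j < n \<Longrightarrow> i > j + 1 \<or> j > i + 1 \<Longrightarrow> gZ i * gZ j - gZ j * gZ i \<in> bH_rels n"
  unfolding bH_rels_def
        apply (rule UnI1, rule UN_I[of i], simp, simp)
       apply (rule UnI1, rule UN_I[of i], simp, simp)
      apply (rule UnI1, rule UN_I[of i], simp, simp)
     apply (rule UnI2, rule UN_I[of i], simp, rule UN_I[of j], simp, rule UnI1, rule UnI1, simp)
    apply (rule UnI2, rule UN_I[of i], simp, rule UN_I[of j], simp, rule UnI1, rule UnI1, simp)
   apply (rule UnI2, rule UN_I[of i], simp, rule UN_I[of j], simp, rule UnI1, rule UnI2, simp only: if_True singleton_iff)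
  apply (rule UnI2, rule UN_I[of i], simp, rule UN_I[of j], simp, rule UnI2, simp only: if_True singleton_iff)
  done

lemma bH_relsE:
  assumes "r \<in> bH_rels n"
  obtains (1) i where "1 \<le> i" "i < n" "r = gE i * gE i - gE i"
  | (2) i where "1 \<le> i" "i < n" "r = gE i * gZ i - gZ i"
  | (3) i where "1 \<le> i" "i < n" "r = gZ i * gZ i - (gE i + sc (qq - qinv) * gZ i)"
  | (4) i j where "1 \<le> i" "i < n" "1 \<le> j" "j < n" "r = gE i * gE j - gE j * gE i"
  | (5) i j where "1 \<le> i" "i < n" "1 \<le> j" "j < n" "r = gE i * gZ j - gZ j * gE i"
  | (6) i j where "1 \<le> i" "i < n" "1 \<le> j" "j < n" "i = j + 1 \<or> j = i + 1" "r = gZ i * gZ j * gZ i - gZ j * gZ i * gZ j"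
  | (7) i j where "1 \<le> i" "i < n" "1 \<le> j" "j < n" "i > j + 1 \<or> j > i + 1" "r = gZ i * gZ j - gZ j * gZ i"
proof -
  from assms consider i where "i \<in> {1..<n}" "r \<in> {gE i * gE i - gE i, gE i * gZ i - gZ i, gZ i * gZ i - (gE i + sc (qq - qinv) * gZ i)}"
    | i j where "i \<in> {1..<n}" "j \<in> {1..<n}" "r \<in> {gE i * gE j - gE j * gE i, gE i * gZ j - gZ j * gE i}"
    | i j where "i \<in> {1..<n}" "j \<in> {1..<n}" "i = j + 1 \<or> j = i + 1" "r = gZ i * gZ j * gZ i - gZ j * gZ i * gZ j"
    | i j where "i \<in> {1..<n}" "j \<in> {1..<n}" "i > j + 1 \<or> j > i + 1" "r = gZ i * gZ j - gZ j * gZ i"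
    unfolding bH_rels_def Un_iff UN_iff
    by (elim disjE bexE) (blast, blast, (simp only: if_split empty_iff singleton_iff split: if_splits; blast)+)
  then show ?thesis
  proof cases
    case 1
    then show ?thesis using that(1-3)[of i] by auto
  next
    case 2
    then show ?thesis using that(4,5)[of i j] by auto
  next
    case 3
    then show ?thesis using that(6)[of i j] by auto
  next
    case 4
    then show ?thesis using that(7)[of i j] by auto
  qed
qed

text \<open>Every index of a relation occurs in each of its terms, so a relation that involves a
  discarded generator vanishes altogether.\<close>

lemma ret_rel:
  assumes "r \<in> bH_rels m" shows "ret n r = 0 \<or> ret n r \<in> bH_rels n"
proof -
  have E: "ret n (gE i) = gE i" "ret n (gZ i) = gZ i" if "1 \<le> i" "i < n" for i using that by (auto simp: ret_gE ret_gZ)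
  have O: "ret n (gE i) = 0" "ret n (gZ i) = 0" if "\<not> i < n" for i using that by (auto simp: ret_gE ret_gZ)
  note s = ret_diff ret_add ret_mult ret_sc
  from assms show ?thesis
  proof (cases rule: bH_relsE)
    case (1 i)
    then show ?thesis using bH_relsI(1)[of i n] E[of i] O[of i] by (cases "i < n") (simp_all add: s)
  next
    case (2 i)
    then show ?thesis using bH_relsI(2)[of i n] E[of i] O[of i] by (cases "i < n") (simp_all add: s)
  next
    case (3 i)
    then show ?thesis using bH_relsI(3)[of i n] E[of i] O[of i] by (cases "i < n") (simp_all add: s)
  next
    case (4 i j)
    then show ?thesis using bH_relsI(4)[of i n j] E[of i] O[of i] E[of j] O[of j]
      by (cases "i < n"; cases "j < n") (simp_all add: s)
  next
    case (5 i j)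
    then show ?thesis using bH_relsI(5)[of i n j] E[of i] O[of i] E[of j] O[of j]
      by (cases "i < n"; cases "j < n") (simp_all add: s)
  next
    case (6 i j)
    show ?thesis unfolding 6(6) using bH_relsI(6)[of i n j] 6(1,3,5) E[of i] O[of i] E[of j] O[of j]
      by (cases "i < n"; cases "j < n") (simp_all add: s)
  next
    case (7 i j)
    show ?thesis unfolding 7(6) using bH_relsI(7)[of i n j] 7(1,3,5) E[of i] O[of i] E[of j] O[of j]
      by (cases "i < n"; cases "j < n") (simp_all add: s)
  qed
qed

text \<open>The retraction maps the large ideal into \<open>bH_ideal n\<close> and fixes the
  carrier. So passing to the infinite algebra imposes no new relations on the small one.\<close>

lemma ideal_inf_carrier:
  assumes "x \<in> fa_carrier n" shows "x \<in> ideal_inf \<longleftrightarrow> x \<in> bH_ideal n"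
proof
  have "ret n x \<in> bH_ideal n" if "x \<in> ideal_inf" for x
    using that unfolding ideal_inf_def
  proof (induction rule: two_sided_ideal.induct)
    case zero
    then show ?case by (simp add: bH_ideal_def two_sided_ideal.zero)
  next
    case (gen r a b)
    then have "ret n r = 0 \<or> ret n r \<in> bH_rels n" using ret_rel by (auto simp: ret_gE ret_gZ)
    then show ?case
    proof
      assume "ret n r = 0"
      then show ?thesis by (simp add: ret_mult bH_ideal_def two_sided_ideal.zero)
    next
      assume "ret n r \<in> bH_rels n"
      then show ?thesis unfolding ret_mult bH_ideal_def by (intro two_sided_ideal.gen ret_carrier)
    qed
  next
    case (add x y)
    then show ?case by (auto simp: ret_add bH_ideal_def intro: two_sided_ideal.add)
  qed
  then show "x \<in> ideal_inf \<Longrightarrow> x \<in> bH_ideal n" using ret_id[OF assms] by metis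
  show "x \<in> bH_ideal n \<Longrightarrow> x \<in> ideal_inf"
    unfolding bH_ideal_def
  proof (induction rule: two_sided_ideal.induct)
    case (gen r a b)
    then show ?case using inf_rel inf_left inf_right by blast
  qed (auto intro: inf_0 inf_add)
qed

quotient_type bh = fa / "\<lambda>x y. x - y \<in> ideal_inf"
proof (rule equivpI)
  show "reflp (\<lambda>x y. x - y \<in> ideal_inf)" by (simp add: reflp_def inf_0)
  show "symp (\<lambda>x y. x - y \<in> ideal_inf)" unfolding symp_def using inf_uminus by fastforce
  show "transp (\<lambda>x y. x - y \<in> ideal_inf)" unfolding transp_def using inf_add by fastforce
qed

instantiation bh :: ring_1
begin

lift_definition zero_bh :: bh is 0 .
lift_definition one_bh :: bh is 1 .
lift_definition plus_bh :: "bh \<Rightarrow> bh \<Rightarrow> bh" is "(+)"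
  using inf_add by (fastforce simp: algebra_simps)
lift_definition uminus_bh :: "bh \<Rightarrow> bh" is uminus
  using inf_uminus by (fastforce simp: algebra_simps)
lift_definition minus_bh :: "bh \<Rightarrow> bh \<Rightarrow> bh" is "(-)"
proof -
  fix a b c d :: fa assume "a - b \<in> ideal_inf" "c - d \<in> ideal_inf"
  then have "(a - b) + - (c - d) \<in> ideal_inf" by (intro inf_add inf_uminus)
  then show "a - c - (b - d) \<in> ideal_inf" by (simp add: algebra_simps)
qed
lift_definition times_bh :: "bh \<Rightarrow> bh \<Rightarrow> bh" is "(*)"
proof -
  fix a b c d :: fa assume "a - b \<in> ideal_inf" "c - d \<in> ideal_inf"
  then have "(a - b) * c + b * (c - d) \<in> ideal_inf" by (intro inf_add inf_left inf_right)
  then show "a * c - b * d \<in> ideal_inf" by (simp add: algebra_simps)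
qed

lemma bh_eqI: "x = y \<Longrightarrow> x - y \<in> ideal_inf"
  by (simp add: inf_0)

instance
proof
  show "(0 :: bh) \<noteq> 1"
  proof (transfer, rule notI)
    \<comment> \<open>For \<open>n = 0\<close> there are no relations at all, so the ideal meets the
      scalars in 0 only.\<close>
    assume "(0 :: fa) - 1 \<in> ideal_inf"
    then have "(0 :: fa) - 1 \<in> bH_ideal 0" using ideal_inf_carrier[of "0 - 1" 0] carrier_sc[of "- 1" 0]
      by (simp add: sc_def single_uminus)
    moreover have "x = 0" if "x \<in> bH_ideal 0" for x
      using that unfolding bH_ideal_def by (induction rule: two_sided_ideal.induct) (auto simp: bH_rels_def)
    ultimately have "(0 :: fa) - 1 = 0" by blast
    then show False by simp
  qed
qed (transfer, rule bh_eqI, simp add: algebra_simps)+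

end

lemma abs_add: "abs_bh (x + y) = abs_bh x + abs_bh y" and abs_mult: "abs_bh (x * y) = abs_bh x * abs_bh y"
  and abs_0: "abs_bh 0 = 0" and abs_1: "abs_bh 1 = 1" and abs_uminus: "abs_bh (- x) = - abs_bh x"
  and abs_diff: "abs_bh (x - y) = abs_bh x - abs_bh y"
  by (simp_all add: plus_bh.abs_eq times_bh.abs_eq zero_bh.abs_eq one_bh.abs_eq uminus_bh.abs_eq minus_bh.abs_eq)

lemma abs_eq_0: "abs_bh x = 0 \<longleftrightarrow> x \<in> ideal_inf"
  by (simp add: zero_bh.abs_eq bh.abs_eq_iff)

lemma abs_sum: "abs_bh (sum f I) = (\<Sum>i\<in>I. abs_bh (f i))"
  by (induction I rule: infinite_finite_induct) (simp_all add: abs_0 abs_add)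

text \<open>Up to sign every relation is sent to itself, with one exception: the image of
  \<open>gE i * gZ i - gZ i\<close> is \<open>gZ i * gE i - gZ i\<close>, which differs from it by a
  commutation relation.\<close>

lemma fstar_rel: "r \<in> bH_rels n \<Longrightarrow> fstar r \<in> ideal_inf"
proof -
  assume r: "r \<in> bH_rels n"
  from r show ?thesis
  proof (cases rule: bH_relsE)
    case (2 i)
    from inf_add[OF inf_rel[OF r] inf_uminus[OF inf_rel[OF bH_relsI(5)[OF 2(1,2,1,2)]]]] show ?thesis
      using 2 by (simp add: fstar_diff fstar_mult)
  next
    case (4 i j)
    then show ?thesis using inf_uminus[OF inf_rel[OF r]] by (simp add: fstar_diff fstar_mult)
  next
    case (5 i j)
    then show ?thesis using inf_uminus[OF inf_rel[OF r]] by (simp add: fstar_diff fstar_mult)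
  next
    case (7 i j)
    show ?thesis using inf_uminus[OF inf_rel[OF r]] unfolding 7(6) by (simp add: fstar_diff fstar_mult)
  next
    case (1 i)
    then show ?thesis using inf_rel[OF r] by (simp add: fstar_diff fstar_mult)
  next
    case (3 i)
    then show ?thesis using inf_rel[OF r] by (simp add: fstar_diff fstar_add fstar_mult sc_central)
  next
    case (6 i j)
    show ?thesis using inf_rel[OF r] unfolding 6(6) by (simp add: fstar_diff fstar_mult mult.assoc)
  qed
qed

lemma fstar_ideal: "x \<in> ideal_inf \<Longrightarrow> fstar x \<in> ideal_inf"
  unfolding ideal_inf_def
proof (induction rule: two_sided_ideal.induct)
  case (gen r a b)
  have "1 * r * 1 \<in> ideal_inf" unfolding ideal_inf_def by (rule two_sided_ideal.gen) (use gen in auto)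
  then have "fstar r \<in> ideal_inf" using gen(1) fstar_rel by auto
  then show ?case using inf_left inf_right unfolding fstar_mult ideal_inf_def by blast
qed (auto simp: fstar_add intro: two_sided_ideal.zero two_sided_ideal.add)

lift_definition star_bh :: "bh \<Rightarrow> bh" is fstar
  using fstar_ideal by (fastforce simp: fstar_diff)

lemma star_abs: "star_bh (abs_bh x) = abs_bh (fstar x)"
  by (rule star_bh.abs_eq)

lemma star_bh_add: "star_bh (x + y) = star_bh x + star_bh y"
  and star_bh_mult: "star_bh (x * y) = star_bh y * star_bh x" and star_bh_star: "star_bh (star_bh x) = x"
  by (transfer, rule bh_eqI, simp add: fstar_add fstar_mult fstar_fstar)+

definition SC :: "laurent \<Rightarrow> bh" where "SC c = abs_bh (sc c)"
definition bE :: "nat \<Rightarrow> bh" where "bE i = abs_bh (gE i)"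
definition bZ :: "nat \<Rightarrow> bh" where "bZ i = abs_bh (gZ i)"

lemma SC_add: "SC (c + d) = SC c + SC d" and SC_mult: "SC (c * d) = SC c * SC d" and SC_1: "SC 1 = 1"
  and star_SC: "star_bh (SC c) = SC c"
  by (simp_all add: SC_def sc_add_fa sc_mult_fa abs_add abs_mult abs_1 star_abs)

lemma SC_comm: "x * SC c = SC c * x"
  unfolding SC_def by (transfer, rule bh_eqI, simp add: sc_central)

lemma rel_eq: "x - y \<in> bH_rels n \<Longrightarrow> abs_bh x = abs_bh y"
  using inf_rel by (simp add: bh.abs_eq_iff)

text \<open>No \<open>bH_n\<close> has a generator of index 0. Setting both to zero lets the
  idempotent and commutation rules below hold for every index.\<close>

lemma bE_0: "bE 0 = 0" and bZ_0: "bZ 0 = 0"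
proof -
  have "gE 0 \<in> ideal_inf" "gZ 0 \<in> ideal_inf"
    unfolding ideal_inf_def
    using two_sided_ideal.gen[of "gE 0" "(\<Union>n. bH_rels n) \<union> {gE 0, gZ 0}" 1 UNIV 1]
      two_sided_ideal.gen[of "gZ 0" "(\<Union>n. bH_rels n) \<union> {gE 0, gZ 0}" 1 UNIV 1] by simp_all
  then show "bE 0 = 0" "bZ 0 = 0" by (simp_all add: bE_def bZ_def abs_eq_0)
qed

lemma bE_idem: "bE i * bE i = bE i" and bE_bZ: "bE i * bZ i = bZ i"
  and bZ_sq: "1 \<le> i \<Longrightarrow> bZ i * bZ i = bE i + SC (qq - qinv) * bZ i"
proof -
  have 1: "bE i * bE i = bE i \<and> bE i * bZ i = bZ i \<and> bZ i * bZ i = bE i + SC (qq - qinv) * bZ i" if "1 \<le> i"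
  proof -
    note r = bH_relsI(1-3)[OF that lessI]
    show ?thesis using r[THEN rel_eq] by (simp add: bE_def bZ_def SC_def abs_mult abs_add)
  qed
  then show "bE i * bE i = bE i" "bE i * bZ i = bZ i" "1 \<le> i \<Longrightarrow> bZ i * bZ i = bE i + SC (qq - qinv) * bZ i"
    using bE_0 bZ_0 by (cases "i = 0"; simp)+
qed

lemma bE_comm_gens: "bE i * bE j = bE j * bE i" "bE i * bZ j = bZ j * bE i"
proof -
  have "bE i * bE j = bE j * bE i \<and> bE i * bZ j = bZ j * bE i" if "1 \<le> i" "1 \<le> j"
  proof -
    have "i < Suc (i + j)" "j < Suc (i + j)" by auto
    note r = bH_relsI(4,5)[OF that(1) this(1) that(2) this(2)]
    show ?thesis using r[THEN rel_eq] by (simp add: bE_def bZ_def abs_mult)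
  qed
  then show "bE i * bE j = bE j * bE i" "bE i * bZ j = bZ j * bE i"
    using bE_0 bZ_0 by (cases "i = 0"; cases "j = 0"; simp)+
qed

lemma bZ_braid: "1 \<le> i \<Longrightarrow> bZ i * bZ (Suc i) * bZ i = bZ (Suc i) * bZ i * bZ (Suc i)"
proof -
  assume "1 \<le> i"
  then have "gZ i * gZ (Suc i) * gZ i - gZ (Suc i) * gZ i * gZ (Suc i) \<in> bH_rels (Suc (Suc i))"
    by (intro bH_relsI(6)) auto
  from rel_eq[OF this] show ?thesis by (simp add: bZ_def abs_mult)
qed

lemma bZ_far: "1 \<le> i \<Longrightarrow> Suc i < j \<Longrightarrow> bZ i * bZ j = bZ j * bZ i"
proof -
  assume "1 \<le> i" "Suc i < j"
  then have "gZ i * gZ j - gZ j * gZ i \<in> bH_rels (Suc j)"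
    by (intro bH_relsI(7)) auto
  from rel_eq[OF this] show ?thesis by (simp add: bZ_def abs_mult)
qed

lemma word_prod: "Poly_Mapping.single (Wrd (g # gs)) (1 :: laurent) = Poly_Mapping.single (Wrd [g]) 1 * Poly_Mapping.single (Wrd gs) 1"
  by (simp add: mult_single plus_wrd_def)

lemma bh_induct [case_names sc add mult E Z]:
  assumes "\<And>c. P (SC c)" "\<And>x y. P x \<Longrightarrow> P y \<Longrightarrow> P (x + y)" "\<And>x y. P x \<Longrightarrow> P y \<Longrightarrow> P (x * y)"
    "\<And>i. P (bE i)" "\<And>i. P (bZ i)"
  shows "P x"
proof -
  have w: "P (abs_bh (Poly_Mapping.single (Wrd gs) 1))" for gs
  proof (induction gs)
    case Nil
    then show ?case using assms(1)[of 1] by (simp add: SC_def sc_def zero_wrd_def)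
  next
    case (Cons g gs)
    have "P (abs_bh (Poly_Mapping.single (Wrd [g]) 1))"
      using assms(4,5) by (cases g) (auto simp: bE_def bZ_def gE_def gZ_def)
    then show ?case using Cons assms(3) by (metis word_prod abs_mult)
  qed
  have "P (abs_bh p)" for p
  proof (induction p rule: fa_induct)
    case zero
    then show ?case using assms(1)[of 0] by (simp add: SC_def)
  next
    case (single v c)
    obtain gs where "v = Wrd gs" by (cases v)
    moreover have "Poly_Mapping.single v c = sc c * Poly_Mapping.single v 1" by (simp add: sc_single)
    ultimately show ?case using assms(3)[OF assms(1) w[of gs]] by (simp add: abs_mult SC_def)
  next
    case (add x y)
    then show ?case using assms(2) by (simp add: abs_add)
  qed
  then show ?thesis by (metis Quotient_bh Quotient_abs_rep)
qed

lemma bE_central: "x * bE i = bE i * x"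
  by (induction x rule: bh_induct)
    (simp_all add: SC_comm distrib_left distrib_right bE_comm_gens, metis mult.assoc)

section \<open>Idempotents attached to linear set partitions\<close>

text \<open>The product form of the idempotent of a linear set partition, \<open>C\<close> being the
  set of indices that are not tied; \<open>abs_EE\<close> shows the agreement with the alternating
  sum.\<close>

definition eps :: "nat \<Rightarrow> nat set \<Rightarrow> bh" where
  "eps n C = prod_list (map (\<lambda>i. if i \<in> C then 1 - bE i else bE i) [1..<n])"

lemma eps_Suc: "1 \<le> n \<Longrightarrow> eps (Suc n) C = eps n C * (if n \<in> C then 1 - bE n else bE n)"
  by (simp add: eps_def)

lemma eps_central: "x * eps n C = eps n C * x"
proof -
  have "x * prod_list (map (\<lambda>i. if i \<in> C then 1 - bE i else bE i) xs)
      = prod_list (map (\<lambda>i. if i \<in> C then 1 - bE i else bE i) xs) * x" for xs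
  proof (induction xs)
    case (Cons i xs)
    let ?f = "if i \<in> C then 1 - bE i else bE i" and ?P = "prod_list (map (\<lambda>i. if i \<in> C then 1 - bE i else bE i) xs)"
    have f: "x * ?f = ?f * x" by (simp add: bE_central[of x] left_diff_distrib right_diff_distrib)
    have "x * (?f * ?P) = (x * ?f) * ?P" by (simp only: mult.assoc)
    also have "\<dots> = ?f * (x * ?P)" unfolding f by (simp only: mult.assoc)
    also have "\<dots> = (?f * ?P) * x" unfolding Cons by (simp only: mult.assoc)
    finally show ?case by simp
  qed simp
  then show ?thesis unfolding eps_def .
qed

lemma eps_idem: "eps n C * eps n C = eps n C"
proof (induction n)
  case (Suc n)
  show ?case
  proof (cases "1 \<le> n")
    case True
    let ?f = "if n \<in> C then 1 - bE n else bE n"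
    have f: "?f * ?f = ?f" by (simp add: bE_idem algebra_simps)
    have "eps n C * ?f * (eps n C * ?f) = eps n C * (?f * eps n C) * ?f" by (simp only: mult.assoc)
    also have "\<dots> = (eps n C * eps n C) * (?f * ?f)" unfolding eps_central[of ?f] by (simp only: mult.assoc)
    finally show ?thesis unfolding eps_Suc[OF True] Suc f .
  qed (simp add: eps_def)
qed (simp add: eps_def)

lemma star_bE: "star_bh (bE i) = bE i" and star_bZ: "star_bh (bZ i) = bZ i"
  by (simp_all add: bE_def bZ_def star_abs)

lemma star_bh_1: "star_bh 1 = 1" and star_bh_diff: "star_bh (x - y) = star_bh x - star_bh y"
proof -
  show "star_bh 1 = 1" using star_SC[of 1] by (simp add: SC_1)
  show "star_bh (x - y) = star_bh x - star_bh y"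
    using star_bh_add[of "x - y" y] by simp
qed

lemma star_eps: "star_bh (eps n C) = eps n C"
proof (induction n)
  case (Suc n)
  have "star_bh (if n \<in> C then 1 - bE n else bE n) = (if n \<in> C then 1 - bE n else bE n)"
    by (simp add: star_bh_diff star_bE star_bh_1)
  then show ?case
    using Suc eps_Suc[of n C] eps_central[of "if n \<in> C then 1 - bE n else bE n" n C]
    by (cases "1 \<le> n") (simp_all add: star_bh_mult, simp add: eps_def star_bh_1)
qed (simp add: eps_def star_bh_1)

lemma eps_bE: "1 \<le> i \<Longrightarrow> i < n \<Longrightarrow> eps n C * bE i = (if i \<in> C then 0 else eps n C)"
proof (induction n)
  case (Suc n)
  show ?case
  proof (cases "i = n")
    case True
    then show ?thesis using Suc.prems eps_Suc[of n C] by (simp add: mult.assoc left_diff_distrib bE_idem)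
  next
    case False
    then have "eps n C * bE i = (if i \<in> C then 0 else eps n C)" "1 \<le> n" using Suc by auto
    then have e: "eps n C * bE i = (if i \<in> C then 0 else eps n C)" "1 \<le> n" by auto
    let ?f = "if n \<in> C then 1 - bE n else bE n"
    have "eps n C * ?f * bE i = eps n C * (?f * bE i)" by (simp only: mult.assoc)
    also have "\<dots> = (eps n C * bE i) * ?f" unfolding bE_central[of ?f] by (simp only: mult.assoc)
    finally show ?thesis unfolding eps_Suc[OF e(2)] e(1) by simp
  qed
qed simp

text \<open>The cut sets with and without \<open>n\<close> differ by the factors
  \<open>1 - bE n\<close> and \<open>bE n\<close>, which add up to 1.\<close>

lemma sum_eps: "(\<Sum>C\<in>Pow {1..<n}. eps n C) = 1"
proof (induction n)
  case (Suc n)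
  show ?case
  proof (cases "1 \<le> n")
    case True
    then have ins: "{1..<Suc n} = insert n {1..<n}" by auto
    have eq: "eps n (insert n C) = eps n C" for C unfolding eps_def by (intro arg_cong[where f = prod_list] map_cong) auto
    have nin: "n \<notin> C" if "C \<in> Pow {1..<n}" for C using that by auto
    have "(\<Sum>C\<in>Pow {1..<Suc n}. eps (Suc n) C)
      = (\<Sum>C\<in>Pow {1..<n}. eps (Suc n) C) + (\<Sum>C\<in>insert n ` Pow {1..<n}. eps (Suc n) C)"
      unfolding ins Pow_insert by (rule sum.union_disjoint) auto
    also have "(\<Sum>C\<in>insert n ` Pow {1..<n}. eps (Suc n) C) = (\<Sum>C\<in>Pow {1..<n}. eps (Suc n) (insert n C))"
      by (rule sum.reindex[unfolded comp_def]) (rule inj_onI, use nin insert_ident in metis)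
    also have "(\<Sum>C\<in>Pow {1..<n}. eps (Suc n) C) + (\<Sum>C\<in>Pow {1..<n}. eps (Suc n) (insert n C))
      = (\<Sum>C\<in>Pow {1..<n}. eps n C)"
      unfolding sum.distrib[symmetric]
      by (rule sum.cong[OF refl]) (simp add: eps_Suc[OF True] nin eq algebra_simps)
    finally show ?thesis using Suc by simp
  next
    case False
    then show ?thesis by (simp add: eps_def)
  qed
qed (simp add: eps_def)

lemma SC_0: "SC 0 = 0"
  by (simp add: SC_def abs_0)

lemma SC_uminus: "SC (- c) = - SC c"
  using SC_add[of c "- c"] by (simp add: SC_0 eq_neg_iff_add_eq_0 add.commute)

definition Acar :: "nat \<Rightarrow> bh set" where "Acar n = abs_bh ` fa_carrier n"

lemma Acar_SC: "SC c \<in> Acar n" and Acar_add: "x \<in> Acar n \<Longrightarrow> y \<in> Acar n \<Longrightarrow> x + y \<in> Acar n"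
  and Acar_mult: "x \<in> Acar n \<Longrightarrow> y \<in> Acar n \<Longrightarrow> x * y \<in> Acar n"
  and Acar_star: "x \<in> Acar n \<Longrightarrow> star_bh x \<in> Acar n"
  and Acar_bZ: "1 \<le> i \<Longrightarrow> i < n \<Longrightarrow> bZ i \<in> Acar n" and Acar_bE: "1 \<le> i \<Longrightarrow> i < n \<Longrightarrow> bE i \<in> Acar n"
  unfolding Acar_def
  by (auto simp: SC_def bZ_def bE_def star_abs abs_add[symmetric] abs_mult[symmetric]
      intro!: imageI carrier_add carrier_mult carrier_fstar carrier_gE carrier_gZ)

lemma Acar_eps: "eps n C \<in> Acar n"
proof -
  have "eps m C \<in> Acar n" if "m \<le> n" for m using that
  proof (induction m)
    case 0
    then show ?case using Acar_SC[of 1] by (simp add: eps_def SC_1)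
  next
    case (Suc m)
    show ?case
    proof (cases "1 \<le> m")
      case True
      have "1 - bE m = SC 1 + SC (- 1) * bE m" by (simp add: SC_uminus SC_1)
      then have "1 - bE m \<in> Acar n" using True Suc by (auto intro!: Acar_add Acar_SC Acar_mult Acar_bE)
      then show ?thesis using Suc True by (simp add: eps_Suc Acar_mult Acar_bE)
    next
      case False
      then show ?thesis using Acar_SC[of 1] by (simp add: eps_def SC_1)
    qed
  qed
  then show ?thesis by simp
qed

definition QP :: "int \<Rightarrow> bh" where "QP k = SC (Poly_Mapping.single k 1)"

lemma hecke_gen_bh: "hecke_gen n C bZ (eps n C) QP star_bh (Acar n) SC"
proof
  show "x * QP k = QP k * x" for x k by (simp add: QP_def SC_comm)
  show "QP (k + l) = QP k * QP l" for k l by (simp add: QP_def SC_mult[symmetric] mult_single)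
  show "QP 0 = 1" by (simp add: QP_def SC_1)
  show "eps n C * (bZ i * bZ i) = eps n C + (QP 1 - QP (- 1)) * (eps n C * bZ i)"
    if "1 \<le> i" "i < n" "i \<notin> C" for i
  proof -
    have "SC (qq - qinv) = QP 1 - QP (- 1)"
      using SC_add[of "qq - qinv" qinv] by (simp add: QP_def qq_def qinv_def)
    then show ?thesis
      using eps_bE[OF that(1,2), of C] that(3) eps_central[of "QP 1 - QP (- 1)" n C]
      by (simp add: bZ_sq[OF that(1)] distrib_left mult.assoc[symmetric])
  qed
  show "eps n C * bZ i = 0" if "1 \<le> i" "i < n" "i \<in> C" for i
    using eps_bE[OF that(1,2), of C] that(3) bE_bZ[of i] by (metis mult.assoc mult_zero_left)
  fix V x b
  assume V: "\<And>x. x \<in> V \<Longrightarrow> eps n C * x = x" "\<And>x y. x \<in> V \<Longrightarrow> y \<in> V \<Longrightarrow> x + y \<in> V"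
    "\<And>c x. x \<in> V \<Longrightarrow> SC c * x \<in> V" "\<And>x i. x \<in> V \<Longrightarrow> 1 \<le> i \<Longrightarrow> i < n \<Longrightarrow> x * bZ i \<in> V"
    and x: "x \<in> V" and b: "b \<in> Acar n"
  have V0: "0 \<in> V" using V(3)[OF x, of 0] by (simp add: SC_def abs_0)
  \<comment> \<open>On the corner \<open>bE i\<close> acts as 0 or as the identity, so closure under
    scalars and the \<open>bZ i\<close> already gives closure under all generators.\<close>
  have VE: "y * bE i \<in> V" if "y \<in> V" "1 \<le> i" "i < n" for y i
  proof -
    have "y * bE i = bE i * (eps n C * y)" unfolding V(1)[OF that(1)] by (rule bE_central)
    also have "\<dots> = (eps n C * bE i) * y" unfolding bE_central[of "eps n C"] by (simp only: mult.assoc)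
    finally have "y * bE i = (if i \<in> C then 0 else y)" unfolding eps_bE[OF that(2,3)] using V(1)[OF that(1)] by simp
    then show ?thesis using that(1) V0 by simp
  qed
  have w: "y * abs_bh (Poly_Mapping.single (Wrd gs) 1) \<in> V" if "set gs \<subseteq> gens n" "y \<in> V" for gs y
    using that
  proof (induction gs arbitrary: y)
    case Nil
    then show ?case by (simp add: zero_wrd_def[symmetric] abs_1)
  next
    case (Cons g gs)
    have "y * abs_bh (Poly_Mapping.single (Wrd [g]) 1) \<in> V"
      using Cons.prems VE[of y] V(4)[of y] by (auto simp: gens_def bE_def bZ_def gE_def gZ_def)
    then show ?case using Cons by (simp add: word_prod[of g gs] abs_mult mult.assoc[symmetric])
  qed
  obtain p where p: "p \<in> fa_carrier n" "b = abs_bh p" using b by (auto simp: Acar_def)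
  have "b = (\<Sum>w\<in>Poly_Mapping.keys p. SC (Poly_Mapping.lookup p w) * abs_bh (Poly_Mapping.single w 1))"
    unfolding p(2) by (subst fa_sum_single[of p]) (simp add: abs_sum SC_def abs_mult[symmetric] sc_single)
  then have "x * b = (\<Sum>w\<in>Poly_Mapping.keys p. SC (Poly_Mapping.lookup p w) * (x * abs_bh (Poly_Mapping.single w 1)))"
    by (simp add: sum_distrib_left mult.assoc[symmetric] SC_comm)
  moreover have "x * abs_bh (Poly_Mapping.single w 1) \<in> V" if "w \<in> Poly_Mapping.keys p" for w
    using w[of "wrd_list w" x] that p(1) x by (cases w) (auto simp: fa_carrier_def)
  then have "(\<Sum>w\<in>F. SC (Poly_Mapping.lookup p w) * (x * abs_bh (Poly_Mapping.single w 1))) \<in> V"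
    if "F \<subseteq> Poly_Mapping.keys p" for F
    using that by (induction F rule: infinite_finite_induct) (auto intro: V0 V(2,3))
  ultimately show "x * b \<in> V" by simp
next
  show "x * eps n C = eps n C * x" for x by (rule eps_central)
  show "x * SC c = SC c * x" for x c by (rule SC_comm)
  show "bZ i * bZ j = bZ j * bZ i" if "1 \<le> i" "Suc i < j" "j < n" for i j using that(1,2) by (rule bZ_far)
  show "\<exists>c. QP k = SC c" for k unfolding QP_def by blast
qed (simp_all add: bZ_braid bZ_far eps_idem star_bh_add star_bh_mult star_bh_star star_bZ star_eps QP_def star_SC
      SC_add SC_mult SC_1 Acar_SC Acar_add Acar_mult Acar_star Acar_bZ Acar_eps)

definition ES :: "nat set \<Rightarrow> bh" where "ES T = prod_list (map bE (sorted_list_of_set T))"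

lemma ES_insert:
  assumes "T \<subseteq> {1..<n}" shows "ES (insert n T) = ES T * bE n"
proof -
  have "finite T" using assms finite_subset by auto
  moreover have "\<forall>x\<in>T. x < n" using assms by auto
  ultimately have "sorted_list_of_set (set (sorted_list_of_set T @ [n])) = sorted_list_of_set T @ [n]"
    by (intro sorted_list_of_set.idem_if_sorted_distinct) (auto simp: sorted_append less_imp_le)
  then have "sorted_list_of_set (insert n T) = sorted_list_of_set T @ [n]" using \<open>finite T\<close> by simp
  then show ?thesis by (simp add: ES_def)
qed

text \<open>Multiplying out the factors \<open>1 - bE i\<close> means choosing which indices of
  \<open>C\<close> join the tied ones, with one sign for each.\<close>

lemma eps_expand:
  "eps n C = (\<Sum>T | {1..<n} - C \<subseteq> T \<and> T \<subseteq> {1..<n}. (- 1) ^ (card T - card ({1..<n} - C)) * ES T)"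
proof (induction n)
  case 0
  have "{T. {1..<0} - C \<subseteq> T \<and> T \<subseteq> {1..<0::nat}} = {{}}" by auto
  then show ?case by (simp add: eps_def ES_def)
next
  case (Suc n)
  show ?case
  proof (cases "1 \<le> n")
    case False
    then have "{T. {1..<Suc n} - C \<subseteq> T \<and> T \<subseteq> {1..<Suc n}} = {{}}" by auto
    then show ?thesis using False by (simp add: eps_def ES_def)
  next
    case True
    let ?I = "{T. {1..<n} - C \<subseteq> T \<and> T \<subseteq> {1..<n}}" and ?c = "card ({1..<n} - C)"
    let ?J = "{T. {1..<Suc n} - C \<subseteq> T \<and> T \<subseteq> {1..<Suc n}}"
    have fin: "finite ?I" by (rule finite_subset[of _ "Pow {1..<n}"]) auto
    have nT: "n \<notin> T" "finite T" "?c \<le> card T" "card (insert n T) = Suc (card T)" if "T \<in> ?I" for T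
    proof -
      show "n \<notin> T" "finite T" using that finite_subset by auto
      then show "?c \<le> card T" "card (insert n T) = Suc (card T)" using that by (auto intro: card_mono)
    qed
    have ins: "{1..<Suc n} = insert n {1..<n}" using True by auto
    have inj: "inj_on (insert n) ?I"
    proof (rule inj_onI)
      fix x y assume "x \<in> ?I" "y \<in> ?I" "insert n x = insert n y"
      then show "x = y" using nT(1) insert_ident by metis
    qed
    show ?thesis
    proof (cases "n \<in> C")
      case nC: True
      have set: "?J = ?I \<union> insert n ` ?I"
      proof (intro equalityI subsetI)
        fix T assume T: "T \<in> ?J"
        show "T \<in> ?I \<union> insert n ` ?I"
        proof (cases "n \<in> T")
          case True
          then have "T = insert n (T - {n})" "T - {n} \<in> ?I" using T ins nC by auto
          then show ?thesis by blast
        next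
          case False
          then show ?thesis using T ins by auto
        qed
      qed (use ins nC in auto)
      have c: "{1..<Suc n} - C = {1..<n} - C" using ins nC by auto
      have "(\<Sum>T\<in>?J. (- 1) ^ (card T - card ({1..<Suc n} - C)) * ES T)
        = (\<Sum>T\<in>?I. (- 1) ^ (card T - ?c) * ES T) + (\<Sum>T\<in>insert n ` ?I. (- 1) ^ (card T - ?c) * ES T)"
        unfolding set unfolding c by (rule sum.union_disjoint) (use fin nT(1) in auto)
      also have "(\<Sum>T\<in>insert n ` ?I. (- 1) ^ (card T - ?c) * ES T) = (\<Sum>T\<in>?I. (- 1) ^ (card (insert n T) - ?c) * ES (insert n T))"
        using sum.reindex[OF inj] by simp
      also have "\<dots> = (\<Sum>T\<in>?I. - ((- 1) ^ (card T - ?c) * ES T * bE n))"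
      proof (rule sum.cong[OF refl])
        fix T assume T: "T \<in> ?I"
        have "card (insert n T) - ?c = Suc (card T - ?c)" using nT(3,4)[OF T] by simp
        then show "(- 1) ^ (card (insert n T) - ?c) * ES (insert n T) = - ((- 1) ^ (card T - ?c) * ES T * bE n)"
          using T ES_insert[of T n] by (simp add: mult.assoc)
      qed
      finally show ?thesis using Suc nC
        by (simp add: eps_Suc[OF True] sum_negf right_diff_distrib sum_distrib_right)
    next
      case nC: False
      have set: "?J = insert n ` ?I"
      proof (intro equalityI subsetI)
        fix T assume T: "T \<in> ?J"
        then have "T = insert n (T - {n})" "T - {n} \<in> ?I" using ins nC by auto
        then show "T \<in> insert n ` ?I" by blast
      qed (use ins nC in auto)
      have c: "card ({1..<Suc n} - C) = Suc ?c"
      proof -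
        have "{1..<Suc n} - C = insert n ({1..<n} - C)" using ins nC by auto
        then show ?thesis by simp
      qed
      have "(\<Sum>T\<in>?J. (- 1) ^ (card T - card ({1..<Suc n} - C)) * ES T)
        = (\<Sum>T\<in>?I. (- 1) ^ (card (insert n T) - Suc ?c) * ES (insert n T))"
        unfolding set unfolding c using sum.reindex[OF inj] by simp
      also have "\<dots> = (\<Sum>T\<in>?I. (- 1) ^ (card T - ?c) * ES T * bE n)"
        by (rule sum.cong[OF refl]) (use nT(4) ES_insert in \<open>auto simp: mult.assoc\<close>)
      finally show ?thesis using Suc nC
        by (simp add: eps_Suc[OF True] sum_distrib_right)
    qed
  qed
qed

section \<open>Linear set partitions as sets of tied neighbours\<close>

definition ties :: "nat \<Rightarrow> nat set set \<Rightarrow> nat set" where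
  "ties n J = {i \<in> {1..<n}. \<exists>B\<in>J. i \<in> B \<and> Suc i \<in> B}"

lemma lsp_block_unique:
  "J \<in> linear_set_partitions n \<Longrightarrow> B \<in> J \<Longrightarrow> B' \<in> J \<Longrightarrow> x \<in> B \<Longrightarrow> x \<in> B' \<Longrightarrow> B = B'"
  unfolding linear_set_partitions_def partition_on_def disjoint_def by blast

lemma lsp_block_exists: "J \<in> linear_set_partitions n \<Longrightarrow> x \<in> {1..n} \<Longrightarrow> \<exists>B\<in>J. x \<in> B"
  unfolding linear_set_partitions_def partition_on_def by blast

lemma lsp_block_sub: "J \<in> linear_set_partitions n \<Longrightarrow> B \<in> J \<Longrightarrow> B \<subseteq> {1..n}"
  unfolding linear_set_partitions_def partition_on_def by blast

lemma lsp_interval: "J \<in> linear_set_partitions n \<Longrightarrow> B \<in> J \<Longrightarrow> \<exists>a b. B = {a..b}"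
  unfolding linear_set_partitions_def by blast

text \<open>Blocks are intervals, so two positions share a block exactly when every neighbouring
  pair between them is tied.\<close>

lemma lsp_same_block:
  assumes J: "J \<in> linear_set_partitions n" and B: "B \<in> J" "i \<in> B" and ij: "i \<le> j" "j \<le> n"
  shows "j \<in> B \<longleftrightarrow> {i..<j} \<subseteq> ties n J"
proof
  assume j: "j \<in> B"
  obtain a b where ab: "B = {a..b}" using lsp_interval[OF J B(1)] by blast
  show "{i..<j} \<subseteq> ties n J"
  proof
    fix k assume k: "k \<in> {i..<j}"
    have "1 \<le> i" using lsp_block_sub[OF J B(1)] B(2) by auto
    then have "k \<in> {1..<n}" "k \<in> B" "Suc k \<in> B" using k j B(2) ij unfolding ab by simp_all
    then show "k \<in> ties n J" using B(1) unfolding ties_def by blast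
  qed
next
  show "{i..<j} \<subseteq> ties n J \<Longrightarrow> j \<in> B" using ij
  proof (induction j rule: dec_induct)
    case (step m)
    have "{i..<m} \<subseteq> {i..<Suc m}" by auto
    then have "m \<in> B" using step by (meson Suc_leD order_trans)
    moreover have "m \<in> ties n J" using step.prems(1) step.hyps by (meson atLeastLessThan_iff lessI subsetD)
    then obtain B' where "B' \<in> J" "m \<in> B'" "Suc m \<in> B'" by (auto simp: ties_def)
    ultimately show ?case using lsp_block_unique[OF J B(1)] by blast
  qed (rule B(2))
qed

lemma lsp_block_eq:
  assumes J: "J \<in> linear_set_partitions n" and B: "B \<in> J" "i \<in> B"
  shows "B = {j \<in> {1..n}. {min i j..<max i j} \<subseteq> ties n J}"
proof (intro equalityI subsetI)
  have i: "i \<in> {1..n}" using lsp_block_sub[OF J B(1)] B(2) by auto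
  {
    fix j assume j: "j \<in> B"
    then have jn: "j \<in> {1..n}" using lsp_block_sub[OF J B(1)] by auto
    then show "j \<in> {j \<in> {1..n}. {min i j..<max i j} \<subseteq> ties n J}"
      using lsp_same_block[OF J B, of j] lsp_same_block[OF J B(1) j, of i] j B(2) i
      by (cases "i \<le> j") (auto simp: min_def max_def)
  next
    fix j assume j: "j \<in> {j \<in> {1..n}. {min i j..<max i j} \<subseteq> ties n J}"
    then obtain B' where B': "B' \<in> J" "j \<in> B'" using lsp_block_exists[OF J] by blast
    show "j \<in> B"
    proof (cases "i \<le> j")
      case True
      then show ?thesis using lsp_same_block[OF J B True] j by simp
    next
      case False
      then have "i \<in> B'" using lsp_same_block[OF J B', of i] j i by (simp add: min_def max_def)
      then show ?thesis using lsp_block_unique[OF J B(1) B'(1) B(2)] B'(2) by blast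
    qed
  }
qed

lemma ties_inj:
  assumes J: "J \<in> linear_set_partitions n" and J': "J' \<in> linear_set_partitions n" and eq: "ties n J = ties n J'"
  shows "J \<subseteq> J'"
proof
  fix B assume B: "B \<in> J"
  have "B \<noteq> {}" using J B unfolding linear_set_partitions_def partition_on_def by blast
  then obtain i where i: "i \<in> B" by blast
  then obtain B' where B': "B' \<in> J'" "i \<in> B'"
    using lsp_block_exists[OF J'] lsp_block_sub[OF J B] by blast
  show "B \<in> J'" using lsp_block_eq[OF J B i] lsp_block_eq[OF J' B'] eq B'(1) by simp
qed

text \<open>The blocks are the classes of the relation that all indices between two positions lie in
  \<open>T\<close>.\<close>

lemma ties_surj:
  assumes T: "T \<subseteq> {1..<n}"
  shows "\<exists>J\<in>linear_set_partitions n. ties n J = T"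
proof -
  let ?b = "\<lambda>i. {j \<in> {1..n}. {min i j..<max i j} \<subseteq> T}"
  let ?J = "?b ` {1..n}"
  have tr: "{min i k..<max i k} \<subseteq> T" if "{min i j..<max i j} \<subseteq> T" "{min j k..<max j k} \<subseteq> T" for i j k :: nat
  proof
    fix x assume "x \<in> {min i k..<max i k}"
    then have "x \<in> {min i j..<max i j} \<or> x \<in> {min j k..<max j k}" by auto
    then show "x \<in> T" using that by blast
  qed
  have sym: "{min i j..<max i j} = {min j i..<max j i}" for i j :: nat by (simp add: min.commute max.commute)
  have beq: "?b i = ?b j" if "j \<in> ?b i" for i j
    using that tr[of i j] tr[of j i] sym by blast
  have refl: "i \<in> ?b i" if "i \<in> {1..n}" for i using that by auto
  have lsp: "?J \<in> linear_set_partitions n"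
    unfolding linear_set_partitions_def partition_on_def disjoint_def
  proof (intro CollectI conjI ballI impI)
    show "\<Union> ?J = {1..n}" using refl by blast
    show "{} \<notin> ?J" using refl by blast
    fix B B' assume "B \<in> ?J" "B' \<in> ?J" "B \<noteq> B'"
    then show "B \<inter> B' = {}" using beq by blast
  next
    fix B assume B: "B \<in> ?J"
    then have fin: "finite B" "B \<noteq> {}" using refl by auto
    obtain i where i: "B = ?b i" using B by blast
    have "B = {Min B..Max B}"
    proof (intro equalityI subsetI)
      fix x assume x: "x \<in> {Min B..Max B}"
      have m: "Min B \<in> ?b i" "Max B \<in> ?b i" using fin i Min_in Max_in by metis+
      have "{min (Min B) (Max B)..<max (Min B) (Max B)} \<subseteq> T"
        using tr[of "Min B" i "Max B"] m sym[of "Min B" i] by simp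
      then have "{min (Min B) x..<max (Min B) x} \<subseteq> T" using x by auto
      then have "{min i x..<max i x} \<subseteq> T" using tr[of i "Min B" x] m by simp
      moreover have "x \<in> {1..n}" using x m by auto
      ultimately show "x \<in> B" using i by blast
    qed (use fin in auto)
    then show "\<exists>a b. B = {a..b}" by blast
  qed
  have "ties n ?J = T"
  proof (intro equalityI subsetI)
    fix i assume i: "i \<in> T"
    then have n: "i \<in> {1..<n}" using T by blast
    then have "i \<in> ?b i" "Suc i \<in> ?b i" "?b i \<in> ?J" using i by auto
    then have "\<exists>B\<in>?J. i \<in> B \<and> Suc i \<in> B" by (intro bexI[of _ "?b i"] conjI)
    then show "i \<in> ties n ?J" using n unfolding ties_def by simp
  next
    fix i assume "i \<in> ties n ?J"
    then obtain B where "B \<in> ?J" "i \<in> B" "Suc i \<in> B" unfolding ties_def by blast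
    then obtain k where "i \<in> ?b k" "Suc i \<in> ?b k" by blast
    then have "{min i (Suc i)..<max i (Suc i)} \<subseteq> T" using tr[of i k "Suc i"] sym[of i k] by simp
    then show "i \<in> T" by simp
  qed
  then show ?thesis using lsp by blast
qed

text \<open>The maximum of a block is an element not tied to its successor, and each such element is
  the maximum of exactly one block. The last position \<open>n\<close> is included because
  \<open>ties\<close> stops before it.\<close>

lemma card_lsp:
  assumes J: "J \<in> linear_set_partitions n" shows "card J = n - card (ties n J)"
proof -
  have B: "finite B \<and> B \<noteq> {} \<and> B \<subseteq> {1..n}" if "B \<in> J" for B
  proof -
    have "B \<noteq> {}" using J that unfolding linear_set_partitions_def partition_on_def by blast
    then show ?thesis using lsp_block_sub[OF J that] finite_subset[of B "{1..n}"] by simp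
  qed
  have "bij_betw Max J ({1..n} - ties n J)"
    unfolding bij_betw_def
  proof (intro conjI equalityI subsetI)
    show "inj_on Max J"
    proof (rule inj_onI)
      fix B B' assume a: "B \<in> J" "B' \<in> J" "Max B = Max B'"
      then have "Max B \<in> B" "Max B \<in> B'" using B Max_in by metis+
      then show "B = B'" using lsp_block_unique[OF J a(1,2)] by blast
    qed
    fix i assume "i \<in> Max ` J"
    then obtain C where C: "C \<in> J" "i = Max C" by blast
    then have i: "i \<in> C" "\<And>x. x \<in> C \<Longrightarrow> x \<le> i" using B Max_in Max_ge by metis+
    have "i \<notin> ties n J"
    proof
      assume "i \<in> ties n J"
      then obtain B' where "B' \<in> J" "i \<in> B'" "Suc i \<in> B'" by (auto simp: ties_def)
      then have "Suc i \<in> C" using lsp_block_unique[OF J C(1)] i(1) by blast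
      then show False using i(2) by fastforce
    qed
    then show "i \<in> {1..n} - ties n J" using B[OF C(1)] i(1) by blast
  next
    fix i assume i: "i \<in> {1..n} - ties n J"
    then obtain C where C: "C \<in> J" "i \<in> C" using lsp_block_exists[OF J] by blast
    obtain a b where ab: "C = {a..b}" using lsp_interval[OF J C(1)] by blast
    have "Suc i \<notin> C"
    proof
      assume s: "Suc i \<in> C"
      then have "Suc i \<le> n" using B[OF C(1)] by auto
      then show False using s i C unfolding ties_def by auto
    qed
    then have "b = i" using ab C(2) by auto
    then have "Max C = i" using ab C(2) by (auto intro: Max_eqI)
    then show "i \<in> Max ` J" using C(1) by blast
  qed
  then have "card J = card ({1..n} - ties n J)" by (rule bij_betw_same_card)
  also have "\<dots> = n - card (ties n J)"
  proof -
    have "ties n J \<subseteq> {1..n}" by (auto simp: ties_def)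
    then show ?thesis by (simp add: card_Diff_subset finite_subset)
  qed
  finally show ?thesis .
qed

lemma lsp_le_ties:
  assumes I: "I \<in> linear_set_partitions n" and J: "J \<in> linear_set_partitions n"
  shows "lsp_le I J \<longleftrightarrow> ties n I \<subseteq> ties n J"
proof
  assume le: "lsp_le I J"
  show "ties n I \<subseteq> ties n J"
  proof
    fix i assume "i \<in> ties n I"
    then obtain D where i: "i \<in> {1..<n}" and D: "D \<in> I" "i \<in> D" "Suc i \<in> D" by (auto simp: ties_def)
    obtain B where B: "B \<in> J" "i \<in> B" using lsp_block_exists[OF J, of i] i by auto
    obtain C where C: "C \<subseteq> I" "B = \<Union>C" using le B(1) unfolding lsp_le_def by blast
    then obtain D' where D': "D' \<in> C" "i \<in> D'" using B(2) by blast
    then have "D' = D" using lsp_block_unique[OF I _ D(1) _ D(2)] C by blast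
    then have "Suc i \<in> B" using D(3) D'(1) C(2) by blast
    then show "i \<in> ties n J" using i B by (auto simp: ties_def)
  qed
next
  assume sub: "ties n I \<subseteq> ties n J"
  show "lsp_le I J" unfolding lsp_le_def
  proof
    fix B assume B: "B \<in> J"
    have DB: "D \<subseteq> B" if D: "D \<in> I" "x \<in> D" "x \<in> B" for D x
    proof
      fix y assume "y \<in> D"
      then have "y \<in> {1..n} \<and> {min x y..<max x y} \<subseteq> ties n I"
        using lsp_block_eq[OF I D(1,2)] by blast
      then have "y \<in> {1..n} \<and> {min x y..<max x y} \<subseteq> ties n J" using sub by blast
      then show "y \<in> B" using lsp_block_eq[OF J B D(3)] by blast
    qed
    have "B = \<Union>{D \<in> I. D \<subseteq> B}"
    proof (intro equalityI subsetI)
      fix x assume x: "x \<in> B"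
      then obtain D where "D \<in> I" "x \<in> D" using lsp_block_exists[OF I, of x] lsp_block_sub[OF J B] by blast
      then show "x \<in> \<Union>{D \<in> I. D \<subseteq> B}" using DB[OF _ _ x] by blast
    qed auto
    then show "\<exists>C\<subseteq>I. B = \<Union>C" by (intro exI[of _ "{D \<in> I. D \<subseteq> B}"] conjI) (rule Collect_restrict)
  qed
qed

lemma abs_EJ: "abs_bh (EJ n J) = ES (ties n J)"
proof -
  have "abs_bh (foldr (\<lambda>i acc. gE i * acc) xs 1) = prod_list (map bE xs)" for xs
    by (induction xs) (simp_all add: abs_1 abs_mult bE_def)
  then show ?thesis by (simp add: EJ_def ES_def ties_def)
qed

text \<open>Taking \<open>ties\<close> turns the coarsenings of \<open>I\<close> into the supersets
  of its tied set. By \<open>card_lsp\<close> the loss in the number of blocks is the number of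
  added ties, so the signs agree with \<open>eps_expand\<close>.\<close>

lemma abs_EE:
  assumes I: "I \<in> linear_set_partitions n"
  shows "abs_bh (EE n I) = eps n ({1..<n} - ties n I)"
proof -
  let ?L = "{J \<in> linear_set_partitions n. lsp_le I J}" and ?P = "{T. ties n I \<subseteq> T \<and> T \<subseteq> {1..<n}}"
  have tI: "ties n K \<subseteq> {1..<n}" for K by (auto simp: ties_def)
  have neg1: "abs_bh (sc ((- 1) ^ k)) = (- 1) ^ k" for k
    unfolding SC_def[symmetric] by (induction k) (simp_all add: SC_1 SC_uminus)
  have bij: "bij_betw (ties n) ?L ?P" unfolding bij_betw_def
  proof (intro conjI equalityI subsetI)
    show "inj_on (ties n) ?L" using ties_inj by (intro inj_onI) blast
    show "T \<in> ?P" if "T \<in> ties n ` ?L" for T using that lsp_le_ties[OF I] tI by auto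
    show "T \<in> ties n ` ?L" if "T \<in> ?P" for T using that ties_surj[of T n] lsp_le_ties[OF I] by auto
  qed
  have "abs_bh (EE n I) = (\<Sum>J\<in>?L. (- 1) ^ (card I - card J) * ES (ties n J))"
    unfolding EE_def by (simp add: abs_sum abs_mult abs_EJ neg1)
  also have "\<dots> = (\<Sum>J\<in>?L. (- 1) ^ (card (ties n J) - card (ties n I)) * ES (ties n J))"
  proof (rule sum.cong[OF refl])
    fix J assume J: "J \<in> ?L"
    then have "ties n I \<subseteq> ties n J" using lsp_le_ties[OF I] by blast
    then have "card (ties n I) \<le> card (ties n J)" using finite_subset[OF tI] by (intro card_mono) auto
    moreover have "card (ties n J) \<le> n" using card_mono[OF _ tI[of J]] by fastforce
    ultimately have "card I - card J = card (ties n J) - card (ties n I)"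
      using card_lsp[OF I] card_lsp[of J n] J by simp
    then show "(- 1) ^ (card I - card J) * ES (ties n J) = (- 1) ^ (card (ties n J) - card (ties n I)) * ES (ties n J)"
      by simp
  qed
  also have "\<dots> = (\<Sum>T\<in>?P. (- 1) ^ (card T - card (ties n I)) * ES T)"
    by (rule sum.reindex_bij_betw[OF bij])
  also have "\<dots> = eps n ({1..<n} - ties n I)"
    unfolding eps_expand using tI[of I] by (simp add: double_diff)
  finally show ?thesis .
qed

section \<open>Multitableaux as words\<close>

definition off :: "nat list list \<Rightarrow> nat \<Rightarrow> nat" where
  "off lam k = (\<Sum>a<k. sum_list (lam ! a))"

text \<open>The positions after which one component of the initial tableau ends and the next
  begins.\<close>

definition cuts :: "nat list list \<Rightarrow> nat set" where
  "cuts lam = off lam ` {1..<length lam}"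

text \<open>The word of a multitableau records for every entry the row that contains it.\<close>
definition wd :: "nat \<Rightarrow> nat list list \<Rightarrow> (nat \<times> nat \<times> nat \<Rightarrow> nat) \<Rightarrow> nat \<Rightarrow> nat" where
  "wd n lam s p = (if p \<in> {1..n} then case inv_into (cells lam) s p of (k, r, c) \<Rightarrow> 3 * (k * n + r) else 0)"

lemma letter_div: "r < n \<Longrightarrow> (3 * (k * n + r)) div (3 * n) = (k :: nat)"
  by (subst div_mult_mult1) simp_all

lemma sum_list_lessThan: "sum_list xs = (\<Sum>i<length xs. xs ! i)"
  by (simp add: sum_list_sum_nth atLeast0LessThan)

lemma off_Suc: "off lam (Suc k) = off lam k + sum_list (lam ! k)"
  by (simp add: off_def)

lemma off_mono: "k \<le> k' \<Longrightarrow> off lam k \<le> off lam k'"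
  unfolding off_def by (intro sum_mono2) auto

lemma off_length: "off lam (length lam) = msize lam"
  by (simp add: off_def msize_def sum_list_lessThan)

lemma finite_cells [simp]: "finite (cells lam)"
proof -
  have "cells lam = (SIGMA k:{..<length lam}. SIGMA r:{..<length (lam ! k)}. {..<lam ! k ! r})"
    by (auto simp: cells_def)
  then show ?thesis by simp
qed

lemma card_cells: "card (cells lam) = msize lam"
proof -
  have "cells lam = (SIGMA k:{..<length lam}. SIGMA r:{..<length (lam ! k)}. {..<lam ! k ! r})"
    by (auto simp: cells_def)
  then have "card (cells lam) = (\<Sum>k<length lam. \<Sum>r<length (lam ! k). lam ! k ! r)"
    by (simp add: card_SigmaI)
  then show ?thesis by (simp add: off_length[symmetric] off_def sum_list_lessThan)
qed

lemma tlam_cell: "(k, r, c) \<in> cells lam \<Longrightarrow> tlam lam (k, r, c) = off lam k + (\<Sum>b<r. lam ! k ! b) + c + 1"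
  by (simp add: tlam_def off_def)

lemma tlam_row_le: "(k, r, c) \<in> cells lam \<Longrightarrow> tlam lam (k, r, c) \<le> off lam k + (\<Sum>b<Suc r. lam ! k ! b)"
  unfolding tlam_cell by (simp add: cells_def)

lemma row_sums_le: "r \<le> r' \<Longrightarrow> (\<Sum>b<r. xs ! b) \<le> (\<Sum>b<r'. xs ! b :: nat)"
  by (intro sum_mono2) auto

lemma tlam_comp_le: "(k, r, c) \<in> cells lam \<Longrightarrow> tlam lam (k, r, c) \<le> off lam (Suc k)"
proof -
  assume c: "(k, r, c) \<in> cells lam"
  then have "Suc r \<le> length (lam ! k)" by (simp add: cells_def)
  then show ?thesis using tlam_row_le[OF c] row_sums_le[of "Suc r" "length (lam ! k)" "lam ! k"]
    by (simp add: off_Suc sum_list_lessThan)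
qed

lemma tlam_gt_off: "(k, r, c) \<in> cells lam \<Longrightarrow> off lam k < tlam lam (k, r, c)"
  unfolding tlam_cell by simp

lemma tlam_less:
  assumes "(k, r, c) \<in> cells lam" "(k', r', c') \<in> cells lam"
    and "k < k' \<or> k = k' \<and> (r < r' \<or> r = r' \<and> c < c')"
  shows "tlam lam (k, r, c) < tlam lam (k', r', c')"
  using assms(3)
proof (elim disjE conjE)
  assume "k < k'"
  then show ?thesis using tlam_comp_le[OF assms(1)] off_mono[of "Suc k" k' lam] tlam_gt_off[OF assms(2)] by simp
next
  assume "k = k'" "r < r'"
  then show ?thesis
    using tlam_row_le[OF assms(1)] tlam_cell[OF assms(2)] row_sums_le[of "Suc r" r' "lam ! k"] by simp
next
  assume "k = k'" "r = r'" "c < c'"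
  then show ?thesis unfolding tlam_cell[OF assms(1)] tlam_cell[OF assms(2)] by simp
qed

lemma tlam_bij: "bij_betw (tlam lam) (cells lam) {1..msize lam}"
proof -
  have inj: "inj_on (tlam lam) (cells lam)"
  proof (rule inj_onI)
    fix x y assume xy: "x \<in> cells lam" "y \<in> cells lam" "tlam lam x = tlam lam y"
    obtain k r c k' r' c' where e: "x = (k, r, c)" "y = (k', r', c')" by (cases x; cases y) auto
    show "x = y"
    proof (rule ccontr)
      assume "x \<noteq> y"
      then have "(k < k' \<or> k = k' \<and> (r < r' \<or> r = r' \<and> c < c')) \<or> (k' < k \<or> k' = k \<and> (r' < r \<or> r' = r \<and> c' < c))"
        using e by auto
      then show False using tlam_less[of k r c lam k' r' c'] tlam_less[of k' r' c' lam k r c] xy e by auto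
    qed
  qed
  have "tlam lam ` cells lam \<subseteq> {1..msize lam}"
  proof
    fix p assume "p \<in> tlam lam ` cells lam"
    then obtain k r c where x: "(k, r, c) \<in> cells lam" "p = tlam lam (k, r, c)" by auto
    then have "Suc k \<le> length lam" by (simp add: cells_def)
    then show "p \<in> {1..msize lam}"
      using tlam_comp_le[OF x(1)] off_mono[of "Suc k" "length lam" lam] tlam_gt_off[OF x(1)] x(2) off_length[of lam] by simp
  qed
  then show ?thesis unfolding bij_betw_def using inj card_image[OF inj]
    by (simp add: card_cells card_subset_eq)
qed

lemma tlam_multitableau: "tlam lam \<in> multitableaux lam"
  using tlam_bij[of lam] by (auto simp: multitableaux_def tlam_def split: prod.splits)

locale multipart =
  fixes n :: nat and lam :: "nat list list"
  assumes lam: "lam \<in> multipartitions n"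
begin

lemma msize: "msize lam = n"
  using lam by (simp add: multipartitions_def)

lemma comp_pos: "k < length lam \<Longrightarrow> r < length (lam ! k) \<Longrightarrow> 0 < lam ! k ! r"
  using lam unfolding multipartitions_def is_partition_def by (metis (no_types, lifting) gr0I mem_Collect_eq nth_mem)

lemma comp_desc: "k < length lam \<Longrightarrow> r \<le> r' \<Longrightarrow> r' < length (lam ! k) \<Longrightarrow> lam ! k ! r' \<le> lam ! k ! r"
  using lam unfolding multipartitions_def is_partition_def
  by (cases "r = r'") (auto simp: sorted_wrt_iff_nth_less)

lemma comp_size: "k < length lam \<Longrightarrow> 0 < sum_list (lam ! k)"
proof -
  assume k: "k < length lam"
  then have "lam ! k \<noteq> []" using lam nth_mem unfolding multipartitions_def by blast
  then have "0 < lam ! k ! 0" using comp_pos[OF k, of 0] by simp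
  moreover have "lam ! k ! 0 \<le> sum_list (lam ! k)" using \<open>lam ! k \<noteq> []\<close> by (simp add: elem_le_sum_list)
  ultimately show ?thesis by simp
qed

lemma off_strict: "k < k' \<Longrightarrow> k' \<le> length lam \<Longrightarrow> off lam k < off lam k'"
  using off_mono[of "Suc k" k' lam] comp_size[of k] by (simp add: off_Suc)

lemma length_row: "k < length lam \<Longrightarrow> length (lam ! k) \<le> n"
proof -
  assume k: "k < length lam"
  have "length (lam ! k) = (\<Sum>r<length (lam ! k). 1)" by simp
  also have "\<dots> \<le> (\<Sum>r<length (lam ! k). lam ! k ! r)"
    by (intro sum_mono) (use comp_pos[OF k] in \<open>auto simp: Suc_le_eq\<close>)
  also have "\<dots> = sum_list (lam ! k)" by (simp add: sum_list_lessThan)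
  also have "\<dots> \<le> off lam (Suc k)" by (simp add: off_Suc)
  also have "\<dots> \<le> n" using off_mono[of "Suc k" "length lam" lam] k by (simp add: off_length msize)
  finally show ?thesis .
qed

lemma cell_row: "(k, r, c) \<in> cells lam \<Longrightarrow> r < n"
  using length_row[of k] by (auto simp: cells_def)

lemma wd_cell:
  assumes "s \<in> multitableaux lam" "(k, r, c) \<in> cells lam"
  shows "wd n lam s (s (k, r, c)) = 3 * (k * n + r)" "s (k, r, c) \<in> {1..n}"
proof -
  have b: "bij_betw s (cells lam) {1..n}" using assms(1) by (simp add: multitableaux_def msize)
  then show i: "s (k, r, c) \<in> {1..n}" using assms(2) bij_betwE by blast
  have "inv_into (cells lam) s (s (k, r, c)) = (k, r, c)"
    using bij_betw_inv_into_left[OF b assms(2)] .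
  then show "wd n lam s (s (k, r, c)) = 3 * (k * n + r)" using i by (simp add: wd_def)
qed

lemma tableau_cellE:
  assumes "s \<in> multitableaux lam" "p \<in> {1..n}"
  obtains k r c where "(k, r, c) \<in> cells lam" "p = s (k, r, c)"
proof -
  have "s ` cells lam = {1..n}" using assms(1) by (simp add: multitableaux_def msize bij_betw_def)
  then obtain x where "x \<in> cells lam" "p = s x" using assms(2) by blast
  then show ?thesis using that by (cases x) auto
qed

lemma wd_letter_set:
  assumes "s \<in> multitableaux lam" "r < n" "p \<le> n"
  shows "{q \<in> {1..p}. wd n lam s q = 3 * (k * n + r)} = (\<lambda>c. s (k, r, c)) ` {c. (k, r, c) \<in> cells lam \<and> s (k, r, c) \<le> p}"
proof (intro equalityI subsetI)
  fix q assume q: "q \<in> {q \<in> {1..p}. wd n lam s q = 3 * (k * n + r)}"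
  then have "q \<in> {1..n}" using assms(3) by auto
  then obtain k' r' c where x: "(k', r', c) \<in> cells lam" "q = s (k', r', c)" using tableau_cellE[OF assms(1)] by blast
  then have "k' * n + r' = k * n + r" using wd_cell[OF assms(1) x(1)] q by simp
  then have "k' = k" "r' = r" using block_letter_eq[OF cell_row[OF x(1)] assms(2)] by auto
  then show "q \<in> (\<lambda>c. s (k, r, c)) ` {c. (k, r, c) \<in> cells lam \<and> s (k, r, c) \<le> p}" using x q by auto
next
  fix q assume "q \<in> (\<lambda>c. s (k, r, c)) ` {c. (k, r, c) \<in> cells lam \<and> s (k, r, c) \<le> p}"
  then show "q \<in> {q \<in> {1..p}. wd n lam s q = 3 * (k * n + r)}" using wd_cell[OF assms(1)] by auto
qed

lemma row_inj: "s \<in> multitableaux lam \<Longrightarrow> inj_on (\<lambda>c. s (k, r, c)) {c. (k, r, c) \<in> cells lam}"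
proof (rule inj_onI)
  fix c c' assume s: "s \<in> multitableaux lam" and c: "c \<in> {c. (k, r, c) \<in> cells lam}" "c' \<in> {c. (k, r, c) \<in> cells lam}"
    and eq: "s (k, r, c) = s (k, r, c')"
  have "inj_on s (cells lam)" using s by (simp add: multitableaux_def bij_betw_def)
  from inj_onD[OF this eq] c show "c = c'" by auto
qed

lemma cnt_wd:
  assumes "s \<in> multitableaux lam" "r < n"
  shows "cnt n (wd n lam s) (3 * (k * n + r)) = part_of (comp_of lam k) r"
proof -
  have "cnt n (wd n lam s) (3 * (k * n + r)) = card ((\<lambda>c. s (k, r, c)) ` {c. (k, r, c) \<in> cells lam \<and> s (k, r, c) \<le> n})"
    unfolding cnt_def wd_letter_set[OF assms order.refl] ..
  also have "{c. (k, r, c) \<in> cells lam \<and> s (k, r, c) \<le> n} = {c. (k, r, c) \<in> cells lam}"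
    using wd_cell(2)[OF assms(1)] by auto
  also have "card ((\<lambda>c. s (k, r, c)) ` {c. (k, r, c) \<in> cells lam}) = card {c. (k, r, c) \<in> cells lam}"
    by (rule card_image[OF row_inj[OF assms(1)]])
  also have "{c. (k, r, c) \<in> cells lam} = {..<part_of (comp_of lam k) r}"
    by (auto simp: cells_def part_of_def comp_of_def)
  finally show ?thesis by simp
qed

lemma wd_outside: "p \<notin> {1..n} \<Longrightarrow> wd n lam s p = 0"
  by (simp only: wd_def if_False)

lemma tlam_cellE:
  assumes "p \<in> {1..n}"
  obtains k r c where "(k, r, c) \<in> cells lam" "p = tlam lam (k, r, c)"
  using tableau_cellE[OF tlam_multitableau assms] .

lemma f0_cell: "(k, r, c) \<in> cells lam \<Longrightarrow> wd n lam (tlam lam) (tlam lam (k, r, c)) = 3 * (k * n + r)"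
  using wd_cell(1)[OF tlam_multitableau] .

lemma cuts_sub: "cuts lam \<subseteq> {1..<n}"
proof
  fix i assume "i \<in> cuts lam"
  then obtain k where k: "1 \<le> k" "k < length lam" "i = off lam k" by (auto simp: cuts_def)
  have "off lam 0 < off lam k" "off lam k < off lam (length lam)" using off_strict k by auto
  then show "i \<in> {1..<n}" using k by (simp add: off_length msize)
qed

lemma blk_tlam:
  assumes "(k, r, c) \<in> cells lam" shows "blk_of (cuts lam) (tlam lam (k, r, c)) = k"
proof -
  let ?p = "tlam lam (k, r, c)"
  have k: "k < length lam" using assms by (simp add: cells_def)
  have less: "off lam a < ?p \<longleftrightarrow> a \<le> k" for a
  proof
    assume "off lam a < ?p"
    then show "a \<le> k" using tlam_comp_le[OF assms] off_mono[of "Suc k" a lam] by (cases "a \<le> k") auto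
  next
    assume "a \<le> k"
    then show "off lam a < ?p" using tlam_gt_off[OF assms] off_mono[of a k lam] by simp
  qed
  have "{i \<in> cuts lam. 1 \<le> i \<and> i < ?p} = off lam ` {1..k}"
  proof (intro equalityI subsetI)
    fix i assume "i \<in> {i \<in> cuts lam. 1 \<le> i \<and> i < ?p}"
    then show "i \<in> off lam ` {1..k}" using less by (auto simp: cuts_def)
  next
    fix i assume "i \<in> off lam ` {1..k}"
    then obtain a where a: "1 \<le> a" "a \<le> k" "i = off lam a" by auto
    then have "i \<in> cuts lam" using k by (auto simp: cuts_def)
    then show "i \<in> {i \<in> cuts lam. 1 \<le> i \<and> i < ?p}" using cuts_sub less a by auto
  qed
  moreover have "inj_on (off lam) {1..k}"
    by (rule strict_mono_on_imp_inj_on) (use off_strict k in \<open>auto intro!: strict_mono_onI\<close>)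
  ultimately show ?thesis unfolding blk_of_def by (simp add: card_image)
qed

lemma f0_less:
  assumes "(k, r, c) \<in> cells lam" "(k', r', c') \<in> cells lam" "tlam lam (k, r, c) \<le> tlam lam (k', r', c')"
  shows "k * n + r \<le> k' * n + r'"
proof -
  have "\<not> (k' < k \<or> k' = k \<and> (r' < r \<or> r' = r \<and> c' < c))" using tlam_less[OF assms(2,1)] assms(3) by auto
  then consider "k < k'" | "k = k'" "r \<le> r'" by force
  then show ?thesis
  proof cases
    case 1
    then have "Suc k * n \<le> k' * n" by (intro mult_le_mono1) simp
    then show ?thesis using cell_row[OF assms(1)] by simp
  qed simp
qed

lemma f0_valid: "valid_word n (cuts lam) (wd n lam (tlam lam))"
  unfolding valid_word_def
proof (intro conjI allI impI ballI wd_outside)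
  show "srt n (wd n lam (tlam lam))" unfolding srt_def
  proof (intro allI impI)
    fix i assume i: "1 \<le> i" "i < n"
    obtain k r c where x: "(k, r, c) \<in> cells lam" "i = tlam lam (k, r, c)" using tlam_cellE[of i] i by auto
    obtain k' r' c' where y: "(k', r', c') \<in> cells lam" "Suc i = tlam lam (k', r', c')" using tlam_cellE[of "Suc i"] i by auto
    show "wd n lam (tlam lam) i \<le> wd n lam (tlam lam) (Suc i)"
      using f0_less[OF x(1) y(1)] x(2) y(2) f0_cell[OF x(1)] f0_cell[OF y(1)] by simp
  qed
  fix p assume "p \<in> {1..n}"
  then obtain k r c where x: "(k, r, c) \<in> cells lam" "p = tlam lam (k, r, c)" using tlam_cellE by blast
  show "\<exists>r<n. wd n lam (tlam lam) p = 3 * (blk_of (cuts lam) p * n + r)"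
    using cell_row[OF x(1)] f0_cell[OF x(1)] blk_tlam[OF x(1)] x(2) by (intro exI[of _ r]) simp
qed

lemma dperm_ex1:
  assumes s: "s \<in> multitableaux lam"
  shows "\<exists>!w. w permutes {1..msize lam} \<and> (\<forall>x\<in>cells lam. s x = w (tlam lam x))"
proof -
  let ?t = "inv_into (cells lam) (tlam lam)"
  let ?w = "\<lambda>p. if p \<in> {1..n} then s (?t p) else p"
  have bs: "bij_betw s (cells lam) {1..n}" using s by (simp add: multitableaux_def msize)
  have bt: "bij_betw (tlam lam) (cells lam) {1..n}" using tlam_bij[of lam] by (simp add: msize)
  have "bij_betw (s \<circ> ?t) {1..n} {1..n}" using bij_betw_inv_into[OF bt] bs by (rule bij_betw_trans)
  then have "bij_betw ?w {1..n} {1..n}" by (rule bij_betw_cong[THEN iffD1, rotated]) auto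
  then have w: "?w permutes {1..n}" by (intro bij_imp_permutes) auto
  have sx: "s x = ?w (tlam lam x)" if "x \<in> cells lam" for x
    using bij_betw_inv_into_left[OF bt that] bij_betwE[OF bt] that by simp
  show ?thesis unfolding msize
  proof (rule ex1I[of _ ?w])
    show "?w permutes {1..n} \<and> (\<forall>x\<in>cells lam. s x = ?w (tlam lam x))" using w sx by blast
    fix w' assume w': "w' permutes {1..n} \<and> (\<forall>x\<in>cells lam. s x = w' (tlam lam x))"
    show "w' = ?w"
    proof
      fix p show "w' p = ?w p"
      proof (cases "p \<in> {1..n}")
        case True
        then obtain x where "x \<in> cells lam" "p = tlam lam x" using bt unfolding bij_betw_def by blast
        then have "w' p = s x" "?w p = s x" using w' sx by metis+
        then show ?thesis by metis
      next
        case False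
        then have "w' p = p" "?w p = p" using permutes_not_in[of w' "{1..n}" p] w' by (blast, simp only: if_False)
        then show ?thesis by metis
      qed
    qed
  qed
qed

lemma dperm:
  assumes "s \<in> multitableaux lam"
  shows "dperm lam s permutes {1..n}" "x \<in> cells lam \<Longrightarrow> s x = dperm lam s (tlam lam x)"
proof -
  have "dperm lam s permutes {1..msize lam} \<and> (\<forall>x\<in>cells lam. s x = dperm lam s (tlam lam x))"
    unfolding dperm_def by (rule theI'[OF dperm_ex1[OF assms]])
  then show "dperm lam s permutes {1..n}" "x \<in> cells lam \<Longrightarrow> s x = dperm lam s (tlam lam x)"
    unfolding msize by blast+
qed

text \<open>The inverse of \<open>dperm lam s\<close> takes an entry of \<open>s\<close> to the
  entry of \<open>tlam\<close> in the same cell, and both words read off the row of that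
  cell.\<close>

lemma wd_dperm:
  assumes "s \<in> multitableaux lam"
  shows "wd n lam (tlam lam) \<circ> inv (dperm lam s) = wd n lam s"
proof
  note d = dperm[OF assms]
  fix p show "(wd n lam (tlam lam) \<circ> inv (dperm lam s)) p = wd n lam s p"
  proof (cases "p \<in> {1..n}")
    case True
    then obtain k r c where x: "(k, r, c) \<in> cells lam" "p = s (k, r, c)" using tableau_cellE[OF assms] by blast
    then have "inv (dperm lam s) p = tlam lam (k, r, c)" using d(2) permutes_inverses(2)[OF d(1)] by simp
    then show ?thesis using f0_cell[OF x(1)] wd_cell(1)[OF assms x(1)] x(2) by simp
  next
    case False
    then have "inv (dperm lam s) p = p" using permutes_not_in[OF permutes_inv[OF d(1)]] by blast
    then show ?thesis using False wd_outside by simp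
  qed
qed

lemma wd_orb: "s \<in> multitableaux lam \<Longrightarrow> wd n lam s \<in> orb n (wd n lam (tlam lam))"
  using wd_dperm orb_compI[OF permutes_inv[OF dperm(1)]] by metis

lemma row_less:
  assumes "standard lam s" "(k, r, c') \<in> cells lam" "c < c'" shows "s (k, r, c) < s (k, r, c')"
  using assms(3,2)
proof (induction c')
  case (Suc m)
  have "(k, r, m) \<in> cells lam" using Suc.prems by (auto simp: cells_def)
  moreover have "s (k, r, m) < s (k, r, Suc m)" using assms(1) Suc.prems by (auto simp: standard_def)
  ultimately show ?case using Suc by (cases "c = m") auto
qed simp

lemma rowinc_dperm:
  assumes "s \<in> Tset lam"
  shows "rowinc n (wd n lam (tlam lam)) (inv (dperm lam s))"
  unfolding rowinc_def
proof (intro allI impI)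
  have s: "s \<in> multitableaux lam" "standard lam s" using assms by (auto simp: Tset_def)
  note d = dperm[OF s(1)]
  fix x y assume xy: "1 \<le> x \<and> x < y \<and> y \<le> n \<and> wd n lam (tlam lam) x = wd n lam (tlam lam) y"
  obtain k r c where x: "(k, r, c) \<in> cells lam" "x = tlam lam (k, r, c)" using tlam_cellE[of x] xy by auto
  obtain k' r' c' where y: "(k', r', c') \<in> cells lam" "y = tlam lam (k', r', c')" using tlam_cellE[of y] xy by auto
  have "k * n + r = k' * n + r'" using xy f0_cell[OF x(1)] f0_cell[OF y(1)] x(2) y(2) by simp
  then have e: "k = k'" "r = r'" using block_letter_eq[OF cell_row[OF x(1)] cell_row[OF y(1)]] by auto
  have "c < c'"
  proof (rule ccontr)
    assume "\<not> c < c'"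
    then have "tlam lam (k', r', c') \<le> tlam lam (k, r, c)"
      unfolding tlam_cell[OF x(1)] tlam_cell[OF y(1)] using e by simp
    then show False using xy x y by simp
  qed
  then have "s (k, r, c) < s (k', r', c')" using row_less[OF s(2)] y(1) e by simp
  then have "dperm lam s x < dperm lam s y" using d(2) x y by simp
  then show "inv (inv (dperm lam s)) x < inv (inv (dperm lam s)) y" using permutes_inv_inv[OF d(1)] by simp
qed

lemma row_stab_eq:
  "row_stab lam = {w. w permutes {1..n} \<and> wd n lam (tlam lam) \<circ> w = wd n lam (tlam lam)}"
proof (intro equalityI subsetI)
  fix w assume "w \<in> row_stab lam"
  then have w: "w permutes {1..n}" "\<And>k r c. (k, r, c) \<in> cells lam \<Longrightarrow>
      \<exists>c'. (k, r, c') \<in> cells lam \<and> w (tlam lam (k, r, c)) = tlam lam (k, r, c')"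
    by (auto simp: row_stab_def msize)
  have "wd n lam (tlam lam) (w p) = wd n lam (tlam lam) p" for p
  proof (cases "p \<in> {1..n}")
    case True
    then obtain k r c where x: "(k, r, c) \<in> cells lam" "p = tlam lam (k, r, c)" using tlam_cellE by blast
    obtain c' where "(k, r, c') \<in> cells lam" "w p = tlam lam (k, r, c')" using w(2)[OF x(1)] x(2) by blast
    then show ?thesis using f0_cell x by simp
  next
    case False
    then show ?thesis using permutes_not_in[OF w(1)] by simp
  qed
  then show "w \<in> {w. w permutes {1..n} \<and> wd n lam (tlam lam) \<circ> w = wd n lam (tlam lam)}" using w(1) by auto
next
  fix w assume "w \<in> {w. w permutes {1..n} \<and> wd n lam (tlam lam) \<circ> w = wd n lam (tlam lam)}"
  then have w: "w permutes {1..n}" "\<And>p. wd n lam (tlam lam) (w p) = wd n lam (tlam lam) p" by (auto simp: fun_eq_iff)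
  have "\<exists>c'. (k, r, c') \<in> cells lam \<and> w (tlam lam (k, r, c)) = tlam lam (k, r, c')" if x: "(k, r, c) \<in> cells lam" for k r c
  proof -
    have "w (tlam lam (k, r, c)) \<in> {1..n}"
      using permutes_in_image[OF w(1)] wd_cell(2)[OF tlam_multitableau x] by blast
    then obtain k' r' c' where y: "(k', r', c') \<in> cells lam" "w (tlam lam (k, r, c)) = tlam lam (k', r', c')"
      using tlam_cellE by blast
    have "k * n + r = k' * n + r'" using w(2)[of "tlam lam (k, r, c)"] f0_cell[OF x] f0_cell[OF y(1)] y(2) by simp
    then have "k = k'" "r = r'" using block_letter_eq[OF cell_row[OF x] cell_row[OF y(1)]] by auto
    then show ?thesis using y by blast
  qed
  then show "w \<in> row_stab lam" using w(1) by (simp add: row_stab_def msize)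
qed

text \<open>An entry of row \<open>Suc r\<close> that is at most \<open>p\<close> has a smaller
  entry directly above it, so the columns reached in row \<open>Suc r\<close> are among those
  reached in row \<open>r\<close>.\<close>

lemma wd_lattice:
  assumes "s \<in> Tset lam" shows "lattice_word n (wd n lam s)"
  unfolding lattice_word_def
proof (intro allI impI)
  have s: "s \<in> multitableaux lam" "standard lam s" using assms by (auto simp: Tset_def)
  fix \<rho> p assume "adj_letter n \<rho>" and p: "p \<le> n"
  then obtain k r where kr: "\<rho> = 3 * (k * n + r)" "Suc r < n" by (auto simp: adj_letter_def)
  let ?D = "\<lambda>r. {c. (k, r, c) \<in> cells lam \<and> s (k, r, c) \<le> p}"
  have c: "card {q \<in> {1..p}. wd n lam s q = 3 * (k * n + r)} = card (?D r)" if "r < n" for r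
    unfolding wd_letter_set[OF s(1) that p]
    by (rule card_image, rule inj_on_subset[OF row_inj[OF s(1)]]) auto
  have "?D (Suc r) \<subseteq> ?D r"
  proof
    fix c assume c: "c \<in> ?D (Suc r)"
    then have "(k, r, c) \<in> cells lam" using comp_desc[of k r "Suc r"] by (force simp: cells_def)
    moreover have "s (k, r, c) < s (k, Suc r, c)" using s(2) c by (auto simp: standard_def)
    ultimately show "c \<in> ?D r" using c by auto
  qed
  moreover have "finite (?D r)" by (rule finite_subset[of _ "{..<lam ! k ! r}"]) (auto simp: cells_def)
  ultimately have "card (?D (Suc r)) \<le> card (?D r)" by (rule card_mono[rotated])
  then have D: "card (?D (Suc r)) \<le> card (?D r)" .
  have r3: "\<rho> + 3 = 3 * (k * n + Suc r)" using kr by simp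
  show "card {q \<in> {1..p}. wd n lam s q = \<rho> + 3} \<le> card {q \<in> {1..p}. wd n lam s q = \<rho>}"
    unfolding r3 unfolding kr(1) c[OF kr(2)] c[OF Suc_lessD[OF kr(2)]] by (rule D)
qed

text \<open>An increasing row is the sorted list of the positions of its letter. Thus a standard
  tableau can be recovered from its word.\<close>

lemma row_enum:
  assumes "s \<in> multitableaux lam" "standard lam s" "(k, r, c) \<in> cells lam"
  shows "s (k, r, c) = sorted_list_of_set {q \<in> {1..n}. wd n lam s q = 3 * (k * n + r)} ! c"
proof -
  let ?m = "lam ! k ! r" and ?xs = "map (\<lambda>c. s (k, r, c)) [0..<lam ! k ! r]"
  have row: "(k, r, d) \<in> cells lam \<longleftrightarrow> d < ?m" for d using assms(3) by (simp add: cells_def)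
  have "sorted ?xs"
    using row_less[OF assms(2)] row by (auto simp: sorted_iff_nth_mono_less intro!: less_imp_le)
  moreover have "distinct ?xs" using row_inj[OF assms(1), of k r] row by (auto simp: distinct_map inj_on_def)
  ultimately have "sorted_list_of_set (set ?xs) = ?xs" by (rule sorted_list_of_set.idem_if_sorted_distinct)
  moreover have "set ?xs = {q \<in> {1..n}. wd n lam s q = 3 * (k * n + r)}"
    unfolding wd_letter_set[OF assms(1) cell_row[OF assms(3)] order.refl] using row wd_cell(2)[OF assms(1)] by force
  ultimately show ?thesis using assms(3) by (simp add: cells_def)
qed

lemma wd_inj: "inj_on (wd n lam) (Tset lam)"
proof (rule inj_onI)
  fix s s' assume a: "s \<in> Tset lam" "s' \<in> Tset lam" and eq: "wd n lam s = wd n lam s'"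
  then have s: "s \<in> multitableaux lam" "standard lam s" "s' \<in> multitableaux lam" "standard lam s'" by (auto simp: Tset_def)
  show "s = s'"
  proof
    fix x show "s x = s' x"
    proof (cases "x \<in> cells lam")
      case True
      then show ?thesis using row_enum[OF s(1,2)] row_enum[OF s(3,4)] eq by (cases x) auto
    next
      case False
      then have "s x = 0" "s' x = 0" using s(1,3) unfolding multitableaux_def by blast+
      then show ?thesis by simp
    qed
  qed
qed

lemma wd_block:
  assumes "s \<in> Tset lam" "p \<in> {1..n}" shows "wd n lam s p div (3 * n) = blk_of (cuts lam) p"
proof -
  have s: "s \<in> multitableaux lam" "initial_kind lam s" using assms by (auto simp: Tset_def)
  obtain k r c where x: "(k, r, c) \<in> cells lam" "p = s (k, r, c)" using tableau_cellE[OF s(1) assms(2)] by blast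
  have "p \<in> tlam lam ` {x \<in> cells lam. fst x = k}"
    using s(2) x unfolding initial_kind_def by (metis (mono_tags, lifting) fst_conv imageI mem_Collect_eq)
  then obtain r' c' where "(k, r', c') \<in> cells lam" "p = tlam lam (k, r', c')" by auto
  then have "blk_of (cuts lam) p = k" using blk_tlam by simp
  moreover have "wd n lam s p = 3 * (k * n + r)" using wd_cell(1)[OF s(1) x(1)] x(2) by simp
  moreover have "(3 * (k * n + r)) div (3 * n) = k" by (rule letter_div[OF cell_row[OF x(1)]])
  ultimately show ?thesis by simp
qed

text \<open>Each row is filled with the sorted positions of its letter. Rows then increase by
  construction, the lattice condition yields the columns, and the hypothesis on blocks yields the
  initial kind.\<close>

lemma wd_surj:
  assumes f: "f \<in> orb n (wd n lam (tlam lam))" and lat: "lattice_word n f"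
    and blk: "\<And>p. p \<in> {1..n} \<Longrightarrow> f p div (3 * n) = blk_of (cuts lam) p"
  shows "\<exists>s\<in>Tset lam. wd n lam s = f"
proof -
  let ?R = "\<lambda>k r. {q \<in> {1..n}. f q = 3 * (k * n + r)}"
  define s where "s x = (if x \<in> cells lam then case x of (k, r, c) \<Rightarrow> sorted_list_of_set (?R k r) ! c else 0)" for x
  have len: "length (sorted_list_of_set (?R k r)) = lam ! k ! r" if "(k, r, c) \<in> cells lam" for k r c
  proof -
    have "length (sorted_list_of_set (?R k r)) = cnt n f (3 * (k * n + r))" by (simp add: cnt_def)
    also have "\<dots> = part_of (comp_of lam k) r" using orb_cnt[OF f] cnt_wd[OF tlam_multitableau cell_row[OF that]] by simp
    finally show ?thesis using that by (simp add: cells_def part_of_def comp_of_def)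
  qed
  have sc: "s (k, r, c) = sorted_list_of_set (?R k r) ! c" if "(k, r, c) \<in> cells lam" for k r c
    using that by (simp add: s_def)
  have mem: "s (k, r, c) \<in> ?R k r" if x: "(k, r, c) \<in> cells lam" for k r c
  proof -
    have "c < length (sorted_list_of_set (?R k r))" using len[OF x] x by (simp add: cells_def)
    then have "sorted_list_of_set (?R k r) ! c \<in> set (sorted_list_of_set (?R k r))" by (rule nth_mem)
    then show ?thesis using sc[OF x] by simp
  qed
  have rowless: "s (k, r, c) < s (k, r, c')" if x: "(k, r, c') \<in> cells lam" "c < c'" for k r c c'
  proof -
    have y: "(k, r, c) \<in> cells lam" using x by (auto simp: cells_def)
    have "sorted_wrt (<) (sorted_list_of_set (?R k r))" by (rule strict_sorted_list_of_set)
    moreover have "c' < length (sorted_list_of_set (?R k r))" unfolding len[OF x(1)] using x(1) by (simp add: cells_def)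
    ultimately show ?thesis unfolding sc[OF x(1)] sc[OF y] using x(2) by (meson sorted_wrt_nth_less)
  qed
  have im: "s ` cells lam = {1..n}"
  proof (intro equalityI subsetI)
    show "p \<in> {1..n}" if "p \<in> s ` cells lam" for p using that mem by force
    fix p assume p: "p \<in> {1..n}"
    obtain g where g: "g permutes {1..n}" "f = wd n lam (tlam lam) \<circ> g" using f by (auto simp: orb_def)
    have "g p \<in> {1..n}" using permutes_in_image[OF g(1)] p by blast
    then obtain k r c where x: "(k, r, c) \<in> cells lam" "g p = tlam lam (k, r, c)" using tlam_cellE by blast
    then have "p \<in> ?R k r" using g(2) f0_cell p by simp
    then have "p \<in> set (sorted_list_of_set (?R k r))" by simp
    then obtain d where d: "d < length (sorted_list_of_set (?R k r))" "sorted_list_of_set (?R k r) ! d = p"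
      unfolding in_set_conv_nth by blast
    then have "(k, r, d) \<in> cells lam" using len[OF x(1)] x(1) by (simp add: cells_def)
    then show "p \<in> s ` cells lam" using sc d by force
  qed
  then have "bij_betw s (cells lam) {1..n}"
    unfolding bij_betw_def by (simp add: eq_card_imp_inj_on card_cells msize)
  then have mt: "s \<in> multitableaux lam" by (auto simp: multitableaux_def msize s_def)
  have wf: "wd n lam s = f"
  proof
    fix p show "wd n lam s p = f p"
    proof (cases "p \<in> {1..n}")
      case True
      then obtain k r c where x: "(k, r, c) \<in> cells lam" "p = s (k, r, c)" using tableau_cellE[OF mt] by blast
      then show ?thesis using wd_cell(1)[OF mt x(1)] mem[OF x(1)] by simp
    next
      case False
      then show ?thesis using wd_outside orb_outside[OF f False] by simp
    qed
  qed
  have std: "standard lam s" unfolding standard_def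
  proof (intro conjI allI impI)
    show "s (k, r, c) < s (k, r, Suc c)" if "(k, r, Suc c) \<in> cells lam" for k r c using rowless[OF that] by simp
    fix k r c assume x: "(k, Suc r, c) \<in> cells lam"
    then have y: "(k, r, c) \<in> cells lam" using comp_desc[of k r "Suc r"] by (force simp: cells_def)
    let ?p = "s (k, Suc r, c)"
    have p: "?p \<le> n" "?p \<noteq> 0" using wd_cell(2)[OF mt x] by auto
    have adj: "adj_letter n (3 * (k * n + r))" using cell_row[OF x] by (auto simp: adj_letter_def)
    let ?D = "\<lambda>r. {d. (k, r, d) \<in> cells lam \<and> s (k, r, d) \<le> ?p}"
    have cc: "card {q \<in> {1..?p}. f q = 3 * (k * n + r)} = card (?D r)" if "r < n" for r
      using wd_letter_set[OF mt that p(1), of k] unfolding wf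
      by (simp add: card_image[OF inj_on_subset[OF row_inj[OF mt]]] subset_iff)
    \<comment> \<open>The lattice inequality is used for the prefix that ends with the entry
      \<open>?p\<close> of the lower cell; row \<open>Suc r\<close> has already reached column
      \<open>c\<close> there.\<close>
    have "card (?D (Suc r)) \<le> card (?D r)"
    proof -
      have "card {q \<in> {1..?p}. f q = 3 * (k * n + r) + 3} \<le> card {q \<in> {1..?p}. f q = 3 * (k * n + r)}"
        using lat adj p(1) unfolding lattice_word_def by blast
      moreover have r3: "3 * (k * n + r) + 3 = 3 * (k * n + Suc r)" by simp
      ultimately show ?thesis unfolding r3 cc[OF cell_row[OF x]] cc[OF cell_row[OF y]] by blast
    qed
    moreover have "{..c} \<subseteq> ?D (Suc r)"
    proof
      fix d assume "d \<in> {..c}"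
      then show "d \<in> ?D (Suc r)" using rowless[OF x, of d] x by (cases "d = c") (auto simp: cells_def)
    qed
    moreover have finD: "finite (?D r)" for r by (rule finite_subset[of _ "{..<lam ! k ! r}"]) (auto simp: cells_def)
    ultimately have card: "Suc c \<le> card (?D r)" using card_mono[of "?D (Suc r)" "{..c}"] by simp
    \<comment> \<open>Row \<open>r\<close> increases, so if column \<open>c\<close> were not reached
      the set would have at most \<open>c\<close> elements, one too few.\<close>
    have "c \<in> ?D r"
    proof (rule ccontr)
      assume nc: "c \<notin> ?D r"
      have "?D r \<subseteq> {..<c}"
      proof
        fix d assume d: "d \<in> ?D r"
        show "d \<in> {..<c}"
        proof (rule ccontr)
          assume "d \<notin> {..<c}"
          then have "c < d" using d nc by (cases "c = d") auto
          then have "s (k, r, c) < s (k, r, d)" using rowless[of k r d c] d by simp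
          then show False using d nc y by auto
        qed
      qed
      then have "card (?D r) \<le> c" using card_mono[of "{..<c}" "?D r"] by simp
      then show False using card by simp
    qed
    moreover have "s (k, r, c) \<noteq> s (k, Suc r, c)" using mem[OF x] mem[OF y] by auto
    ultimately show "s (k, r, c) < s (k, Suc r, c)" by auto
  qed
  have "initial_kind lam s" unfolding initial_kind_def
  proof (intro allI)
    fix k
    have "s ` {x \<in> cells lam. fst x = k} = {p \<in> {1..n}. blk_of (cuts lam) p = k}"
    proof (intro equalityI subsetI)
      fix p assume "p \<in> s ` {x \<in> cells lam. fst x = k}"
      then obtain r c where x: "(k, r, c) \<in> cells lam" "p = s (k, r, c)" by auto
      then have "f p = 3 * (k * n + r)" "p \<in> {1..n}" using mem[OF x(1)] by auto
      then show "p \<in> {p \<in> {1..n}. blk_of (cuts lam) p = k}" using blk[of p] letter_div[OF cell_row[OF x(1)]] by simp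
    next
      fix p assume p: "p \<in> {p \<in> {1..n}. blk_of (cuts lam) p = k}"
      then obtain k' r c where x: "(k', r, c) \<in> cells lam" "p = s (k', r, c)" using tableau_cellE[OF mt, of p] by auto
      then have "f p = 3 * (k' * n + r)" using mem[OF x(1)] by auto
      then have "k' = k" using blk[of p] letter_div[OF cell_row[OF x(1)]] p by simp
      then show "p \<in> s ` {x \<in> cells lam. fst x = k}" using x by force
    qed
    moreover have "tlam lam ` {x \<in> cells lam. fst x = k} = {p \<in> {1..n}. blk_of (cuts lam) p = k}"
    proof (intro equalityI subsetI)
      fix p assume "p \<in> tlam lam ` {x \<in> cells lam. fst x = k}"
      then obtain r c where x: "(k, r, c) \<in> cells lam" "p = tlam lam (k, r, c)" by auto
      then show "p \<in> {p \<in> {1..n}. blk_of (cuts lam) p = k}"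
        using blk_tlam[OF x(1)] wd_cell(2)[OF tlam_multitableau x(1)] by simp
    next
      fix p assume p: "p \<in> {p \<in> {1..n}. blk_of (cuts lam) p = k}"
      then obtain k' r c where x: "(k', r, c) \<in> cells lam" "p = tlam lam (k', r, c)" using tlam_cellE[of p] by auto
      then show "p \<in> tlam lam ` {x \<in> cells lam. fst x = k}" using p blk_tlam[OF x(1)] by force
    qed
    ultimately show "s ` {x \<in> cells lam. fst x = k} = tlam lam ` {x \<in> cells lam. fst x = k}" by simp
  qed
  then have "s \<in> Tset lam" using mt std by (simp add: Tset_def)
  then show ?thesis using wf by blast
qed

lemma Ilam_lsp: "Ilam lam \<in> linear_set_partitions n" and Ilam_ties: "ties n (Ilam lam) = {1..<n} - cuts lam"
proof -
  have I: "Ilam lam = (\<lambda>k. {off lam k + 1..off lam (Suc k)}) ` {..<length lam}" by (simp add: Ilam_def off_def)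
  have off0: "off lam 0 = 0" by (simp add: off_def)
  have offn: "off lam (length lam) = n" by (simp add: off_length msize)
  have ex: "\<exists>k<length lam. off lam k < p \<and> p \<le> off lam (Suc k)" if p: "p \<in> {1..n}" for p
  proof -
    obtain k r c where x: "(k, r, c) \<in> cells lam" "p = tlam lam (k, r, c)" using tlam_cellE[OF p] by blast
    then show ?thesis using tlam_gt_off[OF x(1)] tlam_comp_le[OF x(1)] by (auto simp: cells_def)
  qed
  have uniq: "k = k'" if "off lam k < p" "p \<le> off lam (Suc k)" "off lam k' < p" "p \<le> off lam (Suc k')" for k k' p
    using that off_mono[of "Suc k" k' lam] off_mono[of "Suc k'" k lam] by (cases k k' rule: linorder_cases) auto
  show "Ilam lam \<in> linear_set_partitions n"
    unfolding linear_set_partitions_def partition_on_def disjoint_def I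
  proof (intro CollectI conjI ballI impI)
    show "\<Union> ((\<lambda>k. {off lam k + 1..off lam (Suc k)}) ` {..<length lam}) = {1..n}"
    proof (intro equalityI subsetI)
      fix p assume "p \<in> \<Union> ((\<lambda>k. {off lam k + 1..off lam (Suc k)}) ` {..<length lam})"
      then obtain k where "k < length lam" "off lam k < p" "p \<le> off lam (Suc k)" by auto
      then show "p \<in> {1..n}" using off_mono[of "Suc k" "length lam" lam] offn by auto
    next
      fix p assume "p \<in> {1..n}"
      from ex[OF this] show "p \<in> \<Union> ((\<lambda>k. {off lam k + 1..off lam (Suc k)}) ` {..<length lam})" by force
    qed
    show "{} \<notin> (\<lambda>k. {off lam k + 1..off lam (Suc k)}) ` {..<length lam}"
    proof
      assume "{} \<in> (\<lambda>k. {off lam k + 1..off lam (Suc k)}) ` {..<length lam}"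
      then obtain k where "k < length lam" "{} = {off lam k + 1..off lam (Suc k)}" by auto
      then show False using off_strict[of k "Suc k"] by auto
    qed
    fix B B' assume "B \<in> (\<lambda>k. {off lam k + 1..off lam (Suc k)}) ` {..<length lam}"
      "B' \<in> (\<lambda>k. {off lam k + 1..off lam (Suc k)}) ` {..<length lam}" "B \<noteq> B'"
    then obtain k k' where kk: "B = {off lam k + 1..off lam (Suc k)}" "B' = {off lam k' + 1..off lam (Suc k')}" "k \<noteq> k'"
      by blast
    show "B \<inter> B' = {}"
    proof (rule ccontr)
      assume "B \<inter> B' \<noteq> {}"
      then obtain p where "p \<in> B" "p \<in> B'" by blast
      then show False using uniq[of k p k'] kk by simp
    qed
  qed blast
  show "ties n (Ilam lam) = {1..<n} - cuts lam"
  proof (intro equalityI subsetI)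
    fix i assume "i \<in> ties n (Ilam lam)"
    then obtain k where k: "i \<in> {1..<n}" "k < length lam" "off lam k < i" "Suc i \<le> off lam (Suc k)"
      unfolding ties_def I by auto
    have "i \<notin> cuts lam"
    proof
      assume "i \<in> cuts lam"
      then obtain a where "i = off lam a" by (auto simp: cuts_def)
      then show False using k off_mono[of a k lam] off_mono[of "Suc k" a lam] by (cases "a \<le> k") auto
    qed
    then show "i \<in> {1..<n} - cuts lam" using k by simp
  next
    fix i assume i: "i \<in> {1..<n} - cuts lam"
    then obtain k where k: "k < length lam" "off lam k < i" "i \<le> off lam (Suc k)" using ex[of i] by auto
    have "i \<noteq> off lam (Suc k)"
    proof
      assume e: "i = off lam (Suc k)"
      then have "Suc k \<noteq> length lam" using i offn by auto
      then have "i \<in> cuts lam" using e k by (auto simp: cuts_def)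
      then show False using i by simp
    qed
    then have "i \<in> {off lam k + 1..off lam (Suc k)}" "Suc i \<in> {off lam k + 1..off lam (Suc k)}" using k by auto
    then show "i \<in> ties n (Ilam lam)" unfolding ties_def I using i k(1) by blast
  qed
qed

end

section \<open>From valid words back to multipartitions\<close>

lemma letter_eq:
  fixes n :: nat assumes "r < n" "s < n" "x = 3 * (k * n + r)" "x = 3 * (l * n + s)" shows "k = l \<and> r = s"
proof -
  have "3 * (k * n + r) = 3 * (l * n + s)" using assms(3,4) by metis
  then have "k * n + r = l * n + s" unfolding mult_cancel1 by simp
  then show ?thesis by (rule block_letter_eq[OF assms(1,2)])
qed

lemma blk_mono: assumes "finite C" "p \<le> q" shows "blk_of C p \<le> blk_of C q"
  unfolding blk_of_def by (rule card_mono) (use assms in auto)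

lemma blk_Suc_notin: "i \<notin> C \<Longrightarrow> blk_of C (Suc i) = blk_of C i"
  unfolding blk_of_def by (rule arg_cong[where f = card]) (auto simp: less_Suc_eq)

lemma blk_Suc_le: "1 \<le> i \<Longrightarrow> blk_of C (Suc i) \<le> Suc (blk_of C i)"
  by (cases "i \<in> C") (simp_all add: blk_Suc_cut blk_Suc_notin)

lemma blk_1 [simp]: "blk_of C (Suc 0) = 0"
proof -
  have "{i \<in> C. 1 \<le> i \<and> i < Suc 0} = {}" by auto
  then show ?thesis by (simp only: blk_of_def card.empty)
qed

lemma blk_le: "finite C \<Longrightarrow> blk_of C p \<le> card C"
  unfolding blk_of_def by (rule card_mono) auto

lemma blk_n: "C \<subseteq> {1..<n} \<Longrightarrow> blk_of C n = card C"
  unfolding blk_of_def by (rule arg_cong[where f = card]) auto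

lemma blk_surj:
  assumes C: "C \<subseteq> {1..<n}" and n: "1 \<le> n" and k: "k \<le> card C"
  shows "\<exists>p\<in>{1..n}. blk_of C p = k"
proof -
  let ?P = "\<lambda>p. 1 \<le> p \<and> k \<le> blk_of C p"
  define p where "p = (LEAST p. ?P p)"
  have Pn: "?P n" using n k blk_n[OF C] by simp
  have Pp: "?P p" unfolding p_def by (rule LeastI) (rule Pn)
  have pn: "p \<le> n" unfolding p_def by (rule Least_le) (rule Pn)
  have "blk_of C p \<le> k"
  proof (cases "p = 1")
    case False
    then obtain m where m: "p = Suc m" "1 \<le> m" using Pp by (cases p) auto
    then have "\<not> ?P m" using not_less_Least[of m ?P] unfolding p_def[symmetric] by simp
    then show ?thesis using blk_Suc_le[OF m(2), of C] m by simp
  qed simp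
  then show ?thesis using Pp pn by (intro bexI[of _ p]) auto
qed

lemma card_fibres: "finite A \<Longrightarrow> g ` A \<subseteq> {..<m} \<Longrightarrow> card A = (\<Sum>r<m. card {p \<in> A. g p = r})" for m :: nat
  using sum.group[of A "{..<m}" g "\<lambda>_. 1 :: nat"] by simp

text \<open>The multiplicities of the letters of a component are its row lengths. They decrease
  weakly because the lattice condition for \<open>f\<close> holds on the full word, and no component
  is empty because every block index up to \<open>card C\<close> occurs.\<close>

lemma exists_multipartition:
  assumes n: "1 \<le> n" and C: "C \<subseteq> {1..<n}" and v: "valid_word n C f0"
    and f: "f \<in> orb n f0" "lattice_word n f"
  shows "\<exists>lam\<in>multipartitions n. cuts lam = C \<and> wd n lam (tlam lam) = f0"
proof -
  define K where "K = Suc (card C)"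
  define row where "row k r = cnt n f0 (3 * (k * n + r))" for k r
  \<comment> \<open>Multiplicities decrease, so cutting at the first zero drops only empty
    rows.\<close>
  define lam where "lam = map (\<lambda>k. takeWhile ((<) 0) (map (row k) [0..<n])) [0..<K]"
  have finC: "finite C" using C finite_subset by blast
  have f0p: "\<exists>r<n. f0 p = 3 * (blk_of C p * n + r)" if "p \<in> {1..n}" for p
    using v that by (auto simp: valid_word_def)
  have step: "row k (Suc r) \<le> row k r" if "Suc r < n" for k r
  proof -
    have "adj_letter n (3 * (k * n + r))" using that by (auto simp: adj_letter_def)
    then have "cnt n f (3 * (k * n + r) + 3) \<le> cnt n f (3 * (k * n + r))"
      using f(2) unfolding lattice_word_def cnt_def by blast
    moreover have "3 * (k * n + r) + 3 = 3 * (k * n + Suc r)" by simp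
    ultimately show ?thesis unfolding row_def by (metis orb_cnt[OF f(1)])
  qed
  have anti: "row k r' \<le> row k r" if "r \<le> r'" "r' < n" for k r r'
    using that
  proof (induction r' rule: dec_induct)
    case (step m)
    then show ?case using \<open>\<And>k r. Suc r < n \<Longrightarrow> row k (Suc r) \<le> row k r\<close>[of m k] by simp
  qed simp
  have len: "length lam = K" by (simp add: lam_def)
  have lamk: "lam ! k = takeWhile ((<) 0) (map (row k) [0..<n])" if "k < K" for k
    using that by (simp add: lam_def)
  have lenk: "length (lam ! k) \<le> n" if "k < K" for k
    using length_takeWhile_le[of "(<) 0" "map (row k) [0..<n]"] lamk[OF that] by simp
  have lamkr: "lam ! k ! r = row k r" "0 < row k r" if "k < K" "r < length (lam ! k)" for k r
  proof -
    have rn: "r < n" using lenk[OF that(1)] that(2) by simp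
    show eq: "lam ! k ! r = row k r" using takeWhile_nth[of r "(<) 0" "map (row k) [0..<n]"] that lamk rn by simp
    have "lam ! k ! r \<in> set (takeWhile ((<) 0) (map (row k) [0..<n]))" using that lamk nth_mem by metis
    then show "0 < row k r" using eq set_takeWhileD by metis
  qed
  have zero: "row k r = 0" if "k < K" "length (lam ! k) \<le> r" "r < n" for k r
  proof -
    let ?l = "length (lam ! k)"
    have "?l < length (map (row k) [0..<n])" using that by simp
    then have "\<not> 0 < map (row k) [0..<n] ! ?l"
      using nth_length_takeWhile[of "(<) 0" "map (row k) [0..<n]"] lamk[OF that(1)] by simp
    then have "row k ?l = 0" using that by simp
    then show ?thesis using anti[OF that(2,3), of k] by simp
  qed
  have part: "part_of (comp_of lam k) r = row k r" if "r < n" for k r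
  proof (cases "k < K")
    case True
    then show ?thesis using lamkr[OF True, of r] zero[OF True _ that] by (simp add: part_of_def comp_of_def len)
  next
    case False
    have "f0 p \<noteq> 3 * (k * n + r)" if p: "p \<in> {1..n}" for p
    proof
      assume e: "f0 p = 3 * (k * n + r)"
      obtain s where s: "s < n" "f0 p = 3 * (blk_of C p * n + s)" using f0p[OF p] by blast
      then have "blk_of C p = k" using letter_eq[OF s(1) \<open>r < n\<close> s(2) e] by simp
      then show False using blk_le[OF finC, of p] False by (simp add: K_def)
    qed
    then have "row k r = 0" unfolding row_def cnt_0 by blast
    then show ?thesis using False by (simp add: part_of_def comp_of_def len)
  qed
  have rowsum: "card {p \<in> {1..n}. blk_of C p = k} = (\<Sum>r<n. row k r)" for k
  proof -
    let ?A = "{p \<in> {1..n}. blk_of C p = k}" and ?g = "\<lambda>p. (f0 p div 3) mod n"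
    have g: "f0 p = 3 * (k * n + ?g p) \<and> ?g p < n" if "p \<in> ?A" for p
    proof -
      have "p \<in> {1..n}" "blk_of C p = k" using that by simp_all
      then obtain s where s: "s < n" "f0 p = 3 * (k * n + s)" using f0p by blast
      have "f0 p div 3 = k * n + s" unfolding s(2) by simp
      then have "?g p = s" using s(1) by simp
      then show ?thesis using s by blast
    qed
    have "card ?A = (\<Sum>r<n. card {p \<in> ?A. ?g p = r})"
      by (rule card_fibres) (use g in auto)
    also have "\<dots> = (\<Sum>r<n. row k r)"
    proof (rule sum.cong[OF refl])
      fix r assume r: "r \<in> {..<n}"
      have "{p \<in> ?A. ?g p = r} = {p \<in> {1..n}. f0 p = 3 * (k * n + r)}"
      proof (intro equalityI subsetI)
        fix p assume "p \<in> {p \<in> ?A. ?g p = r}"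
        then have "p \<in> ?A" "?g p = r" by blast+
        then have "f0 p = 3 * (k * n + r)" "p \<in> {1..n}" using g[of p] by blast+
        then show "p \<in> {p \<in> {1..n}. f0 p = 3 * (k * n + r)}" by blast
      next
        fix p assume p: "p \<in> {p \<in> {1..n}. f0 p = 3 * (k * n + r)}"
        then have p': "p \<in> {1..n}" "f0 p = 3 * (k * n + r)" by blast+
        obtain s where s: "s < n" "f0 p = 3 * (blk_of C p * n + s)" using f0p[OF p'(1)] by blast
        have "blk_of C p = k" using letter_eq[OF s(1) _ s(2) p'(2)] r by simp
        moreover have "f0 p div 3 = k * n + r" unfolding p'(2) by simp
        ultimately show "p \<in> {p \<in> ?A. ?g p = r}" using p'(1) r by simp
      qed
      then show "card {p \<in> ?A. ?g p = r} = row k r" by (simp add: row_def cnt_def)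
    qed
    finally show ?thesis .
  qed
  have sumk: "sum_list (lam ! k) = card {p \<in> {1..n}. blk_of C p = k}" if "k < K" for k
  proof -
    have "sum_list (lam ! k) = (\<Sum>r<length (lam ! k). row k r)"
      using lamkr[OF that] by (simp add: sum_list_lessThan)
    also have "\<dots> = (\<Sum>r<n. row k r)" by (rule sum.mono_neutral_left) (use lenk[OF that] zero[OF that] in auto)
    finally show ?thesis using rowsum by simp
  qed
  have offk: "off lam k = card {p \<in> {1..n}. blk_of C p < k}" if "k \<le> K" for k
    using that
  proof (induction k)
    case (Suc k)
    have "{p \<in> {1..n}. blk_of C p < Suc k} = {p \<in> {1..n}. blk_of C p < k} \<union> {p \<in> {1..n}. blk_of C p = k}" by auto
    then have "card {p \<in> {1..n}. blk_of C p < Suc k} = card {p \<in> {1..n}. blk_of C p < k} + card {p \<in> {1..n}. blk_of C p = k}"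
      by (simp only:) (rule card_Un_disjoint, auto)
    then show ?case using Suc sumk[of k] by (simp add: off_Suc)
  qed (simp add: off_def)
  \<comment> \<open>The blocks up to the one ending at the cut \<open>i\<close> fill precisely the
    positions up to \<open>i\<close>; this identifies the offsets of \<open>lam\<close> with the
    cuts.\<close>
  have initseg: "{p \<in> {1..n}. blk_of C p < Suc (blk_of C i)} = {1..i}" if i: "i \<in> C" for i
  proof -
    have i1: "1 \<le> i" "i < n" using C i by auto
    show ?thesis
    proof (intro equalityI subsetI)
      fix p assume p: "p \<in> {p \<in> {1..n}. blk_of C p < Suc (blk_of C i)}"
      have "p \<le> i"
      proof (rule ccontr)
        assume "\<not> p \<le> i"
        then have "blk_of C (Suc i) \<le> blk_of C p" using blk_mono[OF finC] by simp
        then show False using p blk_Suc_cut[OF i i1(1)] by simp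
      qed
      then show "p \<in> {1..i}" using p by simp
    next
      fix p assume "p \<in> {1..i}"
      then show "p \<in> {p \<in> {1..n}. blk_of C p < Suc (blk_of C i)}" using blk_mono[OF finC, of p i] i1 by simp
    qed
  qed
  have size: "msize lam = n"
  proof -
    have "msize lam = card {p \<in> {1..n}. blk_of C p < K}" using offk[of K] by (simp add: off_length[symmetric] len)
    also have "{p \<in> {1..n}. blk_of C p < K} = {1..n}" using blk_le[OF finC] by (auto simp: K_def less_Suc_eq_le)
    finally show ?thesis by simp
  qed
  have "is_partition p \<and> p \<noteq> []" if "p \<in> set lam" for p
  proof -
    obtain k where k: "k < K" "p = lam ! k" using \<open>p \<in> set lam\<close> len unfolding in_set_conv_nth by metis
    have "sorted_wrt (\<ge>) p" unfolding k(2) sorted_wrt_iff_nth_less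
      using lamkr[OF k(1)] anti lenk[OF k(1)] by (auto simp: less_imp_le)
    moreover have "0 \<notin> set p" unfolding k(2) lamk[OF k(1)] using set_takeWhileD by fastforce
    moreover have "p \<noteq> []"
    proof
      assume "p = []"
      then have "sum_list (lam ! k) = 0" using k by simp
      moreover obtain q where "q \<in> {1..n}" "blk_of C q = k" using blk_surj[OF C n, of k] k by (auto simp: K_def)
      ultimately show False using sumk[OF k(1)] by auto
    qed
    ultimately show ?thesis by (simp add: is_partition_def)
  qed
  then have mp: "lam \<in> multipartitions n" using size by (simp add: multipartitions_def)
  interpret multipart n lam by unfold_locales (rule mp)
  have "cuts lam = C"
  proof (intro equalityI subsetI)
    fix i assume "i \<in> cuts lam"
    then obtain k where k: "1 \<le> k" "k < K" "i = off lam k" by (auto simp: cuts_def len)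
    then have ic: "i = card {p \<in> {1..n}. blk_of C p < k}" using offk by simp
    have i: "1 \<le> i" "i < n" using cuts_sub \<open>i \<in> cuts lam\<close> by auto
    show "i \<in> C"
    proof (rule ccontr)
      assume nC: "i \<notin> C"
      have "blk_of C i < k \<longleftrightarrow> blk_of C (Suc i) < k" using blk_Suc_notin[OF nC] by simp
      moreover have "blk_of C (Suc i) \<ge> k"
      proof (rule ccontr)
        assume "\<not> blk_of C (Suc i) \<ge> k"
        then have "blk_of C x < k" if "x \<le> Suc i" for x using blk_mono[OF finC that] by simp
        then have "{1..Suc i} \<subseteq> {p \<in> {1..n}. blk_of C p < k}" using i by auto
        then have "card {1..Suc i} \<le> card {p \<in> {1..n}. blk_of C p < k}" by (intro card_mono) auto
        then have "card {1..Suc i} \<le> i" using ic by simp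
        then show False by simp
      qed
      moreover have "blk_of C i < k"
      proof (rule ccontr)
        assume "\<not> blk_of C i < k"
        then have "\<not> blk_of C x < k" if "i \<le> x" for x using blk_mono[OF finC that] by simp
        then have "{p \<in> {1..n}. blk_of C p < k} \<subseteq> {1..<i}" by (auto simp: not_le[symmetric])
        then have "card {p \<in> {1..n}. blk_of C p < k} \<le> card {1..<i}" by (intro card_mono) auto
        then have "i \<le> i - 1" unfolding ic[symmetric] by simp
        then show False using i(1) by linarith
      qed
      ultimately show False by simp
    qed
  next
    fix i assume i: "i \<in> C"
    let ?k = "Suc (blk_of C i)"
    have i1: "1 \<le> i" using C i by auto
    have k: "?k < K" using blk_le[OF finC, of "Suc i"] blk_Suc_cut[OF i i1] by (simp add: K_def)
    have "off lam ?k = i" using offk[of ?k] k initseg[OF i] by simp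
    then show "i \<in> cuts lam" using k by (auto simp: cuts_def len intro!: image_eqI[of _ _ ?k])
  qed
  moreover have "wd n lam (tlam lam) = f0"
  proof (rule orb_srt_unique)
    show "srt n (wd n lam (tlam lam))" "srt n f0" using f0_valid v by (auto simp: valid_word_def)
    show "wd n lam (tlam lam) \<in> orb n f0"
    proof (rule orbI_cnt)
      show "wd n lam (tlam lam) p = f0 p" if "p \<notin> {1..n}" for p
        using that v wd_outside[OF that, of "tlam lam"] unfolding valid_word_def by metis
      fix x
      show "cnt n (wd n lam (tlam lam)) x = cnt n f0 x"
      proof (cases "\<exists>k r. r < n \<and> x = 3 * (k * n + r)")
        case True
        then obtain k r where "r < n" "x = 3 * (k * n + r)" by blast
        then show ?thesis using cnt_wd[OF tlam_multitableau] part by (simp add: row_def)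
      next
        case False
        have "wd n lam (tlam lam) p \<noteq> x" "f0 p \<noteq> x" if p: "p \<in> {1..n}" for p
          using f0p[OF p] f0_valid p False unfolding valid_word_def by metis+
        then have "cnt n (wd n lam (tlam lam)) x = 0" "cnt n f0 x = 0" unfolding cnt_0 by blast+
        then show ?thesis by simp
      qed
    qed
  qed
  ultimately show ?thesis using mp by blast
qed

context multipart
begin

lemma card_below_Suc:
  "card {p \<in> {1..n}. wd n lam (tlam lam) p < 3 * Suc x}
    = card {p \<in> {1..n}. wd n lam (tlam lam) p < 3 * x} + cnt n (wd n lam (tlam lam)) (3 * x)"
proof -
  have m3: "\<exists>m. wd n lam (tlam lam) p = 3 * m" if "p \<in> {1..n}" for p
    using f0_valid that unfolding valid_word_def by blast
  have "{p \<in> {1..n}. wd n lam (tlam lam) p < 3 * Suc x}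
    = {p \<in> {1..n}. wd n lam (tlam lam) p < 3 * x} \<union> {p \<in> {1..n}. wd n lam (tlam lam) p = 3 * x}"
  proof (intro equalityI subsetI)
    fix p assume p: "p \<in> {p \<in> {1..n}. wd n lam (tlam lam) p < 3 * Suc x}"
    then obtain m where "wd n lam (tlam lam) p = 3 * m" using m3 by blast
    then show "p \<in> {p \<in> {1..n}. wd n lam (tlam lam) p < 3 * x} \<union> {p \<in> {1..n}. wd n lam (tlam lam) p = 3 * x}"
      using p by auto
  qed auto
  then show ?thesis unfolding cnt_def by (simp only:) (rule card_Un_disjoint, auto)
qed

lemma card_below_row:
  "j \<le> n \<Longrightarrow> card {p \<in> {1..n}. wd n lam (tlam lam) p < 3 * (k * n + j)}
    = card {p \<in> {1..n}. wd n lam (tlam lam) p < 3 * (k * n)} + (\<Sum>b<j. part_of (comp_of lam k) b)"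
proof (induction j)
  case (Suc j)
  then show ?case using card_below_Suc[of "k * n + j"] cnt_wd[OF tlam_multitableau, of j k] by simp
qed simp

lemma part_of_ge: "n \<le> b \<Longrightarrow> part_of (comp_of lam k) b = 0"
  using length_row[of k] by (auto simp: part_of_def comp_of_def)

lemma sum_part_of: "(\<Sum>b<n. part_of (comp_of lam k) b) = sum_list (comp_of lam k)"
proof -
  have l: "length (comp_of lam k) \<le> n" using length_row[of k] by (simp add: comp_of_def)
  have "sum_list (comp_of lam k) = (\<Sum>b<length (comp_of lam k). part_of (comp_of lam k) b)"
    by (simp add: sum_list_lessThan part_of_def)
  also have "\<dots> = (\<Sum>b<n. part_of (comp_of lam k) b)"
    by (rule sum.mono_neutral_left) (use l in \<open>auto simp: part_of_def\<close>)
  finally show ?thesis by simp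
qed

lemma card_below_comp:
  "card {p \<in> {1..n}. wd n lam (tlam lam) p < 3 * (k * n)} = (\<Sum>a<k. sum_list (comp_of lam a))"
proof (induction k)
  case (Suc k)
  have "Suc k * n = k * n + n" by simp
  then show ?case using card_below_row[of n k] Suc sum_part_of[of k] by (simp only: lessThan_Suc sum.insert)  simp
qed simp

text \<open>In the sorted word, the partial sums of row lengths count the positions with small
  letters. The cap \<open>min j n\<close> prevents the bound from running into the letters of the
  next component, and rows from \<open>n\<close> on are empty.\<close>

lemma dom_sum_card: "dom_sum lam k j = card {p \<in> {1..n}. wd n lam (tlam lam) p < 3 * (k * n + min j n)}"
proof -
  have "(\<Sum>b<j. part_of (comp_of lam k) b) = (\<Sum>b<min j n. part_of (comp_of lam k) b)"
    by (rule sum.mono_neutral_right) (auto simp: part_of_ge min_def)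
  then show ?thesis unfolding dom_sum_def card_below_row[OF min.cobounded2] card_below_comp by simp
qed

lemma finite_Tset: "finite (Tset lam)"
proof (rule finite_imageD[OF _ wd_inj])
  have "wd n lam ` Tset lam \<subseteq> orb n (wd n lam (tlam lam))" using wd_orb by (auto simp: Tset_def)
  then show "finite (wd n lam ` Tset lam)" using finite_orb finite_subset by blast
qed

end

lemma dominates_word:
  assumes "lam \<in> multipartitions n" "mu \<in> multipartitions n"
    and "\<And>p. wd n mu (tlam mu) p \<le> wd n lam (tlam lam) p"
  shows "dominates mu lam"
proof -
  interpret l: multipart n lam by unfold_locales fact
  interpret m: multipart n mu by unfold_locales fact
  show ?thesis unfolding dominates_def l.dom_sum_card m.dom_sum_card
    using assms(3) by (intro allI card_mono) (auto intro: le_less_trans)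
qed

lemma part_of_inj:
  assumes "0 \<notin> set p" "0 \<notin> set p'" "\<And>j. part_of p j = part_of p' j" shows "p = p'"
proof -
  have nz: "part_of x j = 0 \<longleftrightarrow> length x \<le> j" if "0 \<notin> set x" for x j
  proof -
    have "x ! j \<noteq> 0" if "j < length x" using nth_mem[OF that] \<open>0 \<notin> set x\<close> by metis
    then show ?thesis by (auto simp: part_of_def)
  qed
  have "length p \<le> j \<longleftrightarrow> length p' \<le> j" for j using nz assms by metis
  then have l: "length p = length p'" by (metis le_antisym order.refl)
  moreover have "p ! j = p' ! j" if "j < length p" for j using assms(3)[of j] that l by (simp add: part_of_def)
  ultimately show ?thesis by (rule nth_equalityI)
qed

text \<open>Equal partial sums give equal row lengths, and since all parts are positive and all
  components nonempty the lengths of the lists are determined as well.\<close>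

lemma dominates_antisym:
  assumes "x \<in> multipartitions n" "y \<in> multipartitions n" "dominates x y" "dominates y x"
  shows "x = y"
proof -
  have d: "dom_sum x k j = dom_sum y k j" for k j using assms(3,4) unfolding dominates_def by (metis le_antisym)
  have s0: "dom_sum z k 0 = (\<Sum>a<k. sum_list (comp_of z a))" for z k by (simp add: dom_sum_def)
  have parts: "part_of (comp_of x k) j = part_of (comp_of y k) j" for k j
    using d[of k j] d[of k "Suc j"] by (simp add: dom_sum_def)
  have nz: "0 \<notin> set (comp_of z k)" "comp_of z k = [] \<longleftrightarrow> length z \<le> k" if "z \<in> multipartitions n" for z k
    using that nth_mem[of k z] by (auto simp: multipartitions_def is_partition_def comp_of_def)
  have c: "comp_of x k = comp_of y k" for k using part_of_inj[OF nz(1)[OF assms(1)] nz(1)[OF assms(2)] parts] .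
  then have "length x \<le> k \<longleftrightarrow> length y \<le> k" for k using nz(2)[OF assms(1)] nz(2)[OF assms(2)] by metis
  then have l: "length x = length y" by (metis le_antisym order.refl)
  moreover have "x ! k = y ! k" if "k < length x" for k using c[of k] that l by (simp add: comp_of_def)
  ultimately show ?thesis by (rule nth_equalityI)
qed

lemma dominates_trans: "dominates x y \<Longrightarrow> dominates y z \<Longrightarrow> dominates x z"
  unfolding dominates_def by (meson le_trans)

lemma length_le_sum_list: "0 \<notin> set xs \<Longrightarrow> length xs \<le> sum_list (xs :: nat list)"
  by (induction xs) (auto simp: Suc_le_eq)

lemma finite_multipartitions: "finite (multipartitions n)"
proof -
  let ?P = "{p. set p \<subseteq> {..n} \<and> length p \<le> n}"
  have "multipartitions n \<subseteq> {lam. set lam \<subseteq> ?P \<and> length lam \<le> n}"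
  proof
    fix lam assume lam: "lam \<in> multipartitions n"
    interpret multipart n lam by unfold_locales (rule lam)
    have le: "sum_list p \<le> n" if "p \<in> set lam" for p
      using that lam member_le_sum_list[of "sum_list p" "map sum_list lam"]
      by (auto simp: multipartitions_def msize_def)
    have "p \<in> ?P" if p: "p \<in> set lam" for p
    proof -
      have "0 \<notin> set p" using lam p by (auto simp: multipartitions_def is_partition_def)
      then have "length p \<le> n" using length_le_sum_list le[OF p] le_trans by blast
      moreover have "x \<le> n" if "x \<in> set p" for x using member_le_sum_list[OF that] le[OF p] by simp
      ultimately show ?thesis by auto
    qed
    moreover have "length lam \<le> n"
    proof -
      have "0 \<notin> set (map sum_list lam)"
      proof
        assume "0 \<in> set (map sum_list lam)"
        then obtain k where "k < length lam" "sum_list (lam ! k) = 0" by (metis in_set_conv_nth length_map nth_map)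
        then show False using comp_size[of k] by (metis less_irrefl)
      qed
      then show ?thesis using length_le_sum_list[of "map sum_list lam"] lam by (simp add: multipartitions_def msize_def)
    qed
    ultimately show "lam \<in> {lam. set lam \<subseteq> ?P \<and> length lam \<le> n}" by auto
  qed
  moreover have "finite ?P" by (rule finite_lists_length_le) simp
  then have "finite {lam. set lam \<subseteq> ?P \<and> length lam \<le> n}" by (rule finite_lists_length_le)
  ultimately show ?thesis by (rule finite_subset)
qed

section \<open>Counting pairs of standard tableaux\<close>

text \<open>Pairs of lattice words of the same content are counted by \<open>m!\<close>, by the commutation relation
  \<open>DU - UD = 1\<close> of the up and down operators on Young's lattice. Partitions are functions on row indices.\<close>

definition par :: "(nat \<Rightarrow> nat) \<Rightarrow> bool" where "par c \<longleftrightarrow> (\<forall>r. c (Suc r) \<le> c r)"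

definition ups :: "(nat \<Rightarrow> nat) \<Rightarrow> nat set" where "ups c = {r. r = 0 \<or> c r < c (r - 1)}"

definition dns :: "(nat \<Rightarrow> nat) \<Rightarrow> nat set" where "dns c = {r. c (Suc r) < c r}"

abbreviation inc :: "(nat \<Rightarrow> nat) \<Rightarrow> nat \<Rightarrow> nat \<Rightarrow> nat" where "inc c r \<equiv> c(r := Suc (c r))"

abbreviation dec :: "(nat \<Rightarrow> nat) \<Rightarrow> nat \<Rightarrow> nat \<Rightarrow> nat" where "dec c r \<equiv> c(r := c r - 1)"

definition parts :: "nat \<Rightarrow> (nat \<Rightarrow> nat) set" where
  "parts m = {c. par c \<and> (\<forall>r\<ge>m. c r = 0) \<and> (\<Sum>r<m. c r) = m}"

inductive lat :: "nat list \<Rightarrow> bool" where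
  Nil: "lat []"
| snoc: "lat w \<Longrightarrow> r = 0 \<or> count_list w r < count_list w (r - 1) \<Longrightarrow> lat (w @ [r])"

lemma lat_snocD: "lat (w @ [r]) \<Longrightarrow> lat w \<and> (r = 0 \<or> count_list w r < count_list w (r - 1))"
  by (erule lat.cases) auto

definition lats :: "nat \<Rightarrow> (nat \<Rightarrow> nat) \<Rightarrow> nat list set" where
  "lats m c = {w. lat w \<and> length w = m \<and> count_list w = c}"

lemma par_inc: "par c \<Longrightarrow> r \<in> ups c \<Longrightarrow> par (inc c r)"
  unfolding par_def ups_def
proof (intro allI)
  fix s assume a: "\<forall>r. c (Suc r) \<le> c r" "r \<in> {r. r = 0 \<or> c r < c (r - 1)}"
  show "inc c r (Suc s) \<le> inc c r s" using a by (cases "r = Suc s"; cases "r = s") (auto simp: le_SucI)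
qed

lemma par_dec: "par c \<Longrightarrow> s \<in> dns c \<Longrightarrow> par (dec c s)"
  unfolding par_def dns_def
proof (intro allI)
  fix r assume a: "\<forall>r. c (Suc r) \<le> c r" "s \<in> {r. c (Suc r) < c r}"
  show "dec c s (Suc r) \<le> dec c s r" using a by (cases "s = Suc r"; cases "s = r") (auto simp: le_diff_conv intro: le_trans)
qed

lemma par_mono: "par c \<Longrightarrow> r \<le> s \<Longrightarrow> c s \<le> c r"
  unfolding par_def by (rule lift_Suc_antimono_le) auto

lemma dec_inc: "dec (inc c r) r = c" and inc_dec: "0 < c s \<Longrightarrow> inc (dec c s) s = c"
  and inc_dec_comm: "r \<noteq> s \<Longrightarrow> dec (inc c r) s = inc (dec c s) r"
  by (auto simp: fun_eq_iff)

lemma dns_inc_self: "par c \<Longrightarrow> r \<in> dns (inc c r)"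
  by (auto simp: dns_def par_def less_Suc_eq_le)

lemma ups_dec_self: "par c \<Longrightarrow> s \<in> dns c \<Longrightarrow> s \<in> ups (dec c s)"
proof -
  assume a: "par c" "s \<in> dns c"
  then have "c s \<le> c (s - 1)" using par_mono[of c "s - 1" s] by simp
  then show ?thesis using a by (cases s) (auto simp: ups_def dns_def)
qed

text \<open>Adding and removing boxes in different rows commute; the defect of commutation sits
  entirely in the case of equal rows.\<close>

lemma up_down_comm: "r \<noteq> s \<Longrightarrow> r \<in> ups c \<and> s \<in> dns (inc c r) \<longleftrightarrow> s \<in> dns c \<and> r \<in> ups (dec c s)"
  unfolding ups_def dns_def by (cases "r = Suc s") auto

text \<open>A box can be added to the first row and just below each removable corner. That there is
  one more addable than removable row is the source of the \<open>1\<close> in the commutation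
  relation.\<close>

lemma ups_eq: "ups c = insert 0 (Suc ` dns c)"
proof (intro equalityI subsetI)
  fix r assume "r \<in> ups c"
  then show "r \<in> insert 0 (Suc ` dns c)" by (cases r) (auto simp: ups_def dns_def)
qed (auto simp: ups_def dns_def)

lemma finite_dns: "\<forall>r\<ge>M. c r = 0 \<Longrightarrow> finite (dns c)"
proof (rule finite_subset[of _ "{..<M}"])
  assume a: "\<forall>r\<ge>M. c r = 0"
  show "dns c \<subseteq> {..<M}"
  proof
    fix r assume "r \<in> dns c"
    then have "c r \<noteq> 0" by (auto simp: dns_def)
    then show "r \<in> {..<M}" using a by (cases "M \<le> r") auto
  qed
qed simp

lemma finite_ups: "finite (dns c) \<Longrightarrow> finite (ups c)" and card_ups: "finite (dns c) \<Longrightarrow> card (ups c) = Suc (card (dns c))"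
  unfolding ups_eq by (simp_all add: card_image)

text \<open>A partition of \<open>m\<close> has at most \<open>m\<close> nonzero rows, so the bound
  \<open>M\<close> used in a construction can be traded for the canonical bound
  \<open>m\<close>.\<close>

lemma parts_I:
  assumes "par c" "\<forall>r\<ge>M. c r = 0" "(\<Sum>r<M. c r) = m" shows "c \<in> parts m"
proof -
  have z: "c r = 0" if "m \<le> r" for r
  proof (rule ccontr)
    assume nz: "c r \<noteq> 0"
    then have rM: "Suc r \<le> M" using assms(2) by (meson not_less_eq_eq)
    have "c i \<ge> 1" if "i < Suc r" for i using par_mono[OF assms(1), of i r] nz that by simp
    then have "(\<Sum>i<Suc r. 1) \<le> (\<Sum>i<Suc r. c i)" by (intro sum_mono) auto
    also have "\<dots> \<le> (\<Sum>i<M. c i)" using rM by (intro sum_mono2) auto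
    finally show False using assms(3) \<open>m \<le> r\<close> by simp
  qed
  have "(\<Sum>r<m. c r) = (\<Sum>r<max m M. c r)" by (rule sum.mono_neutral_left) (use z in auto)
  also have "\<dots> = (\<Sum>r<M. c r)" by (rule sum.mono_neutral_right) (use assms(2) in auto)
  finally show ?thesis using assms z by (simp add: parts_def)
qed

lemma sum_upd: "(r :: nat) < M \<Longrightarrow> (\<Sum>i<M. (c(r := v)) i) + c r = (\<Sum>i<M. c i) + (v :: nat)"
proof -
  assume r: "r < M"
  have "(\<Sum>i\<in>{..<M} - {r}. (c(r := v)) i) = (\<Sum>i\<in>{..<M} - {r}. c i)" by (rule sum.cong) auto
  moreover have "(\<Sum>i<M. (c(r := v)) i) = v + (\<Sum>i\<in>{..<M} - {r}. (c(r := v)) i)"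
    using sum.remove[of "{..<M}" r "c(r := v)"] r unfolding fun_upd_same by (simp only: finite_lessThan lessThan_iff)
  moreover have "(\<Sum>i<M. c i) = c r + (\<Sum>i\<in>{..<M} - {r}. c i)"
    using r by (intro sum.remove) auto
  ultimately show ?thesis by linarith
qed

lemma parts_inc: assumes "c \<in> parts m" "r \<in> ups c" shows "inc c r \<in> parts (Suc m)"
proof -
  have c: "par c" "\<forall>r\<ge>m. c r = 0" "(\<Sum>r<m. c r) = m" using assms(1) by (auto simp: parts_def)
  have r: "r < Suc m"
  proof (rule ccontr)
    assume "\<not> r < Suc m"
    then have "c (r - 1) = 0" "r \<noteq> 0" using c(2) by auto
    then show False using assms(2) by (simp add: ups_def)
  qed
  have "(\<Sum>i<Suc m. inc c r i) = Suc m" using sum_upd[OF r, of c "Suc (c r)"] c by simp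
  then show ?thesis using par_inc[OF c(1) assms(2)] c(2) r by (intro parts_I[where M = "Suc m"]) auto
qed

lemma parts_dec: assumes "c \<in> parts (Suc m)" "s \<in> dns c" shows "dec c s \<in> parts m"
proof -
  have c: "par c" "\<forall>r\<ge>Suc m. c r = 0" "(\<Sum>r<Suc m. c r) = Suc m" using assms(1) by (auto simp: parts_def)
  have s: "0 < c s" using assms(2) by (auto simp: dns_def)
  then have sM: "s < Suc m" using c(2) by (metis not_le less_irrefl)
  have "(\<Sum>i<Suc m. dec c s i) = m" using sum_upd[OF sM, of c "c s - 1"] c(3) s by linarith
  then show ?thesis using par_dec[OF c(1) assms(2)] c(2) by (intro parts_I[where M = "Suc m"]) auto
qed

lemma finite_parts: "finite (parts m)"
proof -
  have "parts m \<subseteq> {c. \<forall>r. (r \<in> {..<m} \<longrightarrow> c r \<in> {..m}) \<and> (r \<notin> {..<m} \<longrightarrow> c r = 0)}"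
  proof
    fix c assume "c \<in> parts m"
    then have c: "\<forall>r\<ge>m. c r = 0" "(\<Sum>r<m. c r) = m" by (auto simp: parts_def)
    have "c r \<le> m" if "r < m" for r using member_le_sum[of r "{..<m}" c] that c(2) by simp
    then show "c \<in> {c. \<forall>r. (r \<in> {..<m} \<longrightarrow> c r \<in> {..m}) \<and> (r \<notin> {..<m} \<longrightarrow> c r = 0)}" using c(1) by auto
  qed
  then show ?thesis by (rule finite_subset) (rule finite_set_of_finite_funs, auto)
qed

lemma count_list_snoc: "count_list (w @ [r]) = inc (count_list w) r"
  by (auto simp: fun_eq_iff)

lemma lat_parts: "lat w \<Longrightarrow> count_list w \<in> parts (length w)"
proof (induction rule: lat.induct)
  case Nil
  then show ?case by (simp add: parts_def par_def)
next
  case (snoc w r)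
  then have "r \<in> ups (count_list w)" by (simp add: ups_def)
  from parts_inc[OF snoc.IH this] show ?case by (simp only: count_list_snoc length_append_singleton)
qed

lemma lats_Suc:
  assumes "par c"
  shows "lats (Suc m) c = (\<Union>s\<in>dns c. (\<lambda>w. w @ [s]) ` lats m (dec c s))"
proof (intro equalityI subsetI)
  fix v assume v: "v \<in> lats (Suc m) c"
  then obtain w s where w: "v = w @ [s]" by (cases v rule: rev_cases) (auto simp: lats_def)
  have lw: "lat w" "length w = m" and c: "c = inc (count_list w) s" using v w lat_snocD count_list_snoc by (auto simp: lats_def)
  have "par (count_list w)" using lat_parts[OF lw(1)] by (simp add: parts_def)
  then have "s \<in> dns c" unfolding c by (rule dns_inc_self)
  moreover have "w \<in> lats m (dec c s)" using lw unfolding c dec_inc by (simp add: lats_def)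
  ultimately show "v \<in> (\<Union>s\<in>dns c. (\<lambda>w. w @ [s]) ` lats m (dec c s))" unfolding w by blast
next
  fix v assume "v \<in> (\<Union>s\<in>dns c. (\<lambda>w. w @ [s]) ` lats m (dec c s))"
  then obtain s w where s: "s \<in> dns c" and w: "w \<in> lats m (dec c s)" "v = w @ [s]" by blast
  have "s \<in> ups (count_list w)" using ups_dec_self[OF assms s] w(1) by (simp add: lats_def)
  then have "lat v" using w by (auto simp: ups_def lats_def intro: lat.snoc)
  moreover have "count_list v = c"
    unfolding w(2) count_list_snoc using w(1) inc_dec[of c s] s by (auto simp: lats_def dns_def)
  ultimately show "v \<in> lats (Suc m) c" using w by (simp add: lats_def)
qed

lemma finite_lats: "finite (lats m c)"
proof (rule finite_subset)
  show "lats m c \<subseteq> {w. set w \<subseteq> {..m} \<and> length w = m}"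
  proof
    fix w assume "w \<in> lats m c"
    then have w: "lat w" "length w = m" by (auto simp: lats_def)
    have "\<forall>r\<ge>m. count_list w r = 0" using lat_parts[OF w(1)] w(2) by (simp add: parts_def)
    then have "set w \<subseteq> {..m}" by (auto simp: count_list_0_iff) (meson linear)
    then show "w \<in> {w. set w \<subseteq> {..m} \<and> length w = m}" using w by simp
  qed
  show "finite {w. set w \<subseteq> {..m} \<and> length w = m}" by (rule finite_lists_length_eq) simp
qed

lemma card_lats_Suc:
  assumes "par c" "finite (dns c)"
  shows "card (lats (Suc m) c) = (\<Sum>s\<in>dns c. card (lats m (dec c s)))"
proof -
  have "card (lats (Suc m) c) = (\<Sum>s\<in>dns c. card ((\<lambda>w. w @ [s]) ` lats m (dec c s)))"
    unfolding lats_Suc[OF assms(1)] using finite_lats assms(2) by (intro card_UN_disjoint) auto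
  also have "\<dots> = (\<Sum>s\<in>dns c. card (lats m (dec c s)))"
    by (intro sum.cong card_image) (auto simp: inj_on_def)
  finally show ?thesis .
qed

text \<open>The commutation relation iterated. If \<open>c\<close> has \<open>m - 1\<close> boxes,
  the shapes covering it carry \<open>m\<close> times as many lattice words as \<open>c\<close>; for
  other sizes both sides are zero.\<close>

lemma sum_ups:
  assumes "par c" "\<forall>r\<ge>M. c r = 0"
  shows "(\<Sum>r\<in>ups c. card (lats m (inc c r))) = m * card (lats (m - 1) c)"
  using assms
proof (induction m arbitrary: c)
  case 0
  have "lats 0 (inc c r) = {}" for r by (auto simp: lats_def fun_eq_iff)
  then show ?case by (simp del: fun_upd_apply)
next
  case (Suc m)
  let ?N = "\<lambda>m c. card (lats m c)"
  have fd: "finite (dns c)" and fu: "finite (ups c)" using finite_dns[OF Suc.prems(2)] finite_ups by auto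
  have fin_inc: "finite (dns (inc c r))" for r
    using Suc.prems(2) by (intro finite_dns[where M = "max M (Suc r)"]) auto
  have fin_dec: "finite (dns (dec c s))" for s
    using Suc.prems(2) by (intro finite_dns[where M = M]) auto
  have "(\<Sum>r\<in>ups c. ?N (Suc m) (inc c r)) = (\<Sum>r\<in>ups c. \<Sum>s\<in>dns (inc c r). ?N m (dec (inc c r) s))"
    by (intro sum.cong refl card_lats_Suc par_inc Suc.prems(1) fin_inc)
  \<comment> \<open>Removing the box that has just been added gives \<open>c\<close> back, once for
    every addable row.\<close>
  also have "\<dots> = (\<Sum>r\<in>ups c. ?N m c + (\<Sum>s\<in>dns (inc c r) - {r}. ?N m (dec (inc c r) s)))"
    by (intro sum.cong refl) (simp only: sum.remove[OF fin_inc dns_inc_self[OF Suc.prems(1)]] dec_inc)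
  also have "\<dots> = card (ups c) * ?N m c + (\<Sum>r\<in>ups c. \<Sum>s\<in>dns (inc c r) - {r}. ?N m (dec (inc c r) s))"
    by (simp add: sum.distrib)
  also have "(\<Sum>r\<in>ups c. \<Sum>s\<in>dns (inc c r) - {r}. ?N m (dec (inc c r) s))
    = (\<Sum>s\<in>dns c. \<Sum>r\<in>ups (dec c s) - {s}. ?N m (inc (dec c s) r))"
  proof -
    have sw: "(r, s) \<in> (SIGMA r:ups c. dns (inc c r) - {r}) \<longleftrightarrow> (s, r) \<in> (SIGMA s:dns c. ups (dec c s) - {s})" for r s
      using up_down_comm[of r s c] unfolding mem_Sigma_iff Diff_iff singleton_iff by blast
    have eq: "?N m (dec (inc c r) s) = ?N m (inc (dec c s) r)" if "(r, s) \<in> (SIGMA r:ups c. dns (inc c r) - {r})" for r s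
      using inc_dec_comm[of r s c] that by (metis mem_Sigma_iff Diff_iff singleton_iff)
    have "(\<Sum>r\<in>ups c. \<Sum>s\<in>dns (inc c r) - {r}. ?N m (dec (inc c r) s))
      = (\<Sum>(r, s)\<in>(SIGMA r:ups c. dns (inc c r) - {r}). ?N m (dec (inc c r) s))"
      using fu fin_inc by (intro sum.Sigma) auto
    also have "\<dots> = (\<Sum>(s, r)\<in>(SIGMA s:dns c. ups (dec c s) - {s}). ?N m (inc (dec c s) r))"
    proof (rule sum.reindex_bij_witness[where i = "\<lambda>(s, r). (r, s)" and j = "\<lambda>(r, s). (s, r)"], goal_cases)
      case (2 a) then show ?case using sw by (cases a) (simp only: prod.case)
    next
      case (4 a) then show ?case using sw by (cases a) (simp only: prod.case)
    next
      case (5 a) then show ?case using eq by (cases a) (simp only: prod.case)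
    qed (simp_all only: split_paired_all prod.case)
    also have "\<dots> = (\<Sum>s\<in>dns c. \<Sum>r\<in>ups (dec c s) - {s}. ?N m (inc (dec c s) r))"
      using fd finite_ups[OF fin_dec] by (intro sum.Sigma[symmetric]) auto
    finally show ?thesis .
  qed
  finally have 1: "(\<Sum>r\<in>ups c. ?N (Suc m) (inc c r)) = card (ups c) * ?N m c
    + (\<Sum>s\<in>dns c. \<Sum>r\<in>ups (dec c s) - {s}. ?N m (inc (dec c s) r))" .
  \<comment> \<open>Putting back the term with \<open>r = s\<close> completes the sum to which the
    induction hypothesis for \<open>dec c s\<close> applies.\<close>
  have 2: "(\<Sum>r\<in>ups (dec c s) - {s}. ?N m (inc (dec c s) r)) + ?N m c = m * ?N (m - 1) (dec c s)" if s: "s \<in> dns c" for s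
  proof -
    have "0 < c s" using s by (auto simp: dns_def)
    then have "?N m (inc (dec c s) s) = ?N m c" using inc_dec[of c s] by simp
    moreover have "(\<Sum>r\<in>ups (dec c s). ?N m (inc (dec c s) r)) = m * ?N (m - 1) (dec c s)"
      using Suc.prems(2) by (intro Suc.IH par_dec Suc.prems(1) s) auto
    ultimately show ?thesis
      using sum.remove[OF finite_ups[OF fin_dec] ups_dec_self[OF Suc.prems(1) s], of "\<lambda>r. ?N m (inc (dec c s) r)"]
      by (simp del: fun_upd_apply)
  qed
  have "(\<Sum>s\<in>dns c. \<Sum>r\<in>ups (dec c s) - {s}. ?N m (inc (dec c s) r)) + card (dns c) * ?N m c
    = (\<Sum>s\<in>dns c. m * ?N (m - 1) (dec c s))"
  proof -
    have "card (dns c) * ?N m c = (\<Sum>s\<in>dns c. ?N m c)" by simp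
    then show ?thesis by (simp only: sum.distrib[symmetric]) (rule sum.cong[OF refl 2])
  qed
  also have "\<dots> = m * ?N m c"
    using card_lats_Suc[OF Suc.prems(1) fd, of "m - 1"] by (cases m) (auto simp: sum_distrib_left)
  finally show ?case using 1 card_ups[OF fd] by (simp del: fun_upd_apply)
qed

text \<open>One factor of the square is split by the last letter of the word. The pairs of a shape
  and a removable row are then read as pairs of a smaller shape and an addable row, and
  \<open>sum_ups\<close> evaluates the inner sum.\<close>

lemma sum_card_lats: "(\<Sum>c\<in>parts m. card (lats m c) * card (lats m c)) = fact m"
proof (induction m)
  case 0
  have "parts 0 = {\<lambda>_. 0}" by (auto simp: parts_def par_def)
  moreover have "lats 0 (\<lambda>_. 0) = {[]}" by (auto simp: lats_def fun_eq_iff intro: lat.Nil)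
  ultimately show ?case by simp
next
  case (Suc m)
  let ?N = "\<lambda>m c. card (lats m c)"
  have P: "par c" "finite (dns c)" "finite (ups c)" "\<forall>r\<ge>k. c r = 0" if "c \<in> parts k" for c k
  proof -
    show "par c" and z: "\<forall>r\<ge>k. c r = 0" using that by (auto simp: parts_def)
    show "finite (dns c)" by (rule finite_dns[OF z])
    then show "finite (ups c)" by (rule finite_ups)
  qed
  have "(\<Sum>c\<in>parts (Suc m). ?N (Suc m) c * ?N (Suc m) c)
    = (\<Sum>c\<in>parts (Suc m). \<Sum>s\<in>dns c. ?N (Suc m) c * ?N m (dec c s))"
    using card_lats_Suc[OF P(1,2)] by (simp add: sum_distrib_left del: fun_upd_apply)
  also have "\<dots> = (\<Sum>(c, s)\<in>(SIGMA c:parts (Suc m). dns c). ?N (Suc m) c * ?N m (dec c s))"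
    using finite_parts P(2) by (intro sum.Sigma) auto
  also have "\<dots> = (\<Sum>(d, r)\<in>(SIGMA d:parts m. ups d). ?N (Suc m) (inc d r) * ?N m d)"
  proof (rule sum.reindex_bij_witness[where i = "\<lambda>(d, r). (inc d r, r)" and j = "\<lambda>(c, s). (dec c s, s)"], goal_cases)
    case (1 x)
    then show ?case using inc_dec by (auto simp: dns_def simp del: fun_upd_apply)
  next
    case (2 x)
    then show ?case using parts_dec ups_dec_self P(1) by (auto simp del: fun_upd_apply)
  next
    case (3 x)
    then show ?case using dec_inc by (auto simp del: fun_upd_apply)
  next
    case (4 x)
    then show ?case using parts_inc dns_inc_self P(1) by (auto simp del: fun_upd_apply)
  next
    case (5 x)
    then show ?case using inc_dec by (auto simp: dns_def simp del: fun_upd_apply)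
  qed
  also have "\<dots> = (\<Sum>d\<in>parts m. \<Sum>r\<in>ups d. ?N (Suc m) (inc d r) * ?N m d)"
    using finite_parts P(3) by (intro sum.Sigma[symmetric]) auto
  also have "\<dots> = (\<Sum>d\<in>parts m. Suc m * (?N m d * ?N m d))"
  proof (rule sum.cong[OF refl])
    fix d assume d: "d \<in> parts m"
    have "(\<Sum>r\<in>ups d. ?N (Suc m) (inc d r)) = Suc m * ?N m d"
      using sum_ups[where m = "Suc m", OF P(1)[OF d] P(4)[OF d]] by simp
    then show "(\<Sum>r\<in>ups d. ?N (Suc m) (inc d r) * ?N m d) = Suc m * (?N m d * ?N m d)"
      unfolding sum_distrib_right[symmetric] by (simp only: mult.assoc)
  qed
  also have "\<dots> = fact (Suc m)" by (simp only: sum_distrib_left[symmetric] Suc fact_Suc of_nat_id)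
  finally show ?case .
qed

definition lat_pairs :: "nat \<Rightarrow> (nat list \<times> nat list) set" where
  "lat_pairs m = {(v, w). lat v \<and> lat w \<and> length v = m \<and> length w = m \<and> count_list v = count_list w}"

lemma card_lat_pairs: "finite (lat_pairs m)" "card (lat_pairs m) = fact m"
proof -
  have eq: "lat_pairs m = (\<Union>c\<in>parts m. lats m c \<times> lats m c)"
    using lat_parts by (fastforce simp: lat_pairs_def lats_def)
  show "finite (lat_pairs m)" unfolding eq using finite_parts finite_lats by auto
  have "card (lat_pairs m) = (\<Sum>c\<in>parts m. card (lats m c \<times> lats m c))"
    unfolding eq using finite_parts finite_lats by (intro card_UN_disjoint) (auto simp: lats_def)
  then show "card (lat_pairs m) = fact m" by (simp add: card_cartesian_product sum_card_lats)
qed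

lemma lat_pairs_inj:
  assumes "finite A"
  shows "\<exists>\<psi>. inj_on \<psi> (lat_pairs (card A)) \<and> \<psi> ` lat_pairs (card A) \<subseteq> {g. g permutes A}"
proof -
  have "finite {g. g permutes A}" by (rule finite_permutations[OF assms])
  moreover have "card (lat_pairs (card A)) \<le> card {g. g permutes A}"
    using card_permutations[OF refl assms] card_lat_pairs(2)[of "card A"] by simp
  ultimately show ?thesis using card_le_inj[OF card_lat_pairs(1)] by blast
qed

lemma latI: "(\<And>j r. j \<le> length w \<Longrightarrow> count_list (take j w) (Suc r) \<le> count_list (take j w) r) \<Longrightarrow> lat w"
proof (induction w rule: rev_induct)
  case (snoc x w)
  have "count_list (take j w) (Suc r) \<le> count_list (take j w) r" if "j \<le> length w" for j r
    using snoc.prems[of j r] that by simp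
  then have "lat w" by (rule snoc.IH)
  moreover have "x = 0 \<or> count_list w x < count_list w (x - 1)"
    using snoc.prems[of "Suc (length w)" "x - 1"] by (cases x) auto
  ultimately show ?case by (rule lat.snoc)
qed (rule lat.Nil)

section \<open>The regular representation\<close>

text \<open>Right regular representation of \<open>bH\<^sub>n\<close> on the component with cut set \<open>C\<close>. Functions on words
  carry the transposed operators, so that no finiteness of supports is needed.\<close>

type_synonym vec = "(nat \<Rightarrow> nat) \<Rightarrow> laurent"

text \<open>The clause for equal letters is the eigenvalue \<open>q\<close> of a permutation module.
  With it the formula is a representation on functions of arbitrary words, and the relations can be
  checked pointwise.\<close>

fun actg :: "nat \<Rightarrow> nat set \<Rightarrow> gen \<Rightarrow> vec \<Rightarrow> vec" where
  "actg n C (GE i) v = (if i \<in> {1..<n} - C then v else (\<lambda>_. 0))"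
| "actg n C (GZ i) v = (if i \<in> {1..<n} - C then
     (\<lambda>g. if g i = g (Suc i) then qq * v g
          else v (g \<circ> sadj i) + (if g (Suc i) < g i then (qq - qinv) * v g else 0)) else (\<lambda>_. 0))"

text \<open>The left fold applies the leftmost letter first, which makes this a right
  action.\<close>

definition actw :: "nat \<Rightarrow> nat set \<Rightarrow> gen list \<Rightarrow> vec \<Rightarrow> vec" where
  "actw n C gs v = foldl (\<lambda>v g. actg n C g v) v gs"

definition act :: "nat \<Rightarrow> nat set \<Rightarrow> fa \<Rightarrow> vec \<Rightarrow> vec" where
  "act n C p v = (\<lambda>x. \<Sum>w\<in>Poly_Mapping.keys p. Poly_Mapping.lookup p w * actw n C (wrd_list w) v x)"

lemma qq_qinv: "qq * qinv = 1" "qinv * qq = 1"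
  by (simp_all add: qq_def qinv_def mult_single)

lemma actg_add: "actg n C g (\<lambda>x. v x + w x) = (\<lambda>x. actg n C g v x + actg n C g w x)"
  and actg_scale: "actg n C g (\<lambda>x. c * v x) = (\<lambda>x. c * actg n C g v x)"
  by (cases g; auto simp: algebra_simps)+

lemma actw_Nil [simp]: "actw n C [] v = v" and actw_Cons: "actw n C (g # gs) v = actw n C gs (actg n C g v)"
  and actw_append: "actw n C (gs @ hs) v = actw n C hs (actw n C gs v)"
  by (simp_all add: actw_def)

lemma actw_add: "actw n C gs (\<lambda>x. v x + w x) = (\<lambda>x. actw n C gs v x + actw n C gs w x)"
  by (induction gs arbitrary: v w) (simp_all add: actw_Cons actg_add)

lemma actw_scale: "actw n C gs (\<lambda>x. c * v x) = (\<lambda>x. c * actw n C gs v x)"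
  by (induction gs arbitrary: v) (simp_all add: actw_Cons actg_scale)

lemma act_add_left: "act n C (p + r) v x = act n C p v x + act n C r v x"
  unfolding act_def by (rule sum_keys_add) (simp_all add: distrib_right)

lemma act_single: "act n C (Poly_Mapping.single w c) v x = c * actw n C (wrd_list w) v x"
  by (cases "c = 0") (simp_all add: act_def)

lemma act_0 [simp]: "act n C 0 v x = 0"
  by (simp add: act_def)

lemma act_add_right: "act n C p (\<lambda>x. v x + w x) x = act n C p v x + act n C p w x"
  by (simp add: act_def actw_add distrib_left sum.distrib)

lemma act_scale_right: "act n C p (\<lambda>x. c * v x) x = c * act n C p v x"
  by (simp add: act_def actw_scale sum_distrib_left ac_simps)

lemma act_zero_right: "act n C p (\<lambda>_. 0) x = 0"
  using act_scale_right[of n C p 0 "\<lambda>_. 0" x] by simp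

lemma act_mult: "act n C (p * r) v = act n C r (act n C p v)"
proof
  fix x show "act n C (p * r) v x = act n C r (act n C p v) x"
  proof (induction p rule: fa_induct)
    case zero
    then show ?case using act_zero_right[of n C r x] by (simp add: act_def)
  next
    case (single w c)
    have e: "act n C (Poly_Mapping.single w c) v = (\<lambda>x. c * actw n C (wrd_list w) v x)"
      by (rule ext) (rule act_single)
    show ?case unfolding e act_scale_right
    proof (induction r rule: fa_induct)
      case (single w' d)
      then show ?case by (simp add: mult_single act_single actw_append)
    qed (simp_all add: distrib_left act_add_left)
  next
    case (add p p')
    have e: "act n C (p + p') v = (\<lambda>x. act n C p v x + act n C p' v x)"
      by (rule ext) (rule act_add_left)
    show ?case unfolding e act_add_right distrib_right act_add_left using add by simp
  qed
qed

lemma act_uminus: "act n C (- p) v x = - act n C p v x"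
  using act_add_left[of n C p "- p" v x] by (simp add: eq_neg_iff_add_eq_0 add.commute)

lemma act_diff: "act n C (p - r) v x = act n C p v x - act n C r v x"
  using act_add_left[of n C p "- r" v x] by (simp add: act_uminus)

lemma act_sc: "act n C (sc c) v = (\<lambda>x. c * v x)"
  by (rule ext) (simp add: sc_def act_single)

lemma act_1 [simp]: "act n C 1 v = v"
  using act_sc[of n C 1 v] by simp

lemma act_sc_mult: "act n C (sc c * p) v x = c * act n C p v x"
  by (simp add: act_mult act_sc act_scale_right)

lemma act_gE: "act n C (gE i) v = actg n C (GE i) v" and act_gZ: "act n C (gZ i) v = actg n C (GZ i) v"
  by (rule ext, simp add: gE_def gZ_def act_single actw_Cons)+

lemma qq_sq: "qq * (qq * x) = x + (qq - qinv) * (qq * x)"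
  using qq_qinv(2) by (simp add: algebra_simps)

lemma actZ:
  "i \<in> {1..<n} - C \<Longrightarrow> g i = g (Suc i) \<Longrightarrow> actg n C (GZ i) v g = qq * v g"
  "i \<in> {1..<n} - C \<Longrightarrow> g i < g (Suc i) \<Longrightarrow> actg n C (GZ i) v g = v (g \<circ> sadj i)"
  "i \<in> {1..<n} - C \<Longrightarrow> g (Suc i) < g i \<Longrightarrow> actg n C (GZ i) v g = v (g \<circ> sadj i) + (qq - qinv) * v g"
  "i \<notin> {1..<n} - C \<Longrightarrow> actg n C (GZ i) v g = 0"
  by auto

lemma act_quad:
  assumes "i \<in> {1..<n} - C"
  shows "actg n C (GZ i) (actg n C (GZ i) v) g = v g + (qq - qinv) * actg n C (GZ i) v g"
proof -
  consider "g i = g (Suc i)" | "g i < g (Suc i)" | "g (Suc i) < g i" by linarith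
  then show ?thesis
  proof cases
    case 1
    then show ?thesis using qq_sq[of "v g"] by (simp only: actZ(1)[OF assms])
  next
    case 2
    then have "(g \<circ> sadj i) (Suc i) < (g \<circ> sadj i) i" by simp
    from actZ(3)[where g = "g \<circ> sadj i", OF assms this] show ?thesis
      unfolding actZ(2)[where g = g, OF assms 2] by (simp only: o_sadj_o)
  next
    case 3
    then have "(g \<circ> sadj i) i < (g \<circ> sadj i) (Suc i)" by simp
    from actZ(2)[where g = "g \<circ> sadj i", OF assms this] show ?thesis
      unfolding actZ(3)[where g = g, OF assms 3] by (simp only: o_sadj_o)
  qed
qed

lemma act_far:
  assumes "Suc i < j"
  shows "actg n C (GZ i) (actg n C (GZ j) v) g = actg n C (GZ j) (actg n C (GZ i) v) g"
proof (cases "i \<in> {1..<n} - C \<and> j \<in> {1..<n} - C")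
  case True
  have s: "(g \<circ> sadj i) j = g j" "(g \<circ> sadj i) (Suc j) = g (Suc j)" "(g \<circ> sadj j) i = g i" "(g \<circ> sadj j) (Suc i) = g (Suc i)"
    using assms by (simp_all add: sadj_other)
  have c: "g \<circ> sadj i \<circ> sadj j = g \<circ> sadj j \<circ> sadj i" unfolding comp_assoc sadj_far_commute[OF assms] ..
  have "actg n C (GZ k) w = (\<lambda>g. if g k = g (Suc k) then qq * w g
          else w (g \<circ> sadj k) + (if g (Suc k) < g k then (qq - qinv) * w g else 0))" if "k \<in> {1..<n} - C" for k w
    using that by simp
  note e = this[OF conjunct1[OF True]] this[OF conjunct2[OF True]]
  show ?thesis unfolding e s c by (simp add: algebra_simps)
qed (auto simp del: Diff_iff)

lemma act_braid:
  assumes i: "i \<in> {1..<n} - C" and j: "j \<in> {1..<n} - C" and ji: "j = Suc i"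
  shows "actg n C (GZ i) (actg n C (GZ j) (actg n C (GZ i) v)) g = actg n C (GZ j) (actg n C (GZ i) (actg n C (GZ j) v)) g"
proof -
  have s: "sadj i j = i" "sadj i i = j" "sadj i (Suc j) = Suc j" "sadj j i = i" "sadj j j = Suc j" "sadj j (Suc j) = j"
    unfolding ji by (simp_all add: sadj_other)
  have br: "h \<circ> sadj j \<circ> sadj i \<circ> sadj j = h \<circ> sadj i \<circ> sadj j \<circ> sadj i" for h :: "nat \<Rightarrow> nat"
    unfolding ji using arg_cong[OF sadj_braid[of i], of "\<lambda>f. h \<circ> f"] by (simp add: comp_assoc)
  have ei: "actg n C (GZ i) w = (\<lambda>g. if g i = g j then qq * w g
          else w (g \<circ> sadj i) + (if g j < g i then (qq - qinv) * w g else 0))" for w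
    using i unfolding ji by simp
  have ej: "actg n C (GZ j) w = (\<lambda>g. if g j = g (Suc j) then qq * w g
          else w (g \<circ> sadj j) + (if g (Suc j) < g j then (qq - qinv) * w g else 0))" for w
    using j by simp
  have eqi: "g \<circ> sadj i = g" if "g i = g j"
  proof
    fix x show "(g \<circ> sadj i) x = g x" using that ji by (cases "x = i"; cases "x = Suc i") (auto simp: sadj_other)
  qed
  have eqj: "g \<circ> sadj j = g" if "g j = g (Suc j)"
  proof
    fix x show "(g \<circ> sadj j) x = g x" using that by (cases "x = j"; cases "x = Suc j") (auto simp: sadj_other)
  qed
  have brx: "sadj j (sadj i (sadj j x)) = sadj i (sadj j (sadj i x))" for x
    using fun_cong[OF br[of id], of x] by simp
  have eqij: "g \<circ> sadj i \<circ> sadj j \<circ> sadj i = g \<circ> sadj i \<circ> sadj j" if "g j = g (Suc j)"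
    using br[of g] eqj[OF that] by simp
  define d where "d = qq - qinv"
  have qi: "qq * (qq * x) = x + d * (qq * x)" for x :: laurent unfolding d_def by (rule qq_sq)
  \<comment> \<open>These are the thirteen weak orderings of the letters at the three
    positions.\<close>
  consider "g i = g j" "g j = g (Suc j)" | "g i = g j" "g j < g (Suc j)" | "g i = g j" "g (Suc j) < g j"
    | "g i < g j" "g j = g (Suc j)" | "g j < g i" "g j = g (Suc j)"
    | "g i = g (Suc j)" "g i < g j" | "g i = g (Suc j)" "g j < g i"
    | "g i < g j" "g j < g (Suc j)" | "g i < g (Suc j)" "g (Suc j) < g j" | "g j < g i" "g i < g (Suc j)"
    | "g j < g (Suc j)" "g (Suc j) < g i" | "g (Suc j) < g i" "g i < g j" | "g (Suc j) < g j" "g j < g i"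
    using less_linear[of "g i" "g j"] less_linear[of "g j" "g (Suc j)"] less_linear[of "g i" "g (Suc j)"] by blast
  then show ?thesis
    unfolding ei ej d_def[symmetric] comp_apply s
    by cases (simp_all add: s br brx o_sadj_o eqi eqj eqij qi distrib_left mult.left_commute)
qed

lemma act_rel:
  assumes "r \<in> bH_rels n" shows "act n C r v x = 0"
  using assms
proof (cases rule: bH_relsE)
  case (1 i)
  then show ?thesis by (simp add: act_diff act_mult act_gE)
next
  case (2 i)
  then show ?thesis by (simp add: act_diff act_mult act_gE act_gZ)
next
  case (3 i)
  show ?thesis
  proof (cases "i \<in> C")
    case True
    then show ?thesis by (simp add: 3 act_diff act_add_left act_sc_mult act_mult act_gE act_gZ)
  next
    case False
    then have i: "i \<in> {1..<n} - C" using 3 by simp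
    have "actg n C (GE i) v = v" using i by simp
    then show ?thesis unfolding 3(3) act_diff act_add_left act_sc_mult
      unfolding act_mult act_gE act_gZ act_quad[OF i, of v x] by simp
  qed
next
  case (4 i j)
  then show ?thesis by (simp add: act_diff act_mult act_gE)
next
  case (5 i j)
  then show ?thesis by (auto simp: act_diff act_mult act_gE act_gZ)
next
  case (6 i j)
  show ?thesis
  proof (cases "i \<in> C \<or> j \<in> C")
    case True
    then show ?thesis by (auto simp: 6(6) act_diff act_mult act_gZ fun_eq_iff)
  next
    case False
    then have ij: "i \<in> {1..<n} - C" "j \<in> {1..<n} - C" using 6 by simp_all
    from 6(5) consider "j = Suc i" | "i = Suc j" by auto
    then show ?thesis
    proof cases
      case 1
      show ?thesis unfolding 6(6) act_diff act_mult act_gZ act_braid[OF ij 1, of v x] by (rule diff_self)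
    next
      case 2
      show ?thesis unfolding 6(6) act_diff act_mult act_gZ act_braid[OF ij(2,1) 2, of v x] by (rule diff_self)
    qed
  qed
next
  case (7 i j)
  from 7(5) consider "Suc i < j" | "Suc j < i" by auto
  then show ?thesis
  proof cases
    case 1
    show ?thesis unfolding 7(6) act_diff act_mult act_gZ act_far[OF 1, of n C v x] by (rule diff_self)
  next
    case 2
    show ?thesis unfolding 7(6) act_diff act_mult act_gZ act_far[OF 2, of n C v x] by (rule diff_self)
  qed
qed

lemma act_ideal:
  assumes "y \<in> bH_ideal n" shows "act n C y v x = 0"
  using assms unfolding bH_ideal_def
proof (induction y arbitrary: x)
  case (gen r a b)
  have "act n C r (act n C a v) = (\<lambda>_. 0)" by (rule ext) (rule act_rel[OF gen.hyps(1)])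
  then show ?case by (simp only: act_mult) (rule act_zero_right)
qed (simp_all add: act_add_left)

section \<open>Elements dual to the regular representations\<close>

definition block_perms :: "nat \<Rightarrow> nat set \<Rightarrow> (nat \<Rightarrow> nat) set" where
  "block_perms n C = {g. g permutes {1..n} \<and> (\<forall>p\<in>{1..n}. blk_of C (g p) = blk_of C p)}"

definition zword :: "nat list \<Rightarrow> fa" where "zword ws = prod_list (map gZ ws)"

definition peps :: "nat \<Rightarrow> nat set \<Rightarrow> fa" where
  "peps n C = prod_list (map (\<lambda>i. if i \<in> C then 1 - gE i else gE i) [1..<n])"

lemma act_peps:
  assumes "C \<subseteq> {1..<n}" "C' \<subseteq> {1..<n}"
  shows "act n C (peps n C') v = (if C = C' then v else (\<lambda>_. 0))"
proof -
  have z: "act n C y (\<lambda>_. 0) = (\<lambda>_. 0)" for y by (rule ext) (rule act_zero_right)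
  have 1: "act n C (if i \<in> C' then 1 - gE i else gE i) v = (if i \<in> C \<longleftrightarrow> i \<in> C' then v else (\<lambda>_. 0))"
    if "i \<in> {1..<n}" for i v
    using that by (auto simp: fun_eq_iff act_diff act_gE)
  have "act n C (prod_list (map (\<lambda>i. if i \<in> C' then 1 - gE i else gE i) xs)) v
      = (if \<forall>i\<in>set xs. i \<in> C \<longleftrightarrow> i \<in> C' then v else (\<lambda>_. 0))" if "set xs \<subseteq> {1..<n}" for xs v
    using that
  proof (induction xs arbitrary: v)
    case (Cons i xs)
    then have i: "i \<in> {1..<n}" by simp
    show ?case using Cons by (simp only: list.map prod_list.Cons act_mult 1[OF i]) (simp add: z)
  qed simp
  from this[of "[1..<n]" v] have "act n C (peps n C') v = (if \<forall>i\<in>{1..<n}. i \<in> C \<longleftrightarrow> i \<in> C' then v else (\<lambda>_. 0))"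
    by (simp add: peps_def)
  moreover have "(\<forall>i\<in>{1..<n}. i \<in> C \<longleftrightarrow> i \<in> C') \<longleftrightarrow> C = C'" using assms by blast
  ultimately show ?thesis by simp
qed

text \<open>A reduced word ends in a descent. At a cut the block index increases and is preserved by
  \<open>g\<close>, so \<open>g\<close> ascends there; away from cuts the swap stays inside the
  group and the induction continues.\<close>

lemma redw_block_perm:
  assumes "redw n g ws" "g \<in> block_perms n C" "finite C"
  shows "set ws \<inter> C = {}"
  using assms(1,2)
proof (induction ws arbitrary: g rule: rev_induct)
  case (snoc i ws)
  note r = redw_snocD[OF snoc.prems(1)]
  have b: "blk_of C (g p) = blk_of C p" if "p \<in> {1..n}" for p
    using snoc.prems(2) that by (simp add: block_perms_def)
  have i: "i \<notin> C"
  proof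
    assume "i \<in> C"
    then have "blk_of C (Suc i) = Suc (blk_of C i)" using r by (intro blk_Suc_cut)
    moreover have "blk_of C (g (Suc i)) \<le> blk_of C (g i)" using r(4) assms(3) by (intro blk_mono) auto
    ultimately show False using b[of i] b[of "Suc i"] r by simp
  qed
  have s: "sadj i p \<in> {1..n} \<and> blk_of C (sadj i p) = blk_of C p" if "p \<in> {1..n}" for p
    using that r blk_Suc_notin[OF i] by (cases "p = i"; cases "p = Suc i") (auto simp: sadj_other)
  have "g \<circ> sadj i \<in> block_perms n C"
    using snoc.prems(2) permutes_compose[OF sadj_permutes[OF r(2,3)], of g] b s
    unfolding block_perms_def by auto
  from snoc.IH[OF r(1) this] i show ?case by simp
qed simp

definition delta :: "(nat \<Rightarrow> nat) \<Rightarrow> vec" where "delta h g = of_bool (g = h)"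

lemma act_gZ_delta:
  assumes "i \<in> {1..<n} - C" "h i < h (Suc i)"
  shows "act n C (gZ i) (delta h) = delta (h \<circ> sadj i)"
proof
  fix g :: "nat \<Rightarrow> nat"
  have eq: "g \<circ> sadj i = h \<longleftrightarrow> g = h \<circ> sadj i" by (metis o_sadj_o)
  have ne: "h \<circ> sadj i \<noteq> h" using assms(2) by (metis comp_apply sadj_simps(1) less_irrefl)
  have g: "g i = h (Suc i)" "g (Suc i) = h i" if "g = h \<circ> sadj i" using that by simp_all
  show "act n C (gZ i) (delta h) g = delta (h \<circ> sadj i) g"
    unfolding act_gZ actg.simps if_P[OF assms(1)] delta_def eq
    using assms(2) g ne by auto
qed

text \<open>Along a reduced word every letter is an ascent, where the operator merely moves the
  point mass.\<close>

lemma act_zword: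
  assumes "redw n g ws" "set ws \<inter> C = {}"
  shows "act n C (zword ws) (delta id) = delta g"
  using assms
proof (induction ws arbitrary: g rule: rev_induct)
  case Nil
  then show ?case by (simp add: zword_def redw_def)
next
  case (snoc i ws)
  note r = redw_snocD[OF snoc.prems(1)]
  have i: "i \<in> {1..<n} - C" using r snoc.prems by auto
  have "act n C (zword (ws @ [i])) (delta id) = act n C (gZ i) (delta (g \<circ> sadj i))"
  proof -
    have "zword (ws @ [i]) = zword ws * gZ i" by (simp add: zword_def)
    moreover have "set ws \<inter> C = {}" using snoc.prems(2) by auto
    ultimately show ?thesis by (simp only: act_mult snoc.IH[OF r(1)])
  qed
  also have "\<dots> = delta g" using act_gZ_delta[OF i, of "g \<circ> sadj i"] r(4) by simp
  finally show ?case .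
qed

lemma prod_list_carrier: "(\<And>x. x \<in> set xs \<Longrightarrow> x \<in> fa_carrier n) \<Longrightarrow> prod_list xs \<in> fa_carrier n"
  by (induction xs) (auto intro: carrier_mult)

lemma carrier_uminus: "x \<in> fa_carrier n \<Longrightarrow> - x \<in> fa_carrier n"
  by (simp add: fa_carrier_def)

lemma carrier_diff: "x \<in> fa_carrier n \<Longrightarrow> y \<in> fa_carrier n \<Longrightarrow> x - y \<in> fa_carrier n"
  using carrier_add[of x n "- y"] carrier_uminus[of y n] by simp

lemma zword_carrier: "set ws \<subseteq> {1..<n} \<Longrightarrow> zword ws \<in> fa_carrier n"
  unfolding zword_def by (rule prod_list_carrier) (auto dest!: subsetD intro: carrier_gZ)

lemma peps_carrier: "peps n C \<in> fa_carrier n"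
  unfolding peps_def by (rule prod_list_carrier) (auto intro!: carrier_diff carrier_1 carrier_gE)

text \<open>\<open>peps\<close> projects onto the corner of \<open>C\<close>, and the word of
  \<open>g\<close> then carries the unit mass from \<open>id\<close> to \<open>g\<close>.\<close>

lemma dual_basis:
  assumes C: "C \<subseteq> {1..<n}" and g: "g \<in> block_perms n C"
  shows "\<exists>p\<in>fa_carrier n. \<forall>C' g'. C' \<subseteq> {1..<n} \<longrightarrow> g' \<in> block_perms n C' \<longrightarrow>
    act n C' p (delta id) g' = of_bool (C' = C \<and> g' = g)"
proof -
  have "finite C" using C finite_subset by blast
  obtain ws where ws: "redw n g ws" using redw_exists[of g n] g by (auto simp: block_perms_def)
  have av: "set ws \<inter> C = {}" by (rule redw_block_perm[OF ws g \<open>finite C\<close>])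
  have "act n C' (peps n C * zword ws) (delta id) g' = of_bool (C' = C \<and> g' = g)" if "C' \<subseteq> {1..<n}" for C' g'
    unfolding act_mult act_peps[OF that C] using act_zword[OF ws av] act_zero_right[of n C' "zword ws" g']
    by (auto simp: delta_def)
  moreover have "peps n C * zword ws \<in> fa_carrier n"
    using ws by (intro carrier_mult peps_carrier zword_carrier) (simp add: redw_def)
  ultimately show ?thesis by blast
qed

text \<open>Gaussian elimination without division: the other equations are multiplied by the pivot,
  because the coefficients only form a domain.\<close>

lemma homogeneous_system:
  fixes a :: "'u \<Rightarrow> 'j \<Rightarrow> 'a :: idom"
  assumes "finite J" "finite U" "card J < card U"
  shows "\<exists>x. (\<exists>u\<in>U. x u \<noteq> 0) \<and> (\<forall>j\<in>J. (\<Sum>u\<in>U. x u * a u j) = 0)"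
  using assms
proof (induction J arbitrary: U a rule: finite_induct)
  case empty
  then have "U \<noteq> {}" by auto
  then show ?case by (intro exI[of _ "\<lambda>_. 1"]) auto
next
  case (insert j0 J)
  show ?case
  proof (cases "\<forall>u\<in>U. a u j0 = 0")
    case True
    have "card J < card U" using insert.prems insert.hyps by simp
    from insert.IH[OF insert.prems(1) this, of a] True show ?thesis by auto
  next
    case False
    then obtain u0 where u0: "u0 \<in> U" "a u0 j0 \<noteq> 0" by blast
    have "finite (U - {u0})" "card J < card (U - {u0})" using insert.prems insert.hyps u0 by simp_all
    from insert.IH[OF this, of "\<lambda>u j. a u0 j0 * a u j - a u j0 * a u0 j"]
    obtain x where x: "\<exists>u\<in>U - {u0}. x u \<noteq> 0"
      "\<And>j. j \<in> J \<Longrightarrow> (\<Sum>u\<in>U - {u0}. x u * (a u0 j0 * a u j - a u j0 * a u0 j)) = 0" by blast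
    \<comment> \<open>The value at the pivot \<open>u0\<close> is forced by the equation
      \<open>j0\<close> once the other values are scaled by \<open>a u0 j0\<close>.\<close>
    define y where "y u = (if u = u0 then - (\<Sum>u\<in>U - {u0}. x u * a u j0) else a u0 j0 * x u)" for u
    have y: "(\<Sum>u\<in>U. y u * a u j) = (\<Sum>u\<in>U - {u0}. x u * (a u0 j0 * a u j - a u j0 * a u0 j))" for j
    proof -
      have "(\<Sum>u\<in>U. y u * a u j) = y u0 * a u0 j + (\<Sum>u\<in>U - {u0}. y u * a u j)"
        by (rule sum.remove) (use insert.prems u0 in auto)
      also have "(\<Sum>u\<in>U - {u0}. y u * a u j) = (\<Sum>u\<in>U - {u0}. a u0 j0 * x u * a u j)"
        by (rule sum.cong) (auto simp: y_def)
      also have "y u0 * a u0 j = - (\<Sum>u\<in>U - {u0}. x u * a u j0 * a u0 j)" by (simp add: y_def sum_distrib_right)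
      finally show ?thesis by (simp add: right_diff_distrib sum_subtractf ac_simps)
    qed
    have "(\<Sum>u\<in>U. y u * a u j) = 0" if "j \<in> insert j0 J" for j
      using that x(2) unfolding y by (auto simp: mult.commute)
    moreover have "\<exists>u\<in>U. y u \<noteq> 0" using x(1) u0 by (auto simp: y_def)
    ultimately show ?thesis by blast
  qed
qed

text \<open>If \<open>A\<close> has the rows \<open>a w\<close> and \<open>M\<close> the entries \<open>\<Phi> w (b j)\<close>, then \<open>A M = 1\<close>. The vectors \<open>c\<close> and \<open>a w\<close> are too many to be
  independent, and multiplying a linear relation between them by \<open>M\<close> leaves only \<open>c = 0\<close>.\<close>
lemma independent_if_card_le:
  fixes c :: "'j \<Rightarrow> laurent" and b :: "'j \<Rightarrow> fa" and \<Phi> :: "'w \<Rightarrow> fa \<Rightarrow> laurent"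
  assumes J: "finite J" and W: "finite W" and card: "card J \<le> card W"
    and span: "\<And>w. w \<in> W \<Longrightarrow> \<exists>a. p w - (\<Sum>j\<in>J. sc (a j) * b j) \<in> I"
    and \<Phi>I: "\<And>w x. w \<in> W \<Longrightarrow> x \<in> I \<Longrightarrow> \<Phi> w x = 0"
    and add: "\<And>w x y. \<Phi> w (x + y) = \<Phi> w x + \<Phi> w y" and scale: "\<And>w k x. \<Phi> w (sc k * x) = k * \<Phi> w x"
    and dual: "\<And>w w'. w \<in> W \<Longrightarrow> w' \<in> W \<Longrightarrow> \<Phi> w' (p w) = of_bool (w = w')"
    and c: "(\<Sum>j\<in>J. sc (c j) * b j) \<in> I" and j: "j \<in> J"
  shows "c j = 0"
proof -
  have \<Phi>0: "\<Phi> w 0 = 0" for w using add[of w 0 0] by simp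
  have \<Phi>sum: "\<Phi> w (\<Sum>j\<in>J. sc (k j) * b j) = (\<Sum>j\<in>J. k j * \<Phi> w (b j))" for w k
    using J by (induction J rule: finite_induct) (simp_all add: \<Phi>0 add scale)
  obtain a where a: "\<And>w. w \<in> W \<Longrightarrow> p w - (\<Sum>j\<in>J. sc (a w j) * b j) \<in> I" using span by metis
  have AM: "(\<Sum>j\<in>J. a w j * \<Phi> w' (b j)) = of_bool (w = w')" if "w \<in> W" "w' \<in> W" for w w'
  proof -
    have "\<Phi> w' (p w) = \<Phi> w' (p w - (\<Sum>j\<in>J. sc (a w j) * b j)) + \<Phi> w' (\<Sum>j\<in>J. sc (a w j) * b j)"
      unfolding add[symmetric] by simp
    then show ?thesis using that dual[OF that] \<Phi>I[OF that(2) a[OF that(1)]] by (simp add: \<Phi>sum)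
  qed
  have cM: "(\<Sum>j\<in>J. c j * \<Phi> w (b j)) = 0" if "w \<in> W" for w
    using \<Phi>I[OF that c] by (simp add: \<Phi>sum)
  \<comment> \<open>\<open>None\<close> labels the assumed relation \<open>c\<close>, and
    \<open>Some w\<close> labels the row \<open>a w\<close>.\<close>
  let ?U = "insert None (Some ` W)" and ?a = "\<lambda>u j. case u of None \<Rightarrow> c j | Some w \<Rightarrow> a w j"
  have cU: "card ?U = Suc (card W)" "finite ?U" using W by (simp_all add: card_image card_insert_if)
  obtain x where x: "\<exists>u\<in>?U. x u \<noteq> 0" "\<And>j. j \<in> J \<Longrightarrow> (\<Sum>u\<in>?U. x u * ?a u j) = 0"
  proof -
    have "card J < card ?U" using card unfolding cU(1) by simp
    from homogeneous_system[OF J cU(2) this, of ?a] show ?thesis using that by blast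
  qed
  have x': "x None * c j + (\<Sum>w\<in>W. x (Some w) * a w j) = 0" if "j \<in> J" for j
    using x(2)[OF that] W by (simp add: sum.reindex)
  \<comment> \<open>Pairing with the column \<open>w\<close> of \<open>M\<close> removes
    \<open>c\<close> by \<open>cM\<close> and isolates one coefficient by \<open>AM\<close>.\<close>
  have xS: "x (Some w) = 0" if w: "w \<in> W" for w
  proof -
    have "0 = (\<Sum>j\<in>J. (x None * c j + (\<Sum>w\<in>W. x (Some w) * a w j)) * \<Phi> w (b j))" using x' by simp
    also have "\<dots> = x None * (\<Sum>j\<in>J. c j * \<Phi> w (b j)) + (\<Sum>j\<in>J. \<Sum>w'\<in>W. x (Some w') * (a w' j * \<Phi> w (b j)))"
      by (simp add: distrib_right sum.distrib sum_distrib_left sum_distrib_right mult.assoc)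
    also have "(\<Sum>j\<in>J. \<Sum>w'\<in>W. x (Some w') * (a w' j * \<Phi> w (b j))) = (\<Sum>w'\<in>W. x (Some w') * of_bool (w' = w))"
      unfolding sum.swap[of _ W J] by (rule sum.cong) (simp_all add: sum_distrib_left[symmetric] AM w)
    also have "\<dots> = x (Some w)" using W w by (simp add: of_bool_def if_distrib cong: if_cong)
    finally show ?thesis using cM[OF w] by simp
  qed
  then have "x None \<noteq> 0" using x(1) by auto
  moreover have "x None * c j = 0" using x'[OF j] xS by simp
  ultimately show ?thesis by simp
qed

lemma finite_block_perms: "finite (block_perms n C)"
  by (rule finite_subset[OF _ finite_permutations[of "{1..n}"]]) (auto simp: block_perms_def)

section \<open>Embedding the index set into the block permutations\<close>

definition block_at :: "nat \<Rightarrow> nat set \<Rightarrow> nat \<Rightarrow> nat set" where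
  "block_at n C k = {p \<in> {1..n}. blk_of C p = k}"

text \<open>Recovers \<open>r\<close> from a letter \<open>3 * (k * n + r)\<close> with
  \<open>r < n\<close>.\<close>

definition row_in_block :: "nat \<Rightarrow> (nat \<Rightarrow> nat) \<Rightarrow> nat \<Rightarrow> nat" where
  "row_in_block n f p = (f p div 3) mod n"

definition block_list :: "nat \<Rightarrow> nat set \<Rightarrow> (nat \<Rightarrow> nat) \<Rightarrow> nat \<Rightarrow> nat list" where
  "block_list n C f k = map (row_in_block n f) (sorted_list_of_set (block_at n C k))"

lemma finite_block_at [simp]: "finite (block_at n C k)"
  by (simp add: block_at_def)

lemma count_list_map_distinct: "distinct xs \<Longrightarrow> count_list (map h xs) r = card {p \<in> set xs. h p = r}"
proof (induction xs)
  case (Cons x xs)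
  have "{p \<in> set (x # xs). h p = r} = (if h x = r then insert x {p \<in> set xs. h p = r} else {p \<in> set xs. h p = r})"
    by auto
  then show ?case using Cons by auto
qed simp

text \<open>Translates prefixes of a list of positions, as used by \<open>lat\<close>, into the
  bounds on positions used by \<open>lattice_word\<close>; the bound 0 serves the empty
  prefix.\<close>

lemma set_take_sorted:
  fixes xs :: "nat list"
  assumes "sorted_wrt (<) xs" "0 \<notin> set xs" "set xs \<subseteq> {..n}" "j \<le> length xs"
  shows "\<exists>q\<le>n. set (take j xs) = {p \<in> set xs. p \<le> q}"
proof (cases j)
  case 0
  then show ?thesis using assms(2) by (intro exI[of _ 0]) auto
next
  case (Suc i)
  then have i: "i < length xs" using assms(4) by simp
  have "p \<in> set (take j xs) \<longleftrightarrow> p \<in> set xs \<and> p \<le> xs ! i" for p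
  proof
    assume "p \<in> set (take j xs)"
    then obtain a where a: "a < j" "a < length xs" "p = xs ! a" by (auto simp: in_set_conv_nth)
    then show "p \<in> set xs \<and> p \<le> xs ! i"
      using sorted_wrt_nth_less[OF assms(1), of a i] i Suc by (cases "a = i") auto
  next
    assume p: "p \<in> set xs \<and> p \<le> xs ! i"
    then obtain a where a: "a < length xs" "p = xs ! a" by (auto simp: in_set_conv_nth)
    then have "\<not> i < a" using sorted_wrt_nth_less[OF assms(1), of i a] p by auto
    then show "p \<in> set (take j xs)" using a Suc by (auto simp: in_set_conv_nth)
  qed
  moreover have "xs ! i \<le> n" using assms(3) nth_mem[OF i] by auto
  ultimately show ?thesis by (intro exI[of _ "xs ! i"]) auto
qed

context multipart
begin

lemma wd_letter:
  assumes "s \<in> Tset lam" "p \<in> {1..n}"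
  shows "row_in_block n (wd n lam s) p < n"
    "wd n lam s p = 3 * (blk_of (cuts lam) p * n + row_in_block n (wd n lam s) p)"
proof -
  have "wd n lam s \<in> orb n (wd n lam (tlam lam))" using assms wd_orb by (auto simp: Tset_def)
  then obtain g where g: "g permutes {1..n}" "wd n lam s = wd n lam (tlam lam) \<circ> g" by (auto simp: orb_def)
  have "g p \<in> {1..n}" using permutes_in_image[OF g(1)] assms(2) by blast
  then obtain k r where r: "r < n" "wd n lam s p = 3 * (k * n + r)"
    using f0_valid g(2) unfolding valid_word_def by (metis comp_apply)
  moreover have "k = blk_of (cuts lam) p" using wd_block[OF assms] letter_div[OF r(1), of k] r(2) by simp
  moreover have "row_in_block n (wd n lam s) p = r" using r by (simp add: row_in_block_def)
  ultimately show "row_in_block n (wd n lam s) p < n"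
    "wd n lam s p = 3 * (blk_of (cuts lam) p * n + row_in_block n (wd n lam s) p)" by simp_all
qed

lemma block_row_set:
  assumes "s \<in> Tset lam" "r < n" "q \<le> n"
  shows "{p \<in> block_at n (cuts lam) k. p \<le> q \<and> row_in_block n (wd n lam s) p = r}
    = {p \<in> {1..q}. wd n lam s p = 3 * (k * n + r)}"
proof (intro equalityI subsetI)
  fix p assume "p \<in> {p \<in> block_at n (cuts lam) k. p \<le> q \<and> row_in_block n (wd n lam s) p = r}"
  then show "p \<in> {p \<in> {1..q}. wd n lam s p = 3 * (k * n + r)}"
    using wd_letter(2)[OF assms(1), of p] by (simp add: block_at_def)
next
  fix p assume p: "p \<in> {p \<in> {1..q}. wd n lam s p = 3 * (k * n + r)}"
  then have "p \<in> {1..n}" using assms(3) by auto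
  from letter_eq[OF assms(2) wd_letter(1)[OF assms(1) this] _ wd_letter(2)[OF assms(1) this], of k] p
  have "k = blk_of (cuts lam) p \<and> r = row_in_block n (wd n lam s) p" by blast
  then show "p \<in> {p \<in> block_at n (cuts lam) k. p \<le> q \<and> row_in_block n (wd n lam s) p = r}"
    using \<open>p \<in> {1..n}\<close> p by (simp add: block_at_def)
qed

text \<open>The lattice condition is imposed component by component, hence passes to the rows read
  inside one block. The contents agree because both tableaux have the same shape.\<close>

lemma block_list_pair:
  assumes s: "s \<in> Tset lam" and t: "t \<in> Tset lam"
  shows "(block_list n (cuts lam) (wd n lam s) k, block_list n (cuts lam) (wd n lam t) k)
    \<in> lat_pairs (card (block_at n (cuts lam) k))"
proof -
  let ?B = "block_at n (cuts lam) k" and ?xs = "sorted_list_of_set (block_at n (cuts lam) k)"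
  have big: "{p \<in> A. row_in_block n (wd n lam u) p = r} = {}" if "u \<in> Tset lam" "\<not> r < n" "A \<subseteq> ?B" for A u r
    using wd_letter(1)[OF that(1)] that(2,3) by (auto simp: block_at_def)
  have lat: "lat (block_list n (cuts lam) (wd n lam u) k)" if u: "u \<in> Tset lam" for u
  proof (rule latI)
    fix j r assume "j \<le> length (block_list n (cuts lam) (wd n lam u) k)"
    then have j: "j \<le> length ?xs" by (simp add: block_list_def)
    have xs: "sorted_wrt (<) ?xs" "set ?xs = ?B" "0 \<notin> set ?xs" "set ?xs \<subseteq> {..n}" by (auto simp: block_at_def)
    from set_take_sorted[OF xs(1,3,4) j] obtain q where q: "q \<le> n" "set (take j ?xs) = {p \<in> ?B. p \<le> q}"
      unfolding xs(2) by blast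
    have ct: "count_list (take j (block_list n (cuts lam) (wd n lam u) k)) r
        = card {p \<in> ?B. p \<le> q \<and> row_in_block n (wd n lam u) p = r}" for r
      unfolding block_list_def take_map
      using q(2) by (subst count_list_map_distinct) (auto simp: conj_assoc)
    show "count_list (take j (block_list n (cuts lam) (wd n lam u) k)) (Suc r)
      \<le> count_list (take j (block_list n (cuts lam) (wd n lam u) k)) r"
    proof (cases "Suc r < n")
      case True
      then have adj: "adj_letter n (3 * (k * n + r))" by (auto simp: adj_letter_def)
      have e: "3 * (k * n + r) + 3 = 3 * (k * n + Suc r)" by simp
      have "card {p \<in> {1..q}. wd n lam u p = 3 * (k * n + Suc r)} \<le> card {p \<in> {1..q}. wd n lam u p = 3 * (k * n + r)}"
        using wd_lattice[OF u, unfolded lattice_word_def, rule_format, OF adj q(1)] unfolding e .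
      then show ?thesis unfolding ct using True block_row_set[OF u True q(1)] block_row_set[OF u _ q(1), of r] by simp
    next
      case False
      have "{p \<in> ?B. p \<le> q \<and> row_in_block n (wd n lam u) p = Suc r} = {}"
        using big[OF u False subset_refl] by blast
      then show ?thesis unfolding ct by (simp only: card.empty)
    qed
  qed
  have "count_list (block_list n (cuts lam) (wd n lam s) k) r = count_list (block_list n (cuts lam) (wd n lam t) k) r" for r
  proof -
    have ct: "count_list (block_list n (cuts lam) (wd n lam u) k) r = (if r < n then cnt n (wd n lam (tlam lam)) (3 * (k * n + r)) else 0)"
      if u: "u \<in> Tset lam" for u
    proof -
      have orb: "wd n lam u \<in> orb n (wd n lam (tlam lam))" using u wd_orb by (auto simp: Tset_def)
      have "count_list (block_list n (cuts lam) (wd n lam u) k) r = card {p \<in> ?B. row_in_block n (wd n lam u) p = r}"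
        unfolding block_list_def by (subst count_list_map_distinct) auto
      also have "\<dots> = (if r < n then cnt n (wd n lam u) (3 * (k * n + r)) else 0)"
      proof (cases "r < n")
        case True
        have "{p \<in> ?B. row_in_block n (wd n lam u) p = r} = {p \<in> ?B. p \<le> n \<and> row_in_block n (wd n lam u) p = r}"
          by (auto simp: block_at_def)
        then show ?thesis using block_row_set[OF u True order_refl, of k] True by (simp add: cnt_def)
      next
        case False
        then show ?thesis using big[OF u False subset_refl] by simp
      qed
      finally show ?thesis using orb_cnt[OF orb] by simp
    qed
    show ?thesis unfolding ct[OF s] ct[OF t] ..
  qed
  then show ?thesis using lat[OF s] lat[OF t] by (auto simp: lat_pairs_def block_list_def)
qed

end

lemma word_determined:
  assumes lam: "lam \<in> multipartitions n" and mu: "mu \<in> multipartitions n" and C: "cuts lam = cuts mu"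
    and s: "s \<in> Tset lam" and t: "t \<in> Tset mu"
    and eq: "\<And>p. p \<in> {1..n} \<Longrightarrow> block_list n (cuts lam) (wd n lam s) (blk_of (cuts lam) p)
      = block_list n (cuts lam) (wd n mu t) (blk_of (cuts lam) p)"
  shows "wd n lam s = wd n mu t"
proof
  fix p
  interpret l: multipart n lam by unfold_locales fact
  interpret m: multipart n mu by unfold_locales fact
  show "wd n lam s p = wd n mu t p"
  proof (cases "p \<in> {1..n}")
    case True
    then have "p \<in> block_at n (cuts lam) (blk_of (cuts lam) p)" by (simp add: block_at_def)
    then have "row_in_block n (wd n lam s) p = row_in_block n (wd n mu t) p"
      using eq[OF True] by (simp add: block_list_def)
    then show ?thesis using l.wd_letter(2)[OF s True] m.wd_letter(2)[OF t True] C by simp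
  next
    case False
    then show ?thesis unfolding wd_def by (simp only: if_False)
  qed
qed

lemma card_less_comp:
  "g permutes A \<Longrightarrow> card {p \<in> A. (f \<circ> g) p < x} = card {p \<in> A. f p < (x :: nat)}"
  by (rule bij_betw_same_card[of g], rule bij_betw_byWitness[where f' = "inv g"])
    (auto simp: permutes_inverses permutes_in_image permutes_in_image[OF permutes_inv])

lemma multipartition_determined:
  assumes lam: "lam \<in> multipartitions n" and mu: "mu \<in> multipartitions n"
    and s: "s \<in> Tset lam" and t: "t \<in> Tset mu" and eq: "wd n lam s = wd n mu t"
  shows "lam = mu"
proof -
  interpret l: multipart n lam by unfold_locales fact
  interpret m: multipart n mu by unfold_locales fact
  have "wd n lam s \<in> orb n (wd n lam (tlam lam))" "wd n mu t \<in> orb n (wd n mu (tlam mu))"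
    using s t l.wd_orb m.wd_orb by (auto simp: Tset_def)
  then obtain g h where g: "g permutes {1..n}" "wd n lam s = wd n lam (tlam lam) \<circ> g"
    and h: "h permutes {1..n}" "wd n mu t = wd n mu (tlam mu) \<circ> h" by (auto simp: orb_def)
  have "card {p \<in> {1..n}. wd n lam (tlam lam) p < x} = card {p \<in> {1..n}. wd n mu (tlam mu) p < x}" for x
    using card_less_comp[OF g(1), of "wd n lam (tlam lam)" x] card_less_comp[OF h(1), of "wd n mu (tlam mu)" x]
    unfolding g(2)[symmetric] h(2)[symmetric] eq by simp
  then have "dom_sum lam k j = dom_sum mu k j" for k j unfolding l.dom_sum_card m.dom_sum_card by simp
  then show ?thesis by (intro dominates_antisym[OF lam mu]) (simp_all add: dominates_def)
qed

lemma finite_cidx: "finite (cidx (multipartitions n) Tset)"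
proof -
  have "finite (Tset lam)" if "lam \<in> multipartitions n" for lam
  proof -
    interpret multipart n lam by unfold_locales fact
    show ?thesis by (rule finite_Tset)
  qed
  then show ?thesis unfolding cidx_def using finite_multipartitions by blast
qed

text \<open>In each block the pair of lattice words is encoded as a permutation of that block, and
  these permutations are glued. The cut set and the glued permutation determine both words, the
  words determine the multipartition, and then the tableaux.\<close>

lemma card_cidx_le: "card (cidx (multipartitions n) Tset) \<le> card (SIGMA C:Pow {1..<n}. block_perms n C)"
proof -
  obtain \<psi> where \<psi>: "\<And>A :: nat set. finite A \<Longrightarrow> inj_on (\<psi> A) (lat_pairs (card A)) \<and> \<psi> A ` lat_pairs (card A) \<subseteq> {g. g permutes A}"
    using lat_pairs_inj by metis
  define gm where "gm C f f' p = (if p \<in> {1..n} then \<psi> (block_at n C (blk_of C p))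
    (block_list n C f (blk_of C p), block_list n C f' (blk_of C p)) p else p)" for C f f' p
  define F where "F = (\<lambda>(lam, s, t). (cuts lam, gm (cuts lam) (wd n lam s) (wd n lam t)))"
  have fin: "finite (SIGMA C:Pow {1..<n}. block_perms n C)"
    by (rule finite_SigmaI) (simp_all add: finite_block_perms)
  have im: "F ` cidx (multipartitions n) Tset \<subseteq> (SIGMA C:Pow {1..<n}. block_perms n C)"
  proof
    fix x assume "x \<in> F ` cidx (multipartitions n) Tset"
    then obtain lam s t where lam: "lam \<in> multipartitions n" and st: "s \<in> Tset lam" "t \<in> Tset lam"
      and x: "x = (cuts lam, gm (cuts lam) (wd n lam s) (wd n lam t))"
      by (auto simp: F_def cidx_def)
    interpret multipart n lam by unfold_locales fact
    let ?C = "cuts lam" and ?g = "gm (cuts lam) (wd n lam s) (wd n lam t)"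
    have pm: "\<psi> (block_at n ?C k) (block_list n ?C (wd n lam s) k, block_list n ?C (wd n lam t) k) permutes block_at n ?C k" for k
      using \<psi>[OF finite_block_at] block_list_pair[OF st] by blast
    have gb: "?g p \<in> block_at n ?C (blk_of ?C p)" if "p \<in> {1..n}" for p
      unfolding gm_def if_P[OF that] permutes_in_image[OF pm] using that by (simp add: block_at_def)
    then have b: "?g p \<in> {1..n}" "blk_of ?C (?g p) = blk_of ?C p" if "p \<in> {1..n}" for p
      using that unfolding block_at_def by blast+
    have "?g permutes {1..n}"
    proof (rule inj_imp_permutes)
      show "inj_on ?g {1..n}"
      proof (rule inj_onI)
        fix p q assume pq: "p \<in> {1..n}" "q \<in> {1..n}" "?g p = ?g q"
        then have "blk_of ?C p = blk_of ?C q" using b(2) by metis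
        then show "p = q" using pq permutes_inj[OF pm] by (simp add: gm_def inj_eq)
      qed
    qed (use b in \<open>auto simp: gm_def\<close>)
    then have "?g \<in> block_perms n ?C" using b(2) by (simp add: block_perms_def)
    then show "x \<in> (SIGMA C:Pow {1..<n}. block_perms n C)" using cuts_sub x by auto
  qed
  have "inj_on F (cidx (multipartitions n) Tset)"
  proof (rule inj_onI)
    fix x y assume "x \<in> cidx (multipartitions n) Tset" "y \<in> cidx (multipartitions n) Tset" and F: "F x = F y"
    then obtain lam s t mu s' t' where lam: "lam \<in> multipartitions n" and st: "s \<in> Tset lam" "t \<in> Tset lam"
      and mu: "mu \<in> multipartitions n" and st': "s' \<in> Tset mu" "t' \<in> Tset mu" and xy: "x = (lam, s, t)" "y = (mu, s', t')"
      by (auto simp: cidx_def)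
    interpret l: multipart n lam by unfold_locales fact
    interpret m: multipart n mu by unfold_locales fact
    let ?C = "cuts lam"
    have C: "cuts lam = cuts mu" and g: "gm ?C (wd n lam s) (wd n lam t) = gm ?C (wd n mu s') (wd n mu t')"
      using F xy by (auto simp: F_def)
    have bl: "(block_list n ?C (wd n lam s) k, block_list n ?C (wd n lam t) k)
        = (block_list n ?C (wd n mu s') k, block_list n ?C (wd n mu t') k)" (is "?a = ?b") for k
    proof (rule inj_onD[OF conjunct1[OF \<psi>[OF finite_block_at]]])
      show 1: "?a \<in> lat_pairs (card (block_at n ?C k))" by (rule l.block_list_pair[OF st])
      show 2: "?b \<in> lat_pairs (card (block_at n ?C k))" unfolding C by (rule m.block_list_pair[OF st'])
      have p: "\<psi> (block_at n ?C k) ?a permutes block_at n ?C k" "\<psi> (block_at n ?C k) ?b permutes block_at n ?C k"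
        using \<psi>[OF finite_block_at] 1 2 by blast+
      show "\<psi> (block_at n ?C k) ?a = \<psi> (block_at n ?C k) ?b"
      proof
        fix p show "\<psi> (block_at n ?C k) ?a p = \<psi> (block_at n ?C k) ?b p"
        proof (cases "p \<in> block_at n ?C k")
          case True
          then show ?thesis using fun_cong[OF g, of p] by (simp add: gm_def block_at_def)
        next
          case False
          then show ?thesis using p by (simp add: permutes_not_in)
        qed
      qed
    qed
    have w: "wd n lam s = wd n mu s'" "wd n lam t = wd n mu t'"
      using bl by (auto intro!: word_determined[OF lam mu C])  (use st st' in auto)
    have "lam = mu" by (rule multipartition_determined[OF lam mu st(1) st'(1) w(1)])
    then show "x = y" using w st st' xy inj_onD[OF l.wd_inj] by auto
  qed
  from card_inj_on_le[OF this im fin] show ?thesis .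
qed

section \<open>The cellular basis\<close>

context hecke_gen
begin

text \<open>If \<open>X g\<close> is nonzero then \<open>g\<close> preserves \<open>{1..j}\<close>
  for every cut \<open>j\<close>, so \<open>p\<close> and \<open>g p\<close> have the same cuts to
  their left.\<close>

lemma X_blk:
  assumes g: "g permutes {1..n}" and cut: "cut \<subseteq> {1..<n}" and p: "p \<in> {1..n}" "blk (g p) \<noteq> blk p"
  shows "X g = 0"
proof (rule ccontr)
  assume "X g \<noteq> 0"
  have im: "g ` {1..j} = {1..j}" if j: "j \<in> cut" for j
  proof (rule ccontr)
    assume "g ` {1..j} \<noteq> {1..j}"
    moreover have "1 \<le> j" "j < n" using j cut by auto
    ultimately show False using X_block[OF g _ _ j] \<open>X g \<noteq> 0\<close> by blast
  qed
  have gp: "g p \<in> {1..n}" using permutes_in_image[OF g] p by blast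
  have "j < g p \<longleftrightarrow> j < p" if j: "j \<in> cut" for j
  proof -
    have "g p \<in> g ` {1..j} \<longleftrightarrow> p \<in> {1..j}" by (rule inj_image_mem_iff[OF permutes_inj[OF g]])
    then show ?thesis unfolding im[OF j] using p gp by auto
  qed
  then have "{i \<in> cut. 1 \<le> i \<and> i < g p} = {i \<in> cut. 1 \<le> i \<and> i < p}" by auto
  then show False using p(2) by (simp add: blk_of_def)
qed

text \<open>A letter of a foreign component at \<open>p\<close> forces every \<open>g\<close> in the
  sum to leave the block of \<open>p\<close>. This is the origin of the restriction to tableaux of
  the initial kind.\<close>

lemma e_blk:
  assumes "valid f0" "cut \<subseteq> {1..<n}" "p \<in> {1..n}" "f p div (3 * n) \<noteq> blk p"
  shows "e f0 f = 0"
  unfolding e_def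
proof (rule sum.neutral, rule ballI)
  fix g assume "g \<in> {g. g permutes {1..n} \<and> f0 \<circ> g = f}"
  then have g: "g permutes {1..n}" "f p = f0 (g p)" by auto
  have "g p \<in> {1..n}" using permutes_in_image[OF g(1)] assms(3) by blast
  then obtain r where "r < n" "f0 (g p) = 3 * (blk (g p) * n + r)"
    using assms(1) unfolding valid_word_def by blast
  then have "blk (g p) \<noteq> blk p" using assms(4) g(2) letter_div[of r n "blk (g p)"] by simp
  then show "qp (int (ninv n g) - int (ninv n f)) * X g = 0"
    using X_blk[OF g(1) assms(2,3)] by simp
qed

lemma mb_blk:
  assumes v: "valid f0" and cut: "cut \<subseteq> {1..<n}" and f: "f \<in> orb n f0" and f': "f' \<in> orb n f0"
    and p: "p \<in> {1..n}" "f p div (3 * n) \<noteq> blk p \<or> f' p div (3 * n) \<noteq> blk p"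
  shows "mb f0 f f' = 0"
  using p(2)
proof
  assume "f p div (3 * n) \<noteq> blk p"
  then have "e f0 f = 0" using e_blk[OF v cut p(1)] by blast
  then show ?thesis by (simp add: mb_star_e[OF v f] star_0)
next
  assume "f' p div (3 * n) \<noteq> blk p"
  then have "e f0 f' = 0" using e_blk[OF v cut p(1)] by blast
  moreover have "e f0 f' = e f0 f0 * T (dl f0 f')"
    using e_T_valid[OF v dl(1,2)[OF v f']] dl(3)[OF v f'] by simp
  ultimately show ?thesis by (simp add: mb_def mult.assoc)
qed

end

lemma qq_power: "qq ^ k = Poly_Mapping.single (int k) 1"
  by (induction k) (simp_all add: qq_def mult_single)

locale bh_corner =
  fixes n :: nat and C :: "nat set"
  assumes n1: "1 \<le> n" and C: "C \<subseteq> {1..<n}"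

sublocale bh_corner \<subseteq> hecke_gen n C bZ "eps n C" QP star_bh "Acar n" SC
  by (rule hecke_gen_bh)

lemma zw_carrier: "w permutes {1..n} \<Longrightarrow> zw n w \<in> fa_carrier n"
proof -
  assume "w permutes {1..n}"
  then have "set (SOME ws. ws \<in> reduced_words n w) \<subseteq> {1..<n}" using some_reduced_word by (simp add: redw_def)
  moreover have "set ws \<subseteq> {1..<n} \<Longrightarrow> foldr (\<lambda>i acc. gZ i * acc) ws 1 \<in> fa_carrier n" for ws
    by (induction ws) (auto intro!: carrier_mult carrier_gZ)
  ultimately show ?thesis unfolding zw_def by blast
qed

lemma EE_carrier: "EE n I \<in> fa_carrier n"
proof -
  have fold: "set xs \<subseteq> {1..<n} \<Longrightarrow> foldr (\<lambda>i acc. gE i * acc) xs 1 \<in> fa_carrier n" for xs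
    by (induction xs) (auto intro!: carrier_mult carrier_gE)
  have "EJ n J \<in> fa_carrier n" for J
    unfolding EJ_def by (rule fold) (use finite_subset[of _ "{1..<n}"] in \<open>auto\<close>)
  then show ?thesis unfolding EE_def by (intro carrier_sum carrier_mult carrier_sc)
qed

context bh_corner
begin

text \<open>\<open>T\<close> is indexed through \<open>gw\<close> and \<open>zw\<close> through
  \<open>perm_of_word\<close>; the two conventions differ by inversion.\<close>

lemma abs_zw:
  assumes "w permutes {1..n}" shows "abs_bh (zw n w) = T (inv w)"
proof -
  have "abs_bh (foldr (\<lambda>i acc. gZ i * acc) ws 1) = tw ws" for ws
    by (induction ws) (simp_all add: abs_1 abs_mult tw_def bZ_def[symmetric])
  then show ?thesis unfolding zw_def T_redw[OF some_reduced_word[OF assms]] .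
qed

text \<open>The row stabiliser is closed under inversion, which preserves lengths, and the sorted
  word has no inversions, so no correction of the exponent remains.\<close>

lemma abs_m_lam:
  assumes lam: "lam \<in> multipartitions n" and cuts: "cuts lam = C"
  shows "abs_bh (m_lam n lam) = e (wd n lam (tlam lam)) (wd n lam (tlam lam))"
proof -
  interpret l: multipart n lam by unfold_locales fact
  let ?f = "wd n lam (tlam lam)"
  have "{1..<n} - ({1..<n} - C) = C" using C by auto
  then have E: "abs_bh (EE n (Ilam lam)) = eps n C" using abs_EE[OF l.Ilam_lsp] l.Ilam_ties cuts by simp
  have "ninv n ?f = 0" using l.f0_valid srt_ninv by (simp add: valid_word_def)
  then have "e ?f ?f = (\<Sum>g | g permutes {1..n} \<and> ?f \<circ> g = ?f. QP (int (ninv n g)) * X g)"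
    by (simp add: e_def)
  also have "\<dots> = (\<Sum>w | w permutes {1..n} \<and> ?f \<circ> w = ?f. QP (int (ninv n w)) * X (inv w))"
  proof -
    define W where "W = {w. w permutes {1..n} \<and> ?f \<circ> w = ?f}"
    have W: "inv w \<in> W \<and> inv (inv w) = w \<and> ninv n (inv w) = ninv n w" if "w \<in> W" for w
    proof -
      have w: "w permutes {1..n}" "?f \<circ> w = ?f" using that by (auto simp: W_def)
      have "?f \<circ> inv w = ?f \<circ> (w \<circ> inv w)" using w(2) by (metis comp_assoc)
      then have "?f \<circ> inv w = ?f" unfolding permutes_inv_o(1)[OF w(1)] comp_id .
      then show ?thesis using w permutes_inv permutes_inv_inv ninv_inv unfolding W_def by blast
    qed
    show ?thesis unfolding W_def[symmetric]
      by (rule sum.reindex_bij_witness[where i = inv and j = inv]) (simp_all add: W)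
  qed
  also have "\<dots> = abs_bh (m_lam n lam)"
    unfolding m_lam_def abs_mult E abs_sum sum_distrib_left l.row_stab_eq
  proof (rule sum.cong[OF refl])
    fix w assume "w \<in> {w. w permutes {1..n} \<and> ?f \<circ> w = ?f}"
    then have w: "w permutes {1..n}" by simp
    have "abs_bh (sc (qq ^ perm_len n w)) = QP (int (ninv n w))"
      by (simp only: perm_len_ninv[OF w] qq_power QP_def SC_def)
    then show "QP (int (ninv n w)) * X (inv w) = eps n C * (abs_bh (sc (qq ^ perm_len n w)) * abs_bh (zw n w))"
      unfolding abs_zw[OF w] X_def by (metis mult.assoc qp_comm)
  qed
  finally show ?thesis ..
qed

lemma abs_m_basis:
  assumes lam: "lam \<in> multipartitions n" and cuts: "cuts lam = C" and st: "s \<in> Tset lam" "t \<in> Tset lam"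
  shows "abs_bh (m_basis n lam s t) = mb (wd n lam (tlam lam)) (wd n lam s) (wd n lam t)"
proof -
  interpret l: multipart n lam by unfold_locales fact
  have m: "s \<in> multitableaux lam" "t \<in> multitableaux lam" using st by (auto simp: Tset_def)
  note d = l.dperm(1)[OF m(1)] l.dperm(1)[OF m(2)]
  show ?thesis
    unfolding m_basis_def abs_mult star_abs[symmetric] abs_zw[OF d(1)] abs_zw[OF d(2)] abs_m_lam[OF lam cuts]
      mb_eq[OF l.f0_valid[unfolded cuts] permutes_inv[OF d(1)] l.rowinc_dperm[OF st(1)]
        permutes_inv[OF d(2)] l.rowinc_dperm[OF st(2)]] l.wd_dperm[OF m(1)] l.wd_dperm[OF m(2)] ..
qed

definition bidx :: "(nat \<Rightarrow> nat) set \<Rightarrow> (nat list list \<times> (nat \<times> nat \<times> nat \<Rightarrow> nat) \<times> (nat \<times> nat \<times> nat \<Rightarrow> nat)) set" where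
  "bidx L = {(lam, s, t) \<in> cidx (multipartitions n) Tset. cuts lam = C \<and> wd n lam (tlam lam) \<in> L}"

text \<open>A pair of lattice words with a letter in the wrong block gives zero by
  \<open>mb_blk\<close>. Any other pair comes from tableaux: a lattice rearrangement makes the
  content a multipartition, and \<open>wd_surj\<close> supplies the fillings.\<close>

lemma Bs_basis:
  assumes L: "L \<subseteq> {f. valid f}" and x: "x \<in> spn (Bs L)"
  shows "\<exists>c. x = (\<Sum>i\<in>bidx L. SC (c i) * (case i of (lam, s, t) \<Rightarrow> abs_bh (m_basis n lam s t)))"
proof (rule spn_finite)
  show "finite (bidx L)" by (rule finite_subset[OF _ finite_cidx[of n]]) (auto simp: bidx_def)
  let ?S = "(\<lambda>i. case i of (lam, s, t) \<Rightarrow> abs_bh (m_basis n lam s t)) ` bidx L"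
  have "Bs L \<subseteq> spn ?S"
  proof
    fix y assume "y \<in> Bs L"
    then obtain f1 f f' where f1: "f1 \<in> L" and f: "f \<in> orb n f1" "lattice f" and f': "f' \<in> orb n f1" "lattice f'"
      and y: "y = mb f1 f f'" unfolding Bs_def by blast
    have v: "valid f1" using f1 L by blast
    show "y \<in> spn ?S"
    proof (cases "\<forall>p\<in>{1..n}. f p div (3 * n) = blk p \<and> f' p div (3 * n) = blk p")
      case True
      obtain lam where lam: "lam \<in> multipartitions n" "cuts lam = C" "wd n lam (tlam lam) = f1"
        using exists_multipartition[OF n1 C v f] by blast
      interpret l: multipart n lam by unfold_locales (rule lam(1))
      obtain s t where st: "s \<in> Tset lam" "wd n lam s = f" "t \<in> Tset lam" "wd n lam t = f'"
        using l.wd_surj[unfolded lam(2,3), OF f] l.wd_surj[unfolded lam(2,3), OF f'] True by blast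
      have "(lam, s, t) \<in> bidx L" using lam st f1 by (auto simp: bidx_def cidx_def)
      moreover have "y = abs_bh (m_basis n lam s t)"
        unfolding y abs_m_basis[OF lam(1,2) st(1,3)] lam(3) st(2,4) ..
      ultimately show ?thesis by (intro spn_in image_eqI[of _ _ "(lam, s, t)"]) auto
    next
      case False
      then have "y = 0" unfolding y using mb_blk[OF v C f(1) f'(1)] by blast
      then show ?thesis by (simp add: spn.zero)
    qed
  qed
  then show "x \<in> spn ?S" by (rule spn_trans[OF x])
qed

lemma corner_basis:
  assumes "b \<in> Acar n"
  shows "\<exists>c. eps n C * b = (\<Sum>(lam, s, t)\<in>cidx (multipartitions n) Tset. SC (c (lam, s, t)) * abs_bh (m_basis n lam s t))"
proof -
  let ?L = "{f. valid f}" and ?J = "cidx (multipartitions n) Tset"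
  obtain c where "eps n C * b = (\<Sum>i\<in>bidx ?L. SC (c i) * (case i of (lam, s, t) \<Rightarrow> abs_bh (m_basis n lam s t)))"
    using Bs_basis[OF subset_refl corner_span[OF assms]] by blast
  also have "\<dots> = (\<Sum>i\<in>?J. SC (if i \<in> bidx ?L then c i else 0) * (case i of (lam, s, t) \<Rightarrow> abs_bh (m_basis n lam s t)))"
    by (rule sum.mono_neutral_cong_left) (auto simp: bidx_def SC_0 finite_cidx)
  also have "\<dots> = (\<Sum>(lam, s, t)\<in>?J. SC (if (lam, s, t) \<in> bidx ?L then c (lam, s, t) else 0) * abs_bh (m_basis n lam s t))"
    by (rule sum.cong) auto
  finally show ?thesis by (intro exI[of _ "\<lambda>i. if i \<in> bidx ?L then c i else 0"])
qed

lemma basis_left: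
  assumes lam: "lam \<in> multipartitions n" and cuts: "cuts lam = C" and s: "s \<in> Tset lam" and a: "a \<in> Acar n"
  shows "\<exists>r. \<forall>t\<in>Tset lam. \<exists>c. a * abs_bh (m_basis n lam s t) - (\<Sum>s'\<in>Tset lam. SC (r s') * abs_bh (m_basis n lam s' t))
    = (\<Sum>(mu, u, v)\<in>cidx (multipartitions n) Tset.
        if dominates mu lam \<and> mu \<noteq> lam then SC (c (mu, u, v)) * abs_bh (m_basis n mu u v) else 0)"
proof -
  interpret l: multipart n lam by unfold_locales fact
  let ?f = "wd n lam (tlam lam)" and ?J = "cidx (multipartitions n) Tset"
  have v: "valid ?f" using l.f0_valid cuts by simp
  have orb: "wd n lam t \<in> orb n ?f" if "t \<in> Tset lam" for t using that l.wd_orb by (auto simp: Tset_def)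
  obtain r where r: "\<And>f'. f' \<in> orb n ?f \<Longrightarrow>
      a * mb ?f (wd n lam s) f' - (\<Sum>h | h \<in> orb n ?f \<and> lattice h. SC (r h) * mb ?f h f') \<in> spn (Bs (low ?f))"
    using mb_left[OF v a orb[OF s]] by blast
  have "\<exists>c. a * abs_bh (m_basis n lam s t) - (\<Sum>s'\<in>Tset lam. SC (r (wd n lam s')) * abs_bh (m_basis n lam s' t))
    = (\<Sum>(mu, u, v)\<in>?J. if dominates mu lam \<and> mu \<noteq> lam then SC (c (mu, u, v)) * abs_bh (m_basis n mu u v) else 0)"
    if t: "t \<in> Tset lam" for t
  proof -
    \<comment> \<open>Lattice words that are not words of tableaux in \<open>Tset lam\<close>
      contribute zero, so the sum can be indexed by tableaux.\<close>
    have "(\<Sum>h | h \<in> orb n ?f \<and> lattice h. SC (r h) * mb ?f h (wd n lam t))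
        = (\<Sum>h\<in>wd n lam ` Tset lam. SC (r h) * mb ?f h (wd n lam t))"
    proof (rule sum.mono_neutral_right)
      show "finite {h. h \<in> orb n ?f \<and> lattice h}" by (rule finite_subset[OF _ finite_orb[of n ?f]]) auto
      show "wd n lam ` Tset lam \<subseteq> {h. h \<in> orb n ?f \<and> lattice h}" using orb l.wd_lattice by auto
      show "\<forall>h\<in>{h. h \<in> orb n ?f \<and> lattice h} - wd n lam ` Tset lam. SC (r h) * mb ?f h (wd n lam t) = 0"
      proof
        fix h assume h: "h \<in> {h. h \<in> orb n ?f \<and> lattice h} - wd n lam ` Tset lam"
        then have "\<exists>p\<in>{1..n}. h p div (3 * n) \<noteq> blk p"
          using l.wd_surj[of h] cuts by blast
        then have "mb ?f h (wd n lam t) = 0" using mb_blk[OF v C _ orb[OF t], of h] h by blast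
        then show "SC (r h) * mb ?f h (wd n lam t) = 0" by simp
      qed
    qed
    also have "\<dots> = (\<Sum>s'\<in>Tset lam. SC (r (wd n lam s')) * abs_bh (m_basis n lam s' t))"
      unfolding sum.reindex[OF l.wd_inj] comp_def by (rule sum.cong) (simp_all add: abs_m_basis[OF lam cuts _ t])
    finally have "a * abs_bh (m_basis n lam s t) - (\<Sum>s'\<in>Tset lam. SC (r (wd n lam s')) * abs_bh (m_basis n lam s' t))
      \<in> spn (Bs (low ?f))"
      using r[OF orb[OF t]] abs_m_basis[OF lam cuts s t] by simp
    from Bs_basis[OF _ this] obtain c where c:
      "a * abs_bh (m_basis n lam s t) - (\<Sum>s'\<in>Tset lam. SC (r (wd n lam s')) * abs_bh (m_basis n lam s' t))
      = (\<Sum>i\<in>bidx (low ?f). SC (c i) * (case i of (lam, s, t) \<Rightarrow> abs_bh (m_basis n lam s t)))"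
      by (auto simp: low_def)
    also have "\<dots> = (\<Sum>(mu, u, v)\<in>?J. if dominates mu lam \<and> mu \<noteq> lam
        then SC (if (mu, u, v) \<in> bidx (low ?f) then c (mu, u, v) else 0) * abs_bh (m_basis n mu u v) else 0)"
    proof (rule sum.mono_neutral_cong_left[OF finite_cidx])
      show "bidx (low ?f) \<subseteq> ?J" by (auto simp: bidx_def)
      fix i assume i: "i \<in> bidx (low ?f)"
      then obtain mu u v where x: "i = (mu, u, v)" "mu \<in> multipartitions n" "wd n mu (tlam mu) \<in> low ?f"
        by (auto simp: bidx_def cidx_def)
      then have "dominates mu lam" "mu \<noteq> lam" using dominates_word[OF lam x(2)] by (auto simp: low_def)
      then show "SC (c i) * (case i of (lam, s, t) \<Rightarrow> abs_bh (m_basis n lam s t)) = (case i of (mu, u, v) \<Rightarrow>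
          if dominates mu lam \<and> mu \<noteq> lam
          then SC (if (mu, u, v) \<in> bidx (low ?f) then c (mu, u, v) else 0) * abs_bh (m_basis n mu u v) else 0)"
        using i x(1) by simp
    qed (auto simp: SC_0)
    finally show ?thesis by (intro exI[of _ "\<lambda>i. if i \<in> bidx (low ?f) then c i else 0"])
  qed
  then show ?thesis by (intro exI[of _ "\<lambda>s'. r (wd n lam s')"]) blast
qed

end

section \<open>Transfer from the corners to the free algebra modulo its ideal\<close>

lemma m_basis_carrier:
  assumes "(lam, s, t) \<in> cidx (multipartitions n) Tset" shows "m_basis n lam s t \<in> fa_carrier n"
proof -
  have lam: "lam \<in> multipartitions n" and st: "s \<in> multitableaux lam" "t \<in> multitableaux lam"
    using assms by (auto simp: cidx_def Tset_def)
  interpret multipart n lam by unfold_locales fact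
  have "m_lam n lam \<in> fa_carrier n" unfolding m_lam_def
    by (intro carrier_mult EE_carrier carrier_sum carrier_sc zw_carrier) (simp add: row_stab_eq)
  then show ?thesis unfolding m_basis_def by (intro carrier_mult carrier_fstar zw_carrier dperm(1) st)
qed

lemma abs_eqD:
  assumes "x \<in> fa_carrier n" "y \<in> fa_carrier n" "abs_bh x = abs_bh y" shows "x - y \<in> bH_ideal n"
proof -
  have "abs_bh (x - y) = 0" using assms(3) by (simp add: abs_diff)
  then show ?thesis using ideal_inf_carrier[OF carrier_diff[OF assms(1,2)]] abs_eq_0 by blast
qed

lemma comb_carrier:
  "(\<Sum>(l, s, t)\<in>cidx (multipartitions n) Tset. sc (c (l, s, t)) * m_basis n l s t) \<in> fa_carrier n"
  by (rule carrier_sum) (auto intro!: carrier_mult carrier_sc m_basis_carrier)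

text \<open>The corner idempotents add up to 1, so the expansions of the corner parts of
  \<open>a\<close> are added coefficient by coefficient.\<close>

lemma basis_span:
  assumes n: "1 \<le> n" and a: "a \<in> fa_carrier n"
  shows "\<exists>c. a - (\<Sum>(l, s, t)\<in>cidx (multipartitions n) Tset. sc (c (l, s, t)) * m_basis n l s t) \<in> bH_ideal n"
proof -
  let ?J = "cidx (multipartitions n) Tset"
  have A: "abs_bh a \<in> Acar n" using a by (simp add: Acar_def)
  have "\<forall>C\<in>Pow {1..<n}. \<exists>c. eps n C * abs_bh a = (\<Sum>(l, s, t)\<in>?J. SC (c (l, s, t)) * abs_bh (m_basis n l s t))"
  proof
    fix C assume "C \<in> Pow {1..<n}"
    then interpret bh_corner n C using n by unfold_locales auto
    show "\<exists>c. eps n C * abs_bh a = (\<Sum>(l, s, t)\<in>?J. SC (c (l, s, t)) * abs_bh (m_basis n l s t))"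
      by (rule corner_basis[OF A])
  qed
  from bchoice[OF this] obtain c where c: "\<And>C. C \<in> Pow {1..<n} \<Longrightarrow>
    eps n C * abs_bh a = (\<Sum>(l, s, t)\<in>?J. SC (c C (l, s, t)) * abs_bh (m_basis n l s t))" by blast
  have SC_sum: "SC (sum h K) = (\<Sum>k\<in>K. SC (h k))" for h and K :: "nat set set"
    by (induction K rule: infinite_finite_induct) (simp_all add: SC_0 SC_add)
  have "abs_bh a = (\<Sum>C\<in>Pow {1..<n}. eps n C * abs_bh a)" by (simp only: sum_distrib_right[symmetric] sum_eps mult_1)
  also have "\<dots> = (\<Sum>C\<in>Pow {1..<n}. \<Sum>(l, s, t)\<in>?J. SC (c C (l, s, t)) * abs_bh (m_basis n l s t))"
    using c by (rule sum.cong[OF refl])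
  also have "\<dots> = (\<Sum>(l, s, t)\<in>?J. SC (\<Sum>C\<in>Pow {1..<n}. c C (l, s, t)) * abs_bh (m_basis n l s t))"
    by (subst sum.swap) (simp add: SC_sum sum_distrib_right split_beta)
  also have "\<dots> = abs_bh (\<Sum>(l, s, t)\<in>?J. sc (\<Sum>C\<in>Pow {1..<n}. c C (l, s, t)) * m_basis n l s t)"
    unfolding abs_sum by (rule sum.cong[OF refl]) (simp only: split_paired_all prod.case abs_mult SC_def)
  finally have "a - (\<Sum>(l, s, t)\<in>?J. sc (\<Sum>C\<in>Pow {1..<n}. c C (l, s, t)) * m_basis n l s t) \<in> bH_ideal n"
    by (rule abs_eqD[OF a comb_carrier[where c = "\<lambda>i. \<Sum>C\<in>Pow {1..<n}. c C i"]])
  then show ?thesis by (intro exI[of _ "\<lambda>i. \<Sum>C\<in>Pow {1..<n}. c C i"])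
qed

text \<open>The functional attached to a pair of a cut set and a permutation \<open>g\<close> reads
  the coefficient at \<open>g\<close> of the image of \<open>delta id\<close>.
  \<open>dual_basis\<close> provides the elements dual to these functionals, and
  \<open>card_cidx_le\<close> the bound.\<close>

lemma basis_independent:
  assumes n: "1 \<le> n"
    and c: "(\<Sum>(l, s, t)\<in>cidx (multipartitions n) Tset. sc (c (l, s, t)) * m_basis n l s t) \<in> bH_ideal n"
    and i: "i \<in> cidx (multipartitions n) Tset"
  shows "c i = 0"
proof -
  let ?J = "cidx (multipartitions n) Tset" and ?W = "SIGMA C:Pow {1..<n}. block_perms n C"
  let ?b = "\<lambda>i. case i of (l, s, t) \<Rightarrow> m_basis n l s t"
  let ?\<Phi> = "\<lambda>w x. act n (fst w) x (delta id) (snd w)"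
  have b: "(\<Sum>(l, s, t)\<in>?J. sc (k (l, s, t)) * m_basis n l s t) = (\<Sum>i\<in>?J. sc (k i) * ?b i)" for k
    by (rule sum.cong) auto
  have "\<exists>p. p \<in> fa_carrier n \<and> (\<forall>w'\<in>?W. ?\<Phi> w' p = of_bool (w = w'))" if w: "w \<in> ?W" for w
  proof -
    have w': "fst w \<subseteq> {1..<n}" "snd w \<in> block_perms n (fst w)" using w by auto
    obtain p where p: "p \<in> fa_carrier n" "\<And>C' g'. C' \<subseteq> {1..<n} \<Longrightarrow> g' \<in> block_perms n C' \<Longrightarrow>
      act n C' p (delta id) g' = of_bool (C' = fst w \<and> g' = snd w)" using dual_basis[OF w'] by blast
    have "?\<Phi> w' p = of_bool (w = w')" if "w' \<in> ?W" for w'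
      using p(2)[of "fst w'" "snd w'"] that by (auto simp: prod_eq_iff)
    then show ?thesis using p(1) by blast
  qed
  then obtain p where p: "\<And>w. w \<in> ?W \<Longrightarrow> p w \<in> fa_carrier n"
    "\<And>w w'. w \<in> ?W \<Longrightarrow> w' \<in> ?W \<Longrightarrow> ?\<Phi> w' (p w) = of_bool (w = w')" by metis
  show ?thesis
  proof (rule independent_if_card_le[where J = ?J and W = ?W and b = ?b and I = "bH_ideal n" and \<Phi> = ?\<Phi> and p = p])
    show "finite ?W" by (rule finite_SigmaI) (simp_all add: finite_block_perms)
    show "\<exists>a. p w - (\<Sum>j\<in>?J. sc (a j) * ?b j) \<in> bH_ideal n" if "w \<in> ?W" for w
      using basis_span[OF n p(1)[OF that]] unfolding b .
    show "(\<Sum>j\<in>?J. sc (c j) * ?b j) \<in> bH_ideal n" using c unfolding b .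
  qed (use finite_cidx card_cidx_le p(2) i act_ideal act_add_left act_sc_mult in \<open>auto\<close>)
qed

lemma basis_star:
  assumes n: "1 \<le> n" and i: "(l, s, t) \<in> cidx (multipartitions n) Tset"
  shows "fstar (m_basis n l s t) - m_basis n l t s \<in> bH_ideal n"
proof -
  have l: "l \<in> multipartitions n" and st: "s \<in> Tset l" "t \<in> Tset l" using i by (auto simp: cidx_def)
  interpret m: multipart n l by unfold_locales fact
  interpret bh_corner n "cuts l" using n m.cuts_sub by unfold_locales auto
  have o: "wd n l s \<in> orb n (wd n l (tlam l))" using st m.wd_orb by (auto simp: Tset_def)
  have "abs_bh (fstar (m_basis n l s t)) = star_bh (mb (wd n l (tlam l)) (wd n l s) (wd n l t))"
    by (simp add: star_abs[symmetric] abs_m_basis[OF l refl st])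
  also have "\<dots> = abs_bh (m_basis n l t s)"
    unfolding abs_m_basis[OF l refl st(2,1)] mb_def by (simp add: star_mult star_star star_e mult.assoc)
  finally show ?thesis using i by (intro abs_eqD carrier_fstar m_basis_carrier) (auto simp: cidx_def)
qed

lemma basis_mult:
  assumes n: "1 \<le> n" and l: "l \<in> multipartitions n" and s: "s \<in> Tset l" and a: "a \<in> fa_carrier n"
  shows "\<exists>r. \<forall>t\<in>Tset l. \<exists>c. a * m_basis n l s t - (\<Sum>s'\<in>Tset l. sc (r s') * m_basis n l s' t)
    - (\<Sum>(m, u, v)\<in>cidx (multipartitions n) Tset.
        if dominates m l \<and> m \<noteq> l then sc (c (m, u, v)) * m_basis n m u v else 0) \<in> bH_ideal n"
proof -
  interpret m: multipart n l by unfold_locales fact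
  interpret bh_corner n "cuts l" using n m.cuts_sub by unfold_locales auto
  let ?J = "cidx (multipartitions n) Tset"
  have "abs_bh a \<in> Acar n" using a by (simp add: Acar_def)
  from basis_left[OF l refl s this] obtain r where r: "\<And>t. t \<in> Tset l \<Longrightarrow> \<exists>c.
    abs_bh a * abs_bh (m_basis n l s t) - (\<Sum>s'\<in>Tset l. SC (r s') * abs_bh (m_basis n l s' t))
    = (\<Sum>(mu, u, v)\<in>?J. if dominates mu l \<and> mu \<noteq> l then SC (c (mu, u, v)) * abs_bh (m_basis n mu u v) else 0)"
    by blast
  have "\<exists>c. a * m_basis n l s t - (\<Sum>s'\<in>Tset l. sc (r s') * m_basis n l s' t)
    - (\<Sum>(m, u, v)\<in>?J. if dominates m l \<and> m \<noteq> l then sc (c (m, u, v)) * m_basis n m u v else 0) \<in> bH_ideal n"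
    if t: "t \<in> Tset l" for t
  proof -
    obtain c where c: "abs_bh a * abs_bh (m_basis n l s t) - (\<Sum>s'\<in>Tset l. SC (r s') * abs_bh (m_basis n l s' t))
      = (\<Sum>(mu, u, v)\<in>?J. if dominates mu l \<and> mu \<noteq> l then SC (c (mu, u, v)) * abs_bh (m_basis n mu u v) else 0)"
      using r[OF t] by blast
    have mem: "m_basis n l s' t \<in> fa_carrier n" if "s' \<in> Tset l" for s'
      using that l t by (intro m_basis_carrier) (auto simp: cidx_def)
    have "a * m_basis n l s t - (\<Sum>s'\<in>Tset l. sc (r s') * m_basis n l s' t)
      - (\<Sum>(m, u, v)\<in>?J. if dominates m l \<and> m \<noteq> l then sc (c (m, u, v)) * m_basis n m u v else 0) \<in> bH_ideal n"
    proof (rule abs_eqD)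
      show "a * m_basis n l s t - (\<Sum>s'\<in>Tset l. sc (r s') * m_basis n l s' t) \<in> fa_carrier n"
        by (intro carrier_diff carrier_mult carrier_sum carrier_sc a mem s)
      show "(\<Sum>(m, u, v)\<in>?J. if dominates m l \<and> m \<noteq> l then sc (c (m, u, v)) * m_basis n m u v else 0) \<in> fa_carrier n"
        by (rule carrier_sum) (auto intro!: carrier_mult carrier_sc m_basis_carrier)
      have "(\<Sum>(m, u, v)\<in>?J. if dominates m l \<and> m \<noteq> l then SC (c (m, u, v)) * abs_bh (m_basis n m u v) else 0)
        = abs_bh (\<Sum>(m, u, v)\<in>?J. if dominates m l \<and> m \<noteq> l then sc (c (m, u, v)) * m_basis n m u v else 0)"
        unfolding abs_sum by (rule sum.cong) (auto simp: abs_mult abs_0 SC_def)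
      then show "abs_bh (a * m_basis n l s t - (\<Sum>s'\<in>Tset l. sc (r s') * m_basis n l s' t))
        = abs_bh (\<Sum>(m, u, v)\<in>?J. if dominates m l \<and> m \<noteq> l then sc (c (m, u, v)) * m_basis n m u v else 0)"
        using c by (simp add: abs_diff abs_mult abs_sum SC_def)
    qed
    then show ?thesis by blast
  qed
  then show ?thesis by blast
qed

lemma bH_ideal_0: "0 \<in> bH_ideal n"
  unfolding bH_ideal_def by (rule two_sided_ideal.zero)

theorem theorem5p10:
  fixes n :: nat
  assumes "1 \<le> n"
  shows "cellular_datum (fa_carrier n) (bH_ideal n) fstar (multipartitions n)
           (\<lambda>mu lam. dominates mu lam \<and> mu \<noteq> lam) Tset (m_basis n)"
  unfolding cellular_datum_def
proof (intro conjI ballI allI impI)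
  show "finite (multipartitions n)" by (rule finite_multipartitions)
  show "finite (Tset l)" if "l \<in> multipartitions n" for l
  proof -
    interpret multipart n l by unfold_locales fact
    show ?thesis by (rule finite_Tset)
  qed
  show "dominates x z" if "dominates x y \<and> x \<noteq> y" "dominates y z \<and> y \<noteq> z" for x y z
    using that dominates_trans by blast
  show "x \<noteq> z" if "x \<in> multipartitions n" "y \<in> multipartitions n" "dominates x y \<and> x \<noteq> y" "dominates y z \<and> y \<noteq> z" for x y z
    using that dominates_antisym by blast
  show "\<exists>c. a - (\<Sum>(l, s, t)\<in>cidx (multipartitions n) Tset. sc (c (l, s, t)) * m_basis n l s t) \<in> bH_ideal n"
    if "a \<in> fa_carrier n" for a
    by (rule basis_span[OF assms that])
  show "fstar x \<in> bH_ideal n" if "x \<in> bH_ideal n" for x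
  proof -
    \<comment> \<open>\<open>fstar_ideal\<close> speaks of the infinite ideal; returning to
      \<open>bH_ideal n\<close> requires that both elements lie in the carrier.\<close>
    have "x \<in> fa_carrier n" using that unfolding bH_ideal_def
    proof (induction rule: two_sided_ideal.induct)
      case (gen r a b)
      then have "r \<in> fa_carrier n"
        by (cases rule: bH_relsE) (auto intro!: carrier_diff carrier_add carrier_mult carrier_sc carrier_gE carrier_gZ)
      then show ?case using gen by (intro carrier_mult)
    qed (auto intro: carrier_add)
    then show ?thesis using that fstar_ideal ideal_inf_carrier carrier_fstar by blast
  qed
  show "\<exists>r. \<forall>t\<in>Tset l. \<exists>c. a * m_basis n l s t - (\<Sum>s'\<in>Tset l. sc (r s') * m_basis n l s' t)
    - (\<Sum>(m, u, v)\<in>cidx (multipartitions n) Tset.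
        if dominates m l \<and> m \<noteq> l then sc (c (m, u, v)) * m_basis n m u v else 0) \<in> bH_ideal n"
    if "l \<in> multipartitions n" "s \<in> Tset l" "a \<in> fa_carrier n" for l s a
    by (rule basis_mult[OF assms that])
qed (use basis_independent[OF assms] basis_star[OF assms] in
  \<open>auto simp: bH_ideal_0 fstar_add fstar_mult fstar_fstar sc_central intro: m_basis_carrier carrier_fstar\<close>)

end
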